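(* Let $(K,\mathcal{O},k)\subseteq(K',\mathcal{O}',k')$ be an extension of $p$-modular systems with $k,k'$ finite and $\mathcal{O},\mathcal{O}'$ absolutely unramified. Let $A$ be an $\mathcal{O}$-algebra that is finitely generated as an $\mathcal{O}$-module, and let $A'=\mathcal{O}'\otimes_{\mathcal{O}}A$. For each indecomposable bounded chain complex $C$ of finitely generated $A$-modules, the chain complex of $A'$-modules $C':=\mathcal{O}'\otimes_{\mathcal{O}}C$ is a direct sum of (pairwise) nonisomorphic indecomposable subcomplexes.
   Context: A $p$-modular system $(K,\mathcal{O},k)$ consists of a complete discrete valuation ring $\mathcal{O}$ with field of fractions $K$ of characteristic $0$ and residue field $k$ of characteristic $p$. An extension of $p$-modular systems means $\mathcal{O}\subseteq\mathcal{O}'$ with $J(\mathcal{O})\subseteq J(\mathcal{O}')$ (with induced inclusions $K\subseteq K'$, $k\subseteq k'$). Absolutely unramified means $J(\mathcal{O})=p\mathcal{O}$ and $J(\mathcal{O}')=p\mathcal{O}'$, equivalently $\mathcal{O}\cong W(k)$ and $\mathcal{O}'\cong W(k')$ (Witt vectors). Subcomplexes, isomorphism and indecomposability of $C'$ refer to the category of chain complexes of $A'$-modules (not the homotopy category). *)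

theory Defs
  imports "HOL-Algebra.Algebra" "HOL-Library.Poly_Mapping"
begin

section \<open>\<open>p\<close>-modular systems\<close>

definition ring_char :: "('a, 'b) ring_scheme \<Rightarrow> nat" where
  "ring_char R =
     (if \<exists>n::nat. n > 0 \<and> [n] \<cdot>\<^bsub>R\<^esub> \<one>\<^bsub>R\<^esub> = \<zero>\<^bsub>R\<^esub>
      then LEAST n::nat. n > 0 \<and> [n] \<cdot>\<^bsub>R\<^esub> \<one>\<^bsub>R\<^esub> = \<zero>\<^bsub>R\<^esub> else 0)"

text \<open>Only used for commutative rings, where this is the Jacobson radical.\<close>

definition jacobson_radical :: "('a, 'b) ring_scheme \<Rightarrow> 'a set" where
  "jacobson_radical R = carrier R \<inter> \<Inter> {M. maximalideal M R}"

definition residue_field :: "('a, 'b) ring_scheme \<Rightarrow> 'a set ring" where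
  "residue_field R = R Quot (jacobson_radical R)"

text \<open>Separated and complete in the \<open>I\<close>-adic topology; powers of ideals are taken in the
  multiplicative monoid of ideals.\<close>

definition adically_complete :: "'a set \<Rightarrow> ('a, 'b) ring_scheme \<Rightarrow> bool" where
  "adically_complete I R \<longleftrightarrow>
     (\<Inter>n::nat. I [^]\<^bsub>ideals_set R\<^esub> n) = {\<zero>\<^bsub>R\<^esub>} \<and>
     (\<forall>s :: nat \<Rightarrow> 'a.
        (\<forall>i. s i \<in> carrier R) \<and>
        (\<forall>n::nat. \<exists>N. \<forall>i\<ge>N. \<forall>j\<ge>N. s i \<ominus>\<^bsub>R\<^esub> s j \<in> I [^]\<^bsub>ideals_set R\<^esub> n) \<longrightarrow>
        (\<exists>x\<in>carrier R. \<forall>n::nat. \<exists>N. \<forall>i\<ge>N. s i \<ominus>\<^bsub>R\<^esub> x \<in> I [^]\<^bsub>ideals_set R\<^esub> n))"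

locale discrete_valuation_ring = principal_domain R for R (structure) +
  assumes not_field: "\<not> field R"
    and local: "\<exists>!M. maximalideal M R"

text \<open>For rings on the same type, \<^term>\<open>(\<lambda>x. x) \<in> ring_hom S R\<close> says that \<open>S\<close> is a subring of
  \<open>R\<close>. The third component of the system is \<^term>\<open>residue_field Ov\<close>.\<close>

locale p_modular_system =
  fixes p :: nat and K Ov :: "'r ring"
  assumes prime_p: "Factorial_Ring.prime p"
    and dvr: "discrete_valuation_ring Ov"
    and complete: "adically_complete (jacobson_radical Ov) Ov"
    and field_K: "field K"
    and subring_K: "(\<lambda>x. x) \<in> ring_hom Ov K"
    and fractions: "\<And>x. x \<in> carrier K \<Longrightarrow>
      \<exists>a\<in>carrier Ov. \<exists>b\<in>carrier Ov - {\<zero>\<^bsub>Ov\<^esub>}. x = a \<otimes>\<^bsub>K\<^esub> inv\<^bsub>K\<^esub> b"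
    and char_K: "ring_char K = 0"
    and char_residue: "ring_char (residue_field Ov) = p"

locale p_modular_extension =
  base: p_modular_system p K Ov + ext: p_modular_system p K' Ov'
  for p :: nat and K Ov K' Ov' :: "'r ring" +
  assumes subring_Ov: "(\<lambda>x. x) \<in> ring_hom Ov Ov'"
    and subfield_K: "(\<lambda>x. x) \<in> ring_hom K K'"
    and radical_subset: "jacobson_radical Ov \<subseteq> jacobson_radical Ov'"

definition absolutely_unramified :: "nat \<Rightarrow> ('a, 'b) ring_scheme \<Rightarrow> bool" where
  "absolutely_unramified p R \<longleftrightarrow> jacobson_radical R = PIdl\<^bsub>R\<^esub> ([p] \<cdot>\<^bsub>R\<^esub> \<one>\<^bsub>R\<^esub>)"


section \<open>Modules and algebras\<close>

text \<open>The library's \<^locale>\<open>module\<close> and \<^locale>\<open>algebra\<close> require commutative rings.\<close>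

locale left_module = R?: ring R + M?: abelian_group M
  for R :: "('a, 'x) ring_scheme" (structure) and M :: "('a, 'm, 'y) module_scheme" (structure) +
  assumes smult_closed: "\<lbrakk>a \<in> carrier R; x \<in> carrier M\<rbrakk> \<Longrightarrow> a \<odot>\<^bsub>M\<^esub> x \<in> carrier M"
    and smult_l_distr: "\<lbrakk>a \<in> carrier R; b \<in> carrier R; x \<in> carrier M\<rbrakk> \<Longrightarrow>
      (a \<oplus>\<^bsub>R\<^esub> b) \<odot>\<^bsub>M\<^esub> x = a \<odot>\<^bsub>M\<^esub> x \<oplus>\<^bsub>M\<^esub> b \<odot>\<^bsub>M\<^esub> x"
    and smult_r_distr: "\<lbrakk>a \<in> carrier R; x \<in> carrier M; y \<in> carrier M\<rbrakk> \<Longrightarrow>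
      a \<odot>\<^bsub>M\<^esub> (x \<oplus>\<^bsub>M\<^esub> y) = a \<odot>\<^bsub>M\<^esub> x \<oplus>\<^bsub>M\<^esub> a \<odot>\<^bsub>M\<^esub> y"
    and smult_assoc1: "\<lbrakk>a \<in> carrier R; b \<in> carrier R; x \<in> carrier M\<rbrakk> \<Longrightarrow>
      (a \<otimes>\<^bsub>R\<^esub> b) \<odot>\<^bsub>M\<^esub> x = a \<odot>\<^bsub>M\<^esub> (b \<odot>\<^bsub>M\<^esub> x)"
    and smult_one: "x \<in> carrier M \<Longrightarrow> \<one>\<^bsub>R\<^esub> \<odot>\<^bsub>M\<^esub> x = x"

locale assoc_algebra = module R A + ring A
  for R :: "('r, 'x) ring_scheme" (structure) and A :: "('r, 'a, 'y) module_scheme" (structure) +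
  assumes smult_mult_left: "\<lbrakk>r \<in> carrier R; x \<in> carrier A; y \<in> carrier A\<rbrakk> \<Longrightarrow>
      (r \<odot>\<^bsub>A\<^esub> x) \<otimes>\<^bsub>A\<^esub> y = r \<odot>\<^bsub>A\<^esub> (x \<otimes>\<^bsub>A\<^esub> y)"
    and smult_mult_right: "\<lbrakk>r \<in> carrier R; x \<in> carrier A; y \<in> carrier A\<rbrakk> \<Longrightarrow>
      x \<otimes>\<^bsub>A\<^esub> (r \<odot>\<^bsub>A\<^esub> y) = r \<odot>\<^bsub>A\<^esub> (x \<otimes>\<^bsub>A\<^esub> y)"

definition finitely_generated ::
    "('a, 'x) ring_scheme \<Rightarrow> ('a, 'm, 'y) module_scheme \<Rightarrow> bool" where
  "finitely_generated R M \<longleftrightarrow>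
     (\<exists>S. finite S \<and> S \<subseteq> carrier M \<and>
        carrier M = {\<Oplus>\<^bsub>M\<^esub>s\<in>S. c s \<odot>\<^bsub>M\<^esub> s | c. c \<in> S \<rightarrow> carrier R})"

definition left_module_hom ::
    "('a, 'x) ring_scheme \<Rightarrow> ('a, 'm, 'y) module_scheme \<Rightarrow> ('a, 'n, 'z) module_scheme
      \<Rightarrow> ('m \<Rightarrow> 'n) set" where
  "left_module_hom R M N =
     {f \<in> carrier M \<rightarrow> carrier N.
        (\<forall>x\<in>carrier M. \<forall>y\<in>carrier M. f (x \<oplus>\<^bsub>M\<^esub> y) = f x \<oplus>\<^bsub>N\<^esub> f y) \<and>
        (\<forall>a\<in>carrier R. \<forall>x\<in>carrier M. f (a \<odot>\<^bsub>M\<^esub> x) = a \<odot>\<^bsub>N\<^esub> f x)}"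


section \<open>Chain complexes\<close>

record ('a, 'm) complex_of =
  obj :: "int \<Rightarrow> ('a, 'm) module"
  diff :: "int \<Rightarrow> 'm \<Rightarrow> 'm"

locale chain_complex =
  fixes A :: "('a, 'x) ring_scheme" and C :: "('a, 'm) complex_of"
  assumes obj_module: "\<And>n. left_module A (obj C n)"
    and diff_hom: "\<And>n. diff C n \<in> left_module_hom A (obj C n) (obj C (n - 1))"
    and diff_diff: "\<And>n x. x \<in> carrier (obj C n) \<Longrightarrow>
      diff C (n - 1) (diff C n x) = \<zero>\<^bsub>obj C (n - 1 - 1)\<^esub>"

definition bounded_complex :: "('a, 'm) complex_of \<Rightarrow> bool" where
  "bounded_complex C \<longleftrightarrow>
     (\<exists>a b. \<forall>n. n \<notin> {a..b} \<longrightarrow> carrier (obj C n) = {\<zero>\<^bsub>obj C n\<^esub>})"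

definition complex_iso ::
    "('a, 'x) ring_scheme \<Rightarrow> ('a, 'm) complex_of \<Rightarrow> ('a, 'n) complex_of \<Rightarrow> bool" where
  "complex_iso A C D \<longleftrightarrow>
     (\<exists>f. \<forall>n. f n \<in> left_module_hom A (obj C n) (obj D n) \<and>
        bij_betw (f n) (carrier (obj C n)) (carrier (obj D n)) \<and>
        (\<forall>x\<in>carrier (obj C n). f (n - 1) (diff C n x) = diff D n (f n x)))"

definition subcomplex ::
    "('a, 'x) ring_scheme \<Rightarrow> ('a, 'm) complex_of \<Rightarrow> (int \<Rightarrow> 'm set) \<Rightarrow> bool" where
  "subcomplex A C D \<longleftrightarrow>
     (\<forall>n. submodule (D n) A (obj C n) \<and> diff C n ` D n \<subseteq> D (n - 1))"

definition restrict_complex ::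
    "('a, 'm) complex_of \<Rightarrow> (int \<Rightarrow> 'm set) \<Rightarrow> ('a, 'm) complex_of" where
  "restrict_complex C D = \<lparr>obj = (\<lambda>n. (obj C n)\<lparr>carrier := D n\<rparr>), diff = diff C\<rparr>"

definition internal_direct_sum ::
    "('a, 'x) ring_scheme \<Rightarrow> ('a, 'm) complex_of \<Rightarrow> 'i set \<Rightarrow> ('i \<Rightarrow> int \<Rightarrow> 'm set) \<Rightarrow> bool" where
  "internal_direct_sum A C I D \<longleftrightarrow>
     finite I \<and> (\<forall>i\<in>I. subcomplex A C (D i)) \<and>
     (\<forall>n. \<forall>c\<in>carrier (obj C n).
        \<exists>!f. f \<in> (\<Pi>\<^sub>E i\<in>I. D i n) \<and> c = (\<Oplus>\<^bsub>obj C n\<^esub>i\<in>I. f i))"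

definition indecomposable_complex ::
    "('a, 'x) ring_scheme \<Rightarrow> ('a, 'm) complex_of \<Rightarrow> bool" where
  "indecomposable_complex A C \<longleftrightarrow>
     chain_complex A C \<and>
     (\<exists>n. carrier (obj C n) \<noteq> {\<zero>\<^bsub>obj C n\<^esub>}) \<and>
     (\<forall>D :: bool \<Rightarrow> int \<Rightarrow> 'm set. internal_direct_sum A C UNIV D \<longrightarrow>
        (\<exists>b. \<forall>n. D b n = {\<zero>\<^bsub>obj C n\<^esub>}))"


section \<open>Extension of scalars\<close>

text \<open>
  Throughout, \<open>R\<close> is a subring of the commutative ring \<open>R'\<close> (both on the same type), and
  \<open>R' \<otimes>\<^sub>R M\<close> is the free abelian group on \<open>R' \<times> M\<close> modulo the usual relations; its elements are
  cosets of formal \<open>\<int>\<close>-linear combinations of pairs.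
\<close>

definition tensor_relations ::
    "'r ring \<Rightarrow> 'r ring \<Rightarrow> ('r, 'm) module \<Rightarrow> ('r \<times> 'm \<Rightarrow>\<^sub>0 int) set" where
  "tensor_relations R R' M =
     {frag_of (x \<oplus>\<^bsub>R'\<^esub> y, m) - frag_of (x, m) - frag_of (y, m) | x y m.
        x \<in> carrier R' \<and> y \<in> carrier R' \<and> m \<in> carrier M} \<union>
     {frag_of (x, m \<oplus>\<^bsub>M\<^esub> n) - frag_of (x, m) - frag_of (x, n) | x m n.
        x \<in> carrier R' \<and> m \<in> carrier M \<and> n \<in> carrier M} \<union>
     {frag_of (x \<otimes>\<^bsub>R'\<^esub> r, m) - frag_of (x, r \<odot>\<^bsub>M\<^esub> m) | x r m.
        x \<in> carrier R' \<and> r \<in> carrier R \<and> m \<in> carrier M}"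

definition tensor_free ::
    "'r ring \<Rightarrow> ('r, 'm) module \<Rightarrow> ('r \<times> 'm \<Rightarrow>\<^sub>0 int) monoid" where
  "tensor_free R' M = free_Abelian_group (carrier R' \<times> carrier M)"

definition tensor_null ::
    "'r ring \<Rightarrow> 'r ring \<Rightarrow> ('r, 'm) module \<Rightarrow> ('r \<times> 'm \<Rightarrow>\<^sub>0 int) set" where
  "tensor_null R R' M = generate (tensor_free R' M) (tensor_relations R R' M)"

definition tensor_class ::
    "'r ring \<Rightarrow> 'r ring \<Rightarrow> ('r, 'm) module \<Rightarrow> ('r \<times> 'm \<Rightarrow>\<^sub>0 int) \<Rightarrow> ('r \<times> 'm \<Rightarrow>\<^sub>0 int) set" where
  "tensor_class R R' M u = tensor_null R R' M #>\<^bsub>tensor_free R' M\<^esub> u"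

definition tensor_group ::
    "'r ring \<Rightarrow> 'r ring \<Rightarrow> ('r, 'm) module \<Rightarrow> ('r \<times> 'm \<Rightarrow>\<^sub>0 int) set monoid" where
  "tensor_group R R' M = tensor_free R' M Mod tensor_null R R' M"

text \<open>The biadditive extension of \<open>(x, a) \<cdot> (y, m) = (x y, a \<cdot> m)\<close> to formal sums.\<close>

definition tensor_product_map ::
    "'r ring \<Rightarrow> ('a \<Rightarrow> 'm \<Rightarrow> 'm) \<Rightarrow> ('r \<times> 'a \<Rightarrow>\<^sub>0 int) \<Rightarrow> ('r \<times> 'm \<Rightarrow>\<^sub>0 int) \<Rightarrow> ('r \<times> 'm \<Rightarrow>\<^sub>0 int)"
  where
  "tensor_product_map R' act u v =
     frag_extend (\<lambda>(x, a). frag_extend (\<lambda>(y, m). frag_of (x \<otimes>\<^bsub>R'\<^esub> y, act a m)) v) u"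

text \<open>
  As for \<^const>\<open>FactRing\<close>, operations on cosets are unions over representatives; all cosets
  in such a union coincide.
\<close>

definition base_change_algebra ::
    "'r ring \<Rightarrow> 'r ring \<Rightarrow> ('r, 'a) module \<Rightarrow> ('r, ('r \<times> 'a \<Rightarrow>\<^sub>0 int) set) module" where
  "base_change_algebra R R' A =
     \<lparr>carrier = carrier (tensor_group R R' A),
      monoid.mult = (\<lambda>U V. \<Union>u\<in>U. \<Union>v\<in>V. tensor_class R R' A (tensor_product_map R' (monoid.mult A) u v)),
      one = tensor_class R R' A (frag_of (\<one>\<^bsub>R'\<^esub>, \<one>\<^bsub>A\<^esub>)),
      ring.zero = one (tensor_group R R' A),
      add = monoid.mult (tensor_group R R' A),
      smult = (\<lambda>x U. \<Union>u\<in>U.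
        tensor_class R R' A (frag_extend (\<lambda>(y, a). frag_of (x \<otimes>\<^bsub>R'\<^esub> y, a)) u))\<rparr>"

text \<open>An \<open>A\<close>-module as a module over \<open>R\<close>, via \<open>r \<mapsto> r \<cdot> 1\<^sub>A\<close>. The ring multiplication and unit
  in a \<^typ>\<open>('r, 'm) module\<close> record are irrelevant for modules.\<close>

definition restrict_scalars :: "('r, 'a) module \<Rightarrow> ('a, 'm) module \<Rightarrow> ('r, 'm) module" where
  "restrict_scalars A M =
     \<lparr>carrier = carrier M, monoid.mult = monoid.mult M, one = one M, ring.zero = ring.zero M, add = add M,
      smult = (\<lambda>r m. (r \<odot>\<^bsub>A\<^esub> \<one>\<^bsub>A\<^esub>) \<odot>\<^bsub>M\<^esub> m)\<rparr>"

definition base_change_module ::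
    "'r ring \<Rightarrow> 'r ring \<Rightarrow> ('r, 'a) module \<Rightarrow> ('a, 'm) module
      \<Rightarrow> (('r \<times> 'a \<Rightarrow>\<^sub>0 int) set, ('r \<times> 'm \<Rightarrow>\<^sub>0 int) set) module" where
  "base_change_module R R' A M =
     \<lparr>carrier = carrier (tensor_group R R' (restrict_scalars A M)),
      monoid.mult = undefined,
      one = undefined,
      ring.zero = one (tensor_group R R' (restrict_scalars A M)),
      add = monoid.mult (tensor_group R R' (restrict_scalars A M)),
      smult = (\<lambda>U V. \<Union>u\<in>U. \<Union>v\<in>V.
        tensor_class R R' (restrict_scalars A M) (tensor_product_map R' (smult M) u v))\<rparr>"

definition base_change_complex ::
    "'r ring \<Rightarrow> 'r ring \<Rightarrow> ('r, 'a) module \<Rightarrow> ('a, 'm) complex_of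
      \<Rightarrow> (('r \<times> 'a \<Rightarrow>\<^sub>0 int) set, ('r \<times> 'm \<Rightarrow>\<^sub>0 int) set) complex_of" where
  "base_change_complex R R' A C =
     \<lparr>obj = (\<lambda>n. base_change_module R R' A (obj C n)),
      diff = (\<lambda>n U. \<Union>u\<in>U. tensor_class R R' (restrict_scalars A (obj C (n - 1)))
        (frag_extend (\<lambda>(x, m). frag_of (x, diff C n m)) u))\<rparr>"

end

theory Submission
  imports Defs "HOL-Computational_Algebra.Polynomial_Factorial" "HOL-Computational_Algebra.Fundamental_Theorem_Algebra"
begin

text \<open>
  The ring \<open>E = End C\<close> is separated and complete for the \<open>p\<close>-adic filtration, and its quotients
  are finite; since idempotents of \<open>E / I\<^sub>1\<close>, where \<open>I\<^sub>1\<close> consists of the endomorphisms with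
  values in \<open>p C\<close>, lift to \<open>E\<close>, indecomposability of \<open>C\<close> makes \<open>E / I\<^sub>1\<close> a finite ring without
  nontrivial idempotents. Its nilpotent elements form an ideal with a finite division ring as
  quotient, which is commutative by Wedderburn's theorem. So the commutators of \<open>E\<close> lie in an
  ideal \<open>J\<close> that is nilpotent modulo \<open>I\<^sub>1\<close>.

  The ring \<open>\<O>'\<close> has a finite basis over \<open>\<O>\<close>, and an endomorphism of \<open>C'\<close> has coordinates in \<open>E\<close>
  with respect to it. As \<open>\<O>'\<close> is commutative, the coordinates of a commutator of \<open>E' = End C'\<close>
  lie in \<open>J\<close>, so commutators of \<open>E'\<close> are nilpotent modulo \<open>p\<close>. Write \<open>1\<close> as a sum of
  orthogonal primitive idempotents of \<open>E'\<close>; the images are indecomposable summands of \<open>C'\<close>. An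
  isomorphism between the images of \<open>e \<noteq> f\<close> yields \<open>u, v \<in> E'\<close> with \<open>v u = e\<close> and \<open>u v = f\<close>,
  and then \<open>e = e (v u - u v)\<^sup>M\<close> is divisible by \<open>p\<close>, which is impossible for a nonzero idempotent.
\<close>

text \<open>Isomorphic summands belonging to \<open>e\<close> and \<open>f\<close> make
  \<open>e - f\<close> itself a commutator; this is why commutators decide the matter. The obstacle
  is that a coordinate of a power of a commutator of E' is a sum of long products of different
  elements of \<open>J\<close>, so it does not suffice that each element of \<open>J\<close> is
  nilpotent modulo p. A bound on the length of products, uniform in the factors, is needed. The
  chain \<open>ann_chain\<close>, pulled back to \<open>L 0\<close>, ..., \<open>L M\<close>,
  provides it: left multiplication by \<open>J\<close> lowers the index by one. The modules of C may
  have torsion, so endomorphisms with values in p C need not be p times an endomorphism. The ideals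
  are therefore defined through values, and the coordinates \<kappa> with their product rule take
  the place of an identification of E' with a tensor product. Absolute unramifiedness turns the
  maximal ideals into the multiples of p, so that separation, completeness and finiteness can be
  stated for abelian groups and passed to modules and endomorphisms. Finiteness of k makes the
  quotients of E finite; finiteness of k' makes \<O>' finite over \<O>.\<close>

section \<open>A divisor of q^n - 1 obtained from a primitive root of unity\<close>

lemma map_poly_of_int_mult:
  "map_poly (of_int :: int \<Rightarrow> complex) (f * g) = map_poly of_int f * map_poly of_int g"
  by (intro poly_eqI) (simp add: coeff_map_poly coeff_mult)

lemma map_poly_of_int_xn_minus_1:
  "poly (map_poly (of_int :: int \<Rightarrow> complex) (monom 1 n - 1)) z = z ^ n - 1"
proof -
  have "map_poly (of_int :: int \<Rightarrow> complex) (monom 1 n - 1) = monom 1 n - 1"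
    by (intro poly_eqI) (simp add: coeff_map_poly)
  then show ?thesis
    by (simp add: poly_monom)
qed

lemma poly_of_int_map_poly:
  "poly (map_poly (of_int :: int \<Rightarrow> complex) f) (of_int a) = of_int (poly f a)"
  by (induction f) (simp_all add: map_poly_pCons)

text \<open>A point of the unit circle other than 1 has real part strictly below 1, so the real part
  of the difference alone already exceeds q - 1.\<close>

lemma norm_minus_root_of_unity:
  fixes z :: complex and q :: real
  assumes "norm z = 1" "z \<noteq> 1" "q \<ge> 2"
  shows "norm (of_real q - z) > q - 1"
proof -
  have re: "Re z < 1"
  proof (rule ccontr)
    assume "\<not> Re z < 1"
    then have "(Re z)\<^sup>2 \<ge> 1"
      by (simp add: one_le_power)
    moreover have "(Re z)\<^sup>2 + (Im z)\<^sup>2 = 1"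
      using assms(1) by (metis cmod_power2 one_power2)
    ultimately have "Im z = 0" "(Re z)\<^sup>2 = 1"
      by (smt (verit) zero_le_power2 power_eq_0_iff)+
    then have "z = 1"
      using \<open>\<not> Re z < 1\<close> by (auto simp: power2_eq_1_iff complex_eq_iff)
    then show False using assms by simp
  qed
  have "q - 1 < Re (of_real q - z)" using re by simp
  also have "\<dots> \<le> norm (of_real q - z)" by (rule complex_Re_le_cmod)
  finally show ?thesis .
qed

text \<open>\<open>1 \<le> B\<close> gives B \<le> B * B, so the strict bound survives
  multiplication. It is applied with B = q - 1, which may be 1; then the empty product would violate
  the claim.\<close>

lemma prod_greater_of_factors:
  fixes f :: "'i \<Rightarrow> real"
  assumes "finite I" "I \<noteq> {}" "1 \<le> B" "\<And>i. i \<in> I \<Longrightarrow> B < f i"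
  shows "B < prod f I"
  using assms(1,2,4)
proof (induction I rule: finite_ne_induct)
  case (singleton x)
  then show ?case by simp
next
  case (insert x F)
  have "B \<le> B * B" using \<open>1 \<le> B\<close> by simp
  also have "\<dots> < f x * prod f F"
    using insert \<open>1 \<le> B\<close> by (intro mult_strict_mono) (auto intro: less_trans[of 0 B])
  finally show ?case using insert by simp
qed

text \<open>The witness is the value at \<open>q\<close> of an irreducible integral factor of \<open>X ^ n - 1\<close> that
  vanishes at a primitive \<open>n\<close>-th root of unity; no theory of cyclotomic polynomials is needed.\<close>

lemma cyclotomic_divisor:
  fixes q n :: nat
  assumes q: "q \<ge> 2" and n: "n \<ge> 2"
  obtains N :: int where "\<bar>N\<bar> > int q - 1" "N dvd int q ^ n - 1"
    "\<And>d k. d < n \<Longrightarrow> d > 0 \<Longrightarrow> d dvd n \<Longrightarrow> int q ^ n - 1 = (int q ^ d - 1) * k \<Longrightarrow> N dvd k"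
proof -
  define ev :: "int poly \<Rightarrow> complex \<Rightarrow> complex" where "ev f = poly (map_poly of_int f)" for f
  have ev_mult: "ev (f * g) z = ev f z * ev g z" for f g z
    by (simp add: ev_def map_poly_of_int_mult)
  define F :: "nat \<Rightarrow> int poly" where "F m = monom 1 m - 1" for m
  have ev_F: "ev (F m) z = z ^ m - 1" for m z
    by (simp add: ev_def F_def map_poly_of_int_xn_minus_1)
  define \<zeta> where "\<zeta> = cis (2 * pi / real n)"
  have \<zeta>n: "\<zeta> ^ n = 1"
    using n by (simp add: \<zeta>_def DeMoivre)
  have \<zeta>d: "\<zeta> ^ d \<noteq> 1" if "0 < d" "d < n" for d
  proof
    assume "\<zeta> ^ d = 1"
    then have "cos (real d * (2 * pi / real n)) = 1"
      by (simp add: \<zeta>_def DeMoivre complex_eq_iff)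
    then obtain k :: int where k: "real d * (2 * pi / real n) = of_int k * 2 * pi"
      by (auto simp: cos_one_2pi_int)
    then have "real d = of_int k * real n"
      using n by (simp add: field_simps)
    then have "int d = k * int n"
      by (metis of_int_eq_iff of_int_mult of_int_of_nat_eq)
    with that show False
      by (metis dvd_triv_right int_dvd_int_iff nat_dvd_not_less)
  qed
  have F0: "F n \<noteq> 0"
    using n by (auto simp: F_def poly_eq_iff intro!: exI[of _ n])
  \<comment> \<open>Factoring over the integers keeps the values at \<open>q\<close> integral. Some
    prime factor must vanish at \<zeta>, because the product does.\<close>
  obtain A where A: "\<And>x. x \<in># A \<Longrightarrow> prime_elem x" "normalize (prod_mset A) = normalize (F n)"
    using prime_factorization_exists[OF F0] by blast
  have "F n dvd prod_mset A"
    using A(2) by (metis associated_iff_dvd)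
  then have "ev (prod_mset A) \<zeta> = 0"
    by (auto simp: ev_mult ev_F \<zeta>n elim!: dvdE)
  moreover have "\<exists>x. x \<in># B \<and> ev x \<zeta> = 0" if "ev (prod_mset B) \<zeta> = 0" for B
    using that
  proof (induction B)
    case empty
    then show ?case by (simp add: ev_def)
  next
    case (add x B)
    then show ?case by (auto simp: ev_mult)
  qed
  ultimately obtain P where P: "P \<in># A" "ev P \<zeta> = 0" by blast
  have primeP: "prime_elem P" using A P by blast
  have "P dvd prod_mset A" using P(1) by (rule dvd_prod_mset)
  then have PF: "P dvd F n"
    using A(2) by (metis associated_iff_dvd dvd_trans)
  \<comment> \<open>\<open>P\<close> vanishes at \<zeta> and \<open>F d\<close> does not, so the
    prime \<open>P\<close> has to divide the cofactor.\<close>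
  have key: "P dvd G" if "d < n" "d > 0" "F n = F d * G" for d G
  proof -
    have "ev (F d) \<zeta> \<noteq> 0"
      using \<zeta>d[OF that(2,1)] by (simp add: ev_F)
    then have "\<not> P dvd F d"
      using P(2) by (auto simp: ev_mult elim!: dvdE)
    then show ?thesis
      using PF prime_elem_dvd_multD[OF primeP, of "F d" G] that(3) by auto
  qed
  have F_factor: "F n = F d * (\<Sum>i<n div d. monom 1 (d * i))" if "d dvd n" for d
  proof -
    have "F n = monom 1 d ^ (n div d) - 1"
      using that by (simp add: F_def monom_power)
    also have "\<dots> = (monom 1 d - 1) * (\<Sum>i<n div d. monom 1 d ^ i)"
      by (rule power_diff_1_eq)
    finally show ?thesis by (simp add: F_def monom_power)
  qed
  \<comment> \<open>The cofactor of X - 1 takes the value n at 1, and \<open>P\<close> divides it.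
    Thus 1 is not a root of \<open>P\<close>, as the estimate by
    \<open>norm_minus_root_of_unity\<close> requires.\<close>
  have P1: "ev P 1 \<noteq> 0"
  proof
    assume "ev P 1 = 0"
    moreover have "P dvd (\<Sum>i<n. monom 1 i)"
      using key[of 1 "\<Sum>i<n. monom 1 i"] F_factor[of 1] n by simp
    ultimately have "ev (\<Sum>i<n. monom 1 i) 1 = 0"
      by (auto simp: ev_mult elim!: dvdE)
    moreover have "ev (\<Sum>i<n. monom 1 i) 1 = of_int (poly (\<Sum>i<n. monom 1 i) 1)"
      unfolding ev_def using poly_of_int_map_poly[of _ 1] by simp
    ultimately show False using n by (simp add: poly_sum poly_monom)
  qed
  define cP :: "complex poly" where "cP = map_poly of_int P"
  obtain G where G: "F n = P * G" using PF by blast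
  have root: "norm z = 1 \<and> z \<noteq> 1" if "poly cP z = 0" for z
  proof -
    have "ev P z = 0" using that by (simp add: ev_def cP_def)
    then have "ev (F n) z = 0" by (simp add: G ev_mult)
    then have "z ^ n = 1" by (simp add: ev_F)
    then have "norm z ^ n = 1" by (metis norm_one norm_power)
    then have "norm z = 1"
      using n by (metis norm_ge_zero power_eq_1_iff abs_norm_cancel real_norm_def neq0_conv not_numeral_le_zero)
    moreover have "z \<noteq> 1" using P1 that by (auto simp: ev_def cP_def)
    ultimately show ?thesis by simp
  qed
  have cP0: "cP \<noteq> 0"
    using P1 by (auto simp: cP_def ev_def)
  \<comment> \<open>A divisor of a monic integral polynomial has leading coefficient 1 or -1; hence
    the absolute value of \<open>P\<close> at q is exactly the product of the distances from q to
    its roots.\<close>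
  have "lead_coeff (F n) = 1"
  proof -
    have "degree (F n) = n"
      using n unfolding F_def by (intro antisym degree_diff_le le_degree) (auto simp: degree_monom_eq)
    then show ?thesis using n by (simp add: F_def)
  qed
  then have "lead_coeff P * lead_coeff G = 1"
    by (simp add: G lead_coeff_mult)
  then have lc: "\<bar>lead_coeff P\<bar> = 1"
    using zmult_eq_1_iff by fastforce
  have lcP: "norm (lead_coeff cP) = 1"
  proof -
    have "lead_coeff cP = of_int (lead_coeff P)"
      unfolding cP_def by (subst degree_map_poly) (auto simp: coeff_map_poly)
    then show ?thesis
      using lc by (metis norm_of_int of_int_1 of_int_abs)
  qed
  obtain root where dec: "smult (lead_coeff cP) (\<Prod>i<degree cP. [:- root i, 1:]) = cP"
    by (rule complex_poly_decompose')
  have rt: "poly cP (root i) = 0" if "i < degree cP" for i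
    by (subst dec[symmetric]) (use that in \<open>auto simp: poly_prod intro!: bexI[of _ i]\<close>)
  \<comment> \<open>A nonzero polynomial with a root is not constant, so the product of distances is
    not empty.\<close>
  have "poly cP \<zeta> = 0" using P by (simp add: ev_def cP_def)
  then have deg: "degree cP > 0"
    using cP0 by (cases "degree cP = 0") (auto elim!: degree_eq_zeroE)
  have "norm (poly cP (of_nat q)) = (\<Prod>i<degree cP. norm (of_real (real q) - root i))"
    by (subst dec[symmetric]) (simp add: poly_prod norm_mult lcP prod_norm)
  also have "\<dots> > real q - 1"
    using deg q root[OF rt] by (intro prod_greater_of_factors norm_minus_root_of_unity) auto
  finally have "real q - 1 < norm (poly cP (of_nat q))" .
  also have "poly cP (of_nat q) = of_int (poly P (int q))"
    unfolding cP_def by (metis of_int_of_nat_eq poly_of_int_map_poly)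
  finally have big: "\<bar>poly P (int q)\<bar> > int q - 1"
    by (simp only: norm_of_int)
  show ?thesis
  proof (rule that[OF big])
    show "poly P (int q) dvd int q ^ n - 1"
      using arg_cong[OF G, of "\<lambda>f. poly f (int q)"] by (simp add: F_def poly_monom)
    fix d k assume d: "d < n" "d > 0" "d dvd n" and k: "int q ^ n - 1 = (int q ^ d - 1) * k"
    define H :: "int poly" where "H = (\<Sum>i<n div d. monom 1 (d * i))"
    have FH: "F n = F d * H" unfolding H_def by (rule F_factor[OF d(3)])
    then have "poly P (int q) dvd poly H (int q)"
      using key[OF d(1,2) FH] by (auto elim!: dvdE)
    \<comment> \<open>Cancelling the nonzero factor identifies the given \<open>k\<close> with
      \<open>poly H (int q)\<close>.\<close>
    moreover have "int q ^ n - 1 = (int q ^ d - 1) * poly H (int q)"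
      using arg_cong[OF FH, of "\<lambda>f. poly f (int q)"] by (simp add: F_def poly_monom)
    moreover have "int q ^ d - 1 \<noteq> 0"
      using q d by (simp add: nat_power_eq_Suc_0_iff flip: of_nat_power)
    ultimately show "poly P (int q) dvd k" using k by simp
  qed
qed

section \<open>Wedderburn's theorem on finite division rings\<close>

locale finite_division_ring = ring R for R (structure) +
  assumes finite_carrier: "finite (carrier R)"
    and one_not_zero: "\<one> \<noteq> \<zero>"
    and nonzero_Units: "\<And>x. x \<in> carrier R \<Longrightarrow> x \<noteq> \<zero> \<Longrightarrow> x \<in> Units R"
begin

lemma Units_eq: "Units R = carrier R - {\<zero>}"
proof -
  have "\<zero> \<notin> Units R"
    using one_not_zero by (auto simp: Units_def)
  then show ?thesis
    using nonzero_Units by (auto simp: Units_closed)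
qed

definition division_subring :: "'a set \<Rightarrow> bool" where
  "division_subring F \<longleftrightarrow> F \<subseteq> carrier R \<and> \<zero> \<in> F \<and> \<one> \<in> F \<and> (\<forall>x\<in>F. \<forall>y\<in>F. x \<ominus> y \<in> F \<and> x \<otimes> y \<in> F)
     \<and> (\<forall>x\<in>F. x \<noteq> \<zero> \<longrightarrow> inv x \<in> F)"

text \<open>Closure under negation is not listed: it comes from the scalar -1 as soon as F is a
  division subring.\<close>

definition left_subspace :: "'a set \<Rightarrow> 'a set \<Rightarrow> bool" where
  "left_subspace F V \<longleftrightarrow> V \<subseteq> carrier R \<and> \<zero> \<in> V \<and> (\<forall>x\<in>V. \<forall>y\<in>V. x \<oplus> y \<in> V)
     \<and> (\<forall>a\<in>F. \<forall>x\<in>V. a \<otimes> x \<in> V)"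

text \<open>Replaces a basis by a maximality argument: among the subspaces of V whose size is a
  power of \<open>card F\<close>, a largest one must be V, since adjoining one more vector
  multiplies the size by \<open>card F\<close>.\<close>

lemma card_left_subspace:
  assumes F: "division_subring F" and V: "left_subspace F V"
  shows "\<exists>m. card V = card F ^ m"
proof -
  have Fc: "F \<subseteq> carrier R" and F0: "\<zero> \<in> F" and F1: "\<one> \<in> F" and Fm: "\<And>x y. x \<in> F \<Longrightarrow> y \<in> F \<Longrightarrow> x \<ominus> y \<in> F"
    and Fi: "\<And>x. x \<in> F \<Longrightarrow> x \<noteq> \<zero> \<Longrightarrow> inv x \<in> F" using F by (auto simp: division_subring_def)
  have Vc: "V \<subseteq> carrier R" using V by (simp add: left_subspace_def)
  have finV: "finite V" using Vc finite_carrier finite_subset by blast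
  have F_uminus: "\<ominus> x \<in> F" if "x \<in> F" for x
    using Fm[OF F0 that] Fc that by (auto simp: minus_eq)
  have F_add: "x \<oplus> y \<in> F" if "x \<in> F" "y \<in> F" for x y
    using Fm[OF that(1) F_uminus[OF that(2)]] Fc that by (auto simp: minus_eq)
  define S where "S = {W. left_subspace F W \<and> W \<subseteq> V \<and> (\<exists>m. card W = card F ^ m)}"
  have "{\<zero>} \<in> S"
    using V Fc by (auto simp: S_def left_subspace_def intro: exI[of _ 0])
  moreover have "finite S" using finV by (auto simp: S_def intro: finite_subset[of _ "Pow V"])
  ultimately obtain W where W: "W \<in> S" "\<And>W'. W' \<in> S \<Longrightarrow> card W' \<le> card W"
  proof -
    assume S: "{\<zero>} \<in> S" "finite S"
      and that: "\<And>W. W \<in> S \<Longrightarrow> (\<And>W'. W' \<in> S \<Longrightarrow> card W' \<le> card W) \<Longrightarrow> thesis"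
    have "Max (card ` S) \<in> card ` S" using S by (intro Max_in) auto
    then obtain W where "W \<in> S" "card W = Max (card ` S)" by force
    then show thesis using S(2) by (intro that[of W]) auto
  qed
  obtain m where m: "card W = card F ^ m" using W by (auto simp: S_def)
  have Ws: "left_subspace F W" and WV: "W \<subseteq> V" using W by (auto simp: S_def)
  have Wc: "W \<subseteq> carrier R" using WV Vc by blast
  have W_add: "\<And>x y. x \<in> W \<Longrightarrow> y \<in> W \<Longrightarrow> x \<oplus> y \<in> W" and W_sm: "\<And>a x. a \<in> F \<Longrightarrow> x \<in> W \<Longrightarrow> a \<otimes> x \<in> W"
    and W0: "\<zero> \<in> W"
    using Ws by (auto simp: left_subspace_def)
  have W_uminus: "\<ominus> x \<in> W" if "x \<in> W" for x
    using W_sm[OF F_uminus[OF F1] that] Wc that by (auto simp: l_minus)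
  have "W = V"
  proof (rule ccontr)
    assume "W \<noteq> V"
    then obtain v where v: "v \<in> V" "v \<notin> W" using WV by blast
    have vc: "v \<in> carrier R" using v Vc by blast
    \<comment> \<open>The image of \<open>g\<close> is F v + W. If two pairs with a \<noteq> b had
      the same image, (a - b) v would lie in W, and multiplying by the inverse of a - b would put v
      into W.\<close>
    define g where "g = (\<lambda>(a, w). a \<otimes> v \<oplus> w)"
    have inj: "inj_on g (F \<times> W)"
    proof (rule inj_onI, clarify)
      fix a w b u
      assume H: "a \<in> F" "w \<in> W" "b \<in> F" "u \<in> W" "g (a, w) = g (b, u)"
      have c: "a \<in> carrier R" "w \<in> carrier R" "b \<in> carrier R" "u \<in> carrier R" using H Fc Wc by auto
      have e: "a \<otimes> v \<oplus> w = b \<otimes> v \<oplus> u" using H by (simp add: g_def)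
      have "(a \<ominus> b) \<otimes> v = (a \<otimes> v \<oplus> w) \<oplus> (\<ominus> (b \<otimes> v) \<oplus> \<ominus> w)"
        using c vc by (simp add: minus_eq l_distr l_minus a_ac r_neg2)
      also have "\<dots> = (b \<otimes> v \<oplus> u) \<oplus> (\<ominus> (b \<otimes> v) \<oplus> \<ominus> w)"
        by (simp only: e)
      also have "\<dots> = u \<oplus> \<ominus> w"
      proof -
        have "\<And>s t r. s \<in> carrier R \<Longrightarrow> t \<in> carrier R \<Longrightarrow> r \<in> carrier R \<Longrightarrow>
            (s \<oplus> t) \<oplus> (\<ominus> s \<oplus> r) = t \<oplus> r"
          by (subst a_comm) (simp_all add: a_assoc r_neg2)
        then show ?thesis using c vc by simp
      qed
      finally have d: "(a \<ominus> b) \<otimes> v = u \<oplus> \<ominus> w" .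
      have dW: "(a \<ominus> b) \<otimes> v \<in> W" unfolding d using H W_uminus W_add by blast
      have ab: "a \<ominus> b = \<zero>"
      proof (rule ccontr)
        assume nz: "a \<ominus> b \<noteq> \<zero>"
        have abF: "a \<ominus> b \<in> F" using H Fm by blast
        then have U: "a \<ominus> b \<in> Units R" using nz Fc nonzero_Units by blast
        have "inv (a \<ominus> b) \<otimes> ((a \<ominus> b) \<otimes> v) \<in> W"
          using W_sm[OF Fi[OF abF nz] dW] .
        then show False
          using U vc v(2) by (simp add: m_assoc[symmetric] Units_closed Units_inv_closed Units_l_inv)
      qed
      then have "a = b" using c by (simp add: r_right_minus_eq)
      moreover have "w = u" using e[folded \<open>a = b\<close>] add.l_cancel[of "a \<otimes> v" w u] c vc by blast
      ultimately show "a = b \<and> w = u" by simp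
    qed
    define W' where "W' = g ` (F \<times> W)"
    have cW': "card W' = card F * card W"
      unfolding W'_def using inj by (simp add: card_image card_cartesian_product)
    have "left_subspace F W'"
      unfolding left_subspace_def
    proof (intro conjI ballI)
      show "W' \<subseteq> carrier R" using Fc Wc vc by (auto simp: W'_def g_def)
      have "\<zero> = g (\<zero>, \<zero>)" using vc by (simp add: g_def)
      then show "\<zero> \<in> W'" unfolding W'_def using F0 W0 by blast
    next
      fix x y assume "x \<in> W'" "y \<in> W'"
      then obtain a w b u where H: "a \<in> F" "w \<in> W" "b \<in> F" "u \<in> W" "x = g (a, w)" "y = g (b, u)"
        by (auto simp: W'_def)
      have c: "a \<in> carrier R" "w \<in> carrier R" "b \<in> carrier R" "u \<in> carrier R" using H Fc Wc by auto
      have "x \<oplus> y = g (a \<oplus> b, w \<oplus> u)" using H c vc by (simp add: g_def l_distr a_ac)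
      then show "x \<oplus> y \<in> W'" unfolding W'_def using H F_add W_add by blast
    next
      fix a x assume "a \<in> F" "x \<in> W'"
      then obtain b w where H: "b \<in> F" "w \<in> W" "x = g (b, w)" by (auto simp: W'_def)
      have c: "a \<in> carrier R" "w \<in> carrier R" "b \<in> carrier R" using H Fc Wc \<open>a \<in> F\<close> by auto
      have "a \<otimes> x = g (a \<otimes> b, a \<otimes> w)" using H c vc by (simp add: g_def r_distr m_assoc)
      moreover have "a \<otimes> b \<in> F" using F \<open>a \<in> F\<close> H by (simp add: division_subring_def)
      ultimately show "a \<otimes> x \<in> W'" unfolding W'_def using H \<open>a \<in> F\<close> W_sm by blast
    qed
    moreover have "W' \<subseteq> V"
      using V v WV by (auto simp: W'_def g_def left_subspace_def)
    moreover have "card W' = card F ^ Suc m" using cW' m by simp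
    ultimately have "W' \<in> S" unfolding S_def by blast
    then have "card W' \<le> card W" by (rule W(2))
    \<comment> \<open>Makes the enlargement strict, which contradicts the maximality of W.\<close>
    moreover have "card F \<ge> 2"
    proof -
      have "card {\<zero>, \<one>} \<le> card F"
        using F0 F1 Fc finite_carrier by (intro card_mono) (auto intro: finite_subset)
      then show ?thesis using one_not_zero by simp
    qed
    moreover have "card W > 0" using W0 WV finV by (auto simp: card_gt_0_iff intro: finite_subset)
    ultimately show False using cW' by simp
  qed
  then show ?thesis using m by blast
qed

definition centralizer :: "'a \<Rightarrow> 'a set" where
  "centralizer a = {x \<in> carrier R. x \<otimes> a = a \<otimes> x}"

definition center :: "'a set" where
  "center = {x \<in> carrier R. \<forall>a\<in>carrier R. x \<otimes> a = a \<otimes> x}"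

lemma inv_commute:
  assumes "x \<in> Units R" "a \<in> carrier R" "x \<otimes> a = a \<otimes> x"
  shows "inv x \<otimes> a = a \<otimes> inv x"
proof -
  have xc: "x \<in> carrier R" "inv x \<in> carrier R" using assms by auto
  have "inv x \<otimes> a = inv x \<otimes> (a \<otimes> x) \<otimes> inv x"
    using assms xc by (simp add: m_assoc)
  also have "\<dots> = a \<otimes> inv x"
    using assms xc by (simp add: assms(3)[symmetric] m_assoc[symmetric])
  finally show ?thesis .
qed

lemma division_subring_centralizer:
  assumes "a \<in> carrier R"
  shows "division_subring (centralizer a)"
  unfolding division_subring_def
proof (intro conjI ballI impI)
  fix x y assume xy: "x \<in> centralizer a" "y \<in> centralizer a"
  then have c: "x \<in> carrier R" "y \<in> carrier R" "x \<otimes> a = a \<otimes> x" "y \<otimes> a = a \<otimes> y"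
    by (auto simp: centralizer_def)
  show "x \<ominus> y \<in> centralizer a"
    using c assms by (simp add: centralizer_def minus_eq l_distr r_distr l_minus r_minus)
  show "x \<otimes> y \<in> centralizer a"
    using c assms by (simp add: centralizer_def m_assoc) (simp add: m_assoc[symmetric])
qed (use assms in \<open>auto simp: centralizer_def nonzero_Units inv_commute\<close>)

text \<open>As an intersection of centralizers the center inherits their closure properties.\<close>

lemma center_eq: "center = (\<Inter>a\<in>carrier R. centralizer a)"
  by (auto simp: center_def centralizer_def)

lemma division_subring_center: "division_subring center"
proof -
  have ne: "carrier R \<noteq> {}" by auto
  have "division_subring (centralizer a)" if "a \<in> carrier R" for a
    using that by (rule division_subring_centralizer)
  then show ?thesis
    using ne unfolding center_eq division_subring_def by (simp add: subset_iff) blast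
qed

lemma left_subspace_self:
  assumes "division_subring F" "division_subring V" "F \<subseteq> V"
  shows "left_subspace F V"
proof -
  have "x \<oplus> y \<in> V" if "x \<in> V" "y \<in> V" for x y
  proof -
    have V: "\<And>x y. x \<in> V \<Longrightarrow> y \<in> V \<Longrightarrow> x \<ominus> y \<in> V" "\<zero> \<in> V" "V \<subseteq> carrier R"
      using assms(2) by (auto simp: division_subring_def)
    have "x \<ominus> (\<zero> \<ominus> y) \<in> V" using V that by blast
    then show ?thesis using V(3) that by (auto simp: minus_eq subset_iff)
  qed
  then show ?thesis
    using assms by (auto simp: left_subspace_def division_subring_def subset_iff)
qed

lemma division_subring_carrier: "division_subring (carrier R)"
  by (auto simp: division_subring_def nonzero_Units)

text \<open>Witt's class equation argument. With \<open>q = card center\<close> the unit group has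
  q^n - 1 elements, and a noncentral class has (q^n - 1) / (q^d - 1) elements for a proper divisor d
  of n. The integer N from \<open>cyclotomic_divisor\<close> divides q^n - 1 and all these class
  sizes, hence also q - 1, although its absolute value is larger than q - 1.\<close>

theorem wedderburn:
  assumes "x \<in> carrier R" "y \<in> carrier R"
  shows "x \<otimes> y = y \<otimes> x"
proof (rule ccontr)
  assume noncomm: "x \<otimes> y \<noteq> y \<otimes> x"
  define q where "q = card center"
  have fin: "finite S" if "S \<subseteq> carrier R" for S
    using that finite_carrier finite_subset by blast
  have cent_sub: "center \<subseteq> centralizer a" if "a \<in> carrier R" for a
    using that by (auto simp: center_eq)
  have q2: "q \<ge> 2"
  proof -
    have "card {\<zero>, \<one>} \<le> card center"
      using division_subring_center by (intro card_mono fin) (auto simp: division_subring_def)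
    then show ?thesis using one_not_zero by (simp add: q_def)
  qed
  obtain n where n: "card (carrier R) = q ^ n"
    using card_left_subspace[OF division_subring_center left_subspace_self[OF division_subring_center division_subring_carrier]]
    by (auto simp: q_def center_def)
  \<comment> \<open>The centralizer is a space over the center, and the whole ring is a space over
    the centralizer. Hence q^n = (q^d)^m, and d divides n.\<close>
  have dvd: "\<exists>d. card (centralizer a) = q ^ d \<and> d dvd n \<and> d > 0 \<and> (a \<notin> center \<longrightarrow> d < n)"
    if a: "a \<in> carrier R" for a
  proof -
    obtain d where d: "card (centralizer a) = q ^ d"
      using card_left_subspace[OF division_subring_center left_subspace_self[OF division_subring_center division_subring_centralizer[OF a] cent_sub[OF a]]]
      by (auto simp: q_def)
    obtain m where "card (carrier R) = card (centralizer a) ^ m"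
      using card_left_subspace[OF division_subring_centralizer[OF a] left_subspace_self[OF division_subring_centralizer[OF a] division_subring_carrier]]
      by (auto simp: centralizer_def)
    then have "q ^ n = q ^ (d * m)" using n d by (simp add: power_mult)
    then have nd: "n = d * m" using q2 by simp
    have "card (center) \<le> card (centralizer a)"
      using cent_sub[OF a] by (intro card_mono fin) (auto simp: centralizer_def)
    then have "d > 0" using q2 d by (cases "d = 0") (auto simp: q_def)
    moreover have "d < n" if nc: "a \<notin> center"
    proof -
      have "centralizer a \<subset> carrier R"
      proof -
        obtain b where "b \<in> carrier R" "a \<otimes> b \<noteq> b \<otimes> a"
          using nc a by (auto simp: center_def)
        then have "b \<in> carrier R - centralizer a" by (auto simp: centralizer_def)
        moreover have "centralizer a \<subseteq> carrier R" by (auto simp: centralizer_def)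
        ultimately show ?thesis by blast
      qed
      then have "card (centralizer a) < card (carrier R)"
        using finite_carrier by (rule psubset_card_mono[rotated])
      then show ?thesis using q2 n d by simp
    qed
    ultimately show ?thesis using d nd by auto
  qed
  have xnc: "x \<notin> center" using noncomm assms by (auto simp: center_def)
  have n2: "n \<ge> 2" using dvd[OF assms(1)] xnc by auto
  obtain N :: int where N: "\<bar>N\<bar> > int q - 1" "N dvd int q ^ n - 1"
    "\<And>d k. d < n \<Longrightarrow> d > 0 \<Longrightarrow> d dvd n \<Longrightarrow> int q ^ n - 1 = (int q ^ d - 1) * k \<Longrightarrow> N dvd k"
    using cyclotomic_divisor[OF q2 n2] by blast
  define G where "G = units_of R"
  interpret G: group G unfolding G_def by (rule units_group)
  have Gc: "carrier G = carrier R - {\<zero>}" by (simp add: G_def units_of_carrier Units_eq)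
  have Gm: "a \<otimes>\<^bsub>G\<^esub> b = a \<otimes> b" for a b by (simp add: G_def units_of_mult)
  have Gi: "inv\<^bsub>G\<^esub> a = inv a" if "a \<in> carrier G" for a
    using that by (simp add: G_def units_of_inv units_of_carrier)
  have oG: "Coset.order G = q ^ n - 1"
    using n finite_carrier by (simp add: Coset.order_def Gc card_Diff_singleton)
  define \<phi> where "\<phi> = (\<lambda>g. (\<lambda>h \<in> carrier G. g \<otimes>\<^bsub>G\<^esub> h \<otimes>\<^bsub>G\<^esub> (inv\<^bsub>G\<^esub> g)))"
  interpret act: group_action G "carrier G" \<phi>
    unfolding \<phi>_def by (rule G.action_by_conjugation)
  have finG: "finite (carrier G)" using finite_carrier Gc by simp
  have stab: "stabilizer G \<phi> a = centralizer a - {\<zero>}" if a: "a \<in> carrier G" for a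
  proof -
    have "\<phi> g a = a \<longleftrightarrow> g \<otimes> a = a \<otimes> g" if g: "g \<in> carrier G" for g
    proof -
      have "\<phi> g a = a \<longleftrightarrow> g \<otimes>\<^bsub>G\<^esub> a \<otimes>\<^bsub>G\<^esub> inv\<^bsub>G\<^esub> g = a" using a by (simp add: \<phi>_def)
      also have "\<dots> \<longleftrightarrow> g \<otimes>\<^bsub>G\<^esub> a = a \<otimes>\<^bsub>G\<^esub> g"
        using a g by (metis G.inv_solve_right' G.m_closed)
      finally show ?thesis by (simp add: Gm)
    qed
    then show ?thesis using Gc by (auto simp: stabilizer_def centralizer_def)
  qed
  have cstab: "card (stabilizer G \<phi> a) = card (centralizer a) - 1" if a: "a \<in> carrier G" for a
  proof -
    have "finite (centralizer a)" "\<zero> \<in> centralizer a"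
      using a Gc by (auto simp: centralizer_def intro: fin)
    then show ?thesis by (simp add: stab[OF a])
  qed
  define Orb where "Orb = orbits G (carrier G) \<phi>"
  have finO: "finite Orb" using finG by (simp add: Orb_def orbits_def)
  have part: "(\<Sum>Q\<in>Orb. card Q) = q ^ n - 1"
    using act.disjoint_sum[OF finG, of "\<lambda>_. 1::nat"] oG by (simp add: Orb_def Coset.order_def)
  define Z where "Z = center - {\<zero>}"
  have ZG: "Z \<subseteq> carrier G" by (auto simp: Z_def center_def Gc)
  have orbZ: "orbit G \<phi> a = {a}" if "a \<in> Z" for a
  proof -
    have aG: "a \<in> carrier G" using that ZG by blast
    have "\<phi> g a = a" if g: "g \<in> carrier G" for g
    proof -
      have "g \<otimes>\<^bsub>G\<^esub> a = a \<otimes>\<^bsub>G\<^esub> g"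
        using \<open>a \<in> Z\<close> g Gc by (auto simp: Z_def center_def Gm)
      then show ?thesis using aG g by (simp add: \<phi>_def G.m_assoc)
    qed
    then show ?thesis using G.one_closed by (auto simp: orbit_def intro!: exI[of _ "\<one>\<^bsub>G\<^esub>"])
  qed
  define S1 where "S1 = (\<lambda>a. {a}) ` Z"
  have S1: "S1 \<subseteq> Orb"
  proof
    fix Q assume "Q \<in> S1"
    then obtain a where "a \<in> Z" "Q = {a}" by (auto simp: S1_def)
    then show "Q \<in> Orb" using orbZ[of a] ZG by (auto simp: Orb_def orbits_def)
  qed
  have sumS1: "(\<Sum>Q\<in>S1. card Q) = q - 1"
  proof -
    have "(\<Sum>Q\<in>S1. card Q) = card Z" unfolding S1_def by (subst sum.reindex) (auto simp: inj_on_def)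
    also have "\<dots> = q - 1"
      using division_subring_center by (simp add: Z_def q_def fin division_subring_def)
    finally show ?thesis .
  qed
  \<comment> \<open>By orbit counting the class size is the cofactor of q^d - 1 in q^n - 1, to which
    the third property of \<open>N\<close> applies.\<close>
  have big: "N dvd int (card Q)" if Q: "Q \<in> Orb - S1" for Q
  proof -
    obtain a where a: "a \<in> carrier G" "Q = orbit G \<phi> a" using Q by (auto simp: Orb_def orbits_def)
    have "a \<notin> Z" using Q orbZ a by (auto simp: S1_def)
    then have ac: "a \<in> carrier R" "a \<notin> center" using a Gc by (auto simp: Z_def)
    obtain d where d: "card (centralizer a) = q ^ d" "d dvd n" "d > 0" "d < n" using dvd[OF ac(1)] ac(2) by blast
    have "card Q * (q ^ d - 1) = q ^ n - 1"
      using act.orbit_stabilizer_theorem[OF a(1)] cstab[OF a(1)] d oG a(2) by simp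
    then have "int (card Q * (q ^ d - 1)) = int (q ^ n - 1)" by simp
    then have "int q ^ n - 1 = (int q ^ d - 1) * int (card Q)"
      using q2 by (simp add: of_nat_diff mult.commute)
    then show ?thesis using N(3) d by blast
  qed
  have "(\<Sum>Q\<in>Orb. card Q) = (\<Sum>Q\<in>Orb - S1. card Q) + (\<Sum>Q\<in>S1. card Q)"
    using S1 finO by (rule sum.subset_diff)
  then have "int (q ^ n - 1) = (\<Sum>Q\<in>Orb - S1. int (card Q)) + int (q - 1)"
    unfolding part sumS1 by (simp flip: of_nat_sum)
  \<comment> \<open>The class equation, solved for the contribution of the center.\<close>
  then have "int q - 1 = int q ^ n - 1 - (\<Sum>Q\<in>Orb - S1. int (card Q))"
    using q2 by (simp add: of_nat_diff)
  moreover have "N dvd (\<Sum>Q\<in>Orb - S1. int (card Q))" by (rule dvd_sum) (rule big)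
  ultimately have "N dvd int q - 1" using N(2) by (metis dvd_diff)
  then have "\<bar>N\<bar> \<le> int q - 1"
    using q2 zdvd_imp_le[of "\<bar>N\<bar>" "int q - 1"] by simp
  then show False using N(1) by simp
qed

end

section \<open>Computing with cosets of a two-sided ideal\<close>

lemma ring_hom_nat_pow:
  assumes "h \<in> ring_hom R S" "ring R" "ring S" "x \<in> carrier R"
  shows "h (x [^]\<^bsub>R\<^esub> (n::nat)) = h x [^]\<^bsub>S\<^esub> n"
proof -
  interpret R: ring R by fact
  interpret S: ring S by fact
  show ?thesis
    using assms by (induction n) (simp_all add: ring_hom_one ring_hom_mult)
qed

context ideal
begin

lemma coset_eq_iff:
  assumes "x \<in> carrier R" "y \<in> carrier R"
  shows "I +> x = I +> y \<longleftrightarrow> x \<ominus> y \<in> I"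
  using assms by (metis quotient_eq_iff_same_a_r_cos is_ideal)

lemma coset_eq_zero_iff:
  assumes "x \<in> carrier R"
  shows "I +> x = \<zero>\<^bsub>R Quot I\<^esub> \<longleftrightarrow> x \<in> I"
  using coset_eq_iff[OF assms zero_closed] assms by (simp add: FactRing_def minus_eq a_coset_add_zero[OF a_subset])

lemma carrier_FactRing: "carrier (R Quot I) = (+>) I ` carrier R"
  by (auto simp: FactRing_simps)

lemma finite_FactRing:
  assumes "finite T" "T \<subseteq> carrier R" "\<And>x. x \<in> carrier R \<Longrightarrow> \<exists>t\<in>T. x \<ominus> t \<in> I"
  shows "finite (carrier (R Quot I))"
proof -
  have "carrier (R Quot I) \<subseteq> (+>) I ` T"
  proof
    fix V assume "V \<in> carrier (R Quot I)"
    then obtain x where "x \<in> carrier R" "V = I +> x" by (auto simp: carrier_FactRing)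
    moreover from this(1) obtain t where "t \<in> T" "x \<ominus> t \<in> I" using assms(3) by blast
    ultimately have "V = I +> t" using assms(2) coset_eq_iff[of x t] by auto
    then show "V \<in> (+>) I ` T" using \<open>t \<in> T\<close> by blast
  qed
  then show ?thesis using assms(1) finite_surj by blast
qed

lemma coset_one: "I +> \<one> = \<one>\<^bsub>R Quot I\<^esub>"
  by (rule ring_hom_one[OF rcos_ring_hom])

lemma coset_mult: "x \<in> carrier R \<Longrightarrow> y \<in> carrier R \<Longrightarrow> I +> (x \<otimes> y) = (I +> x) \<otimes>\<^bsub>R Quot I\<^esub> (I +> y)"
  using ring_hom_mult[OF rcos_ring_hom] by blast

lemma coset_minus:
  assumes "x \<in> carrier R" "y \<in> carrier R"
  shows "I +> (x \<ominus> y) = (I +> x) \<ominus>\<^bsub>R Quot I\<^esub> (I +> y)"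
proof -
  interpret Q: ring "R Quot I" by (rule quotient_is_ring)
  interpret h: ring_hom_ring R "R Quot I" "(+>) I" by (rule rcos_ring_hom_ring)
  show ?thesis using assms by (simp add: minus_eq Q.minus_eq h.hom_add h.hom_a_inv)
qed

lemma coset_nat_pow: "x \<in> carrier R \<Longrightarrow> I +> (x [^] (n::nat)) = (I +> x) [^]\<^bsub>R Quot I\<^esub> n"
  by (rule ring_hom_nat_pow[OF rcos_ring_hom local.ring_axioms quotient_is_ring])

end

section \<open>Finite rings without nontrivial idempotents\<close>

text \<open>Two powers of x coincide, so the sequence of powers is eventually periodic; an exponent
  that is a multiple of the period and lies in the periodic range gives an idempotent.\<close>

lemma (in monoid) finite_idempotent_power:
  assumes "finite (carrier G)" "x \<in> carrier G"
  shows "\<exists>n::nat. n > 0 \<and> x [^] n \<otimes> x [^] n = x [^] n"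
proof -
  have "\<not> inj (\<lambda>n::nat. x [^] n)"
  proof
    assume "inj (\<lambda>n::nat. x [^] n)"
    then have "infinite (range (\<lambda>n::nat. x [^] n))" by (simp add: range_inj_infinite)
    moreover have "range (\<lambda>n::nat. x [^] n) \<subseteq> carrier G" using assms by auto
    ultimately show False using assms(1) finite_subset by blast
  qed
  then obtain i j :: nat where ij: "i < j" "x [^] i = x [^] j"
    by (metis injI linorder_cases)
  define k where "k = j - i"
  have k: "k > 0" "x [^] i = x [^] (i + k)" using ij by (auto simp: k_def)
  have step: "x [^] m = x [^] (m + k)" if "m \<ge> i" for m
  proof -
    have "x [^] m = x [^] i \<otimes> x [^] (m - i)" using that assms by (simp add: nat_pow_mult)
    also have "\<dots> = x [^] (i + k) \<otimes> x [^] (m - i)" using k by simp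
    also have "\<dots> = x [^] (m + k)" using that assms by (simp add: nat_pow_mult add.commute)
    finally show ?thesis .
  qed
  have steps: "x [^] m = x [^] (m + k * l)" if "m \<ge> i" for m l
  proof (induction l)
    case (Suc l)
    then show ?case using step[of "m + k * l"] that by (simp add: algebra_simps)
  qed simp
  \<comment> \<open>A positive multiple of the period \<open>k\<close> that is at least the
    preperiod \<open>i\<close>; doubling it moves by whole periods only.\<close>
  define n where "n = k * (i + 1)"
  have "n \<ge> i" "n > 0" using k by (simp_all add: n_def trans_le_add2)
  moreover have "x [^] n \<otimes> x [^] n = x [^] (n + k * (i + 1))"
    using assms by (simp only: nat_pow_mult) (simp only: n_def)
  ultimately have "x [^] n \<otimes> x [^] n = x [^] n" using steps by metis
  then show ?thesis using \<open>k > 0\<close> by (intro exI[of _ n]) (simp add: n_def)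
qed

lemma (in monoid) idempotent_pow:
  assumes "e \<in> carrier G" "e \<otimes> e = e" "n > (0::nat)"
  shows "e [^] n = e"
proof -
  have "e [^] Suc m = e" for m
    using assms by (induction m) (simp_all add: nat_pow_Suc2 m_assoc)
  then show ?thesis using assms(3) gr0_implies_Suc by blast
qed

text \<open>In a general ring merely a set; in a finite ring without nontrivial idempotents it is
  the Jacobson radical.\<close>

definition nilpotents :: "('a, 'b) ring_scheme \<Rightarrow> 'a set" where
  "nilpotents R = {x \<in> carrier R. \<exists>n::nat. x [^]\<^bsub>R\<^esub> n = \<zero>\<^bsub>R\<^esub>}"

text \<open>With N the set of nilpotents, stage j consists of the x annihilated by every product of
  j elements of N on the left. The recursion avoids powers of ideals; that the chain reaches the
  whole ring expresses that the ideal N is nilpotent.\<close>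

fun ann_chain :: "('a, 'b) ring_scheme \<Rightarrow> nat \<Rightarrow> 'a set" where
  "ann_chain R 0 = {\<zero>\<^bsub>R\<^esub>}"
| "ann_chain R (Suc j) = {x \<in> carrier R. \<forall>a\<in>nilpotents R. a \<otimes>\<^bsub>R\<^esub> x \<in> ann_chain R j}"

locale finite_connected_ring = ring R for R (structure) +
  assumes finite_carrier: "finite (carrier R)"
    and one_not_zero: "\<one> \<noteq> \<zero>"
    and idempotents: "\<And>e. e \<in> carrier R \<Longrightarrow> e \<otimes> e = e \<Longrightarrow> e = \<zero> \<or> e = \<one>"
begin

text \<open>If x y = 1, then x^m y^m = 1 for all m, by cancelling in the middle; an exponent that
  kills x gives 0 = 1.\<close>

lemma not_one_sided_inverse_nilpotent:
  assumes "x \<in> nilpotents R" "y \<in> carrier R"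
  shows "x \<otimes> y \<noteq> \<one>" "y \<otimes> x \<noteq> \<one>"
proof -
  obtain n :: nat where x: "x \<in> carrier R" "x [^] n = \<zero>" using assms by (auto simp: nilpotents_def)
  have r: "x [^] m \<otimes> y [^] m = \<one>" if "x \<otimes> y = \<one>" for m :: nat
  proof (induction m)
    case (Suc m)
    have "x [^] Suc m \<otimes> y [^] Suc m = x [^] m \<otimes> (x \<otimes> y) \<otimes> y [^] m"
      using x assms by (simp add: m_assoc nat_pow_Suc2 del: nat_pow_Suc) (simp add: m_assoc[symmetric] nat_pow_Suc2[symmetric])
    then show ?case using Suc that x assms by simp
  qed simp
  have l: "y [^] m \<otimes> x [^] m = \<one>" if "y \<otimes> x = \<one>" for m :: nat
  proof (induction m)
    case (Suc m)
    have "y [^] Suc m \<otimes> x [^] Suc m = y [^] m \<otimes> (y \<otimes> x) \<otimes> x [^] m"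
      using x assms by (simp add: m_assoc nat_pow_Suc2 del: nat_pow_Suc) (simp add: m_assoc[symmetric] nat_pow_Suc2[symmetric])
    then show ?case using Suc that x assms by simp
  qed simp
  show "x \<otimes> y \<noteq> \<one>" using r[of n] x assms one_not_zero by auto
  show "y \<otimes> x \<noteq> \<one>" using l[of n] x assms one_not_zero by auto
qed

text \<open>Some positive power of x is idempotent, hence 0 or 1.\<close>

lemma Units_or_nilpotent:
  assumes "x \<in> carrier R"
  shows "x \<in> Units R \<or> x \<in> nilpotents R"
proof -
  obtain n :: nat where n: "n > 0" "x [^] n \<otimes> x [^] n = x [^] n"
    using finite_idempotent_power[OF finite_carrier assms] by blast
  then consider "x [^] n = \<zero>" | "x [^] n = \<one>" using idempotents assms by blast
  then show ?thesis
  proof cases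
    case 2
    obtain m where m: "n = Suc m" using n(1) gr0_implies_Suc by blast
    then have "x [^] m \<otimes> x = \<one>" "x \<otimes> x [^] m = \<one>" using 2 assms by (simp_all flip: nat_pow_Suc2)
    then have "x \<in> Units R" unfolding Units_def using assms by blast
    then show ?thesis ..
  qed (use assms in \<open>auto simp: nilpotents_def\<close>)
qed

lemma nilpotents_carrier: "x \<in> nilpotents R \<Longrightarrow> x \<in> carrier R"
  by (simp add: nilpotents_def)

text \<open>A product that is not nilpotent is a unit, and then its nilpotent factor would have a
  one-sided inverse.\<close>

lemma nilpotents_mult:
  assumes "x \<in> nilpotents R" "y \<in> carrier R"
  shows "x \<otimes> y \<in> nilpotents R" "y \<otimes> x \<in> nilpotents R"
proof -
  have x: "x \<in> carrier R" using assms nilpotents_carrier by blast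
  show "x \<otimes> y \<in> nilpotents R"
  proof (rule ccontr)
    assume "x \<otimes> y \<notin> nilpotents R"
    then have U: "x \<otimes> y \<in> Units R" using Units_or_nilpotent x assms by blast
    then have "x \<otimes> (y \<otimes> inv (x \<otimes> y)) = \<one>" using Units_r_inv[OF U] x assms(2) U by (simp only: m_assoc Units_inv_closed)
    then show False using not_one_sided_inverse_nilpotent(1)[OF assms(1), of "y \<otimes> inv (x \<otimes> y)"] U assms(2) by simp
  qed
  show "y \<otimes> x \<in> nilpotents R"
  proof (rule ccontr)
    assume "y \<otimes> x \<notin> nilpotents R"
    then have U: "y \<otimes> x \<in> Units R" using Units_or_nilpotent x assms by blast
    then have "(inv (y \<otimes> x) \<otimes> y) \<otimes> x = \<one>" using Units_l_inv[OF U] x assms(2) U by (simp only: m_assoc Units_inv_closed)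
    then show False using not_one_sided_inverse_nilpotent(2)[OF assms(1), of "inv (y \<otimes> x) \<otimes> y"] U assms(2) by simp
  qed
qed

text \<open>If the sum were a unit, dividing by it would give nilpotents with a + b = 1. But b = 1 -
  a is right invertible by the geometric series in a, and no nilpotent is.\<close>

lemma nilpotents_add:
  assumes "x \<in> nilpotents R" "y \<in> nilpotents R"
  shows "x \<oplus> y \<in> nilpotents R"
proof (rule ccontr)
  have c: "x \<in> carrier R" "y \<in> carrier R" using assms nilpotents_carrier by blast+
  assume "x \<oplus> y \<notin> nilpotents R"
  then have U: "x \<oplus> y \<in> Units R" using Units_or_nilpotent c by blast
  define a b where "a = inv (x \<oplus> y) \<otimes> x" and "b = inv (x \<oplus> y) \<otimes> y"
  have ab: "a \<in> nilpotents R" "b \<in> nilpotents R"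
    using nilpotents_mult(2) assms U by (auto simp: a_def b_def)
  have abc: "a \<in> carrier R" "b \<in> carrier R" using ab nilpotents_carrier by auto
  have "a \<oplus> b = \<one>" using U c by (simp add: a_def b_def r_distr[symmetric])
  then have b: "b = \<one> \<ominus> a" using abc by (metis a_comm minus_eq a_assoc a_inv_closed r_neg r_zero)
  obtain n :: nat where n: "a [^] n = \<zero>" using ab by (auto simp: nilpotents_def)
  \<comment> \<open>The witness is the partial sum of the geometric series with m terms.\<close>
  have "\<exists>z\<in>carrier R. b \<otimes> z = \<one> \<ominus> a [^] m" for m :: nat
  proof (induction m)
    case 0
    show ?case using abc by (intro bexI[of _ \<zero>]) (auto simp: minus_eq r_neg)
  next
    case (Suc m)
    then obtain z where z: "z \<in> carrier R" "b \<otimes> z = \<one> \<ominus> a [^] m" by blast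
    have ac: "a [^] m \<in> carrier R" "a \<otimes> a [^] m \<in> carrier R" using abc by auto
    have "b \<otimes> (z \<oplus> a [^] m) = (\<one> \<ominus> a [^] m) \<oplus> (a [^] m \<ominus> a \<otimes> a [^] m)"
      using z abc by (simp add: r_distr) (simp add: b minus_eq l_distr l_minus)
    also have "\<dots> = \<one> \<ominus> a [^] Suc m"
      using abc ac nat_pow_Suc2[of a m] by (simp add: minus_eq a_assoc r_neg1)
    finally show ?case using z abc by blast
  qed
  from this[of n] obtain z where z: "z \<in> carrier R" "b \<otimes> z = \<one>"
    using n by (auto simp: minus_eq)
  then show False using not_one_sided_inverse_nilpotent(1)[OF ab(2) z(1)] by blast
qed

lemma zero_nilpotent: "\<zero> \<in> nilpotents R"
  unfolding nilpotents_def by (auto intro!: exI[of _ "1::nat"])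

lemma ideal_nilpotents: "ideal (nilpotents R) R"
proof (rule idealI)
  show "subgroup (nilpotents R) (add_monoid R)"
  proof (rule subgroup.intro)
    fix x assume x: "x \<in> nilpotents R"
    then have "(\<ominus> \<one>) \<otimes> x \<in> nilpotents R" by (intro nilpotents_mult) auto
    moreover have "(\<ominus> \<one>) \<otimes> x = \<ominus> x" using nilpotents_carrier[OF x] by (simp add: l_minus)
    ultimately show "inv\<^bsub>add_monoid R\<^esub> x \<in> nilpotents R" by (simp add: a_inv_def)
  qed (auto simp: nilpotents_carrier nilpotents_add zero_nilpotent)
qed (auto simp: nilpotents_mult ring_axioms)

lemma commutator_nilpotent:
  assumes "x \<in> carrier R" "y \<in> carrier R"
  shows "x \<otimes> y \<ominus> y \<otimes> x \<in> nilpotents R"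
proof -
  interpret N: ideal "nilpotents R" R by (rule ideal_nilpotents)
  let ?Q = "R Quot nilpotents R"
  interpret Q: ring ?Q by (rule N.quotient_is_ring)
  have "finite_division_ring ?Q"
  proof
    show "finite (carrier ?Q)" using finite_carrier by (simp add: N.carrier_FactRing)
    have "\<one> \<notin> nilpotents R" using not_one_sided_inverse_nilpotent(1)[of \<one> \<one>] by auto
    then show "\<one>\<^bsub>?Q\<^esub> \<noteq> \<zero>\<^bsub>?Q\<^esub>" using N.coset_eq_zero_iff[OF one_closed] N.coset_one by simp
  next
    fix V assume "V \<in> carrier ?Q" "V \<noteq> \<zero>\<^bsub>?Q\<^esub>"
    then obtain x where x: "x \<in> carrier R" "V = nilpotents R +> x" "x \<notin> nilpotents R"
      using N.coset_eq_zero_iff by (auto simp: N.carrier_FactRing)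
    then have U: "x \<in> Units R" using Units_or_nilpotent by blast
    have "V \<otimes>\<^bsub>?Q\<^esub> (nilpotents R +> inv x) = \<one>\<^bsub>?Q\<^esub>" "(nilpotents R +> inv x) \<otimes>\<^bsub>?Q\<^esub> V = \<one>\<^bsub>?Q\<^esub>"
      using U x by (simp_all add: N.coset_mult[symmetric] N.coset_one)
    moreover have "nilpotents R +> inv x \<in> carrier ?Q" using U by (auto simp: N.carrier_FactRing)
    ultimately show "V \<in> Units ?Q"
      using \<open>V \<in> carrier ?Q\<close> unfolding Units_def by blast
  qed
  then interpret Q: finite_division_ring ?Q .
  have "nilpotents R +> (x \<otimes> y) = nilpotents R +> (y \<otimes> x)"
    using Q.wedderburn assms by (simp add: N.coset_mult N.carrier_FactRing)
  then show ?thesis using assms by (simp add: N.coset_eq_iff)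
qed

lemma ann_chain_carrier: "x \<in> ann_chain R j \<Longrightarrow> x \<in> carrier R"
  by (cases j) auto

lemma zero_ann_chain: "\<zero> \<in> ann_chain R j"
  by (induction j) (auto simp: nilpotents_carrier)

lemma add_ann_chain: "x \<in> ann_chain R j \<Longrightarrow> y \<in> ann_chain R j \<Longrightarrow> x \<oplus> y \<in> ann_chain R j"
  by (induction j arbitrary: x y) (auto simp: r_distr nilpotents_carrier)

text \<open>A central element can be moved past the nilpotents that multiply from the left. It is
  meant for the scalars that occur when coordinates are multiplied.\<close>

lemma central_mult_ann_chain:
  assumes "z \<in> carrier R" "\<And>y. y \<in> carrier R \<Longrightarrow> z \<otimes> y = y \<otimes> z" "x \<in> ann_chain R j"
  shows "z \<otimes> x \<in> ann_chain R j"
  using assms(3)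
proof (induction j arbitrary: x)
  case 0
  then show ?case using assms by simp
next
  case (Suc j)
  have "a \<otimes> (z \<otimes> x) = z \<otimes> (a \<otimes> x)" if "a \<in> nilpotents R" for a
  proof -
    have c: "a \<in> carrier R" "x \<in> carrier R" using Suc.prems nilpotents_carrier[OF that] by auto
    have "a \<otimes> (z \<otimes> x) = (z \<otimes> a) \<otimes> x"
      using assms(1) c by (simp only: assms(2) m_assoc)
    then show ?thesis using assms(1) c by (simp only: m_assoc)
  qed
  then show ?case using Suc assms by auto
qed

lemma ann_chain_mono: "i \<le> j \<Longrightarrow> ann_chain R i \<subseteq> ann_chain R j"
proof -
  have "ann_chain R j \<subseteq> ann_chain R (Suc j)" for j
    by (induction j) (auto simp: nilpotents_carrier ann_chain_carrier)
  then show "i \<le> j \<Longrightarrow> ann_chain R i \<subseteq> ann_chain R j" by (rule lift_Suc_mono_le)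
qed

text \<open>The left multiples of \<open>a \<otimes> x\<close> by nilpotents are strictly fewer than those of \<open>x\<close>:
  if \<open>a \<otimes> x = b \<otimes> (a \<otimes> x)\<close> with \<open>b\<close> nilpotent, then \<open>a \<otimes> x = \<zero>\<close>.\<close>

lemma in_ann_chain_card:
  assumes "x \<in> carrier R"
  shows "x \<in> ann_chain R (card ((\<lambda>a. a \<otimes> x) ` nilpotents R))"
  using assms
proof (induction "card ((\<lambda>a. a \<otimes> x) ` nilpotents R)" arbitrary: x rule: less_induct)
  case less
  have fin: "finite (nilpotents R)"
    using finite_carrier by (auto simp: nilpotents_def)
  define k where "k = card ((\<lambda>a. a \<otimes> x) ` nilpotents R)"
  have "k > 0" unfolding k_def using fin zero_nilpotent by (auto simp: card_gt_0_iff)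
  then obtain l where l: "k = Suc l" using gr0_implies_Suc by blast
  have "a \<otimes> x \<in> ann_chain R l" if a: "a \<in> nilpotents R" for a
  proof (cases "a \<otimes> x = \<zero>")
    case True
    then show ?thesis by (simp add: zero_ann_chain)
  next
    case False
    have ac: "a \<in> carrier R" using a nilpotents_carrier by blast
    have nin: "a \<otimes> x \<notin> (\<lambda>b. b \<otimes> (a \<otimes> x)) ` nilpotents R"
    proof
      assume "a \<otimes> x \<in> (\<lambda>b. b \<otimes> (a \<otimes> x)) ` nilpotents R"
      then obtain b where b: "b \<in> nilpotents R" "a \<otimes> x = b \<otimes> (a \<otimes> x)" by blast
      have bc: "b \<in> carrier R" using b nilpotents_carrier by blast
      have "a \<otimes> x = b [^] m \<otimes> (a \<otimes> x)" for m :: nat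
      proof (induction m)
        case (Suc m)
        have "b [^] Suc m \<otimes> (a \<otimes> x) = b [^] m \<otimes> (b \<otimes> (a \<otimes> x))" using bc ac less.prems by (simp add: m_assoc)
        then show ?case using Suc b(2) by simp
      qed (use ac less.prems in simp)
      moreover obtain m :: nat where "b [^] m = \<zero>" using b by (auto simp: nilpotents_def)
      ultimately have "a \<otimes> x = \<zero> \<otimes> (a \<otimes> x)" by metis
      then show False using False ac less.prems by simp
    qed
    have "(\<lambda>b. b \<otimes> (a \<otimes> x)) ` nilpotents R \<subseteq> (\<lambda>a. a \<otimes> x) ` nilpotents R"
    proof
      fix y assume "y \<in> (\<lambda>b. b \<otimes> (a \<otimes> x)) ` nilpotents R"
      then obtain b where b: "b \<in> nilpotents R" "y = b \<otimes> (a \<otimes> x)" by blast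
      then have "y = (b \<otimes> a) \<otimes> x" "b \<otimes> a \<in> nilpotents R"
        using ac less.prems nilpotents_carrier nilpotents_mult by (auto simp: m_assoc)
      then show "y \<in> (\<lambda>a. a \<otimes> x) ` nilpotents R" by blast
    qed
    then have "(\<lambda>b. b \<otimes> (a \<otimes> x)) ` nilpotents R \<subset> (\<lambda>a. a \<otimes> x) ` nilpotents R"
      using nin a by blast
    then have lt: "card ((\<lambda>b. b \<otimes> (a \<otimes> x)) ` nilpotents R) < k"
      unfolding k_def using fin by (intro psubset_card_mono) auto
    have "a \<otimes> x \<in> ann_chain R (card ((\<lambda>b. b \<otimes> (a \<otimes> x)) ` nilpotents R))"
      using less.hyps lt ac less.prems unfolding k_def by blast
    moreover have "card ((\<lambda>b. b \<otimes> (a \<otimes> x)) ` nilpotents R) \<le> l" using lt l by simp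
    ultimately show ?thesis using ann_chain_mono by blast
  qed
  then have "x \<in> ann_chain R (Suc l)" using less.prems by simp
  then show ?case using l by (simp add: k_def)
qed

text \<open>The stage found for a single x is at most the size of the ring, so one length serves all
  elements.\<close>

lemma ann_chain_top: "ann_chain R (card (carrier R)) = carrier R"
proof
  show "carrier R \<subseteq> ann_chain R (card (carrier R))"
  proof
    fix x assume x: "x \<in> carrier R"
    have "card ((\<lambda>a. a \<otimes> x) ` nilpotents R) \<le> card (carrier R)"
      using finite_carrier x nilpotents_carrier by (intro card_mono) auto
    then show "x \<in> ann_chain R (card (carrier R))"
      using in_ann_chain_card[OF x] ann_chain_mono by blast
  qed
qed (auto simp: ann_chain_carrier)

end

section \<open>Complete filtered rings\<close>

text \<open>The powers \<open>x [^] N\<close>, for suitable \<open>N\<close> growing multiplicatively, converge to an idempotent.\<close>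

lemma (in ring) quotient_connected:
  fixes I :: "nat \<Rightarrow> 'a set"
  assumes id: "\<And>k. ideal (I k) R"
    and fin: "\<And>k. finite (carrier (R Quot I k))"
    and sep: "\<And>x. x \<in> carrier R \<Longrightarrow> (\<And>k. x \<in> I k) \<Longrightarrow> x = \<zero>"
    and compl: "\<And>s. (\<And>k. s k \<in> carrier R) \<Longrightarrow> (\<And>k. s (Suc k) \<ominus> s k \<in> I k) \<Longrightarrow>
        \<exists>x\<in>carrier R. \<forall>k. x \<ominus> s k \<in> I k"
    and idem: "\<And>e. e \<in> carrier R \<Longrightarrow> e \<otimes> e = e \<Longrightarrow> e = \<zero> \<or> e = \<one>"
    and proper: "\<one> \<notin> I k"
  shows "finite_connected_ring (R Quot I k)"
proof -
  interpret Ik: ideal "I k" R by (rule id)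
  interpret Q: ring "R Quot I k" by (rule Ik.quotient_is_ring)
  show ?thesis
  proof
    show "finite (carrier (R Quot I k))" by (rule fin)
    show "\<one>\<^bsub>R Quot I k\<^esub> \<noteq> \<zero>\<^bsub>R Quot I k\<^esub>"
      using Ik.coset_eq_zero_iff[OF one_closed] Ik.coset_one proper by simp
  next
    fix V assume V: "V \<in> carrier (R Quot I k)" "V \<otimes>\<^bsub>R Quot I k\<^esub> V = V"
    then obtain x where x: "x \<in> carrier R" "V = I k +> x" by (auto simp: Ik.carrier_FactRing)
    have "\<exists>n::nat. n > 0 \<and> I j +> (x [^] n \<otimes> x [^] n) = I j +> x [^] n" for j
    proof -
      interpret Ij: ideal "I j" R by (rule id)
      interpret Qj: ring "R Quot I j" by (rule Ij.quotient_is_ring)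
      show ?thesis
        using Qj.finite_idempotent_power[OF fin, of "I j +> x"] x
        by (auto simp: Ij.coset_mult Ij.coset_nat_pow Ij.carrier_FactRing)
    qed
    then obtain n where n: "\<And>j. n j > (0::nat)"
      "\<And>j. I j +> (x [^] n j \<otimes> x [^] n j) = I j +> x [^] n j" by metis
    \<comment> \<open>Every \<open>n i\<close> with i \<le> j divides \<open>N j\<close>. Since
      \<open>x [^] n j\<close> is idempotent modulo \<open>I j\<close>, the powers
      \<open>x [^] N i\<close> are constant modulo \<open>I j\<close> from i = j on.\<close>
    define N where "N j = (\<Prod>i\<le>j. n i)" for j
    have N0: "N j > 0" for j by (simp add: N_def n(1) prod_pos)
    have stab: "I j +> x [^] (n j * m) = I j +> x [^] n j" if "m > 0" for j and m :: nat
    proof -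
      interpret Ij: ideal "I j" R by (rule id)
      interpret Qj: ring "R Quot I j" by (rule Ij.quotient_is_ring)
      have "(I j +> x [^] n j) [^]\<^bsub>R Quot I j\<^esub> m = I j +> x [^] n j"
        using n(2)[of j] x that by (intro Qj.idempotent_pow) (auto simp: Ij.coset_mult Ij.carrier_FactRing)
      then show ?thesis using x by (simp add: Ij.coset_nat_pow nat_pow_pow Qj.nat_pow_pow Ij.carrier_FactRing)
    qed
    have NI: "I j +> x [^] N i = I j +> x [^] n j" if "j \<le> i" for i j
    proof -
      have "N i = n j * (\<Prod>l\<in>{..i} - {j}. n l)"
        unfolding N_def using that by (subst prod.remove[of _ j]) auto
      moreover have "(\<Prod>l\<in>{..i} - {j}. n l) > 0" by (simp add: n(1) prod_pos)
      ultimately show ?thesis using stab by simp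
    qed
    have "x [^] N (Suc j) \<ominus> x [^] N j \<in> I j" for j
    proof -
      interpret Ij: ideal "I j" R by (rule id)
      show ?thesis using NI[of j j] NI[of j "Suc j"] x by (simp flip: Ij.coset_eq_iff)
    qed
    then obtain e where e: "e \<in> carrier R" "\<And>j. e \<ominus> x [^] N j \<in> I j"
      using compl[of "\<lambda>j. x [^] N j"] x by auto
    have eI: "I j +> e = I j +> x [^] n j" for j
    proof -
      interpret Ij: ideal "I j" R by (rule id)
      have "I j +> e = I j +> x [^] N j" using e x Ij.coset_eq_iff by simp
      then show ?thesis using NI[of j j] by simp
    qed
    have "e \<otimes> e \<ominus> e \<in> I j" for j
    proof -
      interpret Ij: ideal "I j" R by (rule id)
      have "I j +> (e \<otimes> e) = I j +> e"
        using n(2)[of j] e x by (simp add: Ij.coset_mult eI)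
      then show ?thesis using Ij.coset_eq_iff e by simp
    qed
    then have "e \<otimes> e \<ominus> e = \<zero>" using e by (intro sep) auto
    then have "e \<otimes> e = e" using e by (simp add: r_right_minus_eq)
    then have "e = \<zero> \<or> e = \<one>" using idem e by blast
    \<comment> \<open>\<open>V\<close> is idempotent, so the limit \<open>e\<close> reduces to
      \<open>V\<close> itself and not only to a power of it.\<close>
    moreover have "V [^]\<^bsub>R Quot I k\<^esub> n k = V" using V n(1) by (intro Q.idempotent_pow) auto
    then have "I k +> e = V" using eI[of k] x by (simp add: Ik.coset_nat_pow)
    ultimately show "V = \<zero>\<^bsub>R Quot I k\<^esub> \<or> V = \<one>\<^bsub>R Quot I k\<^esub>"
      using Ik.coset_one Ik.coset_eq_zero_iff[OF zero_closed] Ik.zero_closed by auto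
  qed
qed

text \<open>\<open>J\<close> and \<open>L\<close> are the preimages of the nilpotents and of the
  annihilator chain of the quotient. The chain climbs from I to the whole ring, and left
  multiplication by \<open>J\<close> goes down one stage; the listed closure properties are those
  used for sums of products of coordinates.\<close>

lemma (in ring) commutator_filtration:
  assumes "ideal I R" and conn: "finite_connected_ring (R Quot I)"
  obtains J L M where "\<And>x y. x \<in> carrier R \<Longrightarrow> y \<in> carrier R \<Longrightarrow> x \<otimes> y \<ominus> y \<otimes> x \<in> J"
    "ideal J R" "L (0::nat) = I" "L M = carrier R"
    "\<And>j. L j \<subseteq> carrier R" "\<And>j. \<zero> \<in> L j" "\<And>j x y. x \<in> L j \<Longrightarrow> y \<in> L j \<Longrightarrow> x \<oplus> y \<in> L j"
    "\<And>j z x. z \<in> carrier R \<Longrightarrow> (\<And>y. y \<in> carrier R \<Longrightarrow> z \<otimes> y = y \<otimes> z) \<Longrightarrow> x \<in> L j \<Longrightarrow> z \<otimes> x \<in> L j"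
    "\<And>j a x. a \<in> J \<Longrightarrow> x \<in> L (Suc j) \<Longrightarrow> a \<otimes> x \<in> L j"
proof -
  interpret I: ideal I R by fact
  let ?Q = "R Quot I"
  interpret Q: finite_connected_ring ?Q by (rule conn)
  interpret h: ring_hom_ring R ?Q "(+>) I" by (rule I.rcos_ring_hom_ring)
  define J where "J = {x \<in> carrier R. I +> x \<in> nilpotents ?Q}"
  define L where "L j = {x \<in> carrier R. I +> x \<in> ann_chain ?Q j}" for j
  show thesis
  proof (rule that[of J L "card (carrier ?Q)"])
    fix x y assume xy: "x \<in> carrier R" "y \<in> carrier R"
    then show "x \<otimes> y \<ominus> y \<otimes> x \<in> J"
      using Q.commutator_nilpotent by (simp add: J_def I.coset_minus I.coset_mult I.carrier_FactRing)
  next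
    show "ideal J R"
      unfolding J_def by (rule h.ideal_vimage[OF Q.ideal_nilpotents])
    show "L 0 = I"
      using I.coset_eq_zero_iff I.a_subset by (auto simp: L_def)
    show "L (card (carrier ?Q)) = carrier R"
      by (auto simp: L_def Q.ann_chain_top)
    fix j
    show "L j \<subseteq> carrier R" by (auto simp: L_def)
    show "\<zero> \<in> L j" by (simp add: L_def Q.zero_ann_chain)
    fix x y assume "x \<in> L j" "y \<in> L j"
    then show "x \<oplus> y \<in> L j" by (simp add: L_def Q.add_ann_chain)
  next
    fix j z x assume z: "z \<in> carrier R" "\<And>y. y \<in> carrier R \<Longrightarrow> z \<otimes> y = y \<otimes> z" and x: "x \<in> L j"
    have "(I +> z) \<otimes>\<^bsub>?Q\<^esub> (I +> x) \<in> ann_chain ?Q j"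
    proof (rule Q.central_mult_ann_chain)
      fix Y assume "Y \<in> carrier ?Q"
      then obtain y where "y \<in> carrier R" "Y = I +> y" by (auto simp: I.carrier_FactRing)
      then show "(I +> z) \<otimes>\<^bsub>?Q\<^esub> Y = Y \<otimes>\<^bsub>?Q\<^esub> (I +> z)"
        using z by (simp flip: I.coset_mult)
    qed (use z x in \<open>auto simp: L_def\<close>)
    then show "z \<otimes> x \<in> L j" using z(1) x by (simp add: L_def)
  next
    fix j a x assume "a \<in> J" "x \<in> L (Suc j)"
    then show "a \<otimes> x \<in> L j" by (simp add: L_def J_def)
  qed
qed

section \<open>Orthogonal idempotents\<close>

text \<open>Requiring the entries to be nonzero is what bounds \<open>r\<close>. The case r = 0
  occurs in the zero ring only.\<close>

definition orthogonal_idempotents :: "('a, 'b) ring_scheme \<Rightarrow> nat \<Rightarrow> (nat \<Rightarrow> 'a) \<Rightarrow> bool" where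
  "orthogonal_idempotents R r e \<longleftrightarrow>
     (\<forall>i<r. e i \<in> carrier R \<and> e i \<otimes>\<^bsub>R\<^esub> e i = e i \<and> e i \<noteq> \<zero>\<^bsub>R\<^esub>) \<and>
     (\<forall>i<r. \<forall>j<r. i \<noteq> j \<longrightarrow> e i \<otimes>\<^bsub>R\<^esub> e j = \<zero>\<^bsub>R\<^esub>) \<and>
     (\<Oplus>\<^bsub>R\<^esub>i\<in>{..<r}. e i) = \<one>\<^bsub>R\<^esub>"

text \<open>A system with the largest possible \<open>r\<close> is taken; splitting one of its
  entries would give a longer one. The bound on \<open>r\<close> holds since the entries stay
  distinct modulo I: if e i - e j lies in I, so does e i (e i - e j) = e i, which is then
  zero.\<close>

lemma (in ring) primitive_decomposition:
  assumes "ideal I R" and fin: "finite (carrier (R Quot I))"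
    and small: "\<And>e. e \<in> I \<Longrightarrow> e \<otimes> e = e \<Longrightarrow> e = \<zero>"
  obtains r e where "orthogonal_idempotents R r e"
    "\<And>i f g. i < r \<Longrightarrow> f \<in> carrier R \<Longrightarrow> g \<in> carrier R \<Longrightarrow> f \<otimes> f = f \<Longrightarrow> g \<otimes> g = g \<Longrightarrow>
      f \<otimes> g = \<zero> \<Longrightarrow> g \<otimes> f = \<zero> \<Longrightarrow> f \<oplus> g = e i \<Longrightarrow> f = \<zero> \<or> g = \<zero>"
proof -
  interpret I: ideal I R by fact
  define P where "P r \<longleftrightarrow> (\<exists>e. orthogonal_idempotents R r e)" for r
  have bound: "r \<le> card (carrier (R Quot I))" if Pr: "P r" for r
  proof -
    obtain e where e: "orthogonal_idempotents R r e" using Pr by (auto simp: P_def)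
    have ec: "\<And>i. i < r \<Longrightarrow> e i \<in> carrier R" using e by (auto simp: orthogonal_idempotents_def)
    have "inj_on (\<lambda>i. I +> e i) {..<r}"
    proof (rule inj_onI, rule ccontr)
      fix i j assume ij: "i \<in> {..<r}" "j \<in> {..<r}" "I +> e i = I +> e j" "i \<noteq> j"
      then have "e i \<ominus> e j \<in> I" using ec I.coset_eq_iff by simp
      then have "e i \<otimes> (e i \<ominus> e j) \<in> I" using ij ec by (intro I.I_l_closed) auto
      moreover have "e i \<otimes> (e i \<ominus> e j) = e i"
        using ij ec e by (simp add: orthogonal_idempotents_def minus_eq r_distr r_minus)
      ultimately have "e i = \<zero>" using small ij e by (simp add: orthogonal_idempotents_def)
      then show False using ij e by (simp add: orthogonal_idempotents_def)
    qed
    then have "card ((\<lambda>i. I +> e i) ` {..<r}) = r" by (simp add: card_image)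
    moreover have "(\<lambda>i. I +> e i) ` {..<r} \<subseteq> carrier (R Quot I)" using ec by (auto simp: I.carrier_FactRing)
    ultimately show ?thesis using fin card_mono by metis
  qed
  \<comment> \<open>The starting system consists of 1 alone; in the zero ring it has to be empty, as
    entries are nonzero.\<close>
  have "\<exists>r. P r"
  proof (cases "\<one> = \<zero>")
    case True
    then have "P 0" by (auto simp: P_def orthogonal_idempotents_def)
    then show ?thesis ..
  next
    case False
    then have "orthogonal_idempotents R 1 (\<lambda>_. \<one>)"
      by (auto simp: orthogonal_idempotents_def lessThan_Suc)
    then show ?thesis by (auto simp: P_def)
  qed
  then obtain r where r: "P r" "\<And>s. P s \<Longrightarrow> s \<le> r"
    using bound GreatestI_ex_nat[of P] Greatest_le_nat[of P] by metis
  obtain e where e: "orthogonal_idempotents R r e" using r(1) unfolding P_def by blast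
  have ec: "\<And>i. i < r \<Longrightarrow> e i \<in> carrier R" and eo: "\<And>i j. i < r \<Longrightarrow> j < r \<Longrightarrow> i \<noteq> j \<Longrightarrow> e i \<otimes> e j = \<zero>"
    and e1: "(\<Oplus>i\<in>{..<r}. e i) = \<one>" and en: "\<And>i. i < r \<Longrightarrow> e i \<noteq> \<zero> \<and> e i \<otimes> e i = e i"
    using e by (auto simp: orthogonal_idempotents_def)
  show thesis
  proof (rule that[OF e], rule ccontr)
    fix i f g assume i: "i < r" and c: "f \<in> carrier R" "g \<in> carrier R" and idem: "f \<otimes> f = f" "g \<otimes> g = g"
      and orth: "f \<otimes> g = \<zero>" "g \<otimes> f = \<zero>" and sum: "f \<oplus> g = e i" and nz: "\<not> (f = \<zero> \<or> g = \<zero>)"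
    have fe: "f = f \<otimes> e i" "f = e i \<otimes> f" "g = g \<otimes> e i" "g = e i \<otimes> g"
      using c idem orth by (simp_all add: sum[symmetric] r_distr l_distr)
    \<comment> \<open>\<open>f\<close> and \<open>g\<close> are absorbed by \<open>e i\<close> on
      both sides and so inherit its orthogonality to the other entries.\<close>
    have fj: "f \<otimes> e j = \<zero>" "e j \<otimes> f = \<zero>" "g \<otimes> e j = \<zero>" "e j \<otimes> g = \<zero>" if "j < r" "j \<noteq> i" for j
    proof -
      have "f \<otimes> e j = f \<otimes> (e i \<otimes> e j)" "g \<otimes> e j = g \<otimes> (e i \<otimes> e j)"
        using fe c ec i that by (metis m_assoc)+
      moreover have "e j \<otimes> f = (e j \<otimes> e i) \<otimes> f" "e j \<otimes> g = (e j \<otimes> e i) \<otimes> g"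
        using fe c ec i that by (metis m_assoc)+
      ultimately show "f \<otimes> e j = \<zero>" "e j \<otimes> f = \<zero>" "g \<otimes> e j = \<zero>" "e j \<otimes> g = \<zero>"
        using eo that i c by auto
    qed
    define e' where "e' = e(i := f, r := g)"
    have S: "(\<Oplus>k\<in>{..<Suc r}. e' k) = \<one>"
    proof -
      have "(\<Oplus>k\<in>{..<Suc r}. e' k) = g \<oplus> (\<Oplus>k\<in>{..<r}. e' k)"
        unfolding lessThan_Suc using c ec by (subst finsum_insert) (auto simp: e'_def)
      also have "(\<Oplus>k\<in>{..<r}. e' k) = (\<Oplus>k\<in>insert i ({..<r} - {i}). e' k)"
        using i by (simp add: insert_absorb)
      also have "\<dots> = f \<oplus> (\<Oplus>k\<in>{..<r} - {i}. e' k)"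
        using c ec i by (subst finsum_insert) (auto simp: e'_def)
      also have "(\<Oplus>k\<in>{..<r} - {i}. e' k) = (\<Oplus>k\<in>{..<r} - {i}. e k)"
        using ec by (intro finsum_cong') (auto simp: e'_def)
      also have "g \<oplus> (f \<oplus> (\<Oplus>k\<in>{..<r} - {i}. e k)) = e i \<oplus> (\<Oplus>k\<in>{..<r} - {i}. e k)"
        using c ec by (subst sum[symmetric]) (simp add: finsum_closed Pi_def a_ac)
      also have "\<dots> = (\<Oplus>k\<in>insert i ({..<r} - {i}). e k)"
        using ec i by (subst finsum_insert) auto
      also have "\<dots> = \<one>" using i e1 by (simp add: insert_absorb)
      finally show ?thesis .
    qed
    have "orthogonal_idempotents R (Suc r) e'"
      unfolding orthogonal_idempotents_def
    proof (intro conjI)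
      show "(\<Oplus>k\<in>{..<Suc r}. e' k) = \<one>" by (rule S)
    qed (use c idem orth nz fj ec en eo i in \<open>auto simp: e'_def less_Suc_eq\<close>)
    then have "P (Suc r)" by (auto simp: P_def)
    then show False using r(2)[of "Suc r"] by simp
  qed
qed

lemma (in ring) isomorphic_orthogonal_idempotents:
  assumes "ideal I R" and small: "\<And>e. e \<in> I \<Longrightarrow> e \<otimes> e = e \<Longrightarrow> e = \<zero>"
    and c: "e \<in> carrier R" "f \<in> carrier R" "u \<in> carrier R" "v \<in> carrier R"
    and idem: "e \<otimes> e = e" and ef: "e \<otimes> f = \<zero>"
    and vu: "v \<otimes> u = e" and uv: "u \<otimes> v = f"
    and nil: "(v \<otimes> u \<ominus> u \<otimes> v) [^] (M::nat) \<in> I"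
  shows "e = \<zero>"
proof -
  interpret I: ideal I R by fact
  \<comment> \<open>Because e e = e and e f = 0, the element e absorbs each factor e - f on its
    right.\<close>
  have "e \<otimes> (e \<ominus> f) [^] n = e" for n :: nat
  proof (induction n)
    case (Suc n)
    have "e \<otimes> (e \<ominus> f) [^] Suc n = e \<otimes> (e \<ominus> f)" using Suc c by (simp add: m_assoc[symmetric])
    also have "\<dots> = e" using c idem ef by (simp add: minus_eq r_distr r_minus)
    finally show ?case .
  qed (use c in simp)
  then have "e \<in> I" using I.I_l_closed[OF nil c(1)] vu uv by simp
  then show ?thesis using small idem by blast
qed

text \<open>The notation for products of ideals makes \<open>[n] \<cdot> x\<close> ambiguous.\<close>

no_notation ideal_prod (infixl "\<cdot>\<index>" 80)

section \<open>\<open>p\<close>-adic properties of abelian groups\<close>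

text \<open>Partial sums of the p-adic series with coefficients y. Stage n stops before y n, so that
  it determines the sum modulo p^n.\<close>

primrec padic_sum :: "('a, 'b) ring_scheme \<Rightarrow> nat \<Rightarrow> (nat \<Rightarrow> 'a) \<Rightarrow> nat \<Rightarrow> 'a" where
  "padic_sum G p y 0 = \<zero>\<^bsub>G\<^esub>"
| "padic_sum G p y (Suc n) = padic_sum G p y n \<oplus>\<^bsub>G\<^esub> [(p ^ n)] \<cdot>\<^bsub>G\<^esub> y n"

text \<open>Divisibility is tested inside N, here and in the next two definitions. They concern the
  group N with its own p-adic topology, not the one induced from G, which is what an induction over
  spans of generators needs.\<close>

definition padic_separated :: "nat \<Rightarrow> ('a, 'b) ring_scheme \<Rightarrow> 'a set \<Rightarrow> bool" where
  "padic_separated p G N \<longleftrightarrow> (\<forall>x\<in>N. (\<forall>k::nat. \<exists>y\<in>N. x = [(p ^ k)] \<cdot>\<^bsub>G\<^esub> y) \<longrightarrow> x = \<zero>\<^bsub>G\<^esub>)"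

definition padic_complete :: "nat \<Rightarrow> ('a, 'b) ring_scheme \<Rightarrow> 'a set \<Rightarrow> bool" where
  "padic_complete p G N \<longleftrightarrow> (\<forall>y. (\<forall>k. y k \<in> N) \<longrightarrow>
     (\<exists>x\<in>N. \<forall>n. \<exists>z\<in>N. x = padic_sum G p y n \<oplus>\<^bsub>G\<^esub> [(p ^ n)] \<cdot>\<^bsub>G\<^esub> z))"

definition padic_finite :: "nat \<Rightarrow> ('a, 'b) ring_scheme \<Rightarrow> 'a set \<Rightarrow> bool" where
  "padic_finite p G N \<longleftrightarrow>
     (\<exists>T. finite T \<and> T \<subseteq> N \<and> (\<forall>x\<in>N. \<exists>t\<in>T. \<exists>y\<in>N. x = t \<oplus>\<^bsub>G\<^esub> [p] \<cdot>\<^bsub>G\<^esub> y))"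

context abelian_group
begin

lemma add_pow_closed [simp]: "x \<in> carrier G \<Longrightarrow> [(n::nat)] \<cdot> x \<in> carrier G"
  by (rule add.nat_pow_closed)

lemma add_pow_add: "x \<in> carrier G \<Longrightarrow> y \<in> carrier G \<Longrightarrow> [(n::nat)] \<cdot> (x \<oplus> y) = [n] \<cdot> x \<oplus> [n] \<cdot> y"
  by (rule add.nat_pow_distrib)

lemma add_pow_mult: "x \<in> carrier G \<Longrightarrow> [(m::nat)] \<cdot> ([(n::nat)] \<cdot> x) = [(m * n)] \<cdot> x"
  by (simp add: add.nat_pow_pow mult.commute)

lemma add_pow_uminus: "x \<in> carrier G \<Longrightarrow> [(n::nat)] \<cdot> (\<ominus> x) = \<ominus> ([n] \<cdot> x)"
  by (rule add.nat_pow_inv)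

lemma add_pow_zero [simp]: "[(n::nat)] \<cdot> \<zero> = \<zero>"
  by (rule add.nat_pow_one)

lemma add_pow_minus: "x \<in> carrier G \<Longrightarrow> y \<in> carrier G \<Longrightarrow> [(n::nat)] \<cdot> (x \<ominus> y) = [n] \<cdot> x \<ominus> [n] \<cdot> y"
  by (simp add: minus_eq add_pow_add add_pow_uminus)

lemma padic_sum_closed: "(\<And>k. y k \<in> carrier G) \<Longrightarrow> padic_sum G p y n \<in> carrier G"
  by (induction n) auto

lemma padic_sum_add:
  assumes "\<And>k. y k \<in> carrier G" "\<And>k. z k \<in> carrier G"
  shows "padic_sum G p (\<lambda>k. y k \<oplus> z k) n = padic_sum G p y n \<oplus> padic_sum G p z n"
  by (induction n) (use assms in \<open>simp_all add: add_pow_add padic_sum_closed a_ac\<close>)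

text \<open>Expansion by one more digit: representatives t modulo p^k and s modulo p combine to t +
  p^k s modulo p^(k+1).\<close>

lemma padic_finite_pow:
  assumes fin: "padic_finite p G (carrier G)"
  shows "\<exists>T. finite T \<and> T \<subseteq> carrier G \<and> (\<forall>x\<in>carrier G. \<exists>t\<in>T. \<exists>y\<in>carrier G. x = t \<oplus> [(p ^ k)] \<cdot> y)"
proof (induction k)
  case 0
  show ?case by (intro exI[of _ "{\<zero>}"]) auto
next
  case (Suc k)
  then obtain T where T: "finite T" "T \<subseteq> carrier G"
    "\<And>x. x \<in> carrier G \<Longrightarrow> \<exists>t\<in>T. \<exists>y\<in>carrier G. x = t \<oplus> [(p ^ k)] \<cdot> y" by blast
  obtain S where S: "finite S" "S \<subseteq> carrier G"
    "\<And>x. x \<in> carrier G \<Longrightarrow> \<exists>t\<in>S. \<exists>y\<in>carrier G. x = t \<oplus> [p] \<cdot> y" using fin unfolding padic_finite_def by blast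
  define U where "U = (\<lambda>(t, s). t \<oplus> [(p ^ k)] \<cdot> s) ` (T \<times> S)"
  have "\<exists>u\<in>U. \<exists>y\<in>carrier G. x = u \<oplus> [(p ^ Suc k)] \<cdot> y" if x: "x \<in> carrier G" for x
  proof -
    obtain t y where ty: "t \<in> T" "y \<in> carrier G" "x = t \<oplus> [(p ^ k)] \<cdot> y" using T(3)[OF x] by blast
    obtain s z where sz: "s \<in> S" "z \<in> carrier G" "y = s \<oplus> [p] \<cdot> z" using S(3)[OF ty(2)] by blast
    have "t \<in> carrier G" "s \<in> carrier G" using ty sz T S by auto
    then have "x = (t \<oplus> [(p ^ k)] \<cdot> s) \<oplus> [(p ^ Suc k)] \<cdot> z"
      using ty sz by (simp add: add_pow_add add_pow_mult a_assoc mult.commute)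
    moreover have "t \<oplus> [(p ^ k)] \<cdot> s \<in> U" using ty sz by (auto simp: U_def)
    ultimately show ?thesis using sz(2) by blast
  qed
  moreover have "finite U" "U \<subseteq> carrier G" using T(1,2) S(1,2) by (auto simp: U_def subset_iff)
  ultimately show ?case by blast
qed

text \<open>The consecutive differences of s serve as the terms of a p-adic series, whose sum is
  added to s 0.\<close>

lemma padic_complete_Cauchy:
  assumes compl: "padic_complete p G (carrier G)"
    and s: "\<And>k. s k \<in> carrier G" "\<And>k. \<exists>y\<in>carrier G. s (Suc k) = s k \<oplus> [(p ^ k)] \<cdot> y"
  obtains x where "x \<in> carrier G" "\<And>k. \<exists>y\<in>carrier G. x = s k \<oplus> [(p ^ k)] \<cdot> y"
proof -
  obtain y where y: "\<And>k. y k \<in> carrier G" "\<And>k. s (Suc k) = s k \<oplus> [(p ^ k)] \<cdot> y k"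
    using s(2) by metis
  have sk: "s k = s 0 \<oplus> padic_sum G p y k" for k
    by (induction k) (simp_all add: s(1) y padic_sum_closed a_assoc)
  obtain x where x: "x \<in> carrier G" "\<And>n. \<exists>z\<in>carrier G. x = padic_sum G p y n \<oplus> [(p ^ n)] \<cdot> z"
    using compl y(1) unfolding padic_complete_def by blast
  show thesis
  proof (rule that[of "s 0 \<oplus> x"])
    fix k
    obtain z where "z \<in> carrier G" "x = padic_sum G p y k \<oplus> [(p ^ k)] \<cdot> z" using x by blast
    then show "\<exists>z\<in>carrier G. s 0 \<oplus> x = s k \<oplus> [(p ^ k)] \<cdot> z"
      using s(1) y(1) by (intro bexI[of _ z]) (simp_all add: sk[of k] padic_sum_closed a_assoc)
  qed (use s x in simp)
qed

end

section \<open>Finitely generated modules over a \<open>p\<close>-adic domain\<close>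

text \<open>The abstract form of an absolutely unramified complete discrete valuation ring with
  finite residue field. Everything is phrased with integer multiples, so that the same notions apply
  to modules.\<close>

locale padic_domain = domain R for p :: nat and R (structure) +
  assumes p_gt_1: "p > 1"
    and separated: "padic_separated p R (carrier R)"
    and complete: "padic_complete p R (carrier R)"
    and residue_finite: "padic_finite p R (carrier R)"
    and torsion_free: "\<And>x. x \<in> carrier R \<Longrightarrow> [p] \<cdot> x = \<zero> \<Longrightarrow> x = \<zero>"
    and Units_or_multiple: "\<And>x. x \<in> carrier R \<Longrightarrow> x \<in> Units R \<or> (\<exists>y\<in>carrier R. x = [p] \<cdot> y)"
begin

lemma torsion_free_pow:
  assumes "x \<in> carrier R" "[(p ^ k)] \<cdot> x = \<zero>" shows "x = \<zero>"
  using assms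
proof (induction k)
  case (Suc k)
  then have "[p] \<cdot> ([(p ^ k)] \<cdot> x) = \<zero>" by (simp add: add_pow_mult)
  then have "[(p ^ k)] \<cdot> x = \<zero>" using torsion_free Suc.prems(1) by blast
  then show ?case using Suc.IH Suc.prems(1) by blast
qed simp

text \<open>\<open>a\<close> is the p-adic valuation of x, finite by separation; the cofactor is not
  a multiple of p and hence is a unit.\<close>

lemma unit_decomposition:
  assumes "x \<in> carrier R" "x \<noteq> \<zero>"
  obtains a u where "u \<in> Units R" "x = [(p ^ (a::nat))] \<cdot> u"
proof -
  have "\<not> (\<forall>k::nat. \<exists>y\<in>carrier R. x = [(p ^ k)] \<cdot> y)"
    using separated assms by (auto simp: padic_separated_def)
  then obtain k :: nat where k: "\<not> (\<exists>y\<in>carrier R. x = [(p ^ k)] \<cdot> y)" by blast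
  \<comment> \<open>The shift by \<open>Suc\<close> makes \<open>a\<close> the last power that
    divides x instead of the first that does not.\<close>
  define a where "a = (LEAST k. \<not> (\<exists>y\<in>carrier R. x = [(p ^ Suc k)] \<cdot> y))"
  have "k \<noteq> 0" using k assms by (metis add.nat_pow_eone power_0)
  then obtain k' where "k = Suc k'" using not0_implies_Suc by blast
  then have a: "\<not> (\<exists>y\<in>carrier R. x = [(p ^ Suc a)] \<cdot> y)"
    unfolding a_def using k by (intro LeastI[of "\<lambda>k. \<not> (\<exists>y\<in>carrier R. x = [(p ^ Suc k)] \<cdot> y)"]) simp
  have "\<exists>y\<in>carrier R. x = [(p ^ a)] \<cdot> y"
  proof (cases a)
    case 0
    then show ?thesis using assms by (intro bexI[of _ x]) auto
  next
    case (Suc b)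
    then have "b < (LEAST k. \<not> (\<exists>y\<in>carrier R. x = [(p ^ Suc k)] \<cdot> y))" by (simp add: a_def)
    from not_less_Least[OF this] show ?thesis using Suc by simp
  qed
  then obtain y where y: "y \<in> carrier R" "x = [(p ^ a)] \<cdot> y" by blast
  have "\<not> (\<exists>z\<in>carrier R. y = [p] \<cdot> z)"
  proof
    assume "\<exists>z\<in>carrier R. y = [p] \<cdot> z"
    then obtain z where "z \<in> carrier R" "y = [p] \<cdot> z" by blast
    then have "x = [(p ^ Suc a)] \<cdot> z" using y by (simp add: add_pow_mult mult.commute)
    then show False using a \<open>z \<in> carrier R\<close> by blast
  qed
  then have "y \<in> Units R" using Units_or_multiple y by blast
  then show thesis using that y by blast
qed

end

text \<open>The span is built along a list, so that the p-adic properties can be proved by adjoining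
  one generator at a time.\<close>

primrec gspan :: "('a, 'b) ring_scheme \<Rightarrow> ('a, 'm, 'c) module_scheme \<Rightarrow> 'm list \<Rightarrow> 'm set" where
  "gspan R M [] = {\<zero>\<^bsub>M\<^esub>}"
| "gspan R M (g # gs) = {c \<odot>\<^bsub>M\<^esub> g \<oplus>\<^bsub>M\<^esub> y | c y. c \<in> carrier R \<and> y \<in> gspan R M gs}"

context module
begin

lemma smult_add_pow:
  assumes "c \<in> carrier R" "x \<in> carrier M"
  shows "([(n::nat)] \<cdot>\<^bsub>R\<^esub> c) \<odot>\<^bsub>M\<^esub> x = [n] \<cdot>\<^bsub>M\<^esub> (c \<odot>\<^bsub>M\<^esub> x)"
proof (induction n)
  case 0
  show ?case using assms by simp
next
  case (Suc n)
  then show ?case using assms by (simp add: smult_l_distr)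
qed

lemma gspan_carrier: "set gs \<subseteq> carrier M \<Longrightarrow> gspan R M gs \<subseteq> carrier M"
  by (induction gs) auto

lemma gspan_zero: "set gs \<subseteq> carrier M \<Longrightarrow> \<zero>\<^bsub>M\<^esub> \<in> gspan R M gs"
proof (induction gs)
  case (Cons g gs)
  then show ?case by (auto intro!: exI[of _ "\<zero>\<^bsub>R\<^esub>"] exI[of _ "\<zero>\<^bsub>M\<^esub>"])
qed simp

lemma gspan_ConsI:
  assumes "c \<in> carrier R" "y \<in> gspan R M gs"
  shows "c \<odot>\<^bsub>M\<^esub> g \<oplus>\<^bsub>M\<^esub> y \<in> gspan R M (g # gs)"
  using assms by auto

lemma gspan_ConsE:
  assumes "x \<in> gspan R M (g # gs)"
  obtains c y where "c \<in> carrier R" "y \<in> gspan R M gs" "x = c \<odot>\<^bsub>M\<^esub> g \<oplus>\<^bsub>M\<^esub> y"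
  using assms by auto

lemma gspan_add:
  assumes "set gs \<subseteq> carrier M" "x \<in> gspan R M gs" "y \<in> gspan R M gs"
  shows "x \<oplus>\<^bsub>M\<^esub> y \<in> gspan R M gs"
  using assms
proof (induction gs arbitrary: x y)
  case (Cons g gs)
  obtain c x' where x: "c \<in> carrier R" "x' \<in> gspan R M gs" "x = c \<odot>\<^bsub>M\<^esub> g \<oplus>\<^bsub>M\<^esub> x'" using Cons.prems by (auto elim: gspan_ConsE)
  obtain d y' where y: "d \<in> carrier R" "y' \<in> gspan R M gs" "y = d \<odot>\<^bsub>M\<^esub> g \<oplus>\<^bsub>M\<^esub> y'" using Cons.prems by (auto elim: gspan_ConsE)
  have c: "g \<in> carrier M" "x' \<in> carrier M" "y' \<in> carrier M" using Cons.prems x y gspan_carrier[of gs] by auto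
  have "x \<oplus>\<^bsub>M\<^esub> y = (c \<oplus>\<^bsub>R\<^esub> d) \<odot>\<^bsub>M\<^esub> g \<oplus>\<^bsub>M\<^esub> (x' \<oplus>\<^bsub>M\<^esub> y')"
    using x y c by (simp add: smult_l_distr M.a_ac)
  moreover have "x' \<oplus>\<^bsub>M\<^esub> y' \<in> gspan R M gs" using Cons x y by auto
  ultimately show ?case using gspan_ConsI x y by auto
qed simp

lemma gspan_smult:
  assumes "set gs \<subseteq> carrier M" "x \<in> gspan R M gs" "a \<in> carrier R"
  shows "a \<odot>\<^bsub>M\<^esub> x \<in> gspan R M gs"
  using assms
proof (induction gs arbitrary: x)
  case (Cons g gs)
  obtain c x' where x: "c \<in> carrier R" "x' \<in> gspan R M gs" "x = c \<odot>\<^bsub>M\<^esub> g \<oplus>\<^bsub>M\<^esub> x'" using Cons.prems by (auto elim: gspan_ConsE)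
  have c: "g \<in> carrier M" "x' \<in> carrier M" using Cons.prems x gspan_carrier[of gs] by auto
  have "a \<odot>\<^bsub>M\<^esub> x = (a \<otimes>\<^bsub>R\<^esub> c) \<odot>\<^bsub>M\<^esub> g \<oplus>\<^bsub>M\<^esub> a \<odot>\<^bsub>M\<^esub> x'"
    using x c Cons.prems by (simp add: smult_r_distr smult_assoc1)
  moreover have "a \<odot>\<^bsub>M\<^esub> x' \<in> gspan R M gs" using Cons x by auto
  ultimately show ?case using gspan_ConsI[of "a \<otimes>\<^bsub>R\<^esub> c"] x Cons.prems by auto
qed simp

lemma gspan_uminus:
  assumes "set gs \<subseteq> carrier M" "x \<in> gspan R M gs"
  shows "\<ominus>\<^bsub>M\<^esub> x \<in> gspan R M gs"
proof -
  have "x \<in> carrier M" using assms gspan_carrier by blast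
  then have "\<ominus>\<^bsub>M\<^esub> x = (\<ominus>\<^bsub>R\<^esub> \<one>\<^bsub>R\<^esub>) \<odot>\<^bsub>M\<^esub> x" by (simp add: smult_l_minus)
  then show ?thesis using gspan_smult[OF assms] by simp
qed

lemma gspan_minus:
  assumes "set gs \<subseteq> carrier M" "x \<in> gspan R M gs" "y \<in> gspan R M gs"
  shows "x \<ominus>\<^bsub>M\<^esub> y \<in> gspan R M gs"
  using gspan_add[OF assms(1,2) gspan_uminus[OF assms(1,3)]] by (simp add: M.minus_eq)

lemma gspan_add_pow:
  assumes "set gs \<subseteq> carrier M" "x \<in> gspan R M gs"
  shows "[(n::nat)] \<cdot>\<^bsub>M\<^esub> x \<in> gspan R M gs"
proof -
  have "x \<in> carrier M" using assms gspan_carrier by blast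
  then have "[n] \<cdot>\<^bsub>M\<^esub> x = ([n] \<cdot>\<^bsub>R\<^esub> \<one>\<^bsub>R\<^esub>) \<odot>\<^bsub>M\<^esub> x" by (simp add: smult_add_pow)
  then show ?thesis using gspan_smult[OF assms] by simp
qed

lemma gspan_Cons_superset:
  assumes "set (g # gs) \<subseteq> carrier M" "x \<in> gspan R M gs"
  shows "x \<in> gspan R M (g # gs)"
proof -
  have "x \<in> carrier M" using assms gspan_carrier[of gs] by auto
  then have "x = \<zero>\<^bsub>R\<^esub> \<odot>\<^bsub>M\<^esub> g \<oplus>\<^bsub>M\<^esub> x" using assms by simp
  then show ?thesis using assms(2) gspan_ConsI[of "\<zero>\<^bsub>R\<^esub>" x gs g] by simp
qed

lemma gspan_generator:
  assumes "set gs \<subseteq> carrier M" "g \<in> set gs"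
  shows "g \<in> gspan R M gs"
  using assms
proof (induction gs)
  case (Cons h gs)
  have "h = \<one>\<^bsub>R\<^esub> \<odot>\<^bsub>M\<^esub> h \<oplus>\<^bsub>M\<^esub> \<zero>\<^bsub>M\<^esub>" using Cons.prems by simp
  then have "h \<in> gspan R M (h # gs)"
    using Cons.prems gspan_zero[of gs] gspan_ConsI[of "\<one>\<^bsub>R\<^esub>" "\<zero>\<^bsub>M\<^esub>" gs h] by simp
  moreover have "g \<in> gspan R M (h # gs)" if "g \<in> set gs"
    using Cons that by (intro gspan_Cons_superset) auto
  ultimately show ?case using Cons.prems by auto
qed simp

text \<open>The sum runs over the set of generators, while the list may contain repetitions; in that
  case the coefficients of the repeated generator are added.\<close>

lemma gspan_lincomb:
  assumes "set gs \<subseteq> carrier M" "x \<in> gspan R M gs"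
  shows "\<exists>c\<in>set gs \<rightarrow> carrier R. x = (\<Oplus>\<^bsub>M\<^esub>g\<in>set gs. c g \<odot>\<^bsub>M\<^esub> g)"
  using assms
proof (induction gs arbitrary: x)
  case (Cons g gs)
  obtain a x' where x: "a \<in> carrier R" "x' \<in> gspan R M gs" "x = a \<odot>\<^bsub>M\<^esub> g \<oplus>\<^bsub>M\<^esub> x'" using Cons.prems by (auto elim: gspan_ConsE)
  obtain c where c: "c \<in> set gs \<rightarrow> carrier R" "x' = (\<Oplus>\<^bsub>M\<^esub>g\<in>set gs. c g \<odot>\<^bsub>M\<^esub> g)"
    using Cons x by auto
  have gc: "g \<in> carrier M" "set gs \<subseteq> carrier M" using Cons.prems by auto
  have cc: "c h \<in> carrier R" "h \<in> carrier M" if "h \<in> set gs" for h using that c gc by auto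
  show ?case
  proof (cases "g \<in> set gs")
    case True
    define c' where "c' = c(g := a \<oplus>\<^bsub>R\<^esub> c g)"
    have cg: "c g \<in> carrier R" using c True by auto
    have m: "(\<lambda>h. c h \<odot>\<^bsub>M\<^esub> h) \<in> set gs - {g} \<rightarrow> carrier M" using c gc by auto
    have ins: "set (g # gs) = insert g (set gs - {g})" "set gs = insert g (set gs - {g})" using True by auto
    have s1: "x' = c g \<odot>\<^bsub>M\<^esub> g \<oplus>\<^bsub>M\<^esub> (\<Oplus>\<^bsub>M\<^esub>h\<in>set gs - {g}. c h \<odot>\<^bsub>M\<^esub> h)"
      unfolding c(2) by (subst ins(2), subst M.finsum_insert) (use m cg gc in auto)
    have "(\<Oplus>\<^bsub>M\<^esub>h\<in>set (g # gs). c' h \<odot>\<^bsub>M\<^esub> h) = c' g \<odot>\<^bsub>M\<^esub> g \<oplus>\<^bsub>M\<^esub> (\<Oplus>\<^bsub>M\<^esub>h\<in>set gs - {g}. c' h \<odot>\<^bsub>M\<^esub> h)"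
      by (subst ins(1), subst M.finsum_insert) (use cc cg gc x in \<open>auto simp: c'_def\<close>)
    also have "(\<Oplus>\<^bsub>M\<^esub>h\<in>set gs - {g}. c' h \<odot>\<^bsub>M\<^esub> h) = (\<Oplus>\<^bsub>M\<^esub>h\<in>set gs - {g}. c h \<odot>\<^bsub>M\<^esub> h)"
      using m by (intro M.finsum_cong') (auto simp: c'_def)
    also have "c' g \<odot>\<^bsub>M\<^esub> g \<oplus>\<^bsub>M\<^esub> \<dots> = x"
      unfolding x(3) s1 using x(1) cg gc M.finsum_closed[OF m] by (simp add: c'_def smult_l_distr M.a_assoc)
    finally have "x = (\<Oplus>\<^bsub>M\<^esub>h\<in>set (g # gs). c' h \<odot>\<^bsub>M\<^esub> h)" ..
    moreover have "c' \<in> set (g # gs) \<rightarrow> carrier R" using c x cg by (auto simp: c'_def)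
    ultimately show ?thesis by blast
  next
    case False
    define c' where "c' = c(g := a)"
    have m: "(\<lambda>h. c' h \<odot>\<^bsub>M\<^esub> h) \<in> set gs \<rightarrow> carrier M" using cc False by (auto simp: c'_def)
    have "(\<Oplus>\<^bsub>M\<^esub>h\<in>set (g # gs). c' h \<odot>\<^bsub>M\<^esub> h) = c' g \<odot>\<^bsub>M\<^esub> g \<oplus>\<^bsub>M\<^esub> (\<Oplus>\<^bsub>M\<^esub>h\<in>set gs. c' h \<odot>\<^bsub>M\<^esub> h)"
      unfolding list.set by (subst M.finsum_insert) (use m gc x False in \<open>auto simp: c'_def\<close>)
    also have "(\<Oplus>\<^bsub>M\<^esub>h\<in>set gs. c' h \<odot>\<^bsub>M\<^esub> h) = x'"
      unfolding c(2) using cc False by (intro M.finsum_cong') (auto simp: c'_def)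
    finally have "x = (\<Oplus>\<^bsub>M\<^esub>h\<in>set (g # gs). c' h \<odot>\<^bsub>M\<^esub> h)" using x by (simp add: c'_def)
    moreover have "c' \<in> set (g # gs) \<rightarrow> carrier R" using c x by (auto simp: c'_def)
    ultimately show ?thesis by blast
  qed
qed simp

end

locale padic_module = R?: padic_domain p R + module R M for p :: nat and R (structure) and M (structure)
begin

text \<open>Representatives of R modulo p for the coefficient of the new generator are combined with
  representatives for the remaining span.\<close>

lemma padic_finite_gspan:
  assumes "set gs \<subseteq> carrier M"
  shows "padic_finite p M (gspan R M gs)"
  using assms
proof (induction gs)
  case Nil
  then show ?case by (auto simp: padic_finite_def)
next
  case (Cons g gs)
  then obtain T where T: "finite T" "T \<subseteq> gspan R M gs"
    "\<And>x. x \<in> gspan R M gs \<Longrightarrow> \<exists>t\<in>T. \<exists>y\<in>gspan R M gs. x = t \<oplus>\<^bsub>M\<^esub> [p] \<cdot>\<^bsub>M\<^esub> y" unfolding padic_finite_def by auto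
  obtain S where S: "finite S" "S \<subseteq> carrier R"
    "\<And>x. x \<in> carrier R \<Longrightarrow> \<exists>t\<in>S. \<exists>y\<in>carrier R. x = t \<oplus> [p] \<cdot> y" using residue_finite unfolding padic_finite_def by blast
  have gc: "g \<in> carrier M" "set gs \<subseteq> carrier M" using Cons.prems by auto
  define U where "U = (\<lambda>(s, t). s \<odot>\<^bsub>M\<^esub> g \<oplus>\<^bsub>M\<^esub> t) ` (S \<times> T)"
  have "\<exists>u\<in>U. \<exists>y\<in>gspan R M (g # gs). x = u \<oplus>\<^bsub>M\<^esub> [p] \<cdot>\<^bsub>M\<^esub> y" if xs: "x \<in> gspan R M (g # gs)" for x
  proof -
    obtain c x' where x: "c \<in> carrier R" "x' \<in> gspan R M gs" "x = c \<odot>\<^bsub>M\<^esub> g \<oplus>\<^bsub>M\<^esub> x'" using xs by (rule gspan_ConsE)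
    obtain s d where s: "s \<in> S" "d \<in> carrier R" "c = s \<oplus> [p] \<cdot> d" using S(3)[OF x(1)] by blast
    obtain t y where t: "t \<in> T" "y \<in> gspan R M gs" "x' = t \<oplus>\<^bsub>M\<^esub> [p] \<cdot>\<^bsub>M\<^esub> y" using T(3)[OF x(2)] by blast
    have cc: "s \<in> carrier R" "t \<in> carrier M" "y \<in> carrier M" using s S t T gspan_carrier[OF gc(2)] by auto
    have "x = (s \<odot>\<^bsub>M\<^esub> g \<oplus>\<^bsub>M\<^esub> t) \<oplus>\<^bsub>M\<^esub> [p] \<cdot>\<^bsub>M\<^esub> (d \<odot>\<^bsub>M\<^esub> g \<oplus>\<^bsub>M\<^esub> y)"
      using x s t cc gc by (simp add: smult_l_distr smult_add_pow M.add_pow_add M.a_ac)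
    moreover have "d \<odot>\<^bsub>M\<^esub> g \<oplus>\<^bsub>M\<^esub> y \<in> gspan R M (g # gs)" using gspan_ConsI s t by blast
    moreover have "s \<odot>\<^bsub>M\<^esub> g \<oplus>\<^bsub>M\<^esub> t \<in> U" using s t by (auto simp: U_def)
    ultimately show ?thesis by blast
  qed
  moreover have "finite U" using S T by (simp add: U_def)
  moreover have "U \<subseteq> gspan R M (g # gs)" using S(2) T(2) by (fastforce simp: U_def)
  ultimately show ?case unfolding padic_finite_def by blast
qed

lemma padic_sum_smult:
  assumes "\<And>k. c k \<in> carrier R" "g \<in> carrier M"
  shows "padic_sum M p (\<lambda>k. c k \<odot>\<^bsub>M\<^esub> g) n = padic_sum R p c n \<odot>\<^bsub>M\<^esub> g"
proof (induction n)
  case (Suc n)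
  have "padic_sum R p c n \<in> carrier R" "[(p ^ n)] \<cdot> c n \<in> carrier R"
    using assms R.padic_sum_closed[of c p n] R.add_pow_closed by simp_all
  then show ?case using Suc assms by (simp add: smult_l_distr smult_add_pow)
qed (use assms in simp)

text \<open>Each term of a series is split into a coefficient of the new generator and a remainder,
  and both parts are summed separately. Any choice of splittings will do, so the sum of submodules
  may fail to be direct.\<close>

lemma padic_complete_gspan:
  assumes "set gs \<subseteq> carrier M"
  shows "padic_complete p M (gspan R M gs)"
  using assms
proof (induction gs)
  case Nil
  have "padic_sum M p y n = \<zero>\<^bsub>M\<^esub>" if "\<And>k. y k = \<zero>\<^bsub>M\<^esub>" for y n
    by (induction n) (simp_all add: that)
  then show ?case by (auto simp: padic_complete_def)
next
  case (Cons g gs)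
  have gc: "g \<in> carrier M" "set gs \<subseteq> carrier M" using Cons.prems by auto
  show ?case unfolding padic_complete_def
  proof (intro allI impI)
    fix y :: "nat \<Rightarrow> 'c" assume "\<forall>k. y k \<in> gspan R M (g # gs)"
    then have "\<forall>k. \<exists>c z. c \<in> carrier R \<and> z \<in> gspan R M gs \<and> y k = c \<odot>\<^bsub>M\<^esub> g \<oplus>\<^bsub>M\<^esub> z"
      by auto
    then obtain c z where cz: "\<And>k. c k \<in> carrier R" "\<And>k. z k \<in> gspan R M gs"
      "\<And>k. y k = c k \<odot>\<^bsub>M\<^esub> g \<oplus>\<^bsub>M\<^esub> z k" by metis
    have zc: "z k \<in> carrier M" for k using cz gspan_carrier[OF gc(2)] by auto
    have yy: "y = (\<lambda>k. c k \<odot>\<^bsub>M\<^esub> g \<oplus>\<^bsub>M\<^esub> z k)" by (rule ext) (rule cz(3))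
    have ps: "padic_sum M p y n = padic_sum R p c n \<odot>\<^bsub>M\<^esub> g \<oplus>\<^bsub>M\<^esub> padic_sum M p z n" for n
      unfolding yy using M.padic_sum_add[of "\<lambda>k. c k \<odot>\<^bsub>M\<^esub> g" z p n] padic_sum_smult[of c g n] cz(1) gc(1) zc by simp
    obtain a where a: "a \<in> carrier R" "\<And>n. \<exists>d\<in>carrier R. a = padic_sum R p c n \<oplus> [(p ^ n)] \<cdot> d"
      using complete[unfolded padic_complete_def, rule_format, of c] cz(1) by blast
    obtain x where x: "x \<in> gspan R M gs" "\<And>n. \<exists>w\<in>gspan R M gs. x = padic_sum M p z n \<oplus>\<^bsub>M\<^esub> [(p ^ n)] \<cdot>\<^bsub>M\<^esub> w"
      using Cons.IH[OF gc(2), unfolded padic_complete_def, rule_format, of z] cz(2) by blast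
    have "\<exists>w\<in>gspan R M (g # gs). a \<odot>\<^bsub>M\<^esub> g \<oplus>\<^bsub>M\<^esub> x = padic_sum M p y n \<oplus>\<^bsub>M\<^esub> [(p ^ n)] \<cdot>\<^bsub>M\<^esub> w" for n
    proof -
      obtain d where d: "d \<in> carrier R" "a = padic_sum R p c n \<oplus> [(p ^ n)] \<cdot> d" using a by blast
      obtain w where w: "w \<in> gspan R M gs" "x = padic_sum M p z n \<oplus>\<^bsub>M\<^esub> [(p ^ n)] \<cdot>\<^bsub>M\<^esub> w" using x by blast
      have wc: "w \<in> carrier M" using w gspan_carrier[OF gc(2)] by auto
      have sc: "padic_sum R p c n \<in> carrier R" "padic_sum M p z n \<in> carrier M"
        using cz zc by (simp_all add: R.padic_sum_closed M.padic_sum_closed)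
      have "a \<odot>\<^bsub>M\<^esub> g \<oplus>\<^bsub>M\<^esub> x = padic_sum M p y n \<oplus>\<^bsub>M\<^esub> [(p ^ n)] \<cdot>\<^bsub>M\<^esub> (d \<odot>\<^bsub>M\<^esub> g \<oplus>\<^bsub>M\<^esub> w)"
        unfolding ps d(2) w(2) using d(1) wc gc sc
        by (simp add: smult_l_distr smult_add_pow M.add_pow_add M.a_ac)
      then show ?thesis using gspan_ConsI d w by blast
    qed
    moreover have "a \<odot>\<^bsub>M\<^esub> g \<oplus>\<^bsub>M\<^esub> x \<in> gspan R M (g # gs)" using gspan_ConsI a x by blast
    ultimately show "\<exists>x\<in>gspan R M (g # gs). \<forall>n. \<exists>w\<in>gspan R M (g # gs). x = padic_sum M p y n \<oplus>\<^bsub>M\<^esub> [(p ^ n)] \<cdot>\<^bsub>M\<^esub> w"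
      by blast
  qed
qed

text \<open>If no multiple \<open>[(p ^ a)] \<cdot> g\<close> of the new generator lies in the span \<open>N\<close> of the others,
  the sum \<open>R g + N\<close> is direct; otherwise \<open>[(p ^ a)] \<cdot> (R g + N) \<subseteq> N\<close>.\<close>

lemma padic_separated_gspan:
  assumes "set gs \<subseteq> carrier M"
  shows "padic_separated p M (gspan R M gs)"
  using assms
proof (induction gs)
  case Nil
  then show ?case by (auto simp: padic_separated_def)
next
  case (Cons g gs)
  have gc: "g \<in> carrier M" "set gs \<subseteq> carrier M" using Cons.prems by auto
  define N where "N = gspan R M gs"
  have Nc: "N \<subseteq> carrier M" unfolding N_def by (rule gspan_carrier[OF gc(2)])
  have IH: "x = \<zero>\<^bsub>M\<^esub>" if "x \<in> N" "\<And>k::nat. \<exists>y\<in>N. x = [(p ^ k)] \<cdot>\<^bsub>M\<^esub> y" for x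
    using Cons.IH[OF gc(2)] that unfolding padic_separated_def N_def by blast
  show ?case unfolding padic_separated_def
  proof (intro ballI impI)
    fix x assume x: "x \<in> gspan R M (g # gs)" and "\<forall>k::nat. \<exists>y\<in>gspan R M (g # gs). x = [(p ^ k)] \<cdot>\<^bsub>M\<^esub> y"
    then have "\<exists>c y. c \<in> carrier R \<and> y \<in> N \<and> x = [(p ^ k)] \<cdot>\<^bsub>M\<^esub> (c \<odot>\<^bsub>M\<^esub> g \<oplus>\<^bsub>M\<^esub> y)" for k :: nat
      unfolding N_def by (metis gspan_ConsE)
    then obtain c y where cy: "\<And>k. c k \<in> carrier R" "\<And>k. y k \<in> N"
      "\<And>k::nat. x = [(p ^ k)] \<cdot>\<^bsub>M\<^esub> (c k \<odot>\<^bsub>M\<^esub> g \<oplus>\<^bsub>M\<^esub> y k)" by metis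
    have yc: "y k \<in> carrier M" for k using cy Nc by auto
    show "x = \<zero>\<^bsub>M\<^esub>"
    proof (cases "\<exists>a::nat. [(p ^ a)] \<cdot>\<^bsub>M\<^esub> g \<in> N")
      case True
      then obtain a :: nat where a: "[(p ^ a)] \<cdot>\<^bsub>M\<^esub> g \<in> N" by blast
      \<comment> \<open>Divisibility by p^(k + a) in the larger span is spent in two parts: p^a
        moves the quotient into N, and p^k remains.\<close>
      have "\<exists>z\<in>N. x = [(p ^ k)] \<cdot>\<^bsub>M\<^esub> z" for k :: nat
      proof
        have "x = [(p ^ k)] \<cdot>\<^bsub>M\<^esub> ([(p ^ a)] \<cdot>\<^bsub>M\<^esub> (c (k + a) \<odot>\<^bsub>M\<^esub> g \<oplus>\<^bsub>M\<^esub> y (k + a)))"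
          using cy(1) yc gc by (subst cy(3)[of "k + a"]) (simp add: M.add_pow_mult power_add)
        also have "[(p ^ a)] \<cdot>\<^bsub>M\<^esub> (c (k + a) \<odot>\<^bsub>M\<^esub> g \<oplus>\<^bsub>M\<^esub> y (k + a)) = c (k + a) \<odot>\<^bsub>M\<^esub> ([(p ^ a)] \<cdot>\<^bsub>M\<^esub> g) \<oplus>\<^bsub>M\<^esub> [(p ^ a)] \<cdot>\<^bsub>M\<^esub> y (k + a)"
        proof -
          have "c (k + a) \<odot>\<^bsub>M\<^esub> ([(p ^ a)] \<cdot>\<^bsub>M\<^esub> g) = c (k + a) \<odot>\<^bsub>M\<^esub> (([(p ^ a)] \<cdot> \<one>) \<odot>\<^bsub>M\<^esub> g)"
            using gc by (simp add: smult_add_pow)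
          also have "\<dots> = (([(p ^ a)] \<cdot> \<one>) \<otimes> c (k + a)) \<odot>\<^bsub>M\<^esub> g"
            using gc cy(1) by (simp add: smult_assoc1[symmetric] m_comm)
          also have "\<dots> = [(p ^ a)] \<cdot>\<^bsub>M\<^esub> (c (k + a) \<odot>\<^bsub>M\<^esub> g)"
            using gc cy(1) by (simp add: add_pow_ldistr smult_add_pow)
          finally show ?thesis using cy(1) yc gc by (simp add: M.add_pow_add)
        qed
        finally show "x = [(p ^ k)] \<cdot>\<^bsub>M\<^esub> (c (k + a) \<odot>\<^bsub>M\<^esub> ([(p ^ a)] \<cdot>\<^bsub>M\<^esub> g) \<oplus>\<^bsub>M\<^esub> [(p ^ a)] \<cdot>\<^bsub>M\<^esub> y (k + a))" .
        show "c (k + a) \<odot>\<^bsub>M\<^esub> ([(p ^ a)] \<cdot>\<^bsub>M\<^esub> g) \<oplus>\<^bsub>M\<^esub> [(p ^ a)] \<cdot>\<^bsub>M\<^esub> y (k + a) \<in> N"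
          using a cy(1,2) gc unfolding N_def by (intro gspan_add[OF gc(2)] gspan_smult[OF gc(2)] gspan_add_pow[OF gc(2), of "y (k + a)"]) auto
      qed
      moreover from this[of 0] have "x \<in> N" using Nc by auto
      ultimately show ?thesis using IH by blast
    next
      case False
      \<comment> \<open>Up to a unit a nonzero d is a power p^a, so d g in N would put p^a g into
        N.\<close>
      have indep: "d = \<zero>" if d: "d \<in> carrier R" "d \<odot>\<^bsub>M\<^esub> g \<in> N" for d
      proof (rule ccontr)
        assume "d \<noteq> \<zero>"
        then obtain a u where u: "u \<in> Units R" "d = [(p ^ (a::nat))] \<cdot> u" using unit_decomposition d by blast
        have "inv u \<odot>\<^bsub>M\<^esub> (d \<odot>\<^bsub>M\<^esub> g) = [(p ^ a)] \<cdot>\<^bsub>M\<^esub> g"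
        proof -
          have uc: "u \<in> carrier R" "inv u \<in> carrier R" using u by auto
          have "inv u \<odot>\<^bsub>M\<^esub> (d \<odot>\<^bsub>M\<^esub> g) = (inv u \<otimes> d) \<odot>\<^bsub>M\<^esub> g"
            using uc d(1) gc by (simp add: smult_assoc1)
          also have "inv u \<otimes> d = [(p ^ a)] \<cdot> \<one>"
            using uc u by (simp add: R.add_pow_rdistr)
          finally show ?thesis using gc by (simp add: smult_add_pow)
        qed
        moreover have "inv u \<odot>\<^bsub>M\<^esub> (d \<odot>\<^bsub>M\<^esub> g) \<in> N"
          using d(2) u gspan_smult[OF gc(2), of "d \<odot>\<^bsub>M\<^esub> g" "inv u"] unfolding N_def by simp
        ultimately show False using False by auto
      qed
      \<comment> \<open>The expressions of x for k and for 0 are compared in the direct sum. It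
        follows that \<open>c 0\<close> is divisible by every power of p.\<close>
      have cc: "[(p ^ k)] \<cdot> c k = c 0" for k
      proof -
        have "([(p ^ k)] \<cdot> c k) \<odot>\<^bsub>M\<^esub> g \<oplus>\<^bsub>M\<^esub> [(p ^ k)] \<cdot>\<^bsub>M\<^esub> y k = c 0 \<odot>\<^bsub>M\<^esub> g \<oplus>\<^bsub>M\<^esub> y 0"
          using cy(3)[of k] cy(3)[of 0] cy(1) yc gc by (simp add: M.add_pow_add smult_add_pow)
        then have "([(p ^ k)] \<cdot> c k \<ominus> c 0) \<odot>\<^bsub>M\<^esub> g = y 0 \<ominus>\<^bsub>M\<^esub> [(p ^ k)] \<cdot>\<^bsub>M\<^esub> y k"
        proof -
          define A B D F where A_B_D_F_def: "A = ([(p ^ k)] \<cdot> c k) \<odot>\<^bsub>M\<^esub> g" "B = [(p ^ k)] \<cdot>\<^bsub>M\<^esub> y k" "D = c 0 \<odot>\<^bsub>M\<^esub> g" "F = y 0"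
          have cl: "A \<in> carrier M" "B \<in> carrier M" "D \<in> carrier M" "F \<in> carrier M"
            using cy(1) yc gc by (simp_all add: A_B_D_F_def)
          assume "([(p ^ k)] \<cdot> c k) \<odot>\<^bsub>M\<^esub> g \<oplus>\<^bsub>M\<^esub> [(p ^ k)] \<cdot>\<^bsub>M\<^esub> y k = c 0 \<odot>\<^bsub>M\<^esub> g \<oplus>\<^bsub>M\<^esub> y 0"
          then have e: "A \<oplus>\<^bsub>M\<^esub> B = D \<oplus>\<^bsub>M\<^esub> F" by (simp add: A_B_D_F_def)
          have "A \<ominus>\<^bsub>M\<^esub> D = (A \<oplus>\<^bsub>M\<^esub> B) \<oplus>\<^bsub>M\<^esub> (\<ominus>\<^bsub>M\<^esub> B \<oplus>\<^bsub>M\<^esub> \<ominus>\<^bsub>M\<^esub> D)"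
            using cl by (simp add: M.minus_eq M.a_assoc M.r_neg2)
          also have "\<dots> = (F \<oplus>\<^bsub>M\<^esub> D) \<oplus>\<^bsub>M\<^esub> (\<ominus>\<^bsub>M\<^esub> D \<oplus>\<^bsub>M\<^esub> \<ominus>\<^bsub>M\<^esub> B)"
            using cl e by (simp add: M.a_comm)
          also have "\<dots> = F \<ominus>\<^bsub>M\<^esub> B"
            using cl by (simp add: M.minus_eq M.a_assoc M.r_neg2)
          finally show ?thesis using cy(1) gc unfolding A_B_D_F_def
            by (simp add: R.minus_eq M.minus_eq smult_l_distr smult_l_minus)
        qed
        moreover have "y 0 \<ominus>\<^bsub>M\<^esub> [(p ^ k)] \<cdot>\<^bsub>M\<^esub> y k \<in> N"
          using cy(2) gc unfolding N_def by (intro gspan_minus gspan_add_pow) auto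
        ultimately have "[(p ^ k)] \<cdot> c k \<ominus> c 0 = \<zero>" using cy(1) by (intro indep) auto
        then show ?thesis using cy(1) by (simp add: R.r_right_minus_eq)
      qed
      then have "c 0 = \<zero>"
        using separated cy(1) unfolding padic_separated_def by metis
      then have "c k = \<zero>" for k using torsion_free_pow[OF cy(1), of k k] cc[of k] by simp
      then have xy: "x = [(p ^ k)] \<cdot>\<^bsub>M\<^esub> y k" for k using cy(3)[of k] yc gc by simp
      then have "x = y 0" using xy[of 0] yc[of 0] by simp
      then show ?thesis using IH[of x] cy(2) xy by metis
    qed
  qed
qed

end

lemma (in abelian_group) padic_sum_tail:
  assumes y: "\<And>k. y k \<in> carrier G" and "n \<le> i"
  shows "\<exists>z\<in>carrier G. padic_sum G p y i = padic_sum G p y n \<oplus> [(p ^ n)] \<cdot> z"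
  using assms(2)
proof (induction i rule: dec_induct)
  case base
  show ?case by (intro bexI[of _ \<zero>]) (simp_all add: y padic_sum_closed)
next
  case (step i)
  then obtain z where z: "z \<in> carrier G" "padic_sum G p y i = padic_sum G p y n \<oplus> [(p ^ n)] \<cdot> z" by blast
  have "[(p ^ i)] \<cdot> y i = [(p ^ n)] \<cdot> ([(p ^ (i - n))] \<cdot> y i)"
    using step(1) y by (simp add: add_pow_mult flip: power_add)
  then have "padic_sum G p y (Suc i) = padic_sum G p y n \<oplus> [(p ^ n)] \<cdot> (z \<oplus> [(p ^ (i - n))] \<cdot> y i)"
    using z y by (simp add: add_pow_add a_assoc padic_sum_closed)
  then show ?case using z y by (metis add.m_closed add_pow_closed)
qed

text \<open>Being unramified means that the radical consists of the multiples of p, so its n-th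
  power consists of the multiples of p^n. Adic separation and completeness thereby become the p-adic
  notions.\<close>

lemma (in p_modular_system) padic_domain_Ov:
  assumes fin: "finite (carrier (residue_field Ov))" and unram: "absolutely_unramified p Ov"
  shows "padic_domain p Ov"
proof -
  interpret discrete_valuation_ring Ov by (rule dvr)
  define J where "J = jacobson_radical Ov"
  obtain M where M: "maximalideal M Ov" "\<And>N. maximalideal N Ov \<Longrightarrow> N = M"
    using local by blast
  then have "{N. maximalideal N Ov} = {M}" by blast
  moreover have "M \<subseteq> carrier Ov"
    using M(1) by (meson additive_subgroup.a_subset ideal.axioms(1) maximalideal.axioms(1))
  ultimately have JM: "J = M" by (auto simp: J_def jacobson_radical_def)
  then have Jmax: "maximalideal J Ov" using M(1) by (simp only:)
  then interpret J: ideal J Ov by (rule maximalideal.axioms(1))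
  have mult: "x \<otimes>\<^bsub>Ov\<^esub> [n] \<cdot>\<^bsub>Ov\<^esub> \<one>\<^bsub>Ov\<^esub> = [n] \<cdot>\<^bsub>Ov\<^esub> x" if "x \<in> carrier Ov" for x and n :: nat
    using add_pow_rdistr[OF that one_closed, of n] that by (simp only: r_one)
  have J: "J = {[p] \<cdot>\<^bsub>Ov\<^esub> y | y. y \<in> carrier Ov}"
  proof -
    have "J = PIdl\<^bsub>Ov\<^esub> ([p] \<cdot>\<^bsub>Ov\<^esub> \<one>\<^bsub>Ov\<^esub>)"
      using unram unfolding absolutely_unramified_def J_def .
    also have "\<dots> = {x \<otimes>\<^bsub>Ov\<^esub> [p] \<cdot>\<^bsub>Ov\<^esub> \<one>\<^bsub>Ov\<^esub> | x. x \<in> carrier Ov}"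
      by (rule cgenideal_def)
    also have "\<dots> = {[p] \<cdot>\<^bsub>Ov\<^esub> y | y. y \<in> carrier Ov}"
      unfolding Setcompr_eq_image using mult by (intro image_cong) auto
    finally show ?thesis .
  qed
  have pow: "J [^]\<^bsub>ideals_set Ov\<^esub> n = {[(p ^ n)] \<cdot>\<^bsub>Ov\<^esub> y | y. y \<in> carrier Ov}" for n :: nat
  proof (induction n)
    case 0
    have "J [^]\<^bsub>ideals_set Ov\<^esub> (0::nat) = carrier Ov" by (simp add: nat_pow_def ideals_set_def)
    moreover have "(\<lambda>y. [(p ^ 0)] \<cdot>\<^bsub>Ov\<^esub> y) ` carrier Ov = (\<lambda>y. y) ` carrier Ov"
      by (intro image_cong) auto
    ultimately show ?case unfolding Setcompr_eq_image by simp
  next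
    case (Suc n)
    define I where "I = J [^]\<^bsub>ideals_set Ov\<^esub> n"
    have I: "I = {[(p ^ n)] \<cdot>\<^bsub>Ov\<^esub> y | y. y \<in> carrier Ov}" unfolding I_def by (rule Suc.IH)
    have "J [^]\<^bsub>ideals_set Ov\<^esub> Suc n = ideal_prod Ov I J" by (simp add: nat_pow_def ideals_set_def I_def)
    also have "\<dots> = {[(p ^ Suc n)] \<cdot>\<^bsub>Ov\<^esub> y | y. y \<in> carrier Ov}"
    proof
      show "ideal_prod Ov I J \<subseteq> {[(p ^ Suc n)] \<cdot>\<^bsub>Ov\<^esub> y | y. y \<in> carrier Ov}"
      proof
        fix x assume "x \<in> ideal_prod Ov I J"
        then show "x \<in> {[(p ^ Suc n)] \<cdot>\<^bsub>Ov\<^esub> y | y. y \<in> carrier Ov}"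
        proof induction
          case (prod i j)
          then obtain y z where yz: "y \<in> carrier Ov" "z \<in> carrier Ov" "i = [(p ^ n)] \<cdot>\<^bsub>Ov\<^esub> y" "j = [p] \<cdot>\<^bsub>Ov\<^esub> z"
            unfolding I J by blast
          then have "i \<otimes>\<^bsub>Ov\<^esub> j = [(p ^ Suc n)] \<cdot>\<^bsub>Ov\<^esub> (y \<otimes>\<^bsub>Ov\<^esub> z)"
            by (simp add: add_pow_ldistr add_pow_rdistr add_pow_mult mult.commute)
          then show ?case using yz by blast
        next
          case (sum a b)
          then obtain y z where yz: "y \<in> carrier Ov" "z \<in> carrier Ov"
            "a = [(p ^ Suc n)] \<cdot>\<^bsub>Ov\<^esub> y" "b = [(p ^ Suc n)] \<cdot>\<^bsub>Ov\<^esub> z" by blast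
          then have "a \<oplus>\<^bsub>Ov\<^esub> b = [(p ^ Suc n)] \<cdot>\<^bsub>Ov\<^esub> (y \<oplus>\<^bsub>Ov\<^esub> z)" by (simp only: add_pow_add)
          then show ?case using yz by blast
        qed
      qed
      show "{[(p ^ Suc n)] \<cdot>\<^bsub>Ov\<^esub> y | y. y \<in> carrier Ov} \<subseteq> ideal_prod Ov I J"
      proof clarify
        fix y assume y: "y \<in> carrier Ov"
        have "[(p ^ Suc n)] \<cdot>\<^bsub>Ov\<^esub> y = [(p ^ n)] \<cdot>\<^bsub>Ov\<^esub> y \<otimes>\<^bsub>Ov\<^esub> [p] \<cdot>\<^bsub>Ov\<^esub> \<one>\<^bsub>Ov\<^esub>"
          using y mult[of "[(p ^ n)] \<cdot>\<^bsub>Ov\<^esub> y" p] by (simp add: add_pow_mult)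
        moreover have "[(p ^ n)] \<cdot>\<^bsub>Ov\<^esub> y \<in> I" "[p] \<cdot>\<^bsub>Ov\<^esub> \<one>\<^bsub>Ov\<^esub> \<in> J"
          using y one_closed unfolding I J by blast+
        ultimately show "[(p ^ Suc n)] \<cdot>\<^bsub>Ov\<^esub> y \<in> ideal_prod Ov I J"
          by (simp only: ideal_prod.prod)
      qed
    qed
    finally show ?case .
  qed
  \<comment> \<open>If p were zero, the maximal ideal would be zero and the ring a field.\<close>
  have p_one: "[p] \<cdot>\<^bsub>Ov\<^esub> \<one>\<^bsub>Ov\<^esub> \<noteq> \<zero>\<^bsub>Ov\<^esub>"
  proof
    assume "[p] \<cdot>\<^bsub>Ov\<^esub> \<one>\<^bsub>Ov\<^esub> = \<zero>\<^bsub>Ov\<^esub>"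
    then have "[p] \<cdot>\<^bsub>Ov\<^esub> y = \<zero>\<^bsub>Ov\<^esub>" if "y \<in> carrier Ov" for y
      using mult[OF that, of p] that by simp
    then have "J \<subseteq> {\<zero>\<^bsub>Ov\<^esub>}" unfolding J by auto
    then have "J = {\<zero>\<^bsub>Ov\<^esub>}" using J.zero_closed by blast
    then have "field Ov" using Jmax zeromaximalideal_eq_field by simp
    then show False using not_field by blast
  qed
  show ?thesis
  proof (intro padic_domain.intro padic_domain_axioms.intro)
    show "domain Ov" by (rule domain_axioms)
    show "1 < p" using prime_p prime_gt_1_nat by blast
    have "x = \<zero>\<^bsub>Ov\<^esub>" if x: "\<forall>k::nat. \<exists>y\<in>carrier Ov. x = [(p ^ k)] \<cdot>\<^bsub>Ov\<^esub> y" for x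
    proof -
      have "x \<in> (\<Inter>n::nat. J [^]\<^bsub>ideals_set Ov\<^esub> n)" unfolding pow using x by blast
      moreover have "(\<Inter>n::nat. J [^]\<^bsub>ideals_set Ov\<^esub> n) = {\<zero>\<^bsub>Ov\<^esub>}"
        using complete unfolding adically_complete_def J_def by (rule conjunct1)
      ultimately show ?thesis by simp
    qed
    then show "padic_separated p Ov (carrier Ov)" unfolding padic_separated_def by blast
    show "padic_complete p Ov (carrier Ov)"
      unfolding padic_complete_def
    proof (intro allI impI)
      fix y :: "nat \<Rightarrow> 'r" assume "\<forall>k. y k \<in> carrier Ov"
      then have y: "y k \<in> carrier Ov" for k by blast
      define s where "s = padic_sum Ov p y"
      have sc: "s i \<in> carrier Ov" for i by (simp add: s_def y padic_sum_closed)
      have tail: "\<exists>z\<in>carrier Ov. s i = s n \<oplus>\<^bsub>Ov\<^esub> [(p ^ n)] \<cdot>\<^bsub>Ov\<^esub> z" if "n \<le> i" for i n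
        unfolding s_def using y that by (rule padic_sum_tail)
      have swap: "(a \<oplus>\<^bsub>Ov\<^esub> b) \<ominus>\<^bsub>Ov\<^esub> (a \<oplus>\<^bsub>Ov\<^esub> d) = b \<ominus>\<^bsub>Ov\<^esub> d"
        if "a \<in> carrier Ov" "b \<in> carrier Ov" "d \<in> carrier Ov" for a b d
      proof -
        have "(a \<oplus>\<^bsub>Ov\<^esub> b) \<ominus>\<^bsub>Ov\<^esub> (a \<oplus>\<^bsub>Ov\<^esub> d) = (b \<oplus>\<^bsub>Ov\<^esub> a) \<oplus>\<^bsub>Ov\<^esub> (\<ominus>\<^bsub>Ov\<^esub> a \<oplus>\<^bsub>Ov\<^esub> \<ominus>\<^bsub>Ov\<^esub> d)"
          using that by (simp add: minus_eq minus_add a_comm)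
        also have "\<dots> = b \<ominus>\<^bsub>Ov\<^esub> d" using that by (simp add: minus_eq a_assoc r_neg2)
        finally show ?thesis .
      qed
      have "s i \<ominus>\<^bsub>Ov\<^esub> s j \<in> J [^]\<^bsub>ideals_set Ov\<^esub> n" if "n \<le> i" "n \<le> j" for i j n
      proof -
        obtain z where z: "z \<in> carrier Ov" "s i = s n \<oplus>\<^bsub>Ov\<^esub> [(p ^ n)] \<cdot>\<^bsub>Ov\<^esub> z" using tail \<open>n \<le> i\<close> by blast
        obtain w where w: "w \<in> carrier Ov" "s j = s n \<oplus>\<^bsub>Ov\<^esub> [(p ^ n)] \<cdot>\<^bsub>Ov\<^esub> w" using tail \<open>n \<le> j\<close> by blast
        have "s i \<ominus>\<^bsub>Ov\<^esub> s j = [(p ^ n)] \<cdot>\<^bsub>Ov\<^esub> (z \<ominus>\<^bsub>Ov\<^esub> w)"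
          unfolding z(2) w(2) using z(1) w(1) sc swap by (simp add: add_pow_minus)
        then show ?thesis unfolding pow using z(1) w(1) by blast
      qed
      then have "\<exists>N. \<forall>i\<ge>N. \<forall>j\<ge>N. s i \<ominus>\<^bsub>Ov\<^esub> s j \<in> J [^]\<^bsub>ideals_set Ov\<^esub> n" for n :: nat
        by blast
      then have "\<exists>x\<in>carrier Ov. \<forall>n::nat. \<exists>N. \<forall>i\<ge>N. s i \<ominus>\<^bsub>Ov\<^esub> x \<in> J [^]\<^bsub>ideals_set Ov\<^esub> n"
        by (intro complete[unfolded adically_complete_def, folded J_def, THEN conjunct2, THEN spec[of _ s], THEN mp]
            conjI allI sc)
      then obtain x where x: "x \<in> carrier Ov" "\<forall>n::nat. \<exists>N. \<forall>i\<ge>N. s i \<ominus>\<^bsub>Ov\<^esub> x \<in> J [^]\<^bsub>ideals_set Ov\<^esub> n"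
        by (elim bexE)
      have "\<exists>z\<in>carrier Ov. x = s n \<oplus>\<^bsub>Ov\<^esub> [(p ^ n)] \<cdot>\<^bsub>Ov\<^esub> z" for n
      proof -
        obtain N where N: "\<And>i. i \<ge> N \<Longrightarrow> s i \<ominus>\<^bsub>Ov\<^esub> x \<in> J [^]\<^bsub>ideals_set Ov\<^esub> n" using x by blast
        \<comment> \<open>Beyond n, so that the tail estimate applies, and beyond N, so that
          \<open>s i\<close> is close to the limit.\<close>
        define i where "i = max n N"
        obtain z where z: "z \<in> carrier Ov" "s i = s n \<oplus>\<^bsub>Ov\<^esub> [(p ^ n)] \<cdot>\<^bsub>Ov\<^esub> z" using tail[of n i] by (auto simp: i_def)
        obtain w where w: "w \<in> carrier Ov" "s i \<ominus>\<^bsub>Ov\<^esub> x = [(p ^ n)] \<cdot>\<^bsub>Ov\<^esub> w"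
          using N[of i] unfolding pow i_def by auto
        have "x = s i \<ominus>\<^bsub>Ov\<^esub> (s i \<ominus>\<^bsub>Ov\<^esub> x)"
          using x(1) sc[of i] by (simp add: minus_eq minus_add r_neg2)
        also have "\<dots> = s n \<oplus>\<^bsub>Ov\<^esub> [(p ^ n)] \<cdot>\<^bsub>Ov\<^esub> (z \<ominus>\<^bsub>Ov\<^esub> w)"
          unfolding w(2) unfolding z(2) using z(1) w(1) sc[of n] by (simp add: add_pow_add add_pow_uminus minus_eq a_assoc)
        finally show ?thesis using z(1) w(1) by blast
      qed
      then show "\<exists>x\<in>carrier Ov. \<forall>n. \<exists>z\<in>carrier Ov. x = padic_sum Ov p y n \<oplus>\<^bsub>Ov\<^esub> [(p ^ n)] \<cdot>\<^bsub>Ov\<^esub> z"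
        using x(1) unfolding s_def by blast
    qed
    show "padic_finite p Ov (carrier Ov)"
    proof -
      have "finite ((+>\<^bsub>Ov\<^esub>) J ` carrier Ov)"
        using fin by (simp add: residue_field_def J.carrier_FactRing flip: J_def)
      then obtain T where T: "T \<subseteq> carrier Ov" "finite T" "(+>\<^bsub>Ov\<^esub>) J ` carrier Ov = (+>\<^bsub>Ov\<^esub>) J ` T"
        using finite_subset_image[of "(+>\<^bsub>Ov\<^esub>) J ` carrier Ov" "(+>\<^bsub>Ov\<^esub>) J" "carrier Ov"] by auto
      have "\<exists>t\<in>T. \<exists>y\<in>carrier Ov. x = t \<oplus>\<^bsub>Ov\<^esub> [p] \<cdot>\<^bsub>Ov\<^esub> y" if x: "x \<in> carrier Ov" for x
      proof -
        obtain t where t: "t \<in> T" "J +>\<^bsub>Ov\<^esub> x = J +>\<^bsub>Ov\<^esub> t" using T(3) x by blast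
        have tc: "t \<in> carrier Ov" using t T by blast
        then have "x \<ominus>\<^bsub>Ov\<^esub> t \<in> J" using t(2) x J.coset_eq_iff by blast
        then obtain y where y: "y \<in> carrier Ov" "x \<ominus>\<^bsub>Ov\<^esub> t = [p] \<cdot>\<^bsub>Ov\<^esub> y" unfolding J by blast
        have "x = t \<oplus>\<^bsub>Ov\<^esub> (x \<ominus>\<^bsub>Ov\<^esub> t)" using x tc by (simp add: minus_eq a_lcomm[of t x] r_neg)
        then show ?thesis using y t by auto
      qed
      then show ?thesis unfolding padic_finite_def using T by blast
    qed
  next
    fix x assume x: "x \<in> carrier Ov" "[p] \<cdot>\<^bsub>Ov\<^esub> x = \<zero>\<^bsub>Ov\<^esub>"
    then have "x \<otimes>\<^bsub>Ov\<^esub> [p] \<cdot>\<^bsub>Ov\<^esub> \<one>\<^bsub>Ov\<^esub> = \<zero>\<^bsub>Ov\<^esub>" using mult by simp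
    then show "x = \<zero>\<^bsub>Ov\<^esub>" using p_one x(1) integral by blast
  next
    fix x assume x: "x \<in> carrier Ov"
    show "x \<in> Units Ov \<or> (\<exists>y\<in>carrier Ov. x = [p] \<cdot>\<^bsub>Ov\<^esub> y)"
    proof (rule disjCI)
      assume "\<not> (\<exists>y\<in>carrier Ov. x = [p] \<cdot>\<^bsub>Ov\<^esub> y)"
      then have xJ: "x \<notin> J" unfolding J by blast
      show "x \<in> Units Ov"
      proof (rule ccontr)
        assume nu: "x \<notin> Units Ov"
        \<comment> \<open>A nonzero nonunit has an irreducible divisor. In a principal ideal domain
          that divisor generates a maximal ideal, which can only be \<open>J\<close>.\<close>
        have "x \<noteq> \<zero>\<^bsub>Ov\<^esub>" using xJ J.zero_closed by blast
        then obtain b where b: "b \<in> carrier Ov" "ring_irreducible\<^bsub>Ov\<^esub> b" "b divides\<^bsub>Ov\<^esub> x"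
          using exists_irreducible_divisor[of x] nu x by blast
        have "PIdl\<^bsub>Ov\<^esub> b = J" using M(2) irreducible_imp_maximalideal[OF b(1,2)] JM by simp
        then have "b \<in> J" using cgenideal_self b(1) by blast
        then have "x \<in> J" using b(3) J.I_r_closed by (auto simp: factor_def)
        then show False using xJ by blast
      qed
    qed
  qed
qed

section \<open>Restriction of scalars\<close>

lemma module_restrict_scalars:
  assumes "assoc_algebra R A" "left_module A M"
  shows "module R (restrict_scalars A M)"
proof -
  interpret A: assoc_algebra R A by fact
  interpret M: left_module A M by fact
  let ?N = "restrict_scalars A M"
  have [simp]: "carrier ?N = carrier M" "add ?N = add M" "\<zero>\<^bsub>?N\<^esub> = \<zero>\<^bsub>M\<^esub>"
    "r \<odot>\<^bsub>?N\<^esub> x = (r \<odot>\<^bsub>A\<^esub> \<one>\<^bsub>A\<^esub>) \<odot>\<^bsub>M\<^esub> x" for r x by (simp_all add: restrict_scalars_def)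
  have ag: "abelian_group ?N"
  proof (rule abelian_groupI)
    fix x assume "x \<in> carrier ?N"
    then show "\<exists>y\<in>carrier ?N. y \<oplus>\<^bsub>?N\<^esub> x = \<zero>\<^bsub>?N\<^esub>"
      by (intro bexI[of _ "\<ominus>\<^bsub>M\<^esub> x"]) (simp_all add: M.M.l_neg)
  qed (simp_all add: M.M.a_ac)
  have mm: "(r \<odot>\<^bsub>A\<^esub> \<one>\<^bsub>A\<^esub>) \<otimes>\<^bsub>A\<^esub> (s \<odot>\<^bsub>A\<^esub> \<one>\<^bsub>A\<^esub>) = (r \<otimes>\<^bsub>R\<^esub> s) \<odot>\<^bsub>A\<^esub> \<one>\<^bsub>A\<^esub>"
    if "r \<in> carrier R" "s \<in> carrier R" for r s
    using that by (simp add: A.smult_mult_left A.smult_assoc1)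
  show ?thesis
  proof (rule moduleI)
    show "cring R" by (rule A.R.cring_axioms)
    show "abelian_group ?N" by (rule ag)
  qed (auto simp: M.smult_closed M.smult_r_distr M.smult_one A.smult_l_distr M.smult_l_distr
        M.smult_assoc1[symmetric] mm)
qed

text \<open>The products s t, with s from generators of A over R and t from generators of M over A,
  generate M over R.\<close>

lemma finitely_generated_gspan:
  assumes "assoc_algebra R A" "left_module A M" "finitely_generated R A" "finitely_generated A M"
  obtains gs where "set gs \<subseteq> carrier M" "gspan R (restrict_scalars A M) gs = carrier M"
proof -
  interpret A: assoc_algebra R A by fact
  interpret M: left_module A M by fact
  let ?N = "restrict_scalars A M"
  interpret N: module R ?N by (rule module_restrict_scalars[OF assms(1,2)])
  have N: "carrier ?N = carrier M" "add ?N = add M" "\<zero>\<^bsub>?N\<^esub> = \<zero>\<^bsub>M\<^esub>"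
    "r \<odot>\<^bsub>?N\<^esub> x = (r \<odot>\<^bsub>A\<^esub> \<one>\<^bsub>A\<^esub>) \<odot>\<^bsub>M\<^esub> x" for r x by (simp_all add: restrict_scalars_def)
  obtain S where S: "finite S" "S \<subseteq> carrier A"
    "\<And>a. a \<in> carrier A \<Longrightarrow> \<exists>c\<in>S \<rightarrow> carrier R. a = (\<Oplus>\<^bsub>A\<^esub>s\<in>S. c s \<odot>\<^bsub>A\<^esub> s)"
  proof -
    obtain B where B: "finite B" "B \<subseteq> carrier A"
      "carrier A = {\<Oplus>\<^bsub>A\<^esub>s\<in>B. c s \<odot>\<^bsub>A\<^esub> s | c. c \<in> B \<rightarrow> carrier R}"
      using assms(3) unfolding finitely_generated_def by (elim exE conjE)
    have "\<exists>c\<in>B \<rightarrow> carrier R. a = (\<Oplus>\<^bsub>A\<^esub>s\<in>B. c s \<odot>\<^bsub>A\<^esub> s)" if "a \<in> carrier A" for a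
      using \<open>a \<in> carrier A\<close>[unfolded B(3)] by blast
    then show thesis using that B(1,2) by blast
  qed
  obtain T where T: "finite T" "T \<subseteq> carrier M"
    "\<And>x. x \<in> carrier M \<Longrightarrow> \<exists>c\<in>T \<rightarrow> carrier A. x = (\<Oplus>\<^bsub>M\<^esub>t\<in>T. c t \<odot>\<^bsub>M\<^esub> t)"
  proof -
    obtain B where B: "finite B" "B \<subseteq> carrier M"
      "carrier M = {\<Oplus>\<^bsub>M\<^esub>s\<in>B. c s \<odot>\<^bsub>M\<^esub> s | c. c \<in> B \<rightarrow> carrier A}"
      using assms(4) unfolding finitely_generated_def by (elim exE conjE)
    have "\<exists>c\<in>B \<rightarrow> carrier A. a = (\<Oplus>\<^bsub>M\<^esub>s\<in>B. c s \<odot>\<^bsub>M\<^esub> s)" if "a \<in> carrier M" for a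
      using \<open>a \<in> carrier M\<close>[unfolded B(3)] by blast
    then show thesis using that B(1,2) by blast
  qed
  have "finite ((\<lambda>(s, t). s \<odot>\<^bsub>M\<^esub> t) ` (S \<times> T))" using S(1) T(1) by simp
  then obtain gs where gs: "set gs = (\<lambda>(s, t). s \<odot>\<^bsub>M\<^esub> t) ` (S \<times> T)"
    using finite_list by blast
  have gsc: "set gs \<subseteq> carrier M" unfolding gs using S(2) T(2) M.smult_closed by (fastforce simp: subset_iff)
  then have gsN: "set gs \<subseteq> carrier ?N" by (simp add: N)
  define G where "G = gspan R ?N gs"
  have Gc: "G \<subseteq> carrier M" unfolding G_def using N.gspan_carrier[OF gsN] by (simp add: N)
  have G0: "\<zero>\<^bsub>M\<^esub> \<in> G" unfolding G_def using N.gspan_zero[OF gsN] by (simp add: N)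
  have Gadd: "x \<oplus>\<^bsub>M\<^esub> y \<in> G" if "x \<in> G" "y \<in> G" for x y
    using N.gspan_add[OF gsN] that unfolding G_def by (simp add: N)
  have Gsum: "(\<Oplus>\<^bsub>M\<^esub>i\<in>I. f i) \<in> G" if "finite I" "\<And>i. i \<in> I \<Longrightarrow> f i \<in> G" for I f
    using that
  proof (induction I rule: finite_induct)
    case (insert i I)
    then have "f \<in> I \<rightarrow> carrier M" "f i \<in> carrier M" using Gc by auto
    then show ?case using insert Gadd by (simp add: M.M.finsum_insert)
  qed (simp add: G0)
  have AT: "a \<odot>\<^bsub>M\<^esub> t \<in> G" if a: "a \<in> carrier A" and t: "t \<in> T" for a t
  proof -
    obtain c where c: "c \<in> S \<rightarrow> carrier R" "a = (\<Oplus>\<^bsub>A\<^esub>s\<in>S. c s \<odot>\<^bsub>A\<^esub> s)" using S(3)[OF a] by blast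
    have tc: "t \<in> carrier M" using t T by blast
    have "(\<Oplus>\<^bsub>A\<^esub>s\<in>U. c s \<odot>\<^bsub>A\<^esub> s) \<odot>\<^bsub>M\<^esub> t \<in> G" if "finite U" "U \<subseteq> S" for U
      using that
    proof (induction U rule: finite_induct)
      case empty
      have "\<zero>\<^bsub>A\<^esub> \<odot>\<^bsub>M\<^esub> t = \<zero>\<^bsub>M\<^esub>"
      proof -
        have "\<zero>\<^bsub>A\<^esub> \<odot>\<^bsub>M\<^esub> t = \<zero>\<^bsub>A\<^esub> \<odot>\<^bsub>M\<^esub> t \<oplus>\<^bsub>M\<^esub> \<zero>\<^bsub>A\<^esub> \<odot>\<^bsub>M\<^esub> t"
          using M.smult_l_distr[of "\<zero>\<^bsub>A\<^esub>" "\<zero>\<^bsub>A\<^esub>" t] tc by simp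
        then show ?thesis
          using M.smult_closed[of "\<zero>\<^bsub>A\<^esub>" t] tc by (metis M.M.add.l_cancel_one' A.M.zero_closed)
      qed
      then show ?case by (simp add: G0)
    next
      case (insert s U)
      have sc: "s \<in> carrier A" "c s \<in> carrier R" using insert.prems S c by auto
      have cs: "c s \<in> carrier R" "s \<in> carrier A" if "s \<in> S" for s using that c(1) S(2) by auto
      then have f: "(\<lambda>s. c s \<odot>\<^bsub>A\<^esub> s) \<in> U \<rightarrow> carrier A" using insert.prems by auto
      have "(c s \<odot>\<^bsub>A\<^esub> s) \<odot>\<^bsub>M\<^esub> t = c s \<odot>\<^bsub>?N\<^esub> (s \<odot>\<^bsub>M\<^esub> t)"
        using sc tc by (simp add: N M.smult_assoc1[symmetric] A.smult_mult_left)
      also have "\<dots> \<in> G"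
        unfolding G_def using sc insert.prems t
        by (intro N.gspan_smult N.gspan_generator gsN) (auto simp: gs)
      finally show ?case
        using insert sc tc f A.M.finsum_closed[OF f] Gadd
        by (simp add: A.M.finsum_insert M.smult_l_distr)
    qed
    from this[OF S(1) order_refl] show ?thesis using c by simp
  qed
  have "carrier M \<subseteq> G"
  proof
    fix x assume "x \<in> carrier M"
    then obtain c where c: "c \<in> T \<rightarrow> carrier A" "x = (\<Oplus>\<^bsub>M\<^esub>t\<in>T. c t \<odot>\<^bsub>M\<^esub> t)" using T(3) by blast
    show "x \<in> G" unfolding c(2) using c(1) AT T(1) by (intro Gsum) auto
  qed
  then have "G = carrier M" using Gc by blast
  then show thesis using that[OF gsc] by (simp add: G_def)
qed

section \<open>A basis of the extension ring\<close>

locale subring_extension = R?: cring R + R'?: cring R' for R R' :: "'r ring" +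
  assumes subring: "(\<lambda>x. x) \<in> ring_hom R R'"
begin

lemma sub_carrier: "x \<in> carrier R \<Longrightarrow> x \<in> carrier R'"
  using ring_hom_closed[OF subring] by blast

lemma sub_add: "x \<in> carrier R \<Longrightarrow> y \<in> carrier R \<Longrightarrow> x \<oplus>\<^bsub>R'\<^esub> y = x \<oplus>\<^bsub>R\<^esub> y"
  using ring_hom_add[OF subring] by metis

lemma sub_mult: "x \<in> carrier R \<Longrightarrow> y \<in> carrier R \<Longrightarrow> x \<otimes>\<^bsub>R'\<^esub> y = x \<otimes>\<^bsub>R\<^esub> y"
  using ring_hom_mult[OF subring] by metis

lemma sub_one: "\<one>\<^bsub>R'\<^esub> = \<one>\<^bsub>R\<^esub>"
  using ring_hom_one[OF subring] by simp

text \<open>R' as a module over its subring R. Both rings live on one type, so the scalar action is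
  simply the multiplication of R'.\<close>

definition as_module :: "('r, 'r) module" where
  "as_module = \<lparr>carrier = carrier R', monoid.mult = monoid.mult R', one = one R', ring.zero = ring.zero R',
     add = add R', module.smult = monoid.mult R'\<rparr>"

lemma as_module_simps [simp]:
  "carrier as_module = carrier R'" "add as_module = add R'"
  "\<zero>\<^bsub>as_module\<^esub> = \<zero>\<^bsub>R'\<^esub>" "r \<odot>\<^bsub>as_module\<^esub> x = r \<otimes>\<^bsub>R'\<^esub> x"
  by (simp_all add: as_module_def)

lemma finsum_as_module: "finsum as_module f S = finsum R' f S"
  by (simp add: finsum_def finprod_def as_module_def)

lemma add_pow_as_module: "[(n::nat)] \<cdot>\<^bsub>as_module\<^esub> x = [n] \<cdot>\<^bsub>R'\<^esub> x"
  by (simp add: add_pow_def nat_pow_def as_module_def)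

lemma module_as_module: "module R as_module"
proof (rule moduleI)
  show "abelian_group as_module"
  proof (rule abelian_groupI)
    fix x assume "x \<in> carrier as_module"
    then show "\<exists>y\<in>carrier as_module. y \<oplus>\<^bsub>as_module\<^esub> x = \<zero>\<^bsub>as_module\<^esub>"
      by (intro bexI[of _ "\<ominus>\<^bsub>R'\<^esub> x"]) (simp_all add: R'.l_neg)
  qed (simp_all add: R'.a_ac)
qed (auto simp: sub_carrier R'.l_distr R'.r_distr R'.m_assoc simp flip: sub_add sub_mult sub_one intro: R.cring_axioms)

end

text \<open>The dual basis description of a finitely generated projective module: linear coordinate
  functions together with an expansion. This is the form that carries over to tensor
  products.\<close>

locale finite_dual_basis = subring_extension R R' for R R' :: "'r ring" +
  fixes B :: "'r set" and coord :: "'r \<Rightarrow> 'r \<Rightarrow> 'r"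
  assumes finite_B: "finite B" and B_carrier: "B \<subseteq> carrier R'"
    and coord_closed: "\<And>b x. b \<in> B \<Longrightarrow> x \<in> carrier R' \<Longrightarrow> coord b x \<in> carrier R"
    and coord_add: "\<And>b x y. b \<in> B \<Longrightarrow> x \<in> carrier R' \<Longrightarrow> y \<in> carrier R' \<Longrightarrow>
      coord b (x \<oplus>\<^bsub>R'\<^esub> y) = coord b x \<oplus>\<^bsub>R\<^esub> coord b y"
    and coord_mult: "\<And>b x r. b \<in> B \<Longrightarrow> x \<in> carrier R' \<Longrightarrow> r \<in> carrier R \<Longrightarrow>
      coord b (x \<otimes>\<^bsub>R'\<^esub> r) = coord b x \<otimes>\<^bsub>R\<^esub> r"
    and coord_sum: "\<And>x. x \<in> carrier R' \<Longrightarrow> x = (\<Oplus>\<^bsub>R'\<^esub>b\<in>B. coord b x \<otimes>\<^bsub>R'\<^esub> b)"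

locale padic_extension = R?: padic_domain p R + R'?: padic_domain p R' + subring_extension R R'
  for p and R R' :: "'r ring"
begin

interpretation M: padic_module p R as_module
  by (intro padic_module.intro module_as_module R.padic_domain_axioms)

definition spanning :: "'r set \<Rightarrow> bool" where
  "spanning B \<longleftrightarrow> finite B \<and> B \<subseteq> carrier R' \<and>
     (\<forall>x\<in>carrier R'. \<exists>c\<in>B \<rightarrow> carrier R. x = (\<Oplus>\<^bsub>R'\<^esub>b\<in>B. c b \<otimes>\<^bsub>R'\<^esub> b))"

lemma padic_sum_as_module: "padic_sum as_module p y n = padic_sum R' p y n"
  by (induction n) (simp_all add: add_pow_as_module)

text \<open>Representatives of the finite residue ring span: the \<open>p\<close>-adic expansion of \<open>x\<close> has its
  digits among them, and their span is complete.\<close>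

lemma spanning_exists: "\<exists>B. spanning B"
proof -
  obtain T where T: "finite T" "T \<subseteq> carrier R'"
    "\<And>x. x \<in> carrier R' \<Longrightarrow> \<exists>t\<in>T. \<exists>y\<in>carrier R'. x = t \<oplus>\<^bsub>R'\<^esub> [p] \<cdot>\<^bsub>R'\<^esub> y"
    using R'.residue_finite unfolding padic_finite_def by (elim exE conjE bspec) blast
  obtain ts where ts: "set ts = T" using T(1) finite_list by blast
  have tsc: "set ts \<subseteq> carrier as_module" using ts T by simp
  obtain d q where dq: "\<And>x. x \<in> carrier R' \<Longrightarrow> d x \<in> T" "\<And>x. x \<in> carrier R' \<Longrightarrow> q x \<in> carrier R'"
    "\<And>x. x \<in> carrier R' \<Longrightarrow> x = d x \<oplus>\<^bsub>R'\<^esub> [p] \<cdot>\<^bsub>R'\<^esub> q x"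
    using T(3) by metis
  have "\<exists>c\<in>T \<rightarrow> carrier R. x = (\<Oplus>\<^bsub>R'\<^esub>b\<in>T. c b \<otimes>\<^bsub>R'\<^esub> b)" if x: "x \<in> carrier R'" for x
  proof -
    \<comment> \<open>The remainder after n digits of the expansion of x; \<open>d\<close> picks a
      digit and \<open>q\<close> the quotient that is left.\<close>
    define w where "w n = (q ^^ n) x" for n
    have wc: "w n \<in> carrier R'" for n
      by (induction n) (simp_all add: w_def x dq(2))
    define y where "y n = d (w n)" for n
    have yT: "y n \<in> T" for n using dq(1)[OF wc] by (simp add: y_def)
    then have yc: "y n \<in> carrier R'" for n using T(2) by blast
    have exp: "x = padic_sum R' p y n \<oplus>\<^bsub>R'\<^esub> [(p ^ n)] \<cdot>\<^bsub>R'\<^esub> w n" for n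
    proof (induction n)
      case 0
      show ?case using x by (simp add: w_def)
    next
      case (Suc n)
      have "w n = y n \<oplus>\<^bsub>R'\<^esub> [p] \<cdot>\<^bsub>R'\<^esub> w (Suc n)" using dq(3)[OF wc[of n]] by (simp add: y_def w_def)
      then have "[(p ^ n)] \<cdot>\<^bsub>R'\<^esub> w n = [(p ^ n)] \<cdot>\<^bsub>R'\<^esub> y n \<oplus>\<^bsub>R'\<^esub> [(p ^ Suc n)] \<cdot>\<^bsub>R'\<^esub> w (Suc n)"
        using yc[of n] wc[of "Suc n"] by (simp add: R'.add_pow_add R'.add_pow_mult mult.commute)
      then show ?case using Suc yc wc R'.padic_sum_closed[of y p n]
        by (simp add: R'.a_assoc)
    qed
    have "y k \<in> gspan R as_module ts" for k
      using M.gspan_generator[OF tsc] yT ts by simp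
    then obtain z where z: "z \<in> gspan R as_module ts"
      "\<And>n. \<exists>v\<in>gspan R as_module ts. z = padic_sum R' p y n \<oplus>\<^bsub>R'\<^esub> [(p ^ n)] \<cdot>\<^bsub>R'\<^esub> v"
      using M.padic_complete_gspan[OF tsc, unfolded padic_complete_def, rule_format, of y]
      by (auto simp: padic_sum_as_module add_pow_as_module)
    have zc: "z \<in> carrier R'" using z(1) M.gspan_carrier[OF tsc] by auto
    \<comment> \<open>x and z differ from the same partial sum by multiples of p^n, so their
      difference is divisible by all powers of p and vanishes by separation.\<close>
    have "\<exists>u\<in>carrier R'. x \<ominus>\<^bsub>R'\<^esub> z = [(p ^ n)] \<cdot>\<^bsub>R'\<^esub> u" for n
    proof -
      obtain v where v: "v \<in> gspan R as_module ts" "z = padic_sum R' p y n \<oplus>\<^bsub>R'\<^esub> [(p ^ n)] \<cdot>\<^bsub>R'\<^esub> v" using z(2) by blast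
      have vc: "v \<in> carrier R'" using v(1) M.gspan_carrier[OF tsc] by auto
      define s where "s = padic_sum R' p y n"
      have sc: "s \<in> carrier R'" unfolding s_def using yc by (rule R'.padic_sum_closed)
      have "x \<ominus>\<^bsub>R'\<^esub> z = (s \<oplus>\<^bsub>R'\<^esub> [(p ^ n)] \<cdot>\<^bsub>R'\<^esub> w n) \<ominus>\<^bsub>R'\<^esub> (s \<oplus>\<^bsub>R'\<^esub> [(p ^ n)] \<cdot>\<^bsub>R'\<^esub> v)"
        using exp[of n] v(2) by (simp add: s_def)
      also have "\<dots> = ([(p ^ n)] \<cdot>\<^bsub>R'\<^esub> w n \<oplus>\<^bsub>R'\<^esub> s) \<oplus>\<^bsub>R'\<^esub> (\<ominus>\<^bsub>R'\<^esub> s \<oplus>\<^bsub>R'\<^esub> \<ominus>\<^bsub>R'\<^esub> ([(p ^ n)] \<cdot>\<^bsub>R'\<^esub> v))"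
        using sc vc wc by (simp add: R'.minus_eq R'.minus_add R'.a_comm)
      also have "\<dots> = [(p ^ n)] \<cdot>\<^bsub>R'\<^esub> (w n \<ominus>\<^bsub>R'\<^esub> v)"
        using sc vc wc by (simp add: R'.a_assoc R'.r_neg2 R'.add_pow_minus R'.minus_eq R'.add_pow_add R'.add_pow_uminus)
      finally show ?thesis using vc wc by blast
    qed
    then have "x \<ominus>\<^bsub>R'\<^esub> z = \<zero>\<^bsub>R'\<^esub>"
      using R'.separated x zc unfolding padic_separated_def by (meson R'.minus_closed)
    then have "x = z" using x zc by (simp add: R'.r_right_minus_eq)
    then show ?thesis using M.gspan_lincomb[OF tsc z(1)] ts by (simp add: finsum_as_module)
  qed
  then show ?thesis unfolding spanning_def using T(1,2) by blast
qed

text \<open>A nontrivial relation is divided by the largest common power of p, which is possible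
  because R' is torsion free. Some coefficient then becomes a unit, its generator is a combination
  of the others, and a smaller spanning set arises.\<close>

lemma minimal_spanning_independent:
  assumes B: "spanning B" and minimal: "\<And>B'. spanning B' \<Longrightarrow> card B \<le> card B'"
    and c: "c \<in> B \<rightarrow> carrier R" and rel: "(\<Oplus>\<^bsub>R'\<^esub>b\<in>B. c b \<otimes>\<^bsub>R'\<^esub> b) = \<zero>\<^bsub>R'\<^esub>" and b: "b \<in> B"
  shows "c b = \<zero>\<^bsub>R\<^esub>"
proof (rule ccontr)
  assume nz: "c b \<noteq> \<zero>\<^bsub>R\<^esub>"
  have fin: "finite B" and Bc: "\<And>b. b \<in> B \<Longrightarrow> b \<in> carrier R'"
    and span: "\<And>x. x \<in> carrier R' \<Longrightarrow> \<exists>c\<in>B \<rightarrow> carrier R. x = (\<Oplus>\<^bsub>R'\<^esub>b\<in>B. c b \<otimes>\<^bsub>R'\<^esub> b)"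
    using B unfolding spanning_def by auto
  have cc: "\<And>b. b \<in> B \<Longrightarrow> c b \<in> carrier R" using c by auto
  define S where "S = {b \<in> B. c b \<noteq> \<zero>\<^bsub>R\<^esub>}"
  have "\<exists>a u. u \<in> Units R \<and> c s = [(p ^ (a::nat))] \<cdot>\<^bsub>R\<^esub> u" if "s \<in> S" for s
  proof -
    have "c s \<in> carrier R" "c s \<noteq> \<zero>\<^bsub>R\<^esub>" using that cc by (auto simp: S_def)
    from R.unit_decomposition[OF this] show ?thesis by metis
  qed
  then obtain a u where au: "\<And>s. s \<in> S \<Longrightarrow> u s \<in> Units R" "\<And>s. s \<in> S \<Longrightarrow> c s = [(p ^ a s)] \<cdot>\<^bsub>R\<^esub> u s"
    by metis
  have Sfin: "finite S" and Sne: "S \<noteq> {}" using fin b nz by (auto simp: S_def)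
  \<comment> \<open>The smallest valuation of a nonzero coefficient; it is attained at
    \<open>t\<close>, so the divided coefficient \<open>d t\<close> is a unit.\<close>
  define m where "m = Min (a ` S)"
  have mle: "m \<le> a s" if "s \<in> S" for s unfolding m_def using Sfin that by simp
  have "m \<in> a ` S" unfolding m_def using Sfin Sne by (intro Min_in) auto
  then obtain t where t: "t \<in> S" "a t = m" by blast
  define d where "d s = (if s \<in> S then [(p ^ (a s - m))] \<cdot>\<^bsub>R\<^esub> u s else \<zero>\<^bsub>R\<^esub>)" for s
  have dc: "d s \<in> carrier R" for s by (simp add: d_def au R.Units_closed)
  have cd: "c s = [(p ^ m)] \<cdot>\<^bsub>R\<^esub> d s" if "s \<in> B" for s
  proof (cases "s \<in> S")
    case True
    then show ?thesis
      using mle[OF True] au[OF True] by (simp add: d_def R.add_pow_mult R.Units_closed flip: power_add)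
  next
    case False
    then show ?thesis using that by (simp add: d_def S_def)
  qed
  have dt: "d t \<in> Units R" using t au by (simp add: d_def R.Units_closed)
  have tB: "t \<in> B" using t by (simp add: S_def)
  have df: "(\<lambda>s. d s \<otimes>\<^bsub>R'\<^esub> s) \<in> B \<rightarrow> carrier R'" using dc Bc sub_carrier by auto
  define x where "x = (\<Oplus>\<^bsub>R'\<^esub>s\<in>B. d s \<otimes>\<^bsub>R'\<^esub> s)"
  have xc: "x \<in> carrier R'" unfolding x_def by (rule R'.finsum_closed[OF df])
  define pm where "pm = [(p ^ m)] \<cdot>\<^bsub>R\<^esub> \<one>\<^bsub>R\<^esub>"
  have pmc: "pm \<in> carrier R" by (simp add: pm_def)
  have "[(p ^ m)] \<cdot>\<^bsub>R'\<^esub> x = pm \<otimes>\<^bsub>R'\<^esub> x"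
  proof -
    have "\<one>\<^bsub>R\<^esub> \<otimes>\<^bsub>R'\<^esub> x = x" using xc by (simp flip: sub_one)
    then show ?thesis using M.smult_add_pow[of "\<one>\<^bsub>R\<^esub>" x "p ^ m"] xc by (simp add: pm_def add_pow_as_module)
  qed
  also have "\<dots> = (\<Oplus>\<^bsub>R'\<^esub>s\<in>B. pm \<otimes>\<^bsub>R'\<^esub> (d s \<otimes>\<^bsub>R'\<^esub> s))"
    unfolding x_def using df fin sub_carrier[OF pmc] by (intro R'.finsum_rdistr) auto
  also have "\<dots> = (\<Oplus>\<^bsub>R'\<^esub>s\<in>B. c s \<otimes>\<^bsub>R'\<^esub> s)"
  proof (rule R'.finsum_cong')
    fix s assume s: "s \<in> B"
    have "pm \<otimes>\<^bsub>R'\<^esub> (d s \<otimes>\<^bsub>R'\<^esub> s) = (pm \<otimes>\<^bsub>R\<^esub> d s) \<otimes>\<^bsub>R'\<^esub> s"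
      using pmc dc Bc[OF s] sub_carrier by (simp add: R'.m_assoc flip: sub_mult)
    also have "pm \<otimes>\<^bsub>R\<^esub> d s = c s"
      unfolding cd[OF s] pm_def using dc by (simp add: R.add_pow_ldistr)
    finally show "pm \<otimes>\<^bsub>R'\<^esub> (d s \<otimes>\<^bsub>R'\<^esub> s) = c s \<otimes>\<^bsub>R'\<^esub> s" .
  qed (use cc Bc sub_carrier in auto)
  finally have x0: "x = \<zero>\<^bsub>R'\<^esub>"
    using rel R'.torsion_free_pow[OF xc] by simp
  \<comment> \<open>The coefficients that express \<open>t\<close> through the other generators once
    the divided relation is solved for it.\<close>
  define e where "e s = \<ominus>\<^bsub>R\<^esub> (inv\<^bsub>R\<^esub> (d t) \<otimes>\<^bsub>R\<^esub> d s)" for s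
  have ec: "e s \<in> carrier R" for s using dt dc by (simp add: e_def)
  let ?B = "B - {t}"
  have efin: "(\<lambda>s. e s \<otimes>\<^bsub>R'\<^esub> s) \<in> ?B \<rightarrow> carrier R'" using ec Bc sub_carrier by auto
  have t_eq: "t = (\<Oplus>\<^bsub>R'\<^esub>s\<in>?B. e s \<otimes>\<^bsub>R'\<^esub> s)"
  proof -
    define v where "v = \<ominus>\<^bsub>R\<^esub> (inv\<^bsub>R\<^esub> (d t))"
    have vc: "v \<in> carrier R" "v \<in> carrier R'" using dt sub_carrier by (simp_all add: v_def)
    have df': "(\<lambda>s. d s \<otimes>\<^bsub>R'\<^esub> s) \<in> ?B \<rightarrow> carrier R'" using df by auto
    define y where "y = (\<Oplus>\<^bsub>R'\<^esub>s\<in>?B. d s \<otimes>\<^bsub>R'\<^esub> s)"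
    have yc: "y \<in> carrier R'" unfolding y_def by (rule R'.finsum_closed[OF df'])
    have "x = (\<Oplus>\<^bsub>R'\<^esub>s\<in>insert t ?B. d s \<otimes>\<^bsub>R'\<^esub> s)" using tB by (simp add: x_def insert_absorb)
    also have "\<dots> = d t \<otimes>\<^bsub>R'\<^esub> t \<oplus>\<^bsub>R'\<^esub> y"
      unfolding y_def using df' fin dc[of t] Bc[OF tB] sub_carrier by (intro R'.finsum_insert) auto
    finally have "d t \<otimes>\<^bsub>R'\<^esub> t \<oplus>\<^bsub>R'\<^esub> y = \<zero>\<^bsub>R'\<^esub>" using x0 by simp
    then have "v \<otimes>\<^bsub>R'\<^esub> (d t \<otimes>\<^bsub>R'\<^esub> t \<oplus>\<^bsub>R'\<^esub> y) = \<zero>\<^bsub>R'\<^esub>" using vc by simp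
    then have "(v \<otimes>\<^bsub>R'\<^esub> d t) \<otimes>\<^bsub>R'\<^esub> t \<oplus>\<^bsub>R'\<^esub> v \<otimes>\<^bsub>R'\<^esub> y = \<zero>\<^bsub>R'\<^esub>"
      using vc dc[of t] Bc[OF tB] sub_carrier yc by (simp add: R'.r_distr R'.m_assoc)
    moreover have "v \<otimes>\<^bsub>R'\<^esub> d t = \<ominus>\<^bsub>R'\<^esub> \<one>\<^bsub>R'\<^esub>"
    proof -
      have "v \<otimes>\<^bsub>R'\<^esub> d t = \<ominus>\<^bsub>R\<^esub> \<one>\<^bsub>R\<^esub>"
        using dt dc[of t] vc(1) by (simp add: sub_mult) (simp add: v_def R.l_minus R.Units_l_inv)
      \<comment> \<open>The inclusion is known to respect sums, products and one. That the two
        zeros, and hence the negatives, agree has to be derived: the zero of R is idempotent for the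
        addition of R'.\<close>
      moreover have "(\<ominus>\<^bsub>R\<^esub> \<one>\<^bsub>R\<^esub>) \<oplus>\<^bsub>R'\<^esub> \<one>\<^bsub>R'\<^esub> = \<zero>\<^bsub>R'\<^esub>"
      proof -
        have z: "\<zero>\<^bsub>R\<^esub> \<oplus>\<^bsub>R'\<^esub> \<zero>\<^bsub>R\<^esub> = \<zero>\<^bsub>R\<^esub>" by (simp add: sub_add)
        then have "\<zero>\<^bsub>R\<^esub> = \<zero>\<^bsub>R'\<^esub>"
          using sub_carrier[OF R.zero_closed] by (metis R'.add.l_cancel_one' R'.add.l_cancel_one)
        then show ?thesis by (simp add: sub_one sub_add R.l_neg)
      qed
      ultimately show ?thesis
        using R'.minus_equality[of "\<ominus>\<^bsub>R\<^esub> \<one>\<^bsub>R\<^esub>" "\<one>\<^bsub>R'\<^esub>"] sub_carrier by simp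
    qed
    ultimately have "\<ominus>\<^bsub>R'\<^esub> t \<oplus>\<^bsub>R'\<^esub> v \<otimes>\<^bsub>R'\<^esub> y = \<zero>\<^bsub>R'\<^esub>" using Bc[OF tB] by (simp add: R'.l_minus)
    then have "t = v \<otimes>\<^bsub>R'\<^esub> y" using Bc[OF tB] vc yc
      by (metis R'.a_inv_closed R'.m_closed R'.minus_equality R'.minus_minus R'.a_comm)
    also have "\<dots> = (\<Oplus>\<^bsub>R'\<^esub>s\<in>?B. v \<otimes>\<^bsub>R'\<^esub> (d s \<otimes>\<^bsub>R'\<^esub> s))"
      unfolding y_def using df' fin vc by (intro R'.finsum_rdistr) auto
    also have "\<dots> = (\<Oplus>\<^bsub>R'\<^esub>s\<in>?B. e s \<otimes>\<^bsub>R'\<^esub> s)"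
    proof (rule R'.finsum_cong')
      fix s assume s: "s \<in> ?B"
      have "v \<otimes>\<^bsub>R'\<^esub> (d s \<otimes>\<^bsub>R'\<^esub> s) = (v \<otimes>\<^bsub>R\<^esub> d s) \<otimes>\<^bsub>R'\<^esub> s"
        using vc dc[of s] Bc s sub_carrier by (simp add: R'.m_assoc flip: sub_mult)
      also have "v \<otimes>\<^bsub>R\<^esub> d s = e s" using dt dc by (simp add: v_def e_def R.l_minus)
      finally show "v \<otimes>\<^bsub>R'\<^esub> (d s \<otimes>\<^bsub>R'\<^esub> s) = e s \<otimes>\<^bsub>R'\<^esub> s" .
    qed (use efin in auto)
    finally show ?thesis .
  qed
  have "spanning ?B"
    unfolding spanning_def
  proof (intro conjI ballI)
    fix y assume "y \<in> carrier R'"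
    then obtain f where f: "f \<in> B \<rightarrow> carrier R" "y = (\<Oplus>\<^bsub>R'\<^esub>b\<in>B. f b \<otimes>\<^bsub>R'\<^esub> b)" using span by blast
    have fc: "f s \<in> carrier R" if "s \<in> B" for s using f(1) that by auto
    have ff: "(\<lambda>s. f s \<otimes>\<^bsub>R'\<^esub> s) \<in> ?B \<rightarrow> carrier R'" using fc Bc sub_carrier by auto
    have ftc: "f t \<in> carrier R" "f t \<in> carrier R'" using fc[OF tB] sub_carrier by auto
    define g where "g s = f t \<otimes>\<^bsub>R\<^esub> e s \<oplus>\<^bsub>R\<^esub> f s" for s
    have "y = (\<Oplus>\<^bsub>R'\<^esub>b\<in>insert t ?B. f b \<otimes>\<^bsub>R'\<^esub> b)" using tB f(2) by (simp add: insert_absorb)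
    also have "\<dots> = f t \<otimes>\<^bsub>R'\<^esub> t \<oplus>\<^bsub>R'\<^esub> (\<Oplus>\<^bsub>R'\<^esub>b\<in>?B. f b \<otimes>\<^bsub>R'\<^esub> b)"
      using ff fin ftc Bc[OF tB] by (intro R'.finsum_insert) auto
    also have "f t \<otimes>\<^bsub>R'\<^esub> t = (\<Oplus>\<^bsub>R'\<^esub>s\<in>?B. f t \<otimes>\<^bsub>R'\<^esub> (e s \<otimes>\<^bsub>R'\<^esub> s))"
      using fin ftc efin by (subst t_eq, intro R'.finsum_rdistr) auto
    also have "\<dots> \<oplus>\<^bsub>R'\<^esub> (\<Oplus>\<^bsub>R'\<^esub>b\<in>?B. f b \<otimes>\<^bsub>R'\<^esub> b) = (\<Oplus>\<^bsub>R'\<^esub>s\<in>?B. f t \<otimes>\<^bsub>R'\<^esub> (e s \<otimes>\<^bsub>R'\<^esub> s) \<oplus>\<^bsub>R'\<^esub> f s \<otimes>\<^bsub>R'\<^esub> s)"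
      using ff efin ftc by (intro R'.finsum_addf[symmetric]) auto
    also have "\<dots> = (\<Oplus>\<^bsub>R'\<^esub>s\<in>?B. g s \<otimes>\<^bsub>R'\<^esub> s)"
    proof (rule R'.finsum_cong')
      fix s assume s: "s \<in> ?B"
      then have c: "e s \<in> carrier R" "f s \<in> carrier R" "s \<in> carrier R'" using ec fc Bc by auto
      then have "g s = f t \<otimes>\<^bsub>R'\<^esub> e s \<oplus>\<^bsub>R'\<^esub> f s" using ftc(1) by (simp add: g_def sub_add sub_mult)
      then show "f t \<otimes>\<^bsub>R'\<^esub> (e s \<otimes>\<^bsub>R'\<^esub> s) \<oplus>\<^bsub>R'\<^esub> f s \<otimes>\<^bsub>R'\<^esub> s = g s \<otimes>\<^bsub>R'\<^esub> s"
        using ftc(2) c(3) sub_carrier[OF c(1)] sub_carrier[OF c(2)] by (simp add: R'.m_assoc R'.l_distr)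
    qed (use ftc ec fc Bc sub_carrier in \<open>auto simp: g_def\<close>)
    finally have "y = (\<Oplus>\<^bsub>R'\<^esub>s\<in>?B. g s \<otimes>\<^bsub>R'\<^esub> s)" .
    moreover have "g \<in> ?B \<rightarrow> carrier R" using ftc ec fc by (auto simp: g_def)
    ultimately show "\<exists>c\<in>?B \<rightarrow> carrier R. y = (\<Oplus>\<^bsub>R'\<^esub>b\<in>?B. c b \<otimes>\<^bsub>R'\<^esub> b)" by blast
  qed (use fin Bc in auto)
  then have "card B \<le> card ?B" by (rule minimal)
  then show False using fin tB by (metis card_Diff1_less not_le)
qed

text \<open>A spanning set of least size is independent, so coefficients are unique; uniqueness
  makes the chosen coefficient functions additive and linear over R.\<close>

lemma dual_basis_exists: "\<exists>B coord. finite_dual_basis R R' B coord"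
proof -
  obtain B where B: "spanning B" and minimal: "\<And>B'. spanning B' \<Longrightarrow> card B \<le> card B'"
    using ex_has_least_nat[of spanning _ card] spanning_exists by metis
  have fin: "finite B" and Bc: "B \<subseteq> carrier R'"
    and span: "\<And>x. x \<in> carrier R' \<Longrightarrow> \<exists>c\<in>B \<rightarrow> carrier R. x = (\<Oplus>\<^bsub>R'\<^esub>b\<in>B. c b \<otimes>\<^bsub>R'\<^esub> b)"
    using B unfolding spanning_def by auto
  have Bc': "b \<in> carrier R'" if "b \<in> B" for b using that Bc by blast
  have mult_in: "(\<lambda>b. c b \<otimes>\<^bsub>R'\<^esub> b) \<in> B \<rightarrow> carrier R'" if "c \<in> B \<rightarrow> carrier R" for c
    using that Bc' sub_carrier by (auto simp: Pi_def)
  have unique: "c b = d b" if c: "c \<in> B \<rightarrow> carrier R" and d: "d \<in> B \<rightarrow> carrier R" and b: "b \<in> B"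
    and eq: "(\<Oplus>\<^bsub>R'\<^esub>b\<in>B. c b \<otimes>\<^bsub>R'\<^esub> b) = (\<Oplus>\<^bsub>R'\<^esub>b\<in>B. d b \<otimes>\<^bsub>R'\<^esub> b)" for c d b
  proof -
    have cc: "c s \<in> carrier R" "d s \<in> carrier R" if "s \<in> B" for s using c d that by auto
    define f where "f s = c s \<ominus>\<^bsub>R\<^esub> d s" for s
    have fB: "f \<in> B \<rightarrow> carrier R" using cc by (auto simp: f_def)
    have "(\<Oplus>\<^bsub>R'\<^esub>b\<in>B. f b \<otimes>\<^bsub>R'\<^esub> b) \<oplus>\<^bsub>R'\<^esub> (\<Oplus>\<^bsub>R'\<^esub>b\<in>B. d b \<otimes>\<^bsub>R'\<^esub> b) = (\<Oplus>\<^bsub>R'\<^esub>b\<in>B. f b \<otimes>\<^bsub>R'\<^esub> b \<oplus>\<^bsub>R'\<^esub> d b \<otimes>\<^bsub>R'\<^esub> b)"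
      by (rule R'.finsum_addf[symmetric, OF mult_in[OF fB] mult_in[OF d]])
    also have "\<dots> = (\<Oplus>\<^bsub>R'\<^esub>b\<in>B. c b \<otimes>\<^bsub>R'\<^esub> b)"
    proof (rule R'.finsum_cong')
      fix s assume s: "s \<in> B"
      have "f s \<otimes>\<^bsub>R'\<^esub> s \<oplus>\<^bsub>R'\<^esub> d s \<otimes>\<^bsub>R'\<^esub> s = (f s \<oplus>\<^bsub>R\<^esub> d s) \<otimes>\<^bsub>R'\<^esub> s"
        using fB cc[OF s] Bc'[OF s] s sub_carrier by (simp add: R'.l_distr f_def flip: sub_add)
      also have "f s \<oplus>\<^bsub>R\<^esub> d s = c s" using cc[OF s] by (simp add: f_def R.minus_eq R.a_assoc R.l_neg)
      finally show "f s \<otimes>\<^bsub>R'\<^esub> s \<oplus>\<^bsub>R'\<^esub> d s \<otimes>\<^bsub>R'\<^esub> s = c s \<otimes>\<^bsub>R'\<^esub> s" .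
    qed (use mult_in[OF c] in auto)
    finally have "(\<Oplus>\<^bsub>R'\<^esub>b\<in>B. f b \<otimes>\<^bsub>R'\<^esub> b) = \<zero>\<^bsub>R'\<^esub>"
      unfolding eq R'.add.r_cancel_one[OF R'.finsum_closed[OF mult_in[OF d]] R'.finsum_closed[OF mult_in[OF fB]]] .
    then have "f b = \<zero>\<^bsub>R\<^esub>" using minimal_spanning_independent[OF B minimal fB] b by blast
    then show ?thesis using cc[OF b] by (simp add: f_def R.r_right_minus_eq)
  qed
  define co where "co x = (SOME c. c \<in> B \<rightarrow> carrier R \<and> x = (\<Oplus>\<^bsub>R'\<^esub>b\<in>B. c b \<otimes>\<^bsub>R'\<^esub> b))" for x
  have "co x \<in> B \<rightarrow> carrier R \<and> x = (\<Oplus>\<^bsub>R'\<^esub>b\<in>B. co x b \<otimes>\<^bsub>R'\<^esub> b)" if "x \<in> carrier R'" for x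
    using someI_ex[OF span[OF that, unfolded Bex_def]] unfolding co_def .
  then have co: "co x \<in> B \<rightarrow> carrier R" "x = (\<Oplus>\<^bsub>R'\<^esub>b\<in>B. co x b \<otimes>\<^bsub>R'\<^esub> b)" if "x \<in> carrier R'" for x
    using that by blast+
  have coc: "co x b \<in> carrier R" if "x \<in> carrier R'" "b \<in> B" for x b using co(1)[OF that(1)] that(2) by auto
  have "finite_dual_basis R R' B (\<lambda>b x. co x b)"
  proof (intro finite_dual_basis.intro finite_dual_basis_axioms.intro subring_extension_axioms)
    fix b x y assume b: "b \<in> B" and x: "x \<in> carrier R'" and y: "y \<in> carrier R'"
    have s: "(\<lambda>b. co x b \<oplus>\<^bsub>R\<^esub> co y b) \<in> B \<rightarrow> carrier R" using coc x y by auto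
    have "x \<oplus>\<^bsub>R'\<^esub> y = (\<Oplus>\<^bsub>R'\<^esub>b\<in>B. co x b \<otimes>\<^bsub>R'\<^esub> b) \<oplus>\<^bsub>R'\<^esub> (\<Oplus>\<^bsub>R'\<^esub>b\<in>B. co y b \<otimes>\<^bsub>R'\<^esub> b)"
      using co(2)[OF x] co(2)[OF y] by simp
    also have "\<dots> = (\<Oplus>\<^bsub>R'\<^esub>b\<in>B. co x b \<otimes>\<^bsub>R'\<^esub> b \<oplus>\<^bsub>R'\<^esub> co y b \<otimes>\<^bsub>R'\<^esub> b)"
      by (rule R'.finsum_addf[symmetric, OF mult_in[OF co(1)[OF x]] mult_in[OF co(1)[OF y]]])
    also have "\<dots> = (\<Oplus>\<^bsub>R'\<^esub>b\<in>B. (co x b \<oplus>\<^bsub>R\<^esub> co y b) \<otimes>\<^bsub>R'\<^esub> b)"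
    proof (rule R'.finsum_cong')
      fix s assume "s \<in> B"
      then show "co x s \<otimes>\<^bsub>R'\<^esub> s \<oplus>\<^bsub>R'\<^esub> co y s \<otimes>\<^bsub>R'\<^esub> s = (co x s \<oplus>\<^bsub>R\<^esub> co y s) \<otimes>\<^bsub>R'\<^esub> s"
        using coc[OF x] coc[OF y] Bc' sub_carrier by (simp add: R'.l_distr flip: sub_add)
    qed (use mult_in[OF s] in auto)
    finally have "(\<Oplus>\<^bsub>R'\<^esub>b\<in>B. co (x \<oplus>\<^bsub>R'\<^esub> y) b \<otimes>\<^bsub>R'\<^esub> b) = (\<Oplus>\<^bsub>R'\<^esub>b\<in>B. (co x b \<oplus>\<^bsub>R\<^esub> co y b) \<otimes>\<^bsub>R'\<^esub> b)"
      by (rule trans[OF co(2)[OF R'.a_closed[OF x y], symmetric]])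
    then show "co (x \<oplus>\<^bsub>R'\<^esub> y) b = co x b \<oplus>\<^bsub>R\<^esub> co y b"
      using unique[OF co(1) s b] x y by simp
  next
    fix b x r assume b: "b \<in> B" and x: "x \<in> carrier R'" and r: "r \<in> carrier R"
    have r': "r \<in> carrier R'" using r by (rule sub_carrier)
    have s: "(\<lambda>b. co x b \<otimes>\<^bsub>R\<^esub> r) \<in> B \<rightarrow> carrier R" using coc x r by auto
    have "x \<otimes>\<^bsub>R'\<^esub> r = (\<Oplus>\<^bsub>R'\<^esub>b\<in>B. co x b \<otimes>\<^bsub>R'\<^esub> b) \<otimes>\<^bsub>R'\<^esub> r" using co(2)[OF x] by simp
    also have "\<dots> = (\<Oplus>\<^bsub>R'\<^esub>b\<in>B. (co x b \<otimes>\<^bsub>R'\<^esub> b) \<otimes>\<^bsub>R'\<^esub> r)"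
      by (rule R'.finsum_ldistr[OF fin r' mult_in[OF co(1)[OF x]]])
    also have "\<dots> = (\<Oplus>\<^bsub>R'\<^esub>b\<in>B. (co x b \<otimes>\<^bsub>R\<^esub> r) \<otimes>\<^bsub>R'\<^esub> b)"
    proof (rule R'.finsum_cong')
      fix s assume "s \<in> B"
      then have sc: "co x s \<in> carrier R" "s \<in> carrier R'" "co x s \<in> carrier R'" using coc[OF x] Bc' sub_carrier by auto
      then have "(co x s \<otimes>\<^bsub>R\<^esub> r) \<otimes>\<^bsub>R'\<^esub> s = co x s \<otimes>\<^bsub>R'\<^esub> r \<otimes>\<^bsub>R'\<^esub> s" using r by (simp add: sub_mult)
      then show "(co x s \<otimes>\<^bsub>R'\<^esub> s) \<otimes>\<^bsub>R'\<^esub> r = (co x s \<otimes>\<^bsub>R\<^esub> r) \<otimes>\<^bsub>R'\<^esub> s"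
        using sc r' by (simp add: R'.m_ac)
    qed (use mult_in[OF s] in auto)
    finally have "(\<Oplus>\<^bsub>R'\<^esub>b\<in>B. co (x \<otimes>\<^bsub>R'\<^esub> r) b \<otimes>\<^bsub>R'\<^esub> b) = (\<Oplus>\<^bsub>R'\<^esub>b\<in>B. (co x b \<otimes>\<^bsub>R\<^esub> r) \<otimes>\<^bsub>R'\<^esub> b)"
      by (rule trans[OF co(2)[OF R'.m_closed[OF x r'], symmetric]])
    then show "co (x \<otimes>\<^bsub>R'\<^esub> r) b = co x b \<otimes>\<^bsub>R\<^esub> r"
      using unique[OF co(1) s b] x r' by simp
  qed (use fin Bc coc co(2) in auto)
  then show ?thesis by blast
qed

end

lemma (in abelian_group) minus_zero_imp_eq:
  assumes "x \<in> carrier G" "y \<in> carrier G" "x \<ominus> y = \<zero>"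
  shows "x = y"
  using minus_equality[of x "\<ominus> y"] assms by (simp add: minus_eq)

section \<open>Tensor products\<close>

locale scalar_extension = subring_extension R R' + M: module R M
  for R R' :: "'r ring" and M :: "('r, 'm) module"
begin

abbreviation "null \<equiv> tensor_null R R' M"
abbreviation "cl \<equiv> tensor_class R R' M"
abbreviation "pairs \<equiv> carrier R' \<times> carrier M"

text \<open>The carrier of \<open>tensor_free\<close>, in a form that the simplifier can use: the
  support has to lie in the two carriers, which may be smaller than their types.\<close>

definition formal :: "('r \<times> 'm \<Rightarrow>\<^sub>0 int) set" where
  "formal = {u. Poly_Mapping.keys u \<subseteq> pairs}"

lemma formal_iff: "u \<in> formal \<longleftrightarrow> Poly_Mapping.keys u \<subseteq> pairs"
  by (simp add: formal_def)

definition pure :: "'r \<Rightarrow> 'm \<Rightarrow> ('r \<times> 'm \<Rightarrow>\<^sub>0 int) set" where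
  "pure x m = cl (frag_of (x, m))"

lemma formal_0: "0 \<in> formal" and formal_add: "u \<in> formal \<Longrightarrow> v \<in> formal \<Longrightarrow> u + v \<in> formal"
  and formal_minus: "u \<in> formal \<Longrightarrow> v \<in> formal \<Longrightarrow> u - v \<in> formal"
  and formal_uminus: "u \<in> formal \<Longrightarrow> - u \<in> formal"
  and formal_of: "x \<in> carrier R' \<Longrightarrow> m \<in> carrier M \<Longrightarrow> frag_of (x, m) \<in> formal"
  using keys_add[of u v] keys_diff[of u v] by (auto simp: formal_iff)

lemma relations_formal: "tensor_relations R R' M \<subseteq> formal"
  unfolding tensor_relations_def
  by (auto simp: sub_carrier intro!: formal_minus formal_of)

lemma null_0: "0 \<in> null"
  using generate.one[of "tensor_free R' M"] by (simp add: tensor_null_def tensor_free_def)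

lemma null_add: "u \<in> null \<Longrightarrow> v \<in> null \<Longrightarrow> u + v \<in> null"
  using generate.eng[of u "tensor_free R' M"] by (simp add: tensor_null_def tensor_free_def)

lemma null_relation: "u \<in> tensor_relations R R' M \<Longrightarrow> u \<in> null"
  unfolding tensor_null_def by (rule generate.incl)

lemma null_rel_left: "x \<in> carrier R' \<Longrightarrow> y \<in> carrier R' \<Longrightarrow> m \<in> carrier M \<Longrightarrow>
    frag_of (x \<oplus>\<^bsub>R'\<^esub> y, m) - frag_of (x, m) - frag_of (y, m) \<in> null"
  by (rule null_relation) (unfold tensor_relations_def, blast)

lemma null_rel_right: "x \<in> carrier R' \<Longrightarrow> m \<in> carrier M \<Longrightarrow> n \<in> carrier M \<Longrightarrow>
    frag_of (x, m \<oplus>\<^bsub>M\<^esub> n) - frag_of (x, m) - frag_of (x, n) \<in> null"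
  by (rule null_relation) (unfold tensor_relations_def, blast)

lemma null_rel_balanced: "x \<in> carrier R' \<Longrightarrow> r \<in> carrier R \<Longrightarrow> m \<in> carrier M \<Longrightarrow>
    frag_of (x \<otimes>\<^bsub>R'\<^esub> r, m) - frag_of (x, r \<odot>\<^bsub>M\<^esub> m) \<in> null"
  by (rule null_relation) (unfold tensor_relations_def, blast)

text \<open>The induction over \<open>generate\<close> in additive form. The group inverse equals
  unary minus only for formal sums supported in the carriers, which the relations are.\<close>

lemma null_induct [consumes 1, case_names zero relation add uminus]:
  assumes "u \<in> null" "P 0" "\<And>u. u \<in> tensor_relations R R' M \<Longrightarrow> P u"
    "\<And>u v. P u \<Longrightarrow> P v \<Longrightarrow> P (u + v)" "\<And>u. P u \<Longrightarrow> P (- u)"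
  shows "P u"
proof -
  have "u \<in> generate (tensor_free R' M) (tensor_relations R R' M)" using assms(1) by (simp add: tensor_null_def)
  then show ?thesis
  proof induction
    case (inv h)
    then have "Poly_Mapping.keys h \<subseteq> pairs" using relations_formal formal_iff by blast
    then show ?case using assms(3,5) inv by (simp add: tensor_free_def)
  qed (use assms in \<open>auto simp: tensor_free_def\<close>)
qed

lemma null_formal: "null \<subseteq> formal"
proof
  fix u assume "u \<in> null"
  then show "u \<in> formal"
    by (induction rule: null_induct)
      (use relations_formal formal_0 formal_add formal_uminus in blast)+
qed

lemma null_uminus:
  assumes "u \<in> null"
  shows "- u \<in> null"
proof -
  from assms have "u \<in> null \<and> - u \<in> null"
  proof (induction rule: null_induct)
    case (relation u)
    then have "Poly_Mapping.keys u \<subseteq> pairs" using relations_formal formal_iff by blast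
    then show ?case
      using generate.inv[OF relation, of "tensor_free R' M"] null_relation[OF relation]
      by (simp add: tensor_null_def tensor_free_def)
  next
    case (add u v)
    then show ?case using null_add[of "- u" "- v"] null_add by simp
  qed (auto simp: null_0)
  then show ?thesis ..
qed

lemma null_minus: "u \<in> null \<Longrightarrow> v \<in> null \<Longrightarrow> u - v \<in> null"
  using null_add[OF _ null_uminus] by force

lemma cl_def': "cl u = {n + u | n. n \<in> null}"
  by (auto simp: tensor_class_def r_coset_def tensor_free_def)

lemma cl_self: "u \<in> cl u"
  unfolding cl_def' using null_0 by force

lemma cl_memE: "v \<in> cl u \<Longrightarrow> v - u \<in> null"
  unfolding cl_def' by auto

lemma cl_eqI:
  assumes "u - v \<in> null"
  shows "cl u = cl v"
proof -
  have "cl u \<subseteq> cl v"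
  proof
    fix w assume "w \<in> cl u"
    then obtain n where "n \<in> null" "w = n + u" unfolding cl_def' by blast
    then have "w = (n + (u - v)) + v" "n + (u - v) \<in> null" using null_add[OF _ assms] by auto
    then show "w \<in> cl v" unfolding cl_def' by blast
  qed
  moreover have "cl v \<subseteq> cl u"
  proof
    fix w assume "w \<in> cl v"
    then obtain n where "n \<in> null" "w = n + v" unfolding cl_def' by blast
    then have "w = (n - (u - v)) + u" "n - (u - v) \<in> null" using null_minus[OF _ assms] by auto
    then show "w \<in> cl u" unfolding cl_def' by blast
  qed
  ultimately show ?thesis by (rule equalityI)
qed

lemma cl_formal: "u \<in> formal \<Longrightarrow> v \<in> cl u \<Longrightarrow> v \<in> formal"
  unfolding cl_def' using null_formal formal_add by blast

lemma cl_zero: "cl 0 = null"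
  by (simp add: cl_def')

lemma carrier_tensor_group: "carrier (tensor_group R R' M) = cl ` formal"
  by (auto simp: tensor_group_def FactGroup_def RCOSETS_def tensor_class_def tensor_free_def formal_iff)

lemma one_tensor_group: "one (tensor_group R R' M) = cl 0"
  by (simp add: tensor_group_def cl_zero)

lemma mult_tensor_group: "monoid.mult (tensor_group R R' M) (cl u) (cl v) = cl (u + v)"
proof -
  have "(\<Union>h\<in>cl u. \<Union>k\<in>cl v. {h + k}) = cl (u + v)"
  proof (intro equalityI subsetI)
    fix w assume "w \<in> (\<Union>h\<in>cl u. \<Union>k\<in>cl v. {h + k})"
    then obtain n k where nk: "n \<in> null" "k \<in> null" "w = (n + u) + (k + v)" unfolding cl_def' by blast
    then have "w = (n + k) + (u + v)" by (simp add: algebra_simps)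
    then show "w \<in> cl (u + v)" unfolding cl_def' using null_add[OF nk(1,2)] by blast
  next
    fix w assume "w \<in> cl (u + v)"
    then obtain n where n: "n \<in> null" "w = n + (u + v)" unfolding cl_def' by blast
    then have "w = (n + u) + v" "n + u \<in> cl u" by (auto simp: cl_def' algebra_simps)
    then show "w \<in> (\<Union>h\<in>cl u. \<Union>k\<in>cl v. {h + k})" using cl_self[of v] by blast
  qed
  then show ?thesis by (simp add: tensor_group_def set_mult_def tensor_free_def)
qed

lemma pure_in: "x \<in> carrier R' \<Longrightarrow> m \<in> carrier M \<Longrightarrow> pure x m \<in> cl ` formal"
  unfolding pure_def by (rule imageI) (rule formal_of)

lemma formal_induct [consumes 1, case_names zero of minus]:
  assumes "u \<in> formal" "P 0" "\<And>x m. x \<in> carrier R' \<Longrightarrow> m \<in> carrier M \<Longrightarrow> P (frag_of (x, m))"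
    "\<And>u v. u \<in> formal \<Longrightarrow> v \<in> formal \<Longrightarrow> P u \<Longrightarrow> P v \<Longrightarrow> P (u - v)"
  shows "P u"
  using assms by (intro free_Abelian_group_induct[of u pairs P]) (auto simp: formal_iff)

lemma pure_add_left:
  assumes "x \<in> carrier R'" "y \<in> carrier R'" "m \<in> carrier M"
  shows "cl (frag_of (x \<oplus>\<^bsub>R'\<^esub> y, m)) = cl (frag_of (x, m) + frag_of (y, m))"
  using assms null_rel_left by (intro cl_eqI) (simp add: diff_diff_eq)

lemma pure_add_right:
  assumes "x \<in> carrier R'" "m \<in> carrier M" "n \<in> carrier M"
  shows "cl (frag_of (x, m \<oplus>\<^bsub>M\<^esub> n)) = cl (frag_of (x, m) + frag_of (x, n))"
  using assms null_rel_right by (intro cl_eqI) (simp add: diff_diff_eq)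

lemma pure_balanced:
  assumes "x \<in> carrier R'" "r \<in> carrier R" "m \<in> carrier M"
  shows "pure (x \<otimes>\<^bsub>R'\<^esub> r) m = pure x (r \<odot>\<^bsub>M\<^esub> m)"
  unfolding pure_def using assms by (intro cl_eqI null_rel_balanced)

end

text \<open>A common view of the additive groups of \<^const>\<open>base_change_algebra\<close> and
  \<^const>\<open>base_change_module\<close>.\<close>

locale tensor_carrier = scalar_extension R R' M for R R' :: "'r ring" and M :: "('r, 'm) module" +
  fixes T :: "('c, ('r \<times> 'm \<Rightarrow>\<^sub>0 int) set, 't) module_scheme"
  assumes carrier_T: "carrier T = carrier (tensor_group R R' M)"
    and zero_T: "\<zero>\<^bsub>T\<^esub> = one (tensor_group R R' M)"
    and add_T: "add T = monoid.mult (tensor_group R R' M)"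
begin

lemma carrier_eq: "carrier T = cl ` formal"
  and zero_eq: "\<zero>\<^bsub>T\<^esub> = cl 0"
  and add_cl: "cl u \<oplus>\<^bsub>T\<^esub> cl v = cl (u + v)"
  by (simp_all add: carrier_T zero_T add_T carrier_tensor_group one_tensor_group mult_tensor_group)

lemma cl_in: "u \<in> formal \<Longrightarrow> cl u \<in> carrier T"
  by (simp only: carrier_eq imageI)

lemma abelian_group_T: "abelian_group T"
proof (rule abelian_groupI)
  fix U V W
  assume "U \<in> carrier T" "V \<in> carrier T" "W \<in> carrier T"
  then obtain u v w where u: "u \<in> formal" "U = cl u" and v: "v \<in> formal" "V = cl v" and w: "w \<in> formal" "W = cl w"
    unfolding carrier_eq by (elim imageE)
  show "U \<oplus>\<^bsub>T\<^esub> V \<in> carrier T" unfolding u v add_cl by (intro cl_in formal_add u v)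
  show "U \<oplus>\<^bsub>T\<^esub> V \<oplus>\<^bsub>T\<^esub> W = U \<oplus>\<^bsub>T\<^esub> (V \<oplus>\<^bsub>T\<^esub> W)" unfolding u v w add_cl by (simp add: add.assoc)
  show "U \<oplus>\<^bsub>T\<^esub> V = V \<oplus>\<^bsub>T\<^esub> U" unfolding u v add_cl by (simp add: add.commute)
  show "\<zero>\<^bsub>T\<^esub> \<oplus>\<^bsub>T\<^esub> U = U" unfolding u zero_eq add_cl by simp
  have "cl (- u) \<oplus>\<^bsub>T\<^esub> U = \<zero>\<^bsub>T\<^esub>" unfolding u zero_eq add_cl by simp
  then show "\<exists>V\<in>carrier T. V \<oplus>\<^bsub>T\<^esub> U = \<zero>\<^bsub>T\<^esub>" using cl_in[OF formal_uminus[OF u(1)]] by blast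
next
  show "\<zero>\<^bsub>T\<^esub> \<in> carrier T" unfolding zero_eq by (rule cl_in[OF formal_0])
qed

sublocale T: abelian_group T by (rule abelian_group_T)

lemma uminus_cl: "u \<in> formal \<Longrightarrow> \<ominus>\<^bsub>T\<^esub> (cl u) = cl (- u)"
  by (rule T.minus_equality) (auto simp only: add_cl zero_eq cl_in formal_uminus add.left_inverse)

lemma minus_cl: "u \<in> formal \<Longrightarrow> v \<in> formal \<Longrightarrow> cl u \<ominus>\<^bsub>T\<^esub> cl v = cl (u - v)"
  by (simp only: T.minus_eq uminus_cl add_cl diff_conv_add_uminus)

lemma pure_closed: "x \<in> carrier R' \<Longrightarrow> m \<in> carrier M \<Longrightarrow> pure x m \<in> carrier T"
  using pure_in by (simp only: carrier_eq)

lemma pure_add_left: "x \<in> carrier R' \<Longrightarrow> y \<in> carrier R' \<Longrightarrow> m \<in> carrier M \<Longrightarrow>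
    pure (x \<oplus>\<^bsub>R'\<^esub> y) m = pure x m \<oplus>\<^bsub>T\<^esub> pure y m"
  by (simp only: pure_def pure_add_left add_cl)

lemma pure_add_right: "x \<in> carrier R' \<Longrightarrow> m \<in> carrier M \<Longrightarrow> n \<in> carrier M \<Longrightarrow>
    pure x (m \<oplus>\<^bsub>M\<^esub> n) = pure x m \<oplus>\<^bsub>T\<^esub> pure x n"
  by (simp only: pure_def pure_add_right add_cl)

text \<open>A single step for differences covers sums and negatives; zero arises as the difference
  of a pure tensor with itself.\<close>

lemma tensor_induct [consumes 1, case_names pure minus]:
  assumes "U \<in> carrier T" and pure: "\<And>x m. x \<in> carrier R' \<Longrightarrow> m \<in> carrier M \<Longrightarrow> P (pure x m)"
    and minus: "\<And>U V. U \<in> carrier T \<Longrightarrow> V \<in> carrier T \<Longrightarrow> P U \<Longrightarrow> P V \<Longrightarrow> P (U \<ominus>\<^bsub>T\<^esub> V)"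
  shows "P U"
proof -
  obtain u where u: "u \<in> formal" "U = cl u" using assms(1) unfolding carrier_eq by (elim imageE)
  have "P (cl u)" using u(1)
  proof (induction rule: formal_induct)
    case zero
    have p: "pure \<zero>\<^bsub>R'\<^esub> \<zero>\<^bsub>M\<^esub> \<in> carrier T" "P (pure \<zero>\<^bsub>R'\<^esub> \<zero>\<^bsub>M\<^esub>)"
      by (auto intro: pure pure_closed)
    have "P (pure \<zero>\<^bsub>R'\<^esub> \<zero>\<^bsub>M\<^esub> \<ominus>\<^bsub>T\<^esub> pure \<zero>\<^bsub>R'\<^esub> \<zero>\<^bsub>M\<^esub>)" by (intro minus p)
    moreover have "pure \<zero>\<^bsub>R'\<^esub> \<zero>\<^bsub>M\<^esub> \<ominus>\<^bsub>T\<^esub> pure \<zero>\<^bsub>R'\<^esub> \<zero>\<^bsub>M\<^esub> = \<zero>\<^bsub>T\<^esub>"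
      using p(1) by (simp add: T.minus_eq T.r_neg)
    ultimately show ?case by (simp add: zero_eq)
  next
    case (of x m)
    then show ?case using pure unfolding pure_def by blast
  next
    case (minus u v)
    then show ?case using assms(3)[OF cl_in cl_in] minus_cl by metis
  qed
  then show ?thesis using u by simp
qed

text \<open>The existence half of the universal property for balanced biadditive maps. The extension
  \<open>h\<close> to the free group kills the three kinds of relations and therefore descends to
  classes.\<close>

lemma tensor_universal:
  assumes G: "abelian_group G"
    and closed: "\<And>x m. x \<in> carrier R' \<Longrightarrow> m \<in> carrier M \<Longrightarrow> f x m \<in> carrier G"
    and add_left: "\<And>x y m. x \<in> carrier R' \<Longrightarrow> y \<in> carrier R' \<Longrightarrow> m \<in> carrier M \<Longrightarrow>
      f (x \<oplus>\<^bsub>R'\<^esub> y) m = f x m \<oplus>\<^bsub>G\<^esub> f y m"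
    and add_right: "\<And>x m n. x \<in> carrier R' \<Longrightarrow> m \<in> carrier M \<Longrightarrow> n \<in> carrier M \<Longrightarrow>
      f x (m \<oplus>\<^bsub>M\<^esub> n) = f x m \<oplus>\<^bsub>G\<^esub> f x n"
    and balanced: "\<And>x r m. x \<in> carrier R' \<Longrightarrow> r \<in> carrier R \<Longrightarrow> m \<in> carrier M \<Longrightarrow>
      f (x \<otimes>\<^bsub>R'\<^esub> r) m = f x (r \<odot>\<^bsub>M\<^esub> m)"
  shows "\<exists>g. g \<in> carrier T \<rightarrow> carrier G \<and>
    (\<forall>U\<in>carrier T. \<forall>V\<in>carrier T. g (U \<oplus>\<^bsub>T\<^esub> V) = g U \<oplus>\<^bsub>G\<^esub> g V) \<and>
    (\<forall>x\<in>carrier R'. \<forall>m\<in>carrier M. g (pure x m) = f x m)"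
proof -
  interpret G: abelian_group G by (rule G)
  have "(\<lambda>(x, m). f x m) ` pairs \<subseteq> carrier (add_monoid G)" using closed by auto
  then obtain h where h: "h \<in> hom (free_Abelian_group pairs) (add_monoid G)"
    "\<And>z. z \<in> pairs \<Longrightarrow> h (frag_of z) = (\<lambda>(x, m). f x m) z"
    using comm_group.free_Abelian_group_universal[OF G.a_comm_group] by metis
  have hc: "h u \<in> carrier G" if "u \<in> formal" for u
    using h(1) that by (auto simp: hom_def formal_iff)
  have hadd: "h (u + v) = h u \<oplus>\<^bsub>G\<^esub> h v" if "u \<in> formal" "v \<in> formal" for u v
    using h(1) that by (auto simp: hom_def formal_iff)
  have hof: "h (frag_of (x, m)) = f x m" if "x \<in> carrier R'" "m \<in> carrier M" for x m
    using h(2)[of "(x, m)"] that by simp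
  have h0: "h 0 = \<zero>\<^bsub>G\<^esub>"
    using hadd[OF formal_0 formal_0] hc[OF formal_0] by (metis G.add.l_cancel_one' add_0)
  have hneg: "h (- u) = \<ominus>\<^bsub>G\<^esub> (h u)" if u: "u \<in> formal" for u
    using hadd[OF formal_uminus[OF u] u] hc[OF u] hc[OF formal_uminus[OF u]] h0
    by (intro G.minus_equality[symmetric]) auto
  have hminus: "h (u - v) = h u \<ominus>\<^bsub>G\<^esub> h v" if "u \<in> formal" "v \<in> formal" for u v
    using hadd[OF that(1) formal_uminus[OF that(2)]] hneg[OF that(2)] by (simp add: G.minus_eq)
  have "h u = \<zero>\<^bsub>G\<^esub> \<and> u \<in> formal" if "u \<in> null" for u
    using that
  proof (induction rule: null_induct)
    case zero
    then show ?case using h0 formal_0 by simp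
  next
    case (relation u)
    then have u: "u \<in> formal" using relations_formal by blast
    have cancel: "a \<oplus>\<^bsub>G\<^esub> b \<ominus>\<^bsub>G\<^esub> a \<ominus>\<^bsub>G\<^esub> b = \<zero>\<^bsub>G\<^esub>" if "a \<in> carrier G" "b \<in> carrier G" for a b
    proof -
      have "a \<oplus>\<^bsub>G\<^esub> b \<ominus>\<^bsub>G\<^esub> a \<ominus>\<^bsub>G\<^esub> b = (a \<oplus>\<^bsub>G\<^esub> b) \<ominus>\<^bsub>G\<^esub> (a \<oplus>\<^bsub>G\<^esub> b)"
        using that by (simp add: G.minus_eq G.minus_add G.a_assoc)
      then show ?thesis using that by (simp add: G.r_neg G.minus_eq)
    qed
    from \<open>u \<in> tensor_relations R R' M\<close> consider
      (1) x y m where "u = frag_of (x \<oplus>\<^bsub>R'\<^esub> y, m) - frag_of (x, m) - frag_of (y, m)"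
        "x \<in> carrier R'" "y \<in> carrier R'" "m \<in> carrier M"
      | (2) x m n where "u = frag_of (x, m \<oplus>\<^bsub>M\<^esub> n) - frag_of (x, m) - frag_of (x, n)"
        "x \<in> carrier R'" "m \<in> carrier M" "n \<in> carrier M"
      | (3) x r m where "u = frag_of (x \<otimes>\<^bsub>R'\<^esub> r, m) - frag_of (x, r \<odot>\<^bsub>M\<^esub> m)"
        "x \<in> carrier R'" "r \<in> carrier R" "m \<in> carrier M"
      unfolding tensor_relations_def by blast
    then have "h u = \<zero>\<^bsub>G\<^esub>"
    proof cases
      case 1
      have "h u = f (x \<oplus>\<^bsub>R'\<^esub> y) m \<ominus>\<^bsub>G\<^esub> f x m \<ominus>\<^bsub>G\<^esub> f y m"
        unfolding 1(1) using 1(2-4) by (simp only: hminus formal_minus formal_of hof R'.a_closed)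
      then show ?thesis
        using 1 closed by (simp add: add_left cancel)
    next
      case 2
      have "h u = f x (m \<oplus>\<^bsub>M\<^esub> n) \<ominus>\<^bsub>G\<^esub> f x m \<ominus>\<^bsub>G\<^esub> f x n"
        unfolding 2(1) using 2(2-4) by (simp only: hminus formal_minus formal_of hof M.M.a_closed)
      then show ?thesis
        using 2 closed by (simp add: add_right cancel)
    next
      case 3
      have "h u = f (x \<otimes>\<^bsub>R'\<^esub> r) m \<ominus>\<^bsub>G\<^esub> f x (r \<odot>\<^bsub>M\<^esub> m)"
        unfolding 3(1) using 3(2-4) by (simp only: hminus formal_of hof M.smult_closed R'.m_closed sub_carrier)
      then show ?thesis
        using 3 closed by (simp add: balanced G.minus_eq G.r_neg)
    qed
    then show ?case using u by simp
  next
    case (add u v)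
    then show ?case using hadd formal_add G.r_zero[OF G.zero_closed] by metis
  next
    case (uminus u)
    then show ?case using hneg[of u] formal_uminus[of u] by simp
  qed
  then have hnull: "h u = \<zero>\<^bsub>G\<^esub>" if "u \<in> null" for u using that by blast
  \<comment> \<open>\<open>h\<close> is constant on each class, so the choice of representative does
    not matter.\<close>
  define g where "g U = h (SOME u. u \<in> U)" for U
  have g: "g (cl u) = h u" if u: "u \<in> formal" for u
  proof -
    define v where "v = (SOME v. v \<in> cl u)"
    have v: "v \<in> cl u" unfolding v_def by (rule someI[of _ u]) (rule cl_self)
    have vf: "v \<in> formal" using cl_formal[OF u v] .
    have "h (v - u) = \<zero>\<^bsub>G\<^esub>" using hnull cl_memE[OF v] by blast
    then have "h v = h u" using hminus[OF vf u] hc[OF vf] hc[OF u] G.minus_zero_imp_eq by simp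
    then show ?thesis by (simp add: g_def v_def)
  qed
  show ?thesis
  proof (intro exI[of _ g] conjI ballI funcsetI)
    fix U assume "U \<in> carrier T"
    then show "g U \<in> carrier G" unfolding carrier_eq using g hc by (elim imageE) simp
  next
    fix U V assume "U \<in> carrier T" "V \<in> carrier T"
    then obtain u v where "u \<in> formal" "U = cl u" "v \<in> formal" "V = cl v" unfolding carrier_eq by (elim imageE)
    then show "g (U \<oplus>\<^bsub>T\<^esub> V) = g U \<oplus>\<^bsub>G\<^esub> g V" using g formal_add by (simp only: add_cl hadd)
  next
    fix x m assume "x \<in> carrier R'" "m \<in> carrier M"
    then show "g (pure x m) = f x m" using g[OF formal_of] hof by (simp add: pure_def)
  qed
qed

end

lemma frag_extend_plus_fun: "frag_extend (\<lambda>x. f x + g x) u = frag_extend f u + frag_extend g u"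
proof -
  have "Poly_Mapping.keys u \<subseteq> UNIV" by simp
  then show ?thesis by (induction u rule: frag_induction) (auto simp: frag_extend_diff)
qed

lemma tensor_product_map_add:
  "tensor_product_map R' act (u + u') v = tensor_product_map R' act u v + tensor_product_map R' act u' v"
  "tensor_product_map R' act u (v + v') = tensor_product_map R' act u v + tensor_product_map R' act u v'"
proof -
  show "tensor_product_map R' act (u + u') v = tensor_product_map R' act u v + tensor_product_map R' act u' v"
    by (simp add: tensor_product_map_def frag_extend_add)
  have "(\<lambda>(x, a). frag_extend (\<lambda>(y, m). frag_of (x \<otimes>\<^bsub>R'\<^esub> y, act a m)) (v + v')) =
      (\<lambda>z. (\<lambda>(x, a). frag_extend (\<lambda>(y, m). frag_of (x \<otimes>\<^bsub>R'\<^esub> y, act a m)) v) z +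
           (\<lambda>(x, a). frag_extend (\<lambda>(y, m). frag_of (x \<otimes>\<^bsub>R'\<^esub> y, act a m)) v') z)"
    by (auto simp: frag_extend_add)
  then show "tensor_product_map R' act u (v + v') = tensor_product_map R' act u v + tensor_product_map R' act u v'"
    unfolding tensor_product_map_def by (simp only: frag_extend_plus_fun)
qed

lemma tensor_product_map_0:
  "tensor_product_map R' act 0 v = 0" "tensor_product_map R' act u 0 = 0"
  using tensor_product_map_add(1)[of R' act 0 0 v] tensor_product_map_add(2)[of R' act u 0 0] by simp_all

lemma tensor_product_map_uminus:
  "tensor_product_map R' act (- u) v = - tensor_product_map R' act u v"
  "tensor_product_map R' act u (- v) = - tensor_product_map R' act u v"
proof -
  have "tensor_product_map R' act u v + tensor_product_map R' act (- u) v = 0"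
    using tensor_product_map_add(1)[of R' act u "- u" v] by (simp add: tensor_product_map_0)
  then show "tensor_product_map R' act (- u) v = - tensor_product_map R' act u v"
    by (rule minus_unique[symmetric])
  have "tensor_product_map R' act u v + tensor_product_map R' act u (- v) = 0"
    using tensor_product_map_add(2)[of R' act u v "- v"] by (simp add: tensor_product_map_0)
  then show "tensor_product_map R' act u (- v) = - tensor_product_map R' act u v"
    by (rule minus_unique[symmetric])
qed

lemma tensor_product_map_diff:
  "tensor_product_map R' act (u - u') v = tensor_product_map R' act u v - tensor_product_map R' act u' v"
  "tensor_product_map R' act u (v - v') = tensor_product_map R' act u v - tensor_product_map R' act u v'"
  using tensor_product_map_add[of R' act] tensor_product_map_uminus[of R' act]
  by (metis diff_conv_add_uminus)+

lemma tensor_product_map_of [simp]: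
  "tensor_product_map R' act (frag_of (x, a)) (frag_of (y, m)) = frag_of (x \<otimes>\<^bsub>R'\<^esub> y, act a m)"
  by (simp add: tensor_product_map_def)

text \<open>One setting for two constructions: the product of A', where Q is A itself, and the
  action of A' on an extended module.\<close>

locale tensor_action = P: scalar_extension R R' P + Q: scalar_extension R R' Q
  for R R' :: "'r ring" and P :: "('r, 'a) module" and Q :: "('r, 'm) module" +
  fixes act :: "'a \<Rightarrow> 'm \<Rightarrow> 'm"
  assumes act_closed: "\<And>a m. a \<in> carrier P \<Longrightarrow> m \<in> carrier Q \<Longrightarrow> act a m \<in> carrier Q"
    and act_add_left: "\<And>a b m. a \<in> carrier P \<Longrightarrow> b \<in> carrier P \<Longrightarrow> m \<in> carrier Q \<Longrightarrow>
      act (a \<oplus>\<^bsub>P\<^esub> b) m = act a m \<oplus>\<^bsub>Q\<^esub> act b m"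
    and act_add_right: "\<And>a m n. a \<in> carrier P \<Longrightarrow> m \<in> carrier Q \<Longrightarrow> n \<in> carrier Q \<Longrightarrow>
      act a (m \<oplus>\<^bsub>Q\<^esub> n) = act a m \<oplus>\<^bsub>Q\<^esub> act a n"
    and act_smult_left: "\<And>r a m. r \<in> carrier R \<Longrightarrow> a \<in> carrier P \<Longrightarrow> m \<in> carrier Q \<Longrightarrow>
      act (r \<odot>\<^bsub>P\<^esub> a) m = r \<odot>\<^bsub>Q\<^esub> act a m"
    and act_smult_right: "\<And>r a m. r \<in> carrier R \<Longrightarrow> a \<in> carrier P \<Longrightarrow> m \<in> carrier Q \<Longrightarrow>
      act a (r \<odot>\<^bsub>Q\<^esub> m) = r \<odot>\<^bsub>Q\<^esub> act a m"
begin

abbreviation "tp \<equiv> tensor_product_map R' act"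

lemma tp_formal: "u \<in> P.formal \<Longrightarrow> v \<in> Q.formal \<Longrightarrow> tp u v \<in> Q.formal"
proof (induction rule: P.formal_induct)
  case zero
  show ?case unfolding tensor_product_map_0 by (rule Q.formal_0)
next
  case (of x a)
  from of(3) show ?case
  proof (induction rule: Q.formal_induct)
    case zero
    show ?case unfolding tensor_product_map_0 by (rule Q.formal_0)
  next
    case (of y m)
    then show ?case unfolding tensor_product_map_of
      using \<open>x \<in> carrier R'\<close> \<open>a \<in> carrier P\<close> by (intro Q.formal_of act_closed) auto
  next
    case (minus u v)
    then show ?case unfolding tensor_product_map_diff by (intro Q.formal_minus)
  qed
next
  case (minus u u')
  then show ?case unfolding tensor_product_map_diff by (intro Q.formal_minus)
qed

text \<open>By biadditivity it is enough to multiply each kind of relation by a single pair. For the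
  balanced relation the scalar has to pass the factor y, which uses that R' is commutative.\<close>

lemma tp_null_left:
  assumes "u \<in> P.null" "v \<in> Q.formal"
  shows "tp u v \<in> Q.null"
  using assms(2,1)
proof (induction rule: Q.formal_induct)
  case zero
  show ?case unfolding tensor_product_map_0 by (rule Q.null_0)
next
  case (minus v v')
  then show ?case unfolding tensor_product_map_diff by (intro Q.null_minus)
next
  case (of y m)
  from of(3) show ?case
  proof (induction rule: P.null_induct)
    case (relation u)
    have c: "y \<in> carrier R'" "m \<in> carrier Q" by fact+
    from relation consider
      (1) x z a where "u = frag_of (x \<oplus>\<^bsub>R'\<^esub> z, a) - frag_of (x, a) - frag_of (z, a)"
        "x \<in> carrier R'" "z \<in> carrier R'" "a \<in> carrier P"
      | (2) x a b where "u = frag_of (x, a \<oplus>\<^bsub>P\<^esub> b) - frag_of (x, a) - frag_of (x, b)"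
        "x \<in> carrier R'" "a \<in> carrier P" "b \<in> carrier P"
      | (3) x r a where "u = frag_of (x \<otimes>\<^bsub>R'\<^esub> r, a) - frag_of (x, r \<odot>\<^bsub>P\<^esub> a)"
        "x \<in> carrier R'" "r \<in> carrier R" "a \<in> carrier P"
      unfolding tensor_relations_def by blast
    then show ?case
    proof cases
      case 1
      have "tp u (frag_of (y, m)) = frag_of (x \<otimes>\<^bsub>R'\<^esub> y \<oplus>\<^bsub>R'\<^esub> z \<otimes>\<^bsub>R'\<^esub> y, act a m)
          - frag_of (x \<otimes>\<^bsub>R'\<^esub> y, act a m) - frag_of (z \<otimes>\<^bsub>R'\<^esub> y, act a m)"
        unfolding 1(1) using 1(2-4) c by (simp add: tensor_product_map_diff P.R'.l_distr)
      then show ?thesis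
        using 1(2-4) c act_closed by (simp add: Q.null_rel_left)
    next
      case 2
      have "tp u (frag_of (y, m)) = frag_of (x \<otimes>\<^bsub>R'\<^esub> y, act a m \<oplus>\<^bsub>Q\<^esub> act b m)
          - frag_of (x \<otimes>\<^bsub>R'\<^esub> y, act a m) - frag_of (x \<otimes>\<^bsub>R'\<^esub> y, act b m)"
        unfolding 2(1) using 2(2-4) c by (simp add: tensor_product_map_diff act_add_left)
      then show ?thesis
        using 2(2-4) c act_closed by (simp add: Q.null_rel_right)
    next
      case 3
      have "tp u (frag_of (y, m)) = frag_of ((x \<otimes>\<^bsub>R'\<^esub> y) \<otimes>\<^bsub>R'\<^esub> r, act a m)
          - frag_of (x \<otimes>\<^bsub>R'\<^esub> y, r \<odot>\<^bsub>Q\<^esub> act a m)"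
        unfolding 3(1) using 3(2-4) c P.sub_carrier
        by (simp add: tensor_product_map_diff act_smult_left P.R'.m_ac)
      then show ?thesis
        using 3(2-4) c act_closed by (simp add: Q.null_rel_balanced)
    qed
  next
    case zero
    show ?case unfolding tensor_product_map_0 by (rule Q.null_0)
  next
    case (add u v)
    then show ?case unfolding tensor_product_map_add by (intro Q.null_add)
  next
    case (uminus u)
    then show ?case unfolding tensor_product_map_uminus by (intro Q.null_uminus)
  qed
qed

lemma tp_null_right:
  assumes "u \<in> P.formal" "v \<in> Q.null"
  shows "tp u v \<in> Q.null"
  using assms
proof (induction rule: P.formal_induct)
  case zero
  show ?case unfolding tensor_product_map_0 by (rule Q.null_0)
next
  case (minus v v')
  then show ?case unfolding tensor_product_map_diff by (intro Q.null_minus)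
next
  case (of x a)
  have c: "x \<in> carrier R'" "a \<in> carrier P" by fact+
  from of(3) show ?case
  proof (induction rule: Q.null_induct)
    case (relation u)
    from relation consider
      (1) y z m where "u = frag_of (y \<oplus>\<^bsub>R'\<^esub> z, m) - frag_of (y, m) - frag_of (z, m)"
        "y \<in> carrier R'" "z \<in> carrier R'" "m \<in> carrier Q"
      | (2) y m n where "u = frag_of (y, m \<oplus>\<^bsub>Q\<^esub> n) - frag_of (y, m) - frag_of (y, n)"
        "y \<in> carrier R'" "m \<in> carrier Q" "n \<in> carrier Q"
      | (3) y r m where "u = frag_of (y \<otimes>\<^bsub>R'\<^esub> r, m) - frag_of (y, r \<odot>\<^bsub>Q\<^esub> m)"
        "y \<in> carrier R'" "r \<in> carrier R" "m \<in> carrier Q"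
      unfolding tensor_relations_def by blast
    then show ?case
    proof cases
      case 1
      have "tp (frag_of (x, a)) u = frag_of (x \<otimes>\<^bsub>R'\<^esub> y \<oplus>\<^bsub>R'\<^esub> x \<otimes>\<^bsub>R'\<^esub> z, act a m)
          - frag_of (x \<otimes>\<^bsub>R'\<^esub> y, act a m) - frag_of (x \<otimes>\<^bsub>R'\<^esub> z, act a m)"
        unfolding 1(1) using 1(2-4) c by (simp add: tensor_product_map_diff P.R'.r_distr)
      then show ?thesis
        using 1(2-4) c act_closed by (simp add: Q.null_rel_left)
    next
      case 2
      have "tp (frag_of (x, a)) u = frag_of (x \<otimes>\<^bsub>R'\<^esub> y, act a m \<oplus>\<^bsub>Q\<^esub> act a n)
          - frag_of (x \<otimes>\<^bsub>R'\<^esub> y, act a m) - frag_of (x \<otimes>\<^bsub>R'\<^esub> y, act a n)"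
        unfolding 2(1) using 2(2-4) c by (simp add: tensor_product_map_diff act_add_right)
      then show ?thesis
        using 2(2-4) c act_closed by (simp add: Q.null_rel_right)
    next
      case 3
      have "tp (frag_of (x, a)) u = frag_of ((x \<otimes>\<^bsub>R'\<^esub> y) \<otimes>\<^bsub>R'\<^esub> r, act a m)
          - frag_of (x \<otimes>\<^bsub>R'\<^esub> y, r \<odot>\<^bsub>Q\<^esub> act a m)"
        unfolding 3(1) using 3(2-4) c P.sub_carrier
        by (simp add: tensor_product_map_diff act_smult_right P.R'.m_assoc)
      then show ?thesis
        using 3(2-4) c act_closed by (simp add: Q.null_rel_balanced)
    qed
  next
    case zero
    show ?case unfolding tensor_product_map_0 by (rule Q.null_0)
  next
    case (add u v)
    then show ?case unfolding tensor_product_map_add by (intro Q.null_add)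
  next
    case (uminus u)
    then show ?case unfolding tensor_product_map_uminus by (intro Q.null_uminus)
  qed
qed

text \<open>The change under a change of representatives is tp (u' - u) v' + tp u (v' - v), a sum of
  two null elements; so the union in the definitions collapses to one class.\<close>

lemma tp_cl:
  assumes u: "u \<in> P.formal" and v: "v \<in> Q.formal"
  shows "(\<Union>u'\<in>P.cl u. \<Union>v'\<in>Q.cl v. Q.cl (tp u' v')) = Q.cl (tp u v)"
proof -
  have tp_const: "Q.cl (tp u' v') = Q.cl (tp u v)" if u': "u' \<in> P.cl u" and v': "v' \<in> Q.cl v" for u' v'
  proof -
    have f: "u' \<in> P.formal" "v' \<in> Q.formal" using P.cl_formal[OF u u'] Q.cl_formal[OF v v'] by auto
    have "tp u' v' - tp u v = tp (u' - u) v' + tp u (v' - v)" by (simp add: tensor_product_map_diff)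
    also have "\<dots> \<in> Q.null"
      by (intro Q.null_add tp_null_left tp_null_right P.cl_memE Q.cl_memE u u' v' f)
    finally show ?thesis by (rule Q.cl_eqI)
  qed
  have "(\<Union>u'\<in>P.cl u. \<Union>v'\<in>Q.cl v. Q.cl (tp u' v')) = (\<Union>u'\<in>P.cl u. \<Union>v'\<in>Q.cl v. Q.cl (tp u v))"
    by (intro SUP_cong refl tp_const)
  also have "\<dots> = Q.cl (tp u v)" using P.cl_self[of u] Q.cl_self[of v] by blast
  finally show ?thesis .
qed

end

section \<open>Base change of algebras, modules and complexes\<close>

locale base_change = subring_extension R R' + A: assoc_algebra R A
  for R R' :: "'r ring" and A :: "('r, 'a) module"
begin

abbreviation "A' \<equiv> base_change_algebra R R' A"

sublocale PA: tensor_carrier R R' A A'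
  by (intro tensor_carrier.intro scalar_extension.intro subring_extension_axioms A.module_axioms
      tensor_carrier_axioms.intro) (simp_all add: base_change_algebra_def)

sublocale AA: tensor_action R R' A A "\<lambda>a b. a \<otimes>\<^bsub>A\<^esub> b"
  by (unfold_locales) (auto simp: A.smult_mult_left A.smult_mult_right A.l_distr A.r_distr)

lemma mult_cl:
  assumes "u \<in> PA.formal" "v \<in> PA.formal"
  shows "PA.cl u \<otimes>\<^bsub>A'\<^esub> PA.cl v = PA.cl (AA.tp u v)"
  using AA.tp_cl[OF assms] by (simp add: base_change_algebra_def)

lemma one_cl: "\<one>\<^bsub>A'\<^esub> = PA.pure \<one>\<^bsub>R'\<^esub> \<one>\<^bsub>A\<^esub>"
  by (simp add: base_change_algebra_def PA.pure_def)

text \<open>Stated for an arbitrary action, because it yields both the associativity of A' and the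
  associativity of the action on modules.\<close>

lemma tp_assoc:
  assumes Q: "tensor_action R R' A Q act"
    and act_mult: "\<And>a b m. a \<in> carrier A \<Longrightarrow> b \<in> carrier A \<Longrightarrow> m \<in> carrier Q \<Longrightarrow>
      act (a \<otimes>\<^bsub>A\<^esub> b) m = act a (act b m)"
    and u: "u \<in> PA.formal" and v: "v \<in> PA.formal" and w: "w \<in> scalar_extension.formal R' Q"
  shows "tensor_product_map R' act (AA.tp u v) w = tensor_product_map R' act u (tensor_product_map R' act v w)"
proof -
  interpret Q: tensor_action R R' A Q act by (rule Q)
  show ?thesis
    using u
  proof (induction rule: PA.formal_induct)
    case (of x a)
    from v show ?case
    proof (induction rule: PA.formal_induct)
      case (of y b)
      from w show ?case
      proof (induction rule: Q.Q.formal_induct)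
        case (of z m)
        then show ?case
          using \<open>x \<in> carrier R'\<close> \<open>a \<in> carrier A\<close> \<open>y \<in> carrier R'\<close> \<open>b \<in> carrier A\<close>
          by (simp add: act_mult R'.m_assoc)
      qed (simp_all only: tensor_product_map_0 tensor_product_map_diff)
    qed (simp_all only: tensor_product_map_0 tensor_product_map_diff)
  qed (simp_all only: tensor_product_map_0 tensor_product_map_diff)
qed

lemma tp_one:
  assumes Q: "tensor_action R R' A Q act"
    and act_one: "\<And>m. m \<in> carrier Q \<Longrightarrow> act \<one>\<^bsub>A\<^esub> m = m"
    and w: "w \<in> scalar_extension.formal R' Q"
  shows "tensor_product_map R' act (frag_of (\<one>\<^bsub>R'\<^esub>, \<one>\<^bsub>A\<^esub>)) w = w"
proof -
  interpret Q: tensor_action R R' A Q act by (rule Q)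
  show ?thesis
    using w by (induction rule: Q.Q.formal_induct) (simp_all add: tensor_product_map_0 tensor_product_map_diff act_one)
qed

lemma tp_one_right:
  assumes "u \<in> PA.formal"
  shows "AA.tp u (frag_of (\<one>\<^bsub>R'\<^esub>, \<one>\<^bsub>A\<^esub>)) = u"
  using assms by (induction rule: PA.formal_induct) (simp_all add: tensor_product_map_0 tensor_product_map_diff)

lemma one_formal: "frag_of (\<one>\<^bsub>R'\<^esub>, \<one>\<^bsub>A\<^esub>) \<in> PA.formal"
  by (intro PA.formal_of) auto

lemma ring_base_change: "ring A'"
proof (rule ringI)
  show "abelian_group A'" by (rule PA.abelian_group_T)
  show "monoid A'"
  proof (rule monoidI)
    fix U V W assume "U \<in> carrier A'" "V \<in> carrier A'" "W \<in> carrier A'"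
    then obtain u v w where u: "u \<in> PA.formal" "U = PA.cl u" and v: "v \<in> PA.formal" "V = PA.cl v"
      and w: "w \<in> PA.formal" "W = PA.cl w"
      unfolding PA.carrier_eq by (elim imageE)
    show "U \<otimes>\<^bsub>A'\<^esub> V \<in> carrier A'"
      unfolding u v mult_cl[OF u(1) v(1)] by (intro PA.cl_in AA.tp_formal u v)
    show "(U \<otimes>\<^bsub>A'\<^esub> V) \<otimes>\<^bsub>A'\<^esub> W = U \<otimes>\<^bsub>A'\<^esub> (V \<otimes>\<^bsub>A'\<^esub> W)"
      unfolding u v w using u(1) v(1) w(1)
      by (simp add: mult_cl AA.tp_formal tp_assoc[OF AA.tensor_action_axioms] A.m_assoc)
    show "\<one>\<^bsub>A'\<^esub> \<otimes>\<^bsub>A'\<^esub> U = U"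
      unfolding u one_cl PA.pure_def using u(1) one_formal
      by (simp add: mult_cl tp_one[OF AA.tensor_action_axioms])
    show "U \<otimes>\<^bsub>A'\<^esub> \<one>\<^bsub>A'\<^esub> = U"
      unfolding u one_cl PA.pure_def using u(1) one_formal by (simp add: mult_cl tp_one_right)
  next
    show "\<one>\<^bsub>A'\<^esub> \<in> carrier A'" unfolding one_cl by (intro PA.pure_closed) auto
  qed
  fix U V W assume "U \<in> carrier A'" "V \<in> carrier A'" "W \<in> carrier A'"
  then obtain u v w where u: "u \<in> PA.formal" "U = PA.cl u" and v: "v \<in> PA.formal" "V = PA.cl v"
    and w: "w \<in> PA.formal" "W = PA.cl w"
    unfolding PA.carrier_eq by (elim imageE)
  show "(U \<oplus>\<^bsub>A'\<^esub> V) \<otimes>\<^bsub>A'\<^esub> W = U \<otimes>\<^bsub>A'\<^esub> W \<oplus>\<^bsub>A'\<^esub> V \<otimes>\<^bsub>A'\<^esub> W"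
    "W \<otimes>\<^bsub>A'\<^esub> (U \<oplus>\<^bsub>A'\<^esub> V) = W \<otimes>\<^bsub>A'\<^esub> U \<oplus>\<^bsub>A'\<^esub> W \<otimes>\<^bsub>A'\<^esub> V"
    unfolding u v w using u(1) v(1) w(1)
    by (simp_all add: mult_cl PA.add_cl PA.formal_add tensor_product_map_add)
qed

end

locale base_change_mod = base_change R R' A + M: left_module A M
  for R R' :: "'r ring" and A :: "('r, 'a) module" and M :: "('a, 'm) module"
begin

abbreviation "M' \<equiv> base_change_module R R' A M"
abbreviation "MR \<equiv> restrict_scalars A M"

lemma MR_simps [simp]: "carrier MR = carrier M" "add MR = add M" "\<zero>\<^bsub>MR\<^esub> = \<zero>\<^bsub>M\<^esub>"
  "r \<odot>\<^bsub>MR\<^esub> m = (r \<odot>\<^bsub>A\<^esub> \<one>\<^bsub>A\<^esub>) \<odot>\<^bsub>M\<^esub> m"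
  by (simp_all add: restrict_scalars_def)

lemma module_MR: "module R MR"
  by (rule module_restrict_scalars[OF A.assoc_algebra_axioms M.left_module_axioms])

sublocale PM: tensor_carrier R R' MR M'
  by (intro tensor_carrier.intro scalar_extension.intro subring_extension_axioms module_MR
      tensor_carrier_axioms.intro) (simp_all add: base_change_module_def)

text \<open>The elements r 1 are central in A, which is why the action of A on M is compatible with
  the R-structure obtained by restriction.\<close>

lemma smult_one_mult:
  assumes "r \<in> carrier R" "a \<in> carrier A"
  shows "(r \<odot>\<^bsub>A\<^esub> \<one>\<^bsub>A\<^esub>) \<otimes>\<^bsub>A\<^esub> a = r \<odot>\<^bsub>A\<^esub> a" "a \<otimes>\<^bsub>A\<^esub> (r \<odot>\<^bsub>A\<^esub> \<one>\<^bsub>A\<^esub>) = r \<odot>\<^bsub>A\<^esub> a"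
  using assms by (simp_all add: A.smult_mult_left A.smult_mult_right)

lemma tensor_action_M: "tensor_action R R' A MR (\<lambda>a m. a \<odot>\<^bsub>M\<^esub> m)"
proof (intro tensor_action.intro tensor_action_axioms.intro)
  show "scalar_extension R R' A" "scalar_extension R R' MR"
    by (rule PA.scalar_extension_axioms PM.scalar_extension_axioms)+
  fix r a m assume H: "r \<in> carrier R" "a \<in> carrier A" "m \<in> carrier MR"
  then have c: "r \<odot>\<^bsub>A\<^esub> \<one>\<^bsub>A\<^esub> \<in> carrier A" by simp
  show "(r \<odot>\<^bsub>A\<^esub> a) \<odot>\<^bsub>M\<^esub> m = r \<odot>\<^bsub>MR\<^esub> (a \<odot>\<^bsub>M\<^esub> m)"
    "a \<odot>\<^bsub>M\<^esub> (r \<odot>\<^bsub>MR\<^esub> m) = r \<odot>\<^bsub>MR\<^esub> (a \<odot>\<^bsub>M\<^esub> m)"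
    using H c by (simp_all add: M.smult_assoc1[symmetric] smult_one_mult)
qed (auto simp: M.smult_closed M.smult_l_distr M.smult_r_distr)

sublocale AM: tensor_action R R' A MR "\<lambda>a m. a \<odot>\<^bsub>M\<^esub> m"
  by (rule tensor_action_M)

lemma smult_cl:
  assumes "u \<in> PA.formal" "v \<in> PM.formal"
  shows "PA.cl u \<odot>\<^bsub>M'\<^esub> PM.cl v = PM.cl (AM.tp u v)"
  using AM.tp_cl[OF assms] by (simp add: base_change_module_def)

lemma smult_pure:
  assumes "x \<in> carrier R'" "a \<in> carrier A" "y \<in> carrier R'" "m \<in> carrier M"
  shows "PA.pure x a \<odot>\<^bsub>M'\<^esub> PM.pure y m = PM.pure (x \<otimes>\<^bsub>R'\<^esub> y) (a \<odot>\<^bsub>M\<^esub> m)"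
  unfolding PA.pure_def PM.pure_def using assms by (simp add: smult_cl PA.formal_of PM.formal_of)

lemma left_module_base_change: "left_module A' M'"
proof (intro left_module.intro left_module_axioms.intro)
  show "ring A'" by (rule ring_base_change)
  show "abelian_group M'" by (rule PM.abelian_group_T)
  fix U V W assume "U \<in> carrier A'" and "W \<in> carrier M'"
  then obtain u w where u: "u \<in> PA.formal" "U = PA.cl u" and w: "w \<in> PM.formal" "W = PM.cl w"
    unfolding PA.carrier_eq PM.carrier_eq by (elim imageE)
  show "U \<odot>\<^bsub>M'\<^esub> W \<in> carrier M'"
    unfolding u w smult_cl[OF u(1) w(1)] by (intro PM.cl_in AM.tp_formal u w)
  {
    assume "V \<in> carrier A'"
    then obtain v where v: "v \<in> PA.formal" "V = PA.cl v" unfolding PA.carrier_eq by (elim imageE)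
    show "(U \<oplus>\<^bsub>A'\<^esub> V) \<odot>\<^bsub>M'\<^esub> W = U \<odot>\<^bsub>M'\<^esub> W \<oplus>\<^bsub>M'\<^esub> V \<odot>\<^bsub>M'\<^esub> W"
      unfolding u v w using u(1) v(1) w(1)
      by (simp add: smult_cl PA.add_cl PM.add_cl PA.formal_add tensor_product_map_add)
    show "(U \<otimes>\<^bsub>A'\<^esub> V) \<odot>\<^bsub>M'\<^esub> W = U \<odot>\<^bsub>M'\<^esub> (V \<odot>\<^bsub>M'\<^esub> W)"
    proof -
      have "AM.tp (AA.tp u v) w = AM.tp u (AM.tp v w)"
        using u(1) v(1) w(1) by (intro tp_assoc[OF AM.tensor_action_axioms]) (simp_all add: M.smult_assoc1)
      then show ?thesis
        unfolding u v w using u(1) v(1) w(1) by (simp add: smult_cl mult_cl AA.tp_formal AM.tp_formal)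
    qed
  }
next
  fix U V W assume "U \<in> carrier A'" "V \<in> carrier M'" "W \<in> carrier M'"
  then obtain u v w where u: "u \<in> PA.formal" "U = PA.cl u" and v: "v \<in> PM.formal" "V = PM.cl v"
    and w: "w \<in> PM.formal" "W = PM.cl w"
    unfolding PA.carrier_eq PM.carrier_eq by (elim imageE)
  show "U \<odot>\<^bsub>M'\<^esub> (V \<oplus>\<^bsub>M'\<^esub> W) = U \<odot>\<^bsub>M'\<^esub> V \<oplus>\<^bsub>M'\<^esub> U \<odot>\<^bsub>M'\<^esub> W"
    unfolding u v w using u(1) v(1) w(1)
    by (simp add: smult_cl PM.add_cl PM.formal_add tensor_product_map_add)
next
  fix W assume "W \<in> carrier M'"
  then obtain w where w: "w \<in> PM.formal" "W = PM.cl w"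
    unfolding PM.carrier_eq by (elim imageE)
  show "\<one>\<^bsub>A'\<^esub> \<odot>\<^bsub>M'\<^esub> W = W"
  proof -
    have "AM.tp (frag_of (\<one>\<^bsub>R'\<^esub>, \<one>\<^bsub>A\<^esub>)) w = w"
      using w(1) by (intro tp_one[OF AM.tensor_action_axioms]) (simp_all add: M.smult_one)
    then show ?thesis
      unfolding w one_cl PA.pure_def using w(1) one_formal by (simp add: smult_cl)
  qed
qed

end

text \<open>The map id \<otimes> f, in the shape in which \<open>base_change_complex\<close> writes
  its differentials, so that these are instances by unfolding.\<close>

definition tensor_map ::
    "'r ring \<Rightarrow> 'r ring \<Rightarrow> ('r, 'm) module \<Rightarrow> ('m \<Rightarrow> 'm) \<Rightarrow>
      ('r \<times> 'm \<Rightarrow>\<^sub>0 int) set \<Rightarrow> ('r \<times> 'm \<Rightarrow>\<^sub>0 int) set" where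
  "tensor_map R R' N f U = (\<Union>u\<in>U. tensor_class R R' N (frag_extend (\<lambda>(x, m). frag_of (x, f m)) u))"

locale base_change_hom = M: base_change_mod R R' A M + N: base_change_mod R R' A N
  for R R' :: "'r ring" and A :: "('r, 'a) module" and M N :: "('a, 'm) module" +
  fixes f :: "'m \<Rightarrow> 'm"
  assumes hom: "f \<in> left_module_hom A M N"
begin

lemma f_closed: "m \<in> carrier M \<Longrightarrow> f m \<in> carrier N"
  and f_add: "m \<in> carrier M \<Longrightarrow> n \<in> carrier M \<Longrightarrow> f (m \<oplus>\<^bsub>M\<^esub> n) = f m \<oplus>\<^bsub>N\<^esub> f n"
  and f_smult: "a \<in> carrier A \<Longrightarrow> m \<in> carrier M \<Longrightarrow> f (a \<odot>\<^bsub>M\<^esub> m) = a \<odot>\<^bsub>N\<^esub> f m"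
  using hom by (auto simp: left_module_hom_def)

definition F :: "('r \<times> 'm \<Rightarrow>\<^sub>0 int) \<Rightarrow> ('r \<times> 'm \<Rightarrow>\<^sub>0 int)" where
  "F u = frag_extend (\<lambda>(x, m). frag_of (x, f m)) u"

lemma F_simps [simp]: "F 0 = 0" "F (u + v) = F u + F v" "F (u - v) = F u - F v" "F (- u) = - F u"
  "F (frag_of (x, m)) = frag_of (x, f m)"
  by (simp_all add: F_def frag_extend_add frag_extend_diff frag_extend_minus)

lemma F_formal: "u \<in> M.PM.formal \<Longrightarrow> F u \<in> N.PM.formal"
proof (induction rule: M.PM.formal_induct)
  case (of x m)
  then show ?case by (simp add: N.PM.formal_of f_closed)
qed (simp_all add: N.PM.formal_0 N.PM.formal_minus)

lemma F_null: "u \<in> M.PM.null \<Longrightarrow> F u \<in> N.PM.null"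
proof (induction rule: M.PM.null_induct)
  case (relation u)
  then consider
    (1) x y m where "u = frag_of (x \<oplus>\<^bsub>R'\<^esub> y, m) - frag_of (x, m) - frag_of (y, m)"
      "x \<in> carrier R'" "y \<in> carrier R'" "m \<in> carrier M"
    | (2) x m n where "u = frag_of (x, m \<oplus>\<^bsub>M\<^esub> n) - frag_of (x, m) - frag_of (x, n)"
      "x \<in> carrier R'" "m \<in> carrier M" "n \<in> carrier M"
    | (3) x r m where "u = frag_of (x \<otimes>\<^bsub>R'\<^esub> r, m) - frag_of (x, (r \<odot>\<^bsub>A\<^esub> \<one>\<^bsub>A\<^esub>) \<odot>\<^bsub>M\<^esub> m)"
      "x \<in> carrier R'" "r \<in> carrier R" "m \<in> carrier M"
    unfolding tensor_relations_def M.MR_simps by blast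
  then show ?case
  proof cases
    case 1
    then show ?thesis using N.PM.null_rel_left[of x y "f m"] f_closed by simp
  next
    case 2
    then show ?thesis using N.PM.null_rel_right[of x "f m" "f n"] f_closed f_add by simp
  next
    case 3
    then show ?thesis using N.PM.null_rel_balanced[of x r "f m"] f_closed f_smult by simp
  qed
qed (simp_all add: N.PM.null_0 N.PM.null_add N.PM.null_uminus)

abbreviation "f' \<equiv> tensor_map R R' (restrict_scalars A N) f"

lemma f'_cl:
  assumes u: "u \<in> M.PM.formal"
  shows "f' (M.PM.cl u) = N.PM.cl (F u)"
proof -
  have "N.PM.cl (F v) = N.PM.cl (F u)" if v: "v \<in> M.PM.cl u" for v
  proof (rule N.PM.cl_eqI)
    have "F (v - u) \<in> N.PM.null" by (rule F_null[OF M.PM.cl_memE[OF v]])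
    then show "F v - F u \<in> N.PM.null" by simp
  qed
  then have "(\<Union>v\<in>M.PM.cl u. N.PM.cl (F v)) = (\<Union>v\<in>M.PM.cl u. N.PM.cl (F u))"
    by (intro SUP_cong refl)
  also have "\<dots> = N.PM.cl (F u)" using M.PM.cl_self[of u] by blast
  finally show ?thesis by (simp add: tensor_map_def F_def)
qed

lemma f'_pure: "x \<in> carrier R' \<Longrightarrow> m \<in> carrier M \<Longrightarrow> f' (M.PM.pure x m) = N.PM.pure x (f m)"
  unfolding M.PM.pure_def N.PM.pure_def by (simp add: f'_cl M.PM.formal_of)

lemma F_tp:
  assumes "u \<in> M.PA.formal" "v \<in> M.PM.formal"
  shows "F (M.AM.tp u v) = N.AM.tp u (F v)"
  using assms(1)
proof (induction rule: M.PA.formal_induct)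
  case (of x a)
  from assms(2) show ?case
  proof (induction rule: M.PM.formal_induct)
    case (of y m)
    then show ?case using \<open>a \<in> carrier A\<close> by (simp add: f_smult)
  qed (simp_all add: tensor_product_map_0 tensor_product_map_diff)
qed (simp_all add: tensor_product_map_0 tensor_product_map_diff)

lemma f'_hom: "f' \<in> left_module_hom M.A' M.M' N.M'"
proof -
  have closed: "f' U \<in> carrier N.M'" if "U \<in> carrier M.M'" for U
  proof -
    obtain u where u: "u \<in> M.PM.formal" "U = M.PM.cl u"
      using \<open>U \<in> carrier M.M'\<close> unfolding M.PM.carrier_eq by (elim imageE)
    show ?thesis unfolding u(2) f'_cl[OF u(1)] by (rule N.PM.cl_in[OF F_formal[OF u(1)]])
  qed
  have add: "f' (U \<oplus>\<^bsub>M.M'\<^esub> V) = f' U \<oplus>\<^bsub>N.M'\<^esub> f' V" if "U \<in> carrier M.M'" "V \<in> carrier M.M'" for U V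
  proof -
    obtain u where u: "u \<in> M.PM.formal" "U = M.PM.cl u"
      using \<open>U \<in> carrier M.M'\<close> unfolding M.PM.carrier_eq by (elim imageE)
    obtain v where v: "v \<in> M.PM.formal" "V = M.PM.cl v"
      using \<open>V \<in> carrier M.M'\<close> unfolding M.PM.carrier_eq by (elim imageE)
    show ?thesis
      unfolding u(2) v(2) M.PM.add_cl f'_cl[OF u(1)] f'_cl[OF v(1)] f'_cl[OF M.PM.formal_add[OF u(1) v(1)]]
      by (simp only: N.PM.add_cl F_simps)
  qed
  have smult: "f' (U \<odot>\<^bsub>M.M'\<^esub> V) = U \<odot>\<^bsub>N.M'\<^esub> f' V" if "U \<in> carrier M.A'" "V \<in> carrier M.M'" for U V
  proof -
    obtain u where u: "u \<in> M.PA.formal" "U = M.PA.cl u"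
      using \<open>U \<in> carrier M.A'\<close> unfolding M.PA.carrier_eq by (elim imageE)
    obtain v where v: "v \<in> M.PM.formal" "V = M.PM.cl v"
      using \<open>V \<in> carrier M.M'\<close> unfolding M.PM.carrier_eq by (elim imageE)
    show ?thesis
      unfolding u(2) v(2) M.smult_cl[OF u(1) v(1)] f'_cl[OF v(1)] N.smult_cl[OF u(1) F_formal[OF v(1)]]
        f'_cl[OF M.AM.tp_formal[OF u(1) v(1)]] F_tp[OF u(1) v(1)] ..
  qed
  show ?thesis
    unfolding left_module_hom_def using closed add smult by blast
qed

end

section \<open>Congruences modulo powers of \<open>p\<close>\<close>

definition pcong :: "nat \<Rightarrow> nat \<Rightarrow> ('a, 'b) ring_scheme \<Rightarrow> 'a \<Rightarrow> 'a \<Rightarrow> bool" where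
  "pcong p k G u v \<longleftrightarrow> u \<in> carrier G \<and> v \<in> carrier G \<and> (\<exists>y\<in>carrier G. u = v \<oplus>\<^bsub>G\<^esub> [(p ^ k)] \<cdot>\<^bsub>G\<^esub> y)"

context abelian_group
begin

lemma pcongI: "u \<in> carrier G \<Longrightarrow> v \<in> carrier G \<Longrightarrow> y \<in> carrier G \<Longrightarrow> u = v \<oplus> [(p ^ k)] \<cdot> y \<Longrightarrow> pcong p k G u v"
  by (auto simp: pcong_def)

lemma pcong_iff: "u \<in> carrier G \<Longrightarrow> v \<in> carrier G \<Longrightarrow>
    pcong p k G u v \<longleftrightarrow> (\<exists>y\<in>carrier G. u \<ominus> v = [(p ^ k)] \<cdot> y)"
proof -
  assume c: "u \<in> carrier G" "v \<in> carrier G"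
  have "u = v \<oplus> [(p ^ k)] \<cdot> y \<longleftrightarrow> u \<ominus> v = [(p ^ k)] \<cdot> y" if y: "y \<in> carrier G" for y
  proof
    assume "u = v \<oplus> [(p ^ k)] \<cdot> y"
    then show "u \<ominus> v = [(p ^ k)] \<cdot> y"
      using c y by (simp add: a_comm[of v] minus_eq a_assoc r_neg)
  next
    assume *: "u \<ominus> v = [(p ^ k)] \<cdot> y"
    have "u = v \<oplus> (u \<ominus> v)" using c by (simp add: minus_eq a_lcomm[of v u] r_neg)
    then show "u = v \<oplus> [(p ^ k)] \<cdot> y" using * by simp
  qed
  then show ?thesis using c by (auto simp: pcong_def)
qed

lemma pcong_refl: "u \<in> carrier G \<Longrightarrow> pcong p k G u u"
  by (rule pcongI[of _ _ \<zero>]) auto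

lemma pcong_sym:
  assumes "pcong p k G u v" shows "pcong p k G v u"
proof -
  obtain y where y: "u \<in> carrier G" "v \<in> carrier G" "y \<in> carrier G" "u = v \<oplus> [(p ^ k)] \<cdot> y"
    using assms by (auto simp: pcong_def)
  then have "v = u \<oplus> [(p ^ k)] \<cdot> (\<ominus> y)" by (simp add: add_pow_uminus a_assoc r_neg)
  then show ?thesis using y by (intro pcongI[of _ _ "\<ominus> y"]) auto
qed

lemma pcong_add:
  assumes "pcong p k G u v" "pcong p k G u' v'"
  shows "pcong p k G (u \<oplus> u') (v \<oplus> v')"
proof -
  obtain y where y: "u \<in> carrier G" "v \<in> carrier G" "y \<in> carrier G" "u = v \<oplus> [(p ^ k)] \<cdot> y"
    using assms by (auto simp: pcong_def)
  obtain z where z: "u' \<in> carrier G" "v' \<in> carrier G" "z \<in> carrier G" "u' = v' \<oplus> [(p ^ k)] \<cdot> z"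
    using assms by (auto simp: pcong_def)
  have "u \<oplus> u' = (v \<oplus> v') \<oplus> [(p ^ k)] \<cdot> (y \<oplus> z)"
    using y(2,3) z(2,3) by (simp add: y(4) z(4) add_pow_add a_ac)
  then show ?thesis using y z by (intro pcongI[of _ _ "y \<oplus> z"]) auto
qed

lemma pcong_trans:
  assumes "pcong p k G u v" "pcong p k G v w"
  shows "pcong p k G u w"
proof -
  obtain y where y: "u \<in> carrier G" "v \<in> carrier G" "y \<in> carrier G" "u = v \<oplus> [(p ^ k)] \<cdot> y"
    using assms by (auto simp: pcong_def)
  obtain z where z: "w \<in> carrier G" "z \<in> carrier G" "v = w \<oplus> [(p ^ k)] \<cdot> z"
    using assms by (auto simp: pcong_def)
  have "u = w \<oplus> [(p ^ k)] \<cdot> (z \<oplus> y)"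
    using y z(1,2) by (simp add: z(3) add_pow_add a_assoc)
  then show ?thesis using y z by (intro pcongI[of _ _ "z \<oplus> y"]) auto
qed

lemma pcong_separated:
  assumes sep: "padic_separated p G (carrier G)" and c: "\<And>k. pcong p k G u v"
  shows "u = v"
proof -
  have uv: "u \<in> carrier G" "v \<in> carrier G" using c[of 0] by (auto simp: pcong_def)
  have "\<exists>y\<in>carrier G. u \<ominus> v = [(p ^ k)] \<cdot> y" for k
    using c[of k] pcong_iff[OF uv] by blast
  then have "u \<ominus> v = \<zero>" using sep uv unfolding padic_separated_def by blast
  then show ?thesis using minus_zero_imp_eq uv by blast
qed

end

section \<open>The endomorphism ring of a complex\<close>

text \<open>Extensionality fixes the functions outside the carriers. Without it, equal endomorphisms
  could be different functions, and the ring laws would hold only up to that.\<close>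

definition end_ring :: "('a, 'x) ring_scheme \<Rightarrow> ('a, 'm) complex_of \<Rightarrow> (int \<Rightarrow> 'm \<Rightarrow> 'm) ring" where
  "end_ring A C =
     \<lparr>carrier = {\<phi>. \<forall>n. \<phi> n \<in> left_module_hom A (obj C n) (obj C n) \<and> \<phi> n \<in> extensional (carrier (obj C n)) \<and>
        (\<forall>x\<in>carrier (obj C n). \<phi> (n - 1) (diff C n x) = diff C n (\<phi> n x))},
      monoid.mult = (\<lambda>\<phi> \<psi> n. \<lambda>x\<in>carrier (obj C n). \<phi> n (\<psi> n x)),
      one = (\<lambda>n. \<lambda>x\<in>carrier (obj C n). x),
      ring.zero = (\<lambda>n. \<lambda>x\<in>carrier (obj C n). \<zero>\<^bsub>obj C n\<^esub>),
      add = (\<lambda>\<phi> \<psi> n. \<lambda>x\<in>carrier (obj C n). \<phi> n x \<oplus>\<^bsub>obj C n\<^esub> \<psi> n x)\<rparr>"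

text \<open>Divisibility is required of the values. This ideal can be larger than the multiples of
  p^k in the ring, since with torsion the quotients of the values need not form an endomorphism; in
  exchange, separation and completeness can be checked pointwise.\<close>

definition padic_ideal :: "nat \<Rightarrow> ('a, 'x) ring_scheme \<Rightarrow> ('a, 'm) complex_of \<Rightarrow> nat \<Rightarrow> (int \<Rightarrow> 'm \<Rightarrow> 'm) set" where
  "padic_ideal p A C k = {\<phi> \<in> carrier (end_ring A C).
     \<forall>n. \<forall>x\<in>carrier (obj C n). \<exists>y\<in>carrier (obj C n). \<phi> n x = [(p ^ k)] \<cdot>\<^bsub>obj C n\<^esub> y}"

context chain_complex
begin

abbreviation "E \<equiv> end_ring A C"
abbreviation "cr n \<equiv> carrier (obj C n)"

interpretation M: left_module A "obj C n" for n
  by (rule obj_module)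

lemma obj_group: "abelian_group (obj C n)"
  by (rule M.M.abelian_group_axioms)

lemma diff_closed: "x \<in> cr n \<Longrightarrow> diff C n x \<in> cr (n - 1)"
  and diff_add: "x \<in> cr n \<Longrightarrow> y \<in> cr n \<Longrightarrow> diff C n (x \<oplus>\<^bsub>obj C n\<^esub> y) = diff C n x \<oplus>\<^bsub>obj C (n - 1)\<^esub> diff C n y"
  and diff_smult: "a \<in> carrier A \<Longrightarrow> x \<in> cr n \<Longrightarrow> diff C n (a \<odot>\<^bsub>obj C n\<^esub> x) = a \<odot>\<^bsub>obj C (n - 1)\<^esub> diff C n x"
  using diff_hom[of n] by (auto simp: left_module_hom_def)

lemma end_closed: "\<phi> \<in> carrier E \<Longrightarrow> x \<in> cr n \<Longrightarrow> \<phi> n x \<in> cr n"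
  and end_add: "\<phi> \<in> carrier E \<Longrightarrow> x \<in> cr n \<Longrightarrow> y \<in> cr n \<Longrightarrow>
    \<phi> n (x \<oplus>\<^bsub>obj C n\<^esub> y) = \<phi> n x \<oplus>\<^bsub>obj C n\<^esub> \<phi> n y"
  and end_smult: "\<phi> \<in> carrier E \<Longrightarrow> a \<in> carrier A \<Longrightarrow> x \<in> cr n \<Longrightarrow>
    \<phi> n (a \<odot>\<^bsub>obj C n\<^esub> x) = a \<odot>\<^bsub>obj C n\<^esub> \<phi> n x"
  and end_diff: "\<phi> \<in> carrier E \<Longrightarrow> x \<in> cr n \<Longrightarrow> \<phi> (n - 1) (diff C n x) = diff C n (\<phi> n x)"
  by (auto simp: end_ring_def left_module_hom_def Pi_iff)

lemma end_extensional: "\<phi> \<in> carrier E \<Longrightarrow> \<phi> n \<in> extensional (cr n)"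
  by (simp add: end_ring_def)

lemma end_eqI:
  assumes "\<phi> \<in> carrier E" "\<psi> \<in> carrier E" "\<And>n x. x \<in> cr n \<Longrightarrow> \<phi> n x = \<psi> n x"
  shows "\<phi> = \<psi>"
proof
  fix n show "\<phi> n = \<psi> n"
    using assms end_extensional by (intro extensionalityI[of _ "cr n"]) auto
qed

lemma endI:
  assumes "\<And>n x. x \<in> cr n \<Longrightarrow> f n x \<in> cr n"
    and "\<And>n x y. x \<in> cr n \<Longrightarrow> y \<in> cr n \<Longrightarrow> f n (x \<oplus>\<^bsub>obj C n\<^esub> y) = f n x \<oplus>\<^bsub>obj C n\<^esub> f n y"
    and "\<And>n a x. a \<in> carrier A \<Longrightarrow> x \<in> cr n \<Longrightarrow> f n (a \<odot>\<^bsub>obj C n\<^esub> x) = a \<odot>\<^bsub>obj C n\<^esub> f n x"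
    and "\<And>n x. x \<in> cr n \<Longrightarrow> f (n - 1) (diff C n x) = diff C n (f n x)"
  shows "(\<lambda>n. \<lambda>x\<in>cr n. f n x) \<in> carrier E"
  using assms by (simp add: end_ring_def left_module_hom_def diff_closed M.smult_closed)

lemma E_simps: "x \<in> cr n \<Longrightarrow> (\<phi> \<otimes>\<^bsub>E\<^esub> \<psi>) n x = \<phi> n (\<psi> n x)"
  "x \<in> cr n \<Longrightarrow> (\<phi> \<oplus>\<^bsub>E\<^esub> \<psi>) n x = \<phi> n x \<oplus>\<^bsub>obj C n\<^esub> \<psi> n x"
  "x \<in> cr n \<Longrightarrow> \<one>\<^bsub>E\<^esub> n x = x" "x \<in> cr n \<Longrightarrow> \<zero>\<^bsub>E\<^esub> n x = \<zero>\<^bsub>obj C n\<^esub>"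
  by (simp_all add: end_ring_def)

lemma hom_zero:
  assumes "f \<in> left_module_hom A (obj C n) (obj C m)"
  shows "f \<zero>\<^bsub>obj C n\<^esub> = \<zero>\<^bsub>obj C m\<^esub>"
proof -
  have f: "f \<zero>\<^bsub>obj C n\<^esub> \<in> cr m" "f \<zero>\<^bsub>obj C n\<^esub> = f \<zero>\<^bsub>obj C n\<^esub> \<oplus>\<^bsub>obj C m\<^esub> f \<zero>\<^bsub>obj C n\<^esub>"
    using assms by (auto simp: left_module_hom_def) (metis M.M.l_zero M.M.zero_closed)
  then show ?thesis using M.M.add.l_cancel_one'[of "f \<zero>\<^bsub>obj C n\<^esub>" m "f \<zero>\<^bsub>obj C n\<^esub>"] by simp
qed

lemma diff_zero: "diff C n \<zero>\<^bsub>obj C n\<^esub> = \<zero>\<^bsub>obj C (n - 1)\<^esub>"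
  by (rule hom_zero[OF diff_hom])

lemma end_zero: "\<phi> \<in> carrier E \<Longrightarrow> \<phi> n \<zero>\<^bsub>obj C n\<^esub> = \<zero>\<^bsub>obj C n\<^esub>"
  by (rule hom_zero) (simp add: end_ring_def)

lemma end_uminus:
  assumes "\<phi> \<in> carrier E" "x \<in> cr n"
  shows "\<phi> n (\<ominus>\<^bsub>obj C n\<^esub> x) = \<ominus>\<^bsub>obj C n\<^esub> \<phi> n x"
proof -
  have "\<phi> n (\<ominus>\<^bsub>obj C n\<^esub> x) \<oplus>\<^bsub>obj C n\<^esub> \<phi> n x = \<phi> n (\<ominus>\<^bsub>obj C n\<^esub> x \<oplus>\<^bsub>obj C n\<^esub> x)"
    using assms by (simp add: end_add)
  also have "\<dots> = \<zero>\<^bsub>obj C n\<^esub>" using assms by (simp add: M.M.l_neg end_zero)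
  finally show ?thesis
    using assms end_closed by (intro M.M.minus_equality[symmetric]) auto
qed

lemma diff_uminus:
  assumes "x \<in> cr n"
  shows "diff C n (\<ominus>\<^bsub>obj C n\<^esub> x) = \<ominus>\<^bsub>obj C (n - 1)\<^esub> diff C n x"
proof -
  have "diff C n (\<ominus>\<^bsub>obj C n\<^esub> x) \<oplus>\<^bsub>obj C (n - 1)\<^esub> diff C n x = diff C n (\<ominus>\<^bsub>obj C n\<^esub> x \<oplus>\<^bsub>obj C n\<^esub> x)"
    using assms by (simp add: diff_add)
  also have "\<dots> = \<zero>\<^bsub>obj C (n - 1)\<^esub>" using assms by (simp add: M.M.l_neg diff_zero)
  finally show ?thesis
    using assms diff_closed by (intro M.M.minus_equality[symmetric]) auto
qed

lemma smult_zero_right: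
  assumes "a \<in> carrier A" shows "a \<odot>\<^bsub>obj C n\<^esub> \<zero>\<^bsub>obj C n\<^esub> = \<zero>\<^bsub>obj C n\<^esub>"
proof -
  have c: "a \<odot>\<^bsub>obj C n\<^esub> \<zero>\<^bsub>obj C n\<^esub> \<in> cr n" using assms by (simp add: M.smult_closed)
  have "a \<odot>\<^bsub>obj C n\<^esub> \<zero>\<^bsub>obj C n\<^esub> = a \<odot>\<^bsub>obj C n\<^esub> \<zero>\<^bsub>obj C n\<^esub> \<oplus>\<^bsub>obj C n\<^esub> a \<odot>\<^bsub>obj C n\<^esub> \<zero>\<^bsub>obj C n\<^esub>"
    using M.smult_r_distr[OF assms M.M.zero_closed M.M.zero_closed, of n] by simp
  then show ?thesis using c M.M.add.l_cancel_one'[OF c c] by simp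
qed

lemma smult_uminus_right:
  assumes "a \<in> carrier A" "x \<in> cr n" shows "a \<odot>\<^bsub>obj C n\<^esub> (\<ominus>\<^bsub>obj C n\<^esub> x) = \<ominus>\<^bsub>obj C n\<^esub> (a \<odot>\<^bsub>obj C n\<^esub> x)"
proof -
  have "a \<odot>\<^bsub>obj C n\<^esub> (\<ominus>\<^bsub>obj C n\<^esub> x) \<oplus>\<^bsub>obj C n\<^esub> a \<odot>\<^bsub>obj C n\<^esub> x = \<zero>\<^bsub>obj C n\<^esub>"
    using assms by (simp add: M.smult_r_distr[symmetric] M.M.l_neg smult_zero_right)
  then show ?thesis
    using assms by (intro M.M.minus_equality[symmetric]) (auto simp: M.smult_closed)
qed

lemma E_mult_closed: "\<phi> \<in> carrier E \<Longrightarrow> \<psi> \<in> carrier E \<Longrightarrow> \<phi> \<otimes>\<^bsub>E\<^esub> \<psi> \<in> carrier E"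
proof -
  assume c: "\<phi> \<in> carrier E" "\<psi> \<in> carrier E"
  have "(\<lambda>n. \<lambda>x\<in>cr n. \<phi> n (\<psi> n x)) \<in> carrier E"
    using c by (intro endI) (simp_all add: end_closed end_add end_smult end_diff)
  then show ?thesis by (simp add: end_ring_def)
qed

lemma E_add_closed: "\<phi> \<in> carrier E \<Longrightarrow> \<psi> \<in> carrier E \<Longrightarrow> \<phi> \<oplus>\<^bsub>E\<^esub> \<psi> \<in> carrier E"
proof -
  assume c: "\<phi> \<in> carrier E" "\<psi> \<in> carrier E"
  have "(\<lambda>n. \<lambda>x\<in>cr n. \<phi> n x \<oplus>\<^bsub>obj C n\<^esub> \<psi> n x) \<in> carrier E"
    using c by (intro endI)
      (simp_all add: end_closed end_add end_smult end_diff diff_add M.M.a_ac M.smult_r_distr)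
  then show ?thesis by (simp add: end_ring_def)
qed

lemma E_one_closed: "\<one>\<^bsub>E\<^esub> \<in> carrier E"
proof -
  have "(\<lambda>n. \<lambda>x\<in>cr n. x) \<in> carrier E" by (intro endI) simp_all
  then show ?thesis by (simp add: end_ring_def)
qed

lemma E_zero_closed: "\<zero>\<^bsub>E\<^esub> \<in> carrier E"
proof -
  have "(\<lambda>n. \<lambda>x\<in>cr n. \<zero>\<^bsub>obj C n\<^esub>) \<in> carrier E"
    by (intro endI) (simp_all add: diff_zero smult_zero_right)
  then show ?thesis by (simp add: end_ring_def)
qed

lemma ring_E: "ring E"
proof (rule ringI)
  show "abelian_group E"
  proof (rule abelian_groupI)
    fix \<phi> assume \<phi>: "\<phi> \<in> carrier E"
    have m: "(\<lambda>n. \<lambda>x\<in>cr n. \<ominus>\<^bsub>obj C n\<^esub> \<phi> n x) \<in> carrier E"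
      using \<phi> by (intro endI)
        (simp_all add: end_closed end_add end_smult end_diff diff_uminus smult_uminus_right M.M.minus_add M.M.a_comm)
    show "\<exists>\<psi>\<in>carrier E. \<psi> \<oplus>\<^bsub>E\<^esub> \<phi> = \<zero>\<^bsub>E\<^esub>"
    proof (rule bexI[OF _ m], rule end_eqI)
      fix n x assume "x \<in> cr n"
      then show "((\<lambda>n. \<lambda>x\<in>cr n. \<ominus>\<^bsub>obj C n\<^esub> \<phi> n x) \<oplus>\<^bsub>E\<^esub> \<phi>) n x = \<zero>\<^bsub>E\<^esub> n x"
        using \<phi> by (simp add: E_simps M.M.l_neg end_closed)
    qed (simp_all add: E_add_closed m \<phi> E_zero_closed)
  qed (auto intro!: end_eqI simp: E_add_closed E_zero_closed E_simps end_closed M.M.a_ac)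
  show "monoid E"
    by (rule monoidI) (auto intro!: end_eqI simp: E_mult_closed E_one_closed E_simps end_closed)
qed (auto intro!: end_eqI simp: E_mult_closed E_add_closed E_simps end_closed end_add)

sublocale E: ring E by (rule ring_E)

lemma E_uminus: "\<phi> \<in> carrier E \<Longrightarrow> x \<in> cr n \<Longrightarrow> (\<ominus>\<^bsub>E\<^esub> \<phi>) n x = \<ominus>\<^bsub>obj C n\<^esub> \<phi> n x"
proof -
  assume H: "\<phi> \<in> carrier E" "x \<in> cr n"
  have "(\<ominus>\<^bsub>E\<^esub> \<phi>) n x \<oplus>\<^bsub>obj C n\<^esub> \<phi> n x = (\<ominus>\<^bsub>E\<^esub> \<phi> \<oplus>\<^bsub>E\<^esub> \<phi>) n x" using H by (simp add: E_simps)
  also have "\<dots> = \<zero>\<^bsub>obj C n\<^esub>" using H by (simp add: E.l_neg E_simps)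
  finally show ?thesis using H end_closed by (intro M.M.minus_equality[symmetric]) auto
qed

lemma E_minus: "\<phi> \<in> carrier E \<Longrightarrow> \<psi> \<in> carrier E \<Longrightarrow> x \<in> cr n \<Longrightarrow>
    (\<phi> \<ominus>\<^bsub>E\<^esub> \<psi>) n x = \<phi> n x \<ominus>\<^bsub>obj C n\<^esub> \<psi> n x"
  by (simp add: E.minus_eq M.M.minus_eq E_simps E_uminus)

lemma end_finsum:
  assumes "\<phi> \<in> carrier E" "finite I" "f \<in> I \<rightarrow> cr n"
  shows "\<phi> n (\<Oplus>\<^bsub>obj C n\<^esub>i\<in>I. f i) = (\<Oplus>\<^bsub>obj C n\<^esub>i\<in>I. \<phi> n (f i))"
  using assms(2,3)
proof (induction I rule: finite_induct)
  case empty
  then show ?case using assms(1) by (simp add: end_zero)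
next
  case (insert i I)
  have "(\<Oplus>\<^bsub>obj C n\<^esub>i\<in>insert i I. f i) = f i \<oplus>\<^bsub>obj C n\<^esub> (\<Oplus>\<^bsub>obj C n\<^esub>i\<in>I. f i)"
    using insert by (intro M.M.finsum_insert) auto
  moreover have "(\<Oplus>\<^bsub>obj C n\<^esub>i\<in>insert i I. \<phi> n (f i)) = \<phi> n (f i) \<oplus>\<^bsub>obj C n\<^esub> (\<Oplus>\<^bsub>obj C n\<^esub>i\<in>I. \<phi> n (f i))"
    using insert assms(1) end_closed by (intro M.M.finsum_insert) auto
  moreover have "(\<Oplus>\<^bsub>obj C n\<^esub>i\<in>I. f i) \<in> cr n" using insert.prems by (intro M.M.finsum_closed) auto
  ultimately show ?case using insert assms(1) by (simp add: end_add)
qed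

lemma finsum_E_apply:
  assumes "finite I" "e \<in> I \<rightarrow> carrier E" "x \<in> cr n"
  shows "(\<Oplus>\<^bsub>E\<^esub>i\<in>I. e i) n x = (\<Oplus>\<^bsub>obj C n\<^esub>i\<in>I. e i n x)"
  using assms(1,2)
proof (induction I rule: finite_induct)
  case empty
  then show ?case using assms(3) by (simp add: E_simps)
next
  case (insert i I)
  have "(\<Oplus>\<^bsub>E\<^esub>i\<in>insert i I. e i) = e i \<oplus>\<^bsub>E\<^esub> (\<Oplus>\<^bsub>E\<^esub>i\<in>I. e i)"
    using insert by (intro E.finsum_insert) auto
  moreover have "(\<Oplus>\<^bsub>obj C n\<^esub>i\<in>insert i I. e i n x) = e i n x \<oplus>\<^bsub>obj C n\<^esub> (\<Oplus>\<^bsub>obj C n\<^esub>i\<in>I. e i n x)"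
    using insert assms(3) end_closed by (intro M.M.finsum_insert) (auto simp: Pi_iff)
  ultimately show ?case using insert assms(3) by (simp add: E_simps Pi_iff)
qed

lemma end_add_pow: "\<phi> \<in> carrier E \<Longrightarrow> x \<in> cr n \<Longrightarrow> \<phi> n ([(m::nat)] \<cdot>\<^bsub>obj C n\<^esub> x) = [m] \<cdot>\<^bsub>obj C n\<^esub> \<phi> n x"
  by (induction m) (simp_all add: end_zero end_add end_closed)

lemma end_pcong:
  assumes "\<phi> \<in> carrier E" "pcong p k (obj C n) x y"
  shows "pcong p k (obj C n) (\<phi> n x) (\<phi> n y)"
proof -
  obtain z where z: "x \<in> cr n" "y \<in> cr n" "z \<in> cr n" "x = y \<oplus>\<^bsub>obj C n\<^esub> [(p ^ k)] \<cdot>\<^bsub>obj C n\<^esub> z"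
    using assms(2) by (auto simp: pcong_def)
  then have "\<phi> n x = \<phi> n y \<oplus>\<^bsub>obj C n\<^esub> [(p ^ k)] \<cdot>\<^bsub>obj C n\<^esub> \<phi> n z"
    using assms(1) by (simp add: end_add end_add_pow)
  then show ?thesis using z assms(1) end_closed by (intro M.M.pcongI[of _ _ _ "\<phi> n z"]) auto
qed

lemma padic_ideal_iff:
  assumes "\<phi> \<in> carrier E" "\<psi> \<in> carrier E"
  shows "\<phi> \<ominus>\<^bsub>E\<^esub> \<psi> \<in> padic_ideal p A C k \<longleftrightarrow> (\<forall>n. \<forall>x\<in>cr n. pcong p k (obj C n) (\<phi> n x) (\<psi> n x))"
  using assms by (simp add: padic_ideal_def E_minus M.M.pcong_iff end_closed)

lemma ideal_padic_ideal: "ideal (padic_ideal p A C k) E"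
proof (rule idealI)
  let ?I = "padic_ideal p A C k"
  show "ring E" by (rule ring_E)
  show "subgroup ?I (add_monoid E)"
  proof (rule subgroup.intro)
    show "?I \<subseteq> carrier (add_monoid E)" by (auto simp: padic_ideal_def)
  next
    fix \<phi> \<psi> assume H: "\<phi> \<in> ?I" "\<psi> \<in> ?I"
    have "\<exists>y\<in>cr n. (\<phi> \<oplus>\<^bsub>E\<^esub> \<psi>) n x = [(p ^ k)] \<cdot>\<^bsub>obj C n\<^esub> y" if x: "x \<in> cr n" for n x
    proof -
      obtain y where y: "y \<in> cr n" "\<phi> n x = [(p ^ k)] \<cdot>\<^bsub>obj C n\<^esub> y" using H x unfolding padic_ideal_def by blast
      obtain z where z: "z \<in> cr n" "\<psi> n x = [(p ^ k)] \<cdot>\<^bsub>obj C n\<^esub> z" using H x unfolding padic_ideal_def by blast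
      show ?thesis using y z x by (intro bexI[of _ "y \<oplus>\<^bsub>obj C n\<^esub> z"]) (simp_all add: E_simps M.M.add_pow_add)
    qed
    then show "\<phi> \<otimes>\<^bsub>add_monoid E\<^esub> \<psi> \<in> ?I" using H by (simp add: padic_ideal_def)
  next
    show "\<one>\<^bsub>add_monoid E\<^esub> \<in> ?I"
      by (auto simp: padic_ideal_def E_simps intro!: bexI[of _ "\<zero>\<^bsub>obj C n\<^esub>" for n])
  next
    fix \<phi> assume H: "\<phi> \<in> ?I"
    have "\<exists>y\<in>cr n. (\<ominus>\<^bsub>E\<^esub> \<phi>) n x = [(p ^ k)] \<cdot>\<^bsub>obj C n\<^esub> y" if x: "x \<in> cr n" for n x
    proof -
      obtain y where y: "y \<in> cr n" "\<phi> n x = [(p ^ k)] \<cdot>\<^bsub>obj C n\<^esub> y" using H x unfolding padic_ideal_def by blast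
      have "\<phi> \<in> carrier E" using H by (simp add: padic_ideal_def)
      then show ?thesis using y x by (intro bexI[of _ "\<ominus>\<^bsub>obj C n\<^esub> y"]) (simp_all add: E_uminus M.M.add_pow_uminus)
    qed
    then have "\<ominus>\<^bsub>E\<^esub> \<phi> \<in> ?I" using H by (simp add: padic_ideal_def)
    then show "inv\<^bsub>add_monoid E\<^esub> \<phi> \<in> ?I" by (simp only: a_inv_def)
  qed
  fix \<phi> \<psi> assume H: "\<phi> \<in> ?I" and \<psi>: "\<psi> \<in> carrier E"
  have \<phi>: "\<phi> \<in> carrier E" using H by (simp add: padic_ideal_def)
  have "\<exists>y\<in>cr n. (\<psi> \<otimes>\<^bsub>E\<^esub> \<phi>) n x = [(p ^ k)] \<cdot>\<^bsub>obj C n\<^esub> y" if x: "x \<in> cr n" for n x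
  proof -
    obtain y where y: "y \<in> cr n" "\<phi> n x = [(p ^ k)] \<cdot>\<^bsub>obj C n\<^esub> y" using H x unfolding padic_ideal_def by blast
    show ?thesis using y x \<psi> by (intro bexI[of _ "\<psi> n y"]) (simp_all add: E_simps end_add_pow end_closed)
  qed
  then show "\<psi> \<otimes>\<^bsub>E\<^esub> \<phi> \<in> ?I" using \<phi> \<psi> by (simp add: padic_ideal_def)
  have "\<exists>y\<in>cr n. (\<phi> \<otimes>\<^bsub>E\<^esub> \<psi>) n x = [(p ^ k)] \<cdot>\<^bsub>obj C n\<^esub> y" if x: "x \<in> cr n" for n x
    using H end_closed[OF \<psi> x] x by (simp add: E_simps padic_ideal_def)
  then show "\<phi> \<otimes>\<^bsub>E\<^esub> \<psi> \<in> ?I" using \<phi> \<psi> by (simp add: padic_ideal_def)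
qed

lemma padic_ideal_separated:
  assumes sep: "\<And>n. padic_separated p (obj C n) (cr n)" and \<phi>: "\<And>k. \<phi> \<in> padic_ideal p A C k"
  shows "\<phi> = \<zero>\<^bsub>E\<^esub>"
proof (rule end_eqI)
  show "\<phi> \<in> carrier E" using \<phi>[of 0] by (simp add: padic_ideal_def)
  fix n x assume x: "x \<in> cr n"
  have "\<phi> n x \<in> cr n" using \<open>\<phi> \<in> carrier E\<close> x by (rule end_closed)
  moreover have "\<exists>y\<in>cr n. \<phi> n x = [(p ^ k)] \<cdot>\<^bsub>obj C n\<^esub> y" for k
    using \<phi>[of k] x by (simp add: padic_ideal_def)
  ultimately have "\<phi> n x = \<zero>\<^bsub>obj C n\<^esub>" using sep[of n] unfolding padic_separated_def by blast
  then show "\<phi> n x = \<zero>\<^bsub>E\<^esub> n x" using x by (simp add: E_simps)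
qed (rule E_zero_closed)

text \<open>Each further application of e = e e gains a factor p: a value p^k y becomes p^k e(y),
  and e(y) is itself divisible by p.\<close>

lemma idempotent_in_padic_ideal:
  assumes sep: "\<And>n. padic_separated p (obj C n) (cr n)"
    and e: "e \<in> padic_ideal p A C 1" "e \<otimes>\<^bsub>E\<^esub> e = e"
  shows "e = \<zero>\<^bsub>E\<^esub>"
proof (rule padic_ideal_separated[OF sep])
  have ec: "e \<in> carrier E" using e by (simp add: padic_ideal_def)
  fix k show "e \<in> padic_ideal p A C k"
  proof (induction k)
    case 0
    show ?case using ec end_closed by (auto simp: padic_ideal_def)
  next
    case (Suc k)
    have "\<exists>z\<in>cr n. e n x = [(p ^ Suc k)] \<cdot>\<^bsub>obj C n\<^esub> z" if x: "x \<in> cr n" for n x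
    proof -
      obtain y where y: "y \<in> cr n" "e n x = [(p ^ k)] \<cdot>\<^bsub>obj C n\<^esub> y" using Suc x unfolding padic_ideal_def by blast
      obtain z where z: "z \<in> cr n" "e n y = [(p ^ 1)] \<cdot>\<^bsub>obj C n\<^esub> z" using e(1) y(1) unfolding padic_ideal_def by blast
      have "e n x = e n (e n x)" using x by (subst e(2)[symmetric]) (rule E_simps)
      also have "\<dots> = [(p ^ k)] \<cdot>\<^bsub>obj C n\<^esub> e n y" using ec y by (simp add: end_add_pow)
      also have "\<dots> = [(p ^ Suc k)] \<cdot>\<^bsub>obj C n\<^esub> z" using z by (simp add: M.M.add_pow_mult mult.commute)
      finally show ?thesis using z(1) by blast
    qed
    then show ?case using ec by (simp add: padic_ideal_def)
  qed
qed

text \<open>Modulo p^k an endomorphism is determined by its values, up to p^k, on finitely many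
  representatives in each of the finitely many degrees where C is nonzero.\<close>

lemma finite_end_quotient:
  assumes fin: "\<And>n. padic_finite p (obj C n) (cr n)" and bd: "bounded_complex C"
  shows "finite (carrier (E Quot padic_ideal p A C k))"
proof -
  interpret I: ideal "padic_ideal p A C k" E by (rule ideal_padic_ideal)
  obtain a b where ab: "\<And>n. n \<notin> {a..b} \<Longrightarrow> cr n = {\<zero>\<^bsub>obj C n\<^esub>}" using bd unfolding bounded_complex_def by blast
  define good where "good n T \<longleftrightarrow> finite T \<and> T \<subseteq> cr n \<and> (\<forall>x\<in>cr n. \<exists>t\<in>T. pcong p k (obj C n) x t)" for n T
  have "\<exists>T. good n T" for n
  proof -
    from M.M.padic_finite_pow[OF fin, of n k] obtain T where T: "finite T" "T \<subseteq> cr n"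
      "\<forall>x\<in>cr n. \<exists>t\<in>T. \<exists>y\<in>cr n. x = t \<oplus>\<^bsub>obj C n\<^esub> [(p ^ k)] \<cdot>\<^bsub>obj C n\<^esub> y"
      by (elim exE conjE)
    have "\<exists>t\<in>T. pcong p k (obj C n) x t" if x: "x \<in> cr n" for x
    proof -
      obtain t y where t: "t \<in> T" "y \<in> cr n" "x = t \<oplus>\<^bsub>obj C n\<^esub> [(p ^ k)] \<cdot>\<^bsub>obj C n\<^esub> y"
        using bspec[OF T(3) x] by (elim bexE)
      then have "pcong p k (obj C n) x t" using T(2) x by (intro M.M.pcongI) auto
      then show ?thesis using t(1) by blast
    qed
    then have "good n T" using T(1,2) unfolding good_def by simp
    then show ?thesis by (rule exI)
  qed
  then have good: "good n (SOME T. good n T)" for n by (rule someI_ex)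
  define T where "T n = (SOME T. good n T)" for n
  have T: "\<And>n. finite (T n)" "\<And>n. T n \<subseteq> cr n"
    "\<And>n x. x \<in> cr n \<Longrightarrow> \<exists>t\<in>T n. pcong p k (obj C n) x t"
    using good unfolding T_def good_def by simp_all
  \<comment> \<open>\<open>r n\<close> rounds an element to a representative modulo p^k, and the
    table \<Theta> of an endomorphism records its rounded values at all representatives in the
    degrees from a to b.\<close>
  define r where "r n x = (SOME t. t \<in> T n \<and> pcong p k (obj C n) x t)" for n x
  have r: "r n x \<in> T n" "pcong p k (obj C n) x (r n x)" if x: "x \<in> cr n" for n x
  proof -
    obtain t where t: "t \<in> T n" "pcong p k (obj C n) x t" using T(3)[OF x] by (elim bexE)
    from conjI[OF t] have "r n x \<in> T n \<and> pcong p k (obj C n) x (r n x)"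
      unfolding r_def by (rule someI[of "\<lambda>t. t \<in> T n \<and> pcong p k (obj C n) x t"])
    then show "r n x \<in> T n" "pcong p k (obj C n) x (r n x)" by simp_all
  qed
  define S where "S = Sigma {a..b} T"
  define \<Theta> where "\<Theta> \<phi> = (\<lambda>z\<in>S. (\<lambda>(n, t). r n (\<phi> n t)) z)" for \<phi>
  have finS: "finite S" unfolding S_def using T(1) by (intro finite_SigmaI) simp_all
  have "\<Theta> ` carrier E \<subseteq> (\<Pi>\<^sub>E z\<in>S. T (fst z))"
  proof
    fix w assume "w \<in> \<Theta> ` carrier E"
    then obtain \<phi> where \<phi>: "\<phi> \<in> carrier E" "w = \<Theta> \<phi>" by blast
    have "(\<lambda>(n, t). r n (\<phi> n t)) z \<in> T (fst z)" if "z \<in> S" for z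
    proof -
      obtain n t where z: "z = (n, t)" "t \<in> T n" using \<open>z \<in> S\<close> unfolding S_def by (elim SigmaE)
      have "r n (\<phi> n t) \<in> T n" using T(2)[of n] z(2) by (intro r(1) end_closed[OF \<phi>(1)]) (rule subsetD)
      then show ?thesis by (simp add: z(1))
    qed
    then show "w \<in> (\<Pi>\<^sub>E z\<in>S. T (fst z))" unfolding \<phi>(2) \<Theta>_def by (rule restrict_PiE_iff[THEN iffD2, rule_format])
  qed
  moreover have "finite (\<Pi>\<^sub>E z\<in>S. T (fst z))" using finS T(1) by (intro finite_PiE) simp_all
  ultimately have "finite (\<Theta> ` carrier E)" by (rule finite_subset)
  \<comment> \<open>\<open>B\<close> contains an endomorphism for every table that occurs.\<close>
  from finite_subset_image[OF this order_refl]
  obtain B where B: "B \<subseteq> carrier E" "finite B" "\<Theta> ` carrier E = \<Theta> ` B"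
    by (elim exE conjE)
  show ?thesis
  proof (rule I.finite_FactRing[OF B(2,1)])
    fix \<phi> assume \<phi>: "\<phi> \<in> carrier E"
    then have "\<Theta> \<phi> \<in> \<Theta> ` B" unfolding B(3)[symmetric] by (rule imageI)
    then obtain \<psi> where \<psi>: "\<psi> \<in> B" "\<Theta> \<phi> = \<Theta> \<psi>" by (elim imageE)
    have \<psi>c: "\<psi> \<in> carrier E" using \<psi> B by blast
    have "pcong p k (obj C n) (\<phi> n x) (\<psi> n x)" if x: "x \<in> cr n" for n x
    proof (cases "n \<in> {a..b}")
      case True
      obtain t where t: "t \<in> T n" "pcong p k (obj C n) x t" using T(3)[OF x] by blast
      have tc: "t \<in> cr n" using t T(2) by blast
      have "(n, t) \<in> S" using True t by (simp add: S_def)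
      then have eq: "r n (\<phi> n t) = r n (\<psi> n t)" using fun_cong[OF \<psi>(2), of "(n, t)"] by (simp add: \<Theta>_def)
      \<comment> \<open>From \<phi> at x to \<phi> at the representative t, to the common table
        entry, to \<psi> at t, and back to \<psi> at x.\<close>
      have 1: "pcong p k (obj C n) (\<phi> n x) (\<phi> n t)" by (rule end_pcong[OF \<phi> t(2)])
      have 2: "pcong p k (obj C n) (\<phi> n t) (r n (\<phi> n t))" by (rule r(2)[OF end_closed[OF \<phi> tc]])
      have 3: "pcong p k (obj C n) (r n (\<phi> n t)) (\<psi> n t)"
        unfolding eq by (rule M.M.pcong_sym[OF r(2)[OF end_closed[OF \<psi>c tc]]])
      have 4: "pcong p k (obj C n) (\<psi> n t) (\<psi> n x)" by (rule M.M.pcong_sym[OF end_pcong[OF \<psi>c t(2)]])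
      show ?thesis by (rule M.M.pcong_trans[OF 1 M.M.pcong_trans[OF 2 M.M.pcong_trans[OF 3 4]]])
    next
      case False
      then have "\<phi> n x = \<psi> n x" using ab[OF False] end_closed[OF \<phi> x] end_closed[OF \<psi>c x] by simp
      then show ?thesis using M.M.pcong_refl[OF end_closed[OF \<psi>c x]] by simp
    qed
    then have "\<phi> \<ominus>\<^bsub>E\<^esub> \<psi> \<in> padic_ideal p A C k" unfolding padic_ideal_iff[OF \<phi> \<psi>c] by blast
    then show "\<exists>t\<in>B. \<phi> \<ominus>\<^bsub>E\<^esub> t \<in> padic_ideal p A C k" using \<psi>(1) by (rule bexI)
  qed
qed

text \<open>The limit is taken pointwise. Separation makes it unique, and uniqueness turns the
  pointwise limit into an A-linear map that commutes with the differential.\<close>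

lemma padic_ideal_complete:
  assumes sep: "\<And>n. padic_separated p (obj C n) (cr n)" and compl: "\<And>n. padic_complete p (obj C n) (cr n)"
    and s: "\<And>k. s k \<in> carrier E" "\<And>k. s (Suc k) \<ominus>\<^bsub>E\<^esub> s k \<in> padic_ideal p A C k"
  shows "\<exists>\<phi>\<in>carrier E. \<forall>k. \<phi> \<ominus>\<^bsub>E\<^esub> s k \<in> padic_ideal p A C k"
proof -
  have ex: "\<exists>z. \<forall>k. pcong p k (obj C n) z (s k n x)" if x: "x \<in> cr n" for n x
  proof -
    have sc: "s k n x \<in> cr n" for k using s(1) x by (rule end_closed)
    have "\<exists>y\<in>cr n. s (Suc k) n x = s k n x \<oplus>\<^bsub>obj C n\<^esub> [(p ^ k)] \<cdot>\<^bsub>obj C n\<^esub> y" for k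
      using s(2)[of k] x unfolding padic_ideal_iff[OF s(1) s(1)] pcong_def by blast
    then obtain z where "z \<in> cr n" "\<And>k. \<exists>y\<in>cr n. z = s k n x \<oplus>\<^bsub>obj C n\<^esub> [(p ^ k)] \<cdot>\<^bsub>obj C n\<^esub> y"
      using M.M.padic_complete_Cauchy[OF compl, of "\<lambda>k. s k n x" n] sc by metis
    then show ?thesis using sc unfolding pcong_def by blast
  qed
  define l where "l n x = (SOME z. \<forall>k. pcong p k (obj C n) z (s k n x))" for n x
  have l: "pcong p k (obj C n) (l n x) (s k n x)" if "x \<in> cr n" for n x k
    using someI_ex[OF ex[OF that]] unfolding l_def by blast
  have lc: "l n x \<in> cr n" if "x \<in> cr n" for n x using l[OF that, of 0] by (simp add: pcong_def)
  \<comment> \<open>Each algebraic property of \<open>l\<close> below is proved by exhibiting the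
    desired value as a limit of the same sequence.\<close>
  have uniq: "z = l n x" if "x \<in> cr n" "\<And>k. pcong p k (obj C n) z (s k n x)" for n x z
    by (rule M.M.pcong_separated[OF sep], rule M.M.pcong_trans[OF that(2) M.M.pcong_sym[OF l[OF that(1)]]])
  have \<phi>: "(\<lambda>n. \<lambda>x\<in>cr n. l n x) \<in> carrier E"
  proof (rule endI)
    fix n x y assume "x \<in> cr n" "y \<in> cr n"
    then show "l n (x \<oplus>\<^bsub>obj C n\<^esub> y) = l n x \<oplus>\<^bsub>obj C n\<^esub> l n y"
      using s(1) M.M.pcong_add[OF l l, of x n y] by (intro uniq[symmetric]) (simp_all add: end_add)
  next
    fix n a x assume H: "a \<in> carrier A" "x \<in> cr n"
    have "pcong p k (obj C n) (a \<odot>\<^bsub>obj C n\<^esub> l n x) (s k n (a \<odot>\<^bsub>obj C n\<^esub> x))" for k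
    proof -
      obtain y where y: "y \<in> cr n" "l n x = s k n x \<oplus>\<^bsub>obj C n\<^esub> [(p ^ k)] \<cdot>\<^bsub>obj C n\<^esub> y"
        using l[OF H(2), of k] by (auto simp: pcong_def)
      have "a \<odot>\<^bsub>obj C n\<^esub> ([(m::nat)] \<cdot>\<^bsub>obj C n\<^esub> y) = [m] \<cdot>\<^bsub>obj C n\<^esub> (a \<odot>\<^bsub>obj C n\<^esub> y)" for m
        by (induction m) (simp_all add: H y(1) smult_zero_right M.smult_r_distr)
      then have "a \<odot>\<^bsub>obj C n\<^esub> l n x = s k n (a \<odot>\<^bsub>obj C n\<^esub> x) \<oplus>\<^bsub>obj C n\<^esub> [(p ^ k)] \<cdot>\<^bsub>obj C n\<^esub> (a \<odot>\<^bsub>obj C n\<^esub> y)"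
        using y H s(1) by (simp add: M.smult_r_distr end_smult end_closed)
      then show ?thesis
        using H lc y(1) s(1) end_closed by (intro M.M.pcongI[of _ _ _ "a \<odot>\<^bsub>obj C n\<^esub> y"]) (auto simp: M.smult_closed)
    qed
    then show "l n (a \<odot>\<^bsub>obj C n\<^esub> x) = a \<odot>\<^bsub>obj C n\<^esub> l n x"
      using H by (intro uniq[symmetric]) (simp_all add: M.smult_closed)
  next
    fix n x assume x: "x \<in> cr n"
    have "pcong p k (obj C (n - 1)) (diff C n (l n x)) (s k (n - 1) (diff C n x))" for k
    proof -
      obtain y where y: "y \<in> cr n" "l n x = s k n x \<oplus>\<^bsub>obj C n\<^esub> [(p ^ k)] \<cdot>\<^bsub>obj C n\<^esub> y"
        using l[OF x, of k] by (auto simp: pcong_def)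
      have "diff C n ([(m::nat)] \<cdot>\<^bsub>obj C n\<^esub> y) = [m] \<cdot>\<^bsub>obj C (n - 1)\<^esub> diff C n y" for m
        by (induction m) (simp_all add: y(1) diff_zero diff_add)
      then have "diff C n (l n x) = s k (n - 1) (diff C n x) \<oplus>\<^bsub>obj C (n - 1)\<^esub> [(p ^ k)] \<cdot>\<^bsub>obj C (n - 1)\<^esub> diff C n y"
        using y x s(1) by (simp add: diff_add end_diff end_closed)
      then show ?thesis
        using x lc y(1) s(1) end_closed diff_closed by (intro M.M.pcongI[of _ _ _ "diff C n y"]) auto
    qed
    then show "l (n - 1) (diff C n x) = diff C n (l n x)"
      using x diff_closed by (intro uniq[symmetric]) auto
  qed (rule lc)
  have "(\<lambda>n. \<lambda>x\<in>cr n. l n x) \<ominus>\<^bsub>E\<^esub> s k \<in> padic_ideal p A C k" for k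
    unfolding padic_ideal_iff[OF \<phi> s(1)] using l by simp
  then show ?thesis using \<phi> by blast
qed

end

section \<open>Decompositions and idempotent endomorphisms\<close>

context chain_complex
begin

interpretation M: left_module A "obj C n" for n
  by (rule obj_module)

lemma subcomplexD:
  assumes "subcomplex A C D"
  shows "x \<in> D n \<Longrightarrow> x \<in> cr n" "\<zero>\<^bsub>obj C n\<^esub> \<in> D n"
    "x \<in> D n \<Longrightarrow> y \<in> D n \<Longrightarrow> x \<oplus>\<^bsub>obj C n\<^esub> y \<in> D n" "x \<in> D n \<Longrightarrow> \<ominus>\<^bsub>obj C n\<^esub> x \<in> D n"
    "a \<in> carrier A \<Longrightarrow> x \<in> D n \<Longrightarrow> a \<odot>\<^bsub>obj C n\<^esub> x \<in> D n" "x \<in> D n \<Longrightarrow> diff C n x \<in> D (n - 1)"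
proof -
  have sm: "submodule (D n) A (obj C n)" for n using assms by (simp add: subcomplex_def)
  interpret S: submodule "D n" A "obj C n" by (rule sm)
  show "x \<in> D n \<Longrightarrow> x \<in> cr n" using S.subset by auto
  show "\<zero>\<^bsub>obj C n\<^esub> \<in> D n" using S.one_closed by simp
  show "x \<in> D n \<Longrightarrow> y \<in> D n \<Longrightarrow> x \<oplus>\<^bsub>obj C n\<^esub> y \<in> D n" using S.m_closed by simp
  show "x \<in> D n \<Longrightarrow> \<ominus>\<^bsub>obj C n\<^esub> x \<in> D n" using S.m_inv_closed by (simp add: a_inv_def)
  show "a \<in> carrier A \<Longrightarrow> x \<in> D n \<Longrightarrow> a \<odot>\<^bsub>obj C n\<^esub> x \<in> D n" by (rule S.smult_closed)
  show "x \<in> D n \<Longrightarrow> diff C n x \<in> D (n - 1)" using assms by (auto simp: subcomplex_def)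
qed

lemma restrict_simps [simp]:
  "carrier (obj (restrict_complex C D) n) = D n" "add (obj (restrict_complex C D) n) = add (obj C n)"
  "\<zero>\<^bsub>obj (restrict_complex C D) n\<^esub> = \<zero>\<^bsub>obj C n\<^esub>" "a \<odot>\<^bsub>obj (restrict_complex C D) n\<^esub> x = a \<odot>\<^bsub>obj C n\<^esub> x"
  "diff (restrict_complex C D) = diff C"
  by (simp_all add: restrict_complex_def)

lemma chain_complex_restrict:
  assumes D: "subcomplex A C D"
  shows "chain_complex A (restrict_complex C D)"
proof (rule chain_complex.intro)
  note d = subcomplexD[OF D]
  fix n
  show "left_module A (obj (restrict_complex C D) n)"
  proof (intro left_module.intro left_module_axioms.intro)
    show "ring A" by (rule M.R.ring_axioms)
    show "abelian_group (obj (restrict_complex C D) n)"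
    proof (rule abelian_groupI)
      fix x assume "x \<in> carrier (obj (restrict_complex C D) n)"
      then show "\<exists>y\<in>carrier (obj (restrict_complex C D) n). y \<oplus>\<^bsub>obj (restrict_complex C D) n\<^esub> x = \<zero>\<^bsub>obj (restrict_complex C D) n\<^esub>"
        using d by (intro bexI[of _ "\<ominus>\<^bsub>obj C n\<^esub> x"]) (simp_all add: M.M.l_neg)
    qed (use d in \<open>simp_all add: M.M.a_ac\<close>)
  qed (use d in \<open>simp_all add: M.smult_l_distr M.smult_r_distr M.smult_assoc1 M.smult_one\<close>)
  show "diff (restrict_complex C D) n \<in> left_module_hom A (obj (restrict_complex C D) n) (obj (restrict_complex C D) (n - 1))"
    using d by (simp add: left_module_hom_def diff_add diff_smult)
  fix x assume "x \<in> carrier (obj (restrict_complex C D) n)"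
  then show "diff (restrict_complex C D) (n - 1) (diff (restrict_complex C D) n x) = \<zero>\<^bsub>obj (restrict_complex C D) (n - 1 - 1)\<^esub>"
    using d diff_diff by simp
qed

abbreviation im :: "(int \<Rightarrow> 'm \<Rightarrow> 'm) \<Rightarrow> int \<Rightarrow> 'm set" where
  "im e n \<equiv> e n ` cr n"

lemma idem_apply:
  assumes "e \<otimes>\<^bsub>E\<^esub> e = e" "x \<in> cr n" shows "e n (e n x) = e n x"
  using E_simps(1)[OF assms(2), of e e] assms(1) by simp

lemma im_iff:
  assumes "e \<in> carrier E" "e \<otimes>\<^bsub>E\<^esub> e = e"
  shows "x \<in> im e n \<longleftrightarrow> x \<in> cr n \<and> e n x = x"
  using idem_apply[OF assms(2)] end_closed[OF assms(1)] by force

lemma subcomplex_im: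
  assumes e: "e \<in> carrier E"
  shows "subcomplex A C (im e)"
  unfolding subcomplex_def
proof (intro allI conjI)
  fix n
  show "submodule (im e n) A (obj C n)"
  proof (intro submodule.intro submodule_axioms.intro subgroup.intro)
    show "im e n \<subseteq> carrier (add_monoid (obj C n))" using end_closed[OF e] by auto
    have "\<zero>\<^bsub>obj C n\<^esub> = e n \<zero>\<^bsub>obj C n\<^esub>" using end_zero[OF e] by simp
    then show "\<one>\<^bsub>add_monoid (obj C n)\<^esub> \<in> im e n" by (simp add: image_iff) (metis M.M.zero_closed)
  next
    fix x y assume "x \<in> im e n" "y \<in> im e n"
    then obtain u v where "u \<in> cr n" "v \<in> cr n" "x = e n u" "y = e n v" by blast
    then have "x \<oplus>\<^bsub>obj C n\<^esub> y = e n (u \<oplus>\<^bsub>obj C n\<^esub> v)" "u \<oplus>\<^bsub>obj C n\<^esub> v \<in> cr n" using end_add[OF e] by simp_all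
    then show "x \<otimes>\<^bsub>add_monoid (obj C n)\<^esub> y \<in> im e n" by simp
  next
    fix x assume "x \<in> im e n"
    then obtain u where "u \<in> cr n" "x = e n u" by blast
    then have "\<ominus>\<^bsub>obj C n\<^esub> x = e n (\<ominus>\<^bsub>obj C n\<^esub> u)" "\<ominus>\<^bsub>obj C n\<^esub> u \<in> cr n" using end_uminus[OF e] by simp_all
    then have "\<ominus>\<^bsub>obj C n\<^esub> x \<in> im e n" by simp
    then show "inv\<^bsub>add_monoid (obj C n)\<^esub> x \<in> im e n" by (simp only: a_inv_def)
  next
    fix a x assume a: "a \<in> carrier A" and "x \<in> im e n"
    then obtain u where "u \<in> cr n" "x = e n u" by blast
    then have "a \<odot>\<^bsub>obj C n\<^esub> x = e n (a \<odot>\<^bsub>obj C n\<^esub> u)" "a \<odot>\<^bsub>obj C n\<^esub> u \<in> cr n"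
      using end_smult[OF e a] M.smult_closed[OF a] by simp_all
    then show "a \<odot>\<^bsub>obj C n\<^esub> x \<in> im e n" by simp
  qed
  show "diff C n ` im e n \<subseteq> im e (n - 1)"
  proof
    fix y assume "y \<in> diff C n ` im e n"
    then obtain u where "u \<in> cr n" "y = diff C n (e n u)" by blast
    then have "y = e (n - 1) (diff C n u)" "diff C n u \<in> cr (n - 1)" using end_diff[OF e] diff_closed by simp_all
    then show "y \<in> im e (n - 1)" by simp
  qed
qed

text \<open>The component of c in summand i is e i applied to c.\<close>

lemma internal_direct_sum_idempotents:
  assumes fin: "finite I" and e: "\<And>i. i \<in> I \<Longrightarrow> e i \<in> carrier E" "\<And>i. i \<in> I \<Longrightarrow> e i \<otimes>\<^bsub>E\<^esub> e i = e i"
    and orth: "\<And>i j. i \<in> I \<Longrightarrow> j \<in> I \<Longrightarrow> i \<noteq> j \<Longrightarrow> e i \<otimes>\<^bsub>E\<^esub> e j = \<zero>\<^bsub>E\<^esub>"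
    and sum: "(\<Oplus>\<^bsub>E\<^esub>i\<in>I. e i) = \<one>\<^bsub>E\<^esub>"
  shows "internal_direct_sum A C I (\<lambda>i. im (e i))"
  unfolding internal_direct_sum_def
proof (intro conjI ballI allI)
  show "finite I" by (rule fin)
  show "subcomplex A C (im (e i))" if "i \<in> I" for i using that e by (intro subcomplex_im)
  fix n c assume c: "c \<in> cr n"
  have eP: "e \<in> I \<rightarrow> carrier E" using e by blast
  have "c = (\<Oplus>\<^bsub>obj C n\<^esub>i\<in>I. e i n c)"
    using finsum_E_apply[OF fin eP c] sum c by (simp add: E_simps)
  also have "\<dots> = (\<Oplus>\<^bsub>obj C n\<^esub>i\<in>I. (\<lambda>i\<in>I. e i n c) i)"
    using e(1) c end_closed by (intro M.M.finsum_cong') auto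
  finally have c1: "c = (\<Oplus>\<^bsub>obj C n\<^esub>i\<in>I. (\<lambda>i\<in>I. e i n c) i)" .
  show "\<exists>!f. f \<in> (\<Pi>\<^sub>E i\<in>I. im (e i) n) \<and> c = (\<Oplus>\<^bsub>obj C n\<^esub>i\<in>I. f i)"
  proof (rule ex1I[of _ "\<lambda>i\<in>I. e i n c"])
    show "(\<lambda>i\<in>I. e i n c) \<in> (\<Pi>\<^sub>E i\<in>I. im (e i) n) \<and> c = (\<Oplus>\<^bsub>obj C n\<^esub>i\<in>I. (\<lambda>i\<in>I. e i n c) i)"
      using c c1 by auto
  next
    fix f assume f: "f \<in> (\<Pi>\<^sub>E i\<in>I. im (e i) n) \<and> c = (\<Oplus>\<^bsub>obj C n\<^esub>i\<in>I. f i)"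
    then have fim: "\<And>i. i \<in> I \<Longrightarrow> f i \<in> im (e i) n" and fext: "f \<in> extensional I" by (auto simp: PiE_def)
    have fi: "f i \<in> cr n" "e i n (f i) = f i" if "i \<in> I" for i
      using fim[OF that] unfolding im_iff[OF e[OF that]] by simp_all
    show "f = (\<lambda>i\<in>I. e i n c)"
    proof (rule extensionalityI[OF fext])
      fix j assume j: "j \<in> I"
      \<comment> \<open>Applying e j to any decomposition of c isolates its j-th component, by
        orthogonality.\<close>
      have "e j n c = (\<Oplus>\<^bsub>obj C n\<^esub>i\<in>I. e j n (f i))"
        using end_finsum[OF e(1)[OF j] fin, of f n] fi f by (simp add: Pi_iff)
      also have "\<dots> = (\<Oplus>\<^bsub>obj C n\<^esub>i\<in>I. if j = i then f i else \<zero>\<^bsub>obj C n\<^esub>)"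
      proof (rule M.M.finsum_cong')
        fix i assume i: "i \<in> I"
        show "e j n (f i) = (if j = i then f i else \<zero>\<^bsub>obj C n\<^esub>)"
        proof (cases "j = i")
          case False
          have "e j n (f i) = e j n (e i n (f i))" using fi(2)[OF i] by simp
          also have "\<dots> = (e j \<otimes>\<^bsub>E\<^esub> e i) n (f i)" using fi(1)[OF i] by (simp add: E_simps)
          also have "\<dots> = \<zero>\<^bsub>obj C n\<^esub>" using orth[OF j i False] fi(1)[OF i] by (simp add: E_simps)
          finally show ?thesis using False by simp
        qed (use fi(2)[OF i] in simp)
      qed (use fi in auto)
      also have "\<dots> = f j" using fin j fi by (intro M.M.add.finprod_singleton) auto
      finally show "f j = (\<lambda>i\<in>I. e i n c) j" using j by simp
    qed simp
  qed
qed

text \<open>The converse for two summands: the projections along the decomposition are endomorphisms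
  of the complex, because uniqueness of components forces them to be additive, A-linear and
  compatible with the differential.\<close>

lemma internal_direct_sum_bool:
  fixes D :: "bool \<Rightarrow> int \<Rightarrow> 'm set"
  assumes D: "internal_direct_sum A C UNIV D"
  obtains f g where "f \<in> carrier E" "g \<in> carrier E" "f \<otimes>\<^bsub>E\<^esub> f = f" "g \<otimes>\<^bsub>E\<^esub> g = g"
    "f \<otimes>\<^bsub>E\<^esub> g = \<zero>\<^bsub>E\<^esub>" "g \<otimes>\<^bsub>E\<^esub> f = \<zero>\<^bsub>E\<^esub>" "f \<oplus>\<^bsub>E\<^esub> g = \<one>\<^bsub>E\<^esub>"
    "\<And>n. D True n = im f n" "\<And>n. D False n = im g n"
proof -
  have sub: "subcomplex A C (D b)" for b using D by (simp add: internal_direct_sum_def)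
  note d = subcomplexD[OF sub]
  have ex1: "\<exists>!f. f \<in> (\<Pi>\<^sub>E i\<in>UNIV. D i n) \<and> c = (\<Oplus>\<^bsub>obj C n\<^esub>i\<in>UNIV. f i)" if "c \<in> cr n" for c n
    using D that by (simp add: internal_direct_sum_def)
  have sum: "(\<Oplus>\<^bsub>obj C n\<^esub>i\<in>UNIV. f i) = f True \<oplus>\<^bsub>obj C n\<^esub> f False"
    if "f True \<in> cr n" "f False \<in> cr n" for f :: "bool \<Rightarrow> 'm" and n
  proof -
    have "(\<Oplus>\<^bsub>obj C n\<^esub>i\<in>UNIV. f i) = (\<Oplus>\<^bsub>obj C n\<^esub>i\<in>insert True (insert False {}). f i)" by (simp add: UNIV_bool insert_commute)
    also have "\<dots> = f True \<oplus>\<^bsub>obj C n\<^esub> f False" using that by (simp add: M.M.finsum_insert)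
    finally show ?thesis .
  qed
  define comp where "comp n c = (THE f. f \<in> (\<Pi>\<^sub>E i\<in>UNIV. D i n) \<and> c = (\<Oplus>\<^bsub>obj C n\<^esub>i\<in>UNIV. f i))" for n c
  define a where "a n c = comp n c True" for n c
  define b where "b n c = comp n c False" for n c
  have ab: "a n c \<in> D True n" "b n c \<in> D False n" "c = a n c \<oplus>\<^bsub>obj C n\<^esub> b n c" if c: "c \<in> cr n" for n c
  proof -
    have p: "comp n c \<in> (\<Pi>\<^sub>E i\<in>UNIV. D i n)" "c = (\<Oplus>\<^bsub>obj C n\<^esub>i\<in>UNIV. comp n c i)"
      using theI'[OF ex1[OF c]] unfolding comp_def by simp_all
    show 1: "a n c \<in> D True n" "b n c \<in> D False n" using p(1) by (auto simp: a_def b_def)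
    show "c = a n c \<oplus>\<^bsub>obj C n\<^esub> b n c"
      using p(2) sum[of "comp n c" n] d(1)[OF 1(1)] d(1)[OF 1(2)] by (simp add: a_def b_def)
  qed
  \<comment> \<open>The form of uniqueness used from here on: components are read off from any
    splitting into members of the two summands.\<close>
  have uniq: "a n (x \<oplus>\<^bsub>obj C n\<^esub> y) = x" "b n (x \<oplus>\<^bsub>obj C n\<^esub> y) = y" if x: "x \<in> D True n" and y: "y \<in> D False n" for n x y
  proof -
    have c: "x \<in> cr n" "y \<in> cr n" "x \<oplus>\<^bsub>obj C n\<^esub> y \<in> cr n" using d(1)[OF x] d(1)[OF y] by auto
    define h where "h i = (if i then x else y)" for i
    have "h \<in> (\<Pi>\<^sub>E i\<in>UNIV. D i n) \<and> x \<oplus>\<^bsub>obj C n\<^esub> y = (\<Oplus>\<^bsub>obj C n\<^esub>i\<in>UNIV. h i)"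
      using x y c sum[of h n] by (auto simp: h_def PiE_iff)
    then have "comp n (x \<oplus>\<^bsub>obj C n\<^esub> y) = h"
      unfolding comp_def by (intro the1_equality ex1 c(3))
    then show "a n (x \<oplus>\<^bsub>obj C n\<^esub> y) = x" "b n (x \<oplus>\<^bsub>obj C n\<^esub> y) = y" by (simp_all add: a_def b_def h_def)
  qed
  have ac: "a n c \<in> cr n" "b n c \<in> cr n" if "c \<in> cr n" for n c using ab[OF that] d(1) by blast+
  have at: "a n x = x" "b n x = \<zero>\<^bsub>obj C n\<^esub>" if "x \<in> D True n" for n x
    using uniq[OF that d(2)[of n False]] d(1)[OF that] by simp_all
  have bt: "a n x = \<zero>\<^bsub>obj C n\<^esub>" "b n x = x" if "x \<in> D False n" for n x
    using uniq[OF d(2)[of n True] that] d(1)[OF that] by simp_all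
  have add: "a n (x \<oplus>\<^bsub>obj C n\<^esub> y) = a n x \<oplus>\<^bsub>obj C n\<^esub> a n y \<and> b n (x \<oplus>\<^bsub>obj C n\<^esub> y) = b n x \<oplus>\<^bsub>obj C n\<^esub> b n y"
    if x: "x \<in> cr n" and y: "y \<in> cr n" for n x y
  proof -
    have "x \<oplus>\<^bsub>obj C n\<^esub> y = (a n x \<oplus>\<^bsub>obj C n\<^esub> b n x) \<oplus>\<^bsub>obj C n\<^esub> (a n y \<oplus>\<^bsub>obj C n\<^esub> b n y)"
      using ab(3)[OF x] ab(3)[OF y] by simp
    also have "\<dots> = (a n x \<oplus>\<^bsub>obj C n\<^esub> a n y) \<oplus>\<^bsub>obj C n\<^esub> (b n x \<oplus>\<^bsub>obj C n\<^esub> b n y)"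
      using ac[OF x] ac[OF y] by (simp add: M.M.a_ac)
    finally have "x \<oplus>\<^bsub>obj C n\<^esub> y = (a n x \<oplus>\<^bsub>obj C n\<^esub> a n y) \<oplus>\<^bsub>obj C n\<^esub> (b n x \<oplus>\<^bsub>obj C n\<^esub> b n y)" .
    then show ?thesis
      using uniq[OF d(3)[OF ab(1)[OF x] ab(1)[OF y]] d(3)[OF ab(2)[OF x] ab(2)[OF y]]] by simp
  qed
  have sm: "a n (r \<odot>\<^bsub>obj C n\<^esub> x) = r \<odot>\<^bsub>obj C n\<^esub> a n x \<and> b n (r \<odot>\<^bsub>obj C n\<^esub> x) = r \<odot>\<^bsub>obj C n\<^esub> b n x"
    if r: "r \<in> carrier A" and x: "x \<in> cr n" for n r x
  proof -
    have "r \<odot>\<^bsub>obj C n\<^esub> (a n x \<oplus>\<^bsub>obj C n\<^esub> b n x) = r \<odot>\<^bsub>obj C n\<^esub> a n x \<oplus>\<^bsub>obj C n\<^esub> r \<odot>\<^bsub>obj C n\<^esub> b n x"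
      using ac[OF x] r by (simp add: M.smult_r_distr)
    then show ?thesis
      using uniq[OF d(5)[OF r ab(1)[OF x]] d(5)[OF r ab(2)[OF x]]] ab(3)[OF x] by simp
  qed
  have df: "a (n - 1) (diff C n x) = diff C n (a n x) \<and> b (n - 1) (diff C n x) = diff C n (b n x)"
    if x: "x \<in> cr n" for n x
  proof -
    have "diff C n (a n x \<oplus>\<^bsub>obj C n\<^esub> b n x) = diff C n (a n x) \<oplus>\<^bsub>obj C (n - 1)\<^esub> diff C n (b n x)"
      using ac[OF x] by (simp add: diff_add)
    then show ?thesis
      using uniq[OF d(6)[OF ab(1)[OF x]] d(6)[OF ab(2)[OF x]]] ab(3)[OF x] by simp
  qed
  define f where "f = (\<lambda>n. \<lambda>x\<in>cr n. a n x)"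
  define g where "g = (\<lambda>n. \<lambda>x\<in>cr n. b n x)"
  have fE: "f \<in> carrier E" unfolding f_def by (rule endI) (simp_all add: ac add sm df)
  have gE: "g \<in> carrier E" unfolding g_def by (rule endI) (simp_all add: ac add sm df)
  have fx: "f n x = a n x" and gx: "g n x = b n x" if "x \<in> cr n" for n x using that by (simp_all add: f_def g_def)
  show thesis
  proof (rule that[OF fE gE])
    show "f \<otimes>\<^bsub>E\<^esub> f = f" using fE by (intro end_eqI) (simp_all add: E_simps fx ac at ab)
    show "g \<otimes>\<^bsub>E\<^esub> g = g" using gE by (intro end_eqI) (simp_all add: E_simps gx ac bt ab)
    show "f \<otimes>\<^bsub>E\<^esub> g = \<zero>\<^bsub>E\<^esub>" using fE gE by (intro end_eqI) (simp_all add: E_simps fx gx ac bt ab)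
    show "g \<otimes>\<^bsub>E\<^esub> f = \<zero>\<^bsub>E\<^esub>" using fE gE by (intro end_eqI) (simp_all add: E_simps fx gx ac at ab)
    show "f \<oplus>\<^bsub>E\<^esub> g = \<one>\<^bsub>E\<^esub>" using fE gE by (intro end_eqI) (simp_all add: E_simps fx gx ab(3)[symmetric])
    show "D True n = im f n" for n
    proof (intro equalityI subsetI)
      fix x assume x: "x \<in> D True n"
      then have "x = f n x" "x \<in> cr n" using at(1)[OF x] fx d(1)[OF x] by simp_all
      then show "x \<in> im f n" by (rule image_eqI)
    qed (auto simp: fx ab)
    show "D False n = im g n" for n
    proof (intro equalityI subsetI)
      fix x assume x: "x \<in> D False n"
      then have "x = g n x" "x \<in> cr n" using bt(2)[OF x] gx d(1)[OF x] by simp_all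
      then show "x \<in> im g n" by (rule image_eqI)
    qed (auto simp: gx ab)
  qed
qed

lemma im_zero_imp:
  assumes "e \<in> carrier E" "\<And>n. im e n = {\<zero>\<^bsub>obj C n\<^esub>}"
  shows "e = \<zero>\<^bsub>E\<^esub>"
proof (rule end_eqI[OF assms(1) E_zero_closed])
  fix n x assume "x \<in> cr n"
  then have "e n x \<in> im e n" by simp
  then show "e n x = \<zero>\<^bsub>E\<^esub> n x" using assms(2)[of n] \<open>x \<in> cr n\<close> by (simp add: E_simps)
qed

text \<open>The images of e and of 1 - e decompose C, and an endomorphism whose image is zero is
  zero.\<close>

lemma indecomposable_idempotents:
  assumes ind: "indecomposable_complex A C" and e: "e \<in> carrier E" "e \<otimes>\<^bsub>E\<^esub> e = e"
  shows "e = \<zero>\<^bsub>E\<^esub> \<or> e = \<one>\<^bsub>E\<^esub>"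
proof -
  define f where "f b = (if b then e else \<one>\<^bsub>E\<^esub> \<ominus>\<^bsub>E\<^esub> e)" for b
  have c: "f b \<in> carrier E" for b using e by (simp add: f_def)
  have 1: "(\<one>\<^bsub>E\<^esub> \<ominus>\<^bsub>E\<^esub> e) \<otimes>\<^bsub>E\<^esub> e = \<zero>\<^bsub>E\<^esub>" "e \<otimes>\<^bsub>E\<^esub> (\<one>\<^bsub>E\<^esub> \<ominus>\<^bsub>E\<^esub> e) = \<zero>\<^bsub>E\<^esub>"
    using e by (simp_all add: E.minus_eq E.l_distr E.r_distr E.l_minus E.r_minus E.r_neg)
  have 2: "(\<one>\<^bsub>E\<^esub> \<ominus>\<^bsub>E\<^esub> e) \<otimes>\<^bsub>E\<^esub> (\<one>\<^bsub>E\<^esub> \<ominus>\<^bsub>E\<^esub> e) = \<one>\<^bsub>E\<^esub> \<ominus>\<^bsub>E\<^esub> e"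
    using e 1 by (simp add: E.minus_eq E.r_distr E.r_minus)
  have s: "(\<Oplus>\<^bsub>E\<^esub>b\<in>UNIV. f b) = \<one>\<^bsub>E\<^esub>"
  proof -
    have "(\<Oplus>\<^bsub>E\<^esub>b\<in>UNIV. f b) = (\<Oplus>\<^bsub>E\<^esub>b\<in>insert True (insert False {}). f b)" by (simp add: UNIV_bool insert_commute)
    also have "\<dots> = f True \<oplus>\<^bsub>E\<^esub> f False" using c[of True] c[of False] by (simp add: E.finsum_insert)
    also have "\<dots> = \<one>\<^bsub>E\<^esub>" using e by (simp add: f_def E.minus_eq E.a_lcomm[of e] E.r_neg)
    finally show ?thesis .
  qed
  have "internal_direct_sum A C UNIV (\<lambda>b. im (f b))"
  proof (rule internal_direct_sum_idempotents[OF _ c _ _ s])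
    show "f i \<otimes>\<^bsub>E\<^esub> f i = f i" for i using e 2 by (simp add: f_def)
    show "f i \<otimes>\<^bsub>E\<^esub> f j = \<zero>\<^bsub>E\<^esub>" if "i \<noteq> j" for i j using that 1 by (simp add: f_def)
  qed simp
  then obtain b where b: "\<And>n. im (f b) n = {\<zero>\<^bsub>obj C n\<^esub>}"
    using ind unfolding indecomposable_complex_def by blast
  have "f b = \<zero>\<^bsub>E\<^esub>" by (rule im_zero_imp[OF c b])
  then show ?thesis
    using e E.minus_zero_imp_eq[of "\<one>\<^bsub>E\<^esub>" e] by (cases b) (simp_all add: f_def)
qed

text \<open>A decomposition of the image of e gives idempotent endomorphisms \<open>f1\<close>,
  \<open>g1\<close> of that image. Composed with e they become orthogonal idempotents of C with sum
  e, so primitivity applies.\<close>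

lemma indecomposable_restrict_primitive:
  assumes e: "e \<in> carrier E" "e \<otimes>\<^bsub>E\<^esub> e = e" "e \<noteq> \<zero>\<^bsub>E\<^esub>"
    and prim: "\<And>f g. f \<in> carrier E \<Longrightarrow> g \<in> carrier E \<Longrightarrow> f \<otimes>\<^bsub>E\<^esub> f = f \<Longrightarrow> g \<otimes>\<^bsub>E\<^esub> g = g \<Longrightarrow>
      f \<otimes>\<^bsub>E\<^esub> g = \<zero>\<^bsub>E\<^esub> \<Longrightarrow> g \<otimes>\<^bsub>E\<^esub> f = \<zero>\<^bsub>E\<^esub> \<Longrightarrow> f \<oplus>\<^bsub>E\<^esub> g = e \<Longrightarrow> f = \<zero>\<^bsub>E\<^esub> \<or> g = \<zero>\<^bsub>E\<^esub>"
  shows "indecomposable_complex A (restrict_complex C (im e))"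
proof -
  let ?S = "restrict_complex C (im e)"
  have sub: "subcomplex A C (im e)" by (rule subcomplex_im[OF e(1)])
  interpret S: chain_complex A ?S by (rule chain_complex_restrict[OF sub])
  note d = subcomplexD[OF sub]
  have e_im: "e n x \<in> im e n" if "x \<in> cr n" for n x using that by simp
  show ?thesis
    unfolding indecomposable_complex_def
  proof (intro conjI allI impI)
    show "chain_complex A ?S" by (rule S.chain_complex_axioms)
    show "\<exists>n. carrier (obj ?S n) \<noteq> {\<zero>\<^bsub>obj ?S n\<^esub>}"
      using im_zero_imp[OF e(1)] e(3) by auto
    fix D :: "bool \<Rightarrow> int \<Rightarrow> 'm set" assume "internal_direct_sum A ?S UNIV D"
    then obtain f1 g1 where fg1: "f1 \<in> carrier S.E" "g1 \<in> carrier S.E" "f1 \<otimes>\<^bsub>S.E\<^esub> f1 = f1" "g1 \<otimes>\<^bsub>S.E\<^esub> g1 = g1"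
      "f1 \<otimes>\<^bsub>S.E\<^esub> g1 = \<zero>\<^bsub>S.E\<^esub>" "g1 \<otimes>\<^bsub>S.E\<^esub> f1 = \<zero>\<^bsub>S.E\<^esub>" "f1 \<oplus>\<^bsub>S.E\<^esub> g1 = \<one>\<^bsub>S.E\<^esub>"
      "\<And>n. D True n = f1 n ` im e n" "\<And>n. D False n = g1 n ` im e n"
      by (rule S.internal_direct_sum_bool) simp
    \<comment> \<open>The map e projects C onto its image, so h after e extends an endomorphism of
      the image to all of C.\<close>
    have lift: "(\<lambda>n. \<lambda>x\<in>cr n. h n (e n x)) \<in> carrier E" if h: "h \<in> carrier S.E" for h
    proof (rule endI)
      fix n x assume x: "x \<in> cr n"
      show "h n (e n x) \<in> cr n" using S.end_closed[OF h, of "e n x" n] x d(1) by simp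
      show "h (n - 1) (e (n - 1) (diff C n x)) = diff C n (h n (e n x))"
        using S.end_diff[OF h, of "e n x" n] x end_diff[OF e(1) x] by simp
    next
      fix n x y assume "x \<in> cr n" "y \<in> cr n"
      then show "h n (e n (x \<oplus>\<^bsub>obj C n\<^esub> y)) = h n (e n x) \<oplus>\<^bsub>obj C n\<^esub> h n (e n y)"
        using S.end_add[OF h, of "e n x" n "e n y"] end_add[OF e(1)] by simp
    next
      fix n a x assume "a \<in> carrier A" "x \<in> cr n"
      then show "h n (e n (a \<odot>\<^bsub>obj C n\<^esub> x)) = a \<odot>\<^bsub>obj C n\<^esub> h n (e n x)"
        using S.end_smult[OF h, of a "e n x" n] end_smult[OF e(1)] by simp
    qed
    define f where "f = (\<lambda>n. \<lambda>x\<in>cr n. f1 n (e n x))"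
    define g where "g = (\<lambda>n. \<lambda>x\<in>cr n. g1 n (e n x))"
    have fE: "f \<in> carrier E" and gE: "g \<in> carrier E" using lift fg1(1,2) by (simp_all add: f_def g_def)
    have fx: "f n x = f1 n (e n x)" and gx: "g n x = g1 n (e n x)" if "x \<in> cr n" for n x
      using that by (simp_all add: f_def g_def)
    have S_im: "h n (e n x) \<in> im e n" "e n (h n (e n x)) = h n (e n x)" "h n (e n x) \<in> cr n"
      if h: "h \<in> carrier S.E" and x: "x \<in> cr n" for h n x
    proof -
      show 1: "h n (e n x) \<in> im e n" using S.end_closed[OF h, of "e n x" n] x by simp
      then show "e n (h n (e n x)) = h n (e n x)" "h n (e n x) \<in> cr n" using im_iff[OF e(1,2)] by blast+
    qed
    have comp: "h n (e n (k n (e n x))) = (h \<otimes>\<^bsub>S.E\<^esub> k) n (e n x)" if "x \<in> cr n" "k \<in> carrier S.E" for h k n x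
      using S.E_simps(1)[of "e n x" n h k] S_im(2)[OF that(2,1)] that(1) by simp
    have "f = \<zero>\<^bsub>E\<^esub> \<or> g = \<zero>\<^bsub>E\<^esub>"
    proof (rule prim[OF fE gE])
      show "f \<otimes>\<^bsub>E\<^esub> f = f"
      proof (rule end_eqI)
        fix n x assume x: "x \<in> cr n"
        show "(f \<otimes>\<^bsub>E\<^esub> f) n x = f n x"
          unfolding E_simps(1)[OF x] fx[OF x] fx[OF S_im(3)[OF fg1(1) x]] comp[OF x fg1(1)] fg1(3) ..
      qed (use fE in auto)
      show "g \<otimes>\<^bsub>E\<^esub> g = g"
      proof (rule end_eqI)
        fix n x assume x: "x \<in> cr n"
        show "(g \<otimes>\<^bsub>E\<^esub> g) n x = g n x"
          unfolding E_simps(1)[OF x] gx[OF x] gx[OF S_im(3)[OF fg1(2) x]] comp[OF x fg1(2)] fg1(4) ..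
      qed (use gE in auto)
      show "f \<otimes>\<^bsub>E\<^esub> g = \<zero>\<^bsub>E\<^esub>"
      proof (rule end_eqI)
        fix n x assume x: "x \<in> cr n"
        show "(f \<otimes>\<^bsub>E\<^esub> g) n x = \<zero>\<^bsub>E\<^esub> n x"
          unfolding E_simps(1)[OF x] gx[OF x] fx[OF S_im(3)[OF fg1(2) x]] comp[OF x fg1(2)] fg1(5)
          using x by (simp add: S.E_simps E_simps)
      qed (use fE gE in auto)
      show "g \<otimes>\<^bsub>E\<^esub> f = \<zero>\<^bsub>E\<^esub>"
      proof (rule end_eqI)
        fix n x assume x: "x \<in> cr n"
        show "(g \<otimes>\<^bsub>E\<^esub> f) n x = \<zero>\<^bsub>E\<^esub> n x"
          unfolding E_simps(1)[OF x] fx[OF x] gx[OF S_im(3)[OF fg1(1) x]] comp[OF x fg1(1)] fg1(6)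
          using x by (simp add: S.E_simps E_simps)
      qed (use fE gE in auto)
      show "f \<oplus>\<^bsub>E\<^esub> g = e"
      proof (rule end_eqI)
        fix n x assume x: "x \<in> cr n"
        have "(f \<oplus>\<^bsub>E\<^esub> g) n x = (f1 \<oplus>\<^bsub>S.E\<^esub> g1) n (e n x)" using x by (simp add: E_simps S.E_simps fx gx)
        also have "\<dots> = e n x" using x fg1(7) by (simp add: S.E_simps)
        finally show "(f \<oplus>\<^bsub>E\<^esub> g) n x = e n x" .
      qed (use fE gE e in auto)
    qed
    then show "\<exists>b. \<forall>n. D b n = {\<zero>\<^bsub>obj ?S n\<^esub>}"
    proof
      assume f0: "f = \<zero>\<^bsub>E\<^esub>"
      have "D True n = {\<zero>\<^bsub>obj C n\<^esub>}" for n
      proof -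
        have "f1 n ` im e n = (\<lambda>x. f n x) ` cr n" by (auto simp: fx)
        also have "\<dots> = {\<zero>\<^bsub>obj C n\<^esub>}" using M.M.zero_closed[of n] by (force simp: f0 E_simps)
        finally show ?thesis using fg1(8) by simp
      qed
      then show ?thesis by (intro exI[of _ True]) simp
    next
      assume g0: "g = \<zero>\<^bsub>E\<^esub>"
      have "D False n = {\<zero>\<^bsub>obj C n\<^esub>}" for n
      proof -
        have "g1 n ` im e n = (\<lambda>x. g n x) ` cr n" by (auto simp: gx)
        also have "\<dots> = {\<zero>\<^bsub>obj C n\<^esub>}" using M.M.zero_closed[of n] by (force simp: g0 E_simps)
        finally show ?thesis using fg1(9) by simp
      qed
      then show ?thesis by (intro exI[of _ False]) simp
    qed
  qed
qed

text \<open>With h the isomorphism of the images, u is h after e, and v is the inverse of h after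
  f.\<close>

lemma complex_iso_idempotents:
  assumes e: "e \<in> carrier E" "e \<otimes>\<^bsub>E\<^esub> e = e" and f: "f \<in> carrier E" "f \<otimes>\<^bsub>E\<^esub> f = f"
    and iso: "complex_iso A (restrict_complex C (im e)) (restrict_complex C (im f))"
  obtains u v where "u \<in> carrier E" "v \<in> carrier E" "v \<otimes>\<^bsub>E\<^esub> u = e" "u \<otimes>\<^bsub>E\<^esub> v = f"
proof -
  note de = subcomplexD[OF subcomplex_im[OF e(1)]]
  note df = subcomplexD[OF subcomplex_im[OF f(1)]]
  obtain h where h: "\<And>n. h n \<in> left_module_hom A (obj (restrict_complex C (im e)) n) (obj (restrict_complex C (im f)) n)"
    "\<And>n. bij_betw (h n) (im e n) (im f n)"
    "\<And>n x. x \<in> im e n \<Longrightarrow> h (n - 1) (diff C n x) = diff C n (h n x)"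
    using iso unfolding complex_iso_def by auto
  have hc: "h n x \<in> im f n" and hadd: "y \<in> im e n \<Longrightarrow> h n (x \<oplus>\<^bsub>obj C n\<^esub> y) = h n x \<oplus>\<^bsub>obj C n\<^esub> h n y"
    and hsm: "a \<in> carrier A \<Longrightarrow> h n (a \<odot>\<^bsub>obj C n\<^esub> x) = a \<odot>\<^bsub>obj C n\<^esub> h n x" if "x \<in> im e n" for n x y a
    using h(1)[of n] that unfolding left_module_hom_def by auto
  define k where "k n = the_inv_into (im e n) (h n)" for n
  have kh: "k n (h n x) = x" if "x \<in> im e n" for n x
    unfolding k_def using h(2)[of n] that by (intro the_inv_into_f_f) (auto simp: bij_betw_def)
  have hk: "h n (k n y) = y" and kc: "k n y \<in> im e n" if "y \<in> im f n" for n y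
    unfolding k_def using h(2)[of n] that
    by (auto intro: f_the_inv_into_f_bij_betw bij_betwE[OF bij_betw_the_inv_into, THEN bspec])
  \<comment> \<open>Used to transfer the properties of h to its inverse: a value of \<open>k\<close>
    is found by exhibiting a preimage under h.\<close>
  have kI: "k n y = x" if "x \<in> im e n" "h n x = y" for n x y using kh[OF that(1)] that(2) by simp
  have e_im: "e n x \<in> im e n" and f_im: "f n x \<in> im f n" if "x \<in> cr n" for n x using that by simp_all
  define u where "u = (\<lambda>n. \<lambda>x\<in>cr n. h n (e n x))"
  define v where "v = (\<lambda>n. \<lambda>x\<in>cr n. k n (f n x))"
  have uE: "u \<in> carrier E"
    unfolding u_def
  proof (rule endI)
    fix n x assume x: "x \<in> cr n"
    show "h n (e n x) \<in> cr n" by (rule df(1)[OF hc[OF e_im[OF x]]])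
    show "h (n - 1) (e (n - 1) (diff C n x)) = diff C n (h n (e n x))"
      using h(3)[OF e_im[OF x]] end_diff[OF e(1) x] by simp
  qed (simp_all add: end_add[OF e(1)] end_smult[OF e(1)] hadd hsm e_im)
  have vE: "v \<in> carrier E"
    unfolding v_def
  proof (rule endI)
    fix n x assume x: "x \<in> cr n"
    show "k n (f n x) \<in> cr n" by (rule de(1)[OF kc[OF f_im[OF x]]])
    have "h (n - 1) (diff C n (k n (f n x))) = diff C n (f n x)"
      using h(3)[OF kc[OF f_im[OF x]]] hk[OF f_im[OF x]] by simp
    then have "k (n - 1) (diff C n (f n x)) = diff C n (k n (f n x))"
      by (rule kI[OF de(6)[OF kc[OF f_im[OF x]]]])
    then show "k (n - 1) (f (n - 1) (diff C n x)) = diff C n (k n (f n x))"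
      using end_diff[OF f(1) x] by simp
  next
    fix n x y assume x: "x \<in> cr n" and y: "y \<in> cr n"
    have "h n (k n (f n x) \<oplus>\<^bsub>obj C n\<^esub> k n (f n y)) = f n (x \<oplus>\<^bsub>obj C n\<^esub> y)"
      using hadd[OF kc[OF f_im[OF x]] kc[OF f_im[OF y]]] hk[OF f_im[OF x]] hk[OF f_im[OF y]] end_add[OF f(1) x y] by simp
    then show "k n (f n (x \<oplus>\<^bsub>obj C n\<^esub> y)) = k n (f n x) \<oplus>\<^bsub>obj C n\<^esub> k n (f n y)"
      by (rule kI[OF de(3)[OF kc[OF f_im[OF x]] kc[OF f_im[OF y]]]])
  next
    fix n a x assume a: "a \<in> carrier A" and x: "x \<in> cr n"
    have "h n (a \<odot>\<^bsub>obj C n\<^esub> k n (f n x)) = f n (a \<odot>\<^bsub>obj C n\<^esub> x)"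
      using hsm[OF kc[OF f_im[OF x]] a] hk[OF f_im[OF x]] end_smult[OF f(1) a x] by simp
    then show "k n (f n (a \<odot>\<^bsub>obj C n\<^esub> x)) = a \<odot>\<^bsub>obj C n\<^esub> k n (f n x)"
      by (rule kI[OF de(5)[OF a kc[OF f_im[OF x]]]])
  qed
  show thesis
  proof (rule that[OF uE vE])
    show "v \<otimes>\<^bsub>E\<^esub> u = e"
    proof (rule end_eqI)
      fix n x assume x: "x \<in> cr n"
      have 1: "h n (e n x) \<in> im f n" by (rule hc[OF e_im[OF x]])
      then have "h n (e n x) \<in> cr n" "f n (h n (e n x)) = h n (e n x)" using im_iff[OF f] by blast+
      then show "(v \<otimes>\<^bsub>E\<^esub> u) n x = e n x" using x kh[OF e_im[OF x]] by (simp add: E_simps u_def v_def)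
    qed (use uE vE e in auto)
    show "u \<otimes>\<^bsub>E\<^esub> v = f"
    proof (rule end_eqI)
      fix n x assume x: "x \<in> cr n"
      have 1: "k n (f n x) \<in> im e n" by (rule kc[OF f_im[OF x]])
      then have "k n (f n x) \<in> cr n" "e n (k n (f n x)) = k n (f n x)" using im_iff[OF e] by blast+
      then show "(u \<otimes>\<^bsub>E\<^esub> v) n x = f n x" using x hk[OF f_im[OF x]] by (simp add: E_simps u_def v_def)
    qed (use uE vE f in auto)
  qed
qed

end

section \<open>Additive maps, finite sums, and the additive nature of the p-adic notions\<close>

text \<open>Collects what follows from additivity alone, since the maps concerned (pure tensors in
  one argument, coordinate maps, differentials, scalar multiplications) are linear over different
  rings.\<close>

lemma additive_map_minus:
  assumes G: "abelian_group G" and H: "abelian_group H"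
    and closed: "\<And>x. x \<in> carrier G \<Longrightarrow> f x \<in> carrier H"
    and add: "\<And>x y. x \<in> carrier G \<Longrightarrow> y \<in> carrier G \<Longrightarrow> f (x \<oplus>\<^bsub>G\<^esub> y) = f x \<oplus>\<^bsub>H\<^esub> f y"
  shows "f \<zero>\<^bsub>G\<^esub> = \<zero>\<^bsub>H\<^esub>"
    and "x \<in> carrier G \<Longrightarrow> y \<in> carrier G \<Longrightarrow> f (x \<ominus>\<^bsub>G\<^esub> y) = f x \<ominus>\<^bsub>H\<^esub> f y"
    and "x \<in> carrier G \<Longrightarrow> f ([(n::nat)] \<cdot>\<^bsub>G\<^esub> x) = [n] \<cdot>\<^bsub>H\<^esub> f x"
    and "finite I \<Longrightarrow> g \<in> I \<rightarrow> carrier G \<Longrightarrow> f (\<Oplus>\<^bsub>G\<^esub>i\<in>I. g i) = (\<Oplus>\<^bsub>H\<^esub>i\<in>I. f (g i))"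
proof -
  interpret G: abelian_group G by (rule G)
  interpret H: abelian_group H by (rule H)
  have "f \<zero>\<^bsub>G\<^esub> = f \<zero>\<^bsub>G\<^esub> \<oplus>\<^bsub>H\<^esub> f \<zero>\<^bsub>G\<^esub>" using add[of "\<zero>\<^bsub>G\<^esub>" "\<zero>\<^bsub>G\<^esub>"] by simp
  then show zero: "f \<zero>\<^bsub>G\<^esub> = \<zero>\<^bsub>H\<^esub>"
    using closed[OF G.zero_closed] H.add.l_cancel_one'[OF closed[OF G.zero_closed] closed[OF G.zero_closed]] by simp
  have um: "f (\<ominus>\<^bsub>G\<^esub> x) = \<ominus>\<^bsub>H\<^esub> f x" if x: "x \<in> carrier G" for x
  proof -
    have "f (\<ominus>\<^bsub>G\<^esub> x) \<oplus>\<^bsub>H\<^esub> f x = \<zero>\<^bsub>H\<^esub>"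
      using add[of "\<ominus>\<^bsub>G\<^esub> x" x] x zero by (simp add: G.l_neg)
    then show ?thesis using x closed by (intro H.minus_equality[symmetric]) auto
  qed
  show "f (x \<ominus>\<^bsub>G\<^esub> y) = f x \<ominus>\<^bsub>H\<^esub> f y" if "x \<in> carrier G" "y \<in> carrier G"
    using that add um by (simp add: G.minus_eq H.minus_eq)
  show "f ([n] \<cdot>\<^bsub>G\<^esub> x) = [n] \<cdot>\<^bsub>H\<^esub> f x" if x: "x \<in> carrier G"
    by (induction n) (simp_all add: zero x add)
  show "f (\<Oplus>\<^bsub>G\<^esub>i\<in>I. g i) = (\<Oplus>\<^bsub>H\<^esub>i\<in>I. f (g i))" if "finite I" "g \<in> I \<rightarrow> carrier G"
    using that
  proof (induction I rule: finite_induct)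
    case (insert i I)
    have "g i \<in> carrier G" "g \<in> I \<rightarrow> carrier G" using insert.prems by auto
    moreover from this have "(\<lambda>i. f (g i)) \<in> I \<rightarrow> carrier H" using closed by auto
    ultimately show ?case
      using insert closed by (simp add: G.finsum_insert H.finsum_insert add G.finsum_closed)
  qed (simp add: zero)
qed

context abelian_monoid
begin

lemma finsum_mem:
  assumes "finite I" "\<And>i. i \<in> I \<Longrightarrow> f i \<in> N" "N \<subseteq> carrier G" "\<zero> \<in> N"
    "\<And>x y. x \<in> N \<Longrightarrow> y \<in> N \<Longrightarrow> x \<oplus> y \<in> N"
  shows "(\<Oplus>i\<in>I. f i) \<in> N"
  using assms(1,2)
proof (induction I rule: finite_induct)
  case (insert i I)
  have "(\<Oplus>i\<in>insert i I. f i) = f i \<oplus> (\<Oplus>i\<in>I. f i)"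
    using insert assms(3) by (intro finsum_insert) auto
  then show ?case using insert assms(5) by simp
qed (simp add: assms(4))

lemma finsum_swap:
  assumes "finite I" "finite J" "\<And>i j. i \<in> I \<Longrightarrow> j \<in> J \<Longrightarrow> f i j \<in> carrier G"
  shows "(\<Oplus>i\<in>I. \<Oplus>j\<in>J. f i j) = (\<Oplus>j\<in>J. \<Oplus>i\<in>I. f i j)"
  using assms(1,3)
proof (induction I rule: finite_induct)
  case empty
  show ?case by (simp add: finsum_zero)
next
  case (insert a I)
  have c: "(\<lambda>j. f i j) \<in> J \<rightarrow> carrier G" if "i \<in> insert a I" for i using insert.prems that by auto
  have c': "(\<lambda>i. f i j) \<in> I \<rightarrow> carrier G" "f a j \<in> carrier G" if "j \<in> J" for j using insert.prems that by auto
  have "(\<Oplus>i\<in>insert a I. \<Oplus>j\<in>J. f i j) = (\<Oplus>j\<in>J. f a j) \<oplus> (\<Oplus>i\<in>I. \<Oplus>j\<in>J. f i j)"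
    using insert c by (intro finsum_insert) (auto intro: finsum_closed)
  also have "\<dots> = (\<Oplus>j\<in>J. f a j) \<oplus> (\<Oplus>j\<in>J. \<Oplus>i\<in>I. f i j)" using insert by simp
  also have "\<dots> = (\<Oplus>j\<in>J. f a j \<oplus> (\<Oplus>i\<in>I. f i j))"
    using c c' by (intro finsum_addf[symmetric]) (auto intro: finsum_closed)
  also have "\<dots> = (\<Oplus>j\<in>J. \<Oplus>i\<in>insert a I. f i j)"
    using insert c' by (intro finsum_cong') (auto simp: finsum_insert intro!: finsum_closed)
  finally show ?case .
qed

end

lemma (in ideal) finsum_minus_mem:
  assumes "finite S" "\<And>s. s \<in> S \<Longrightarrow> f s \<in> carrier R" "\<And>s. s \<in> S \<Longrightarrow> g s \<in> carrier R" "\<And>s. s \<in> S \<Longrightarrow> f s \<ominus> g s \<in> I"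
  shows "(\<Oplus>s\<in>S. f s) \<ominus> (\<Oplus>s\<in>S. g s) \<in> I"
  using assms
proof (induction S rule: finite_induct)
  case empty
  show ?case by (simp add: minus_eq)
next
  case (insert s S)
  have c: "f \<in> S \<rightarrow> carrier R" "g \<in> S \<rightarrow> carrier R" "f s \<in> carrier R" "g s \<in> carrier R" using insert.prems by auto
  have fc: "finsum R f S \<in> carrier R" "finsum R g S \<in> carrier R" using c by (auto intro: finsum_closed)
  have "(\<Oplus>s\<in>insert s S. f s) \<ominus> (\<Oplus>s\<in>insert s S. g s) = (f s \<ominus> g s) \<oplus> (finsum R f S \<ominus> finsum R g S)"
    using insert.hyps c fc by (simp add: finsum_insert minus_eq minus_add a_ac)
  also have "\<dots> \<in> I"
  proof (rule additive_subgroup.a_closed[OF is_additive_subgroup])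
    show "f s \<ominus> g s \<in> I" using insert.prems(3) by simp
    show "finsum R f S \<ominus> finsum R g S \<in> I" using insert.IH insert.prems by simp
  qed
  finally show ?case .
qed

lemma restrict_scalars_add_pow: "[(n::nat)] \<cdot>\<^bsub>restrict_scalars A M\<^esub> x = [n] \<cdot>\<^bsub>M\<^esub> x"
  by (simp add: add_pow_def nat_pow_def restrict_scalars_def)

lemma restrict_scalars_padic_sum: "padic_sum (restrict_scalars A M) p y n = padic_sum M p y n"
  by (induction n) (simp_all add: restrict_scalars_add_pow, simp_all add: restrict_scalars_def)

text \<open>The three notions see only the additive group, which restriction of scalars leaves
  unchanged.\<close>

lemma restrict_scalars_padic:
  "padic_separated p (restrict_scalars A M) N \<longleftrightarrow> padic_separated p M N"
  "padic_complete p (restrict_scalars A M) N \<longleftrightarrow> padic_complete p M N"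
  "padic_finite p (restrict_scalars A M) N \<longleftrightarrow> padic_finite p M N"
proof -
  have *: "\<zero>\<^bsub>restrict_scalars A M\<^esub> = \<zero>\<^bsub>M\<^esub>" "add (restrict_scalars A M) = add M"
    by (simp_all add: restrict_scalars_def)
  show "padic_separated p (restrict_scalars A M) N \<longleftrightarrow> padic_separated p M N"
    "padic_complete p (restrict_scalars A M) N \<longleftrightarrow> padic_complete p M N"
    "padic_finite p (restrict_scalars A M) N \<longleftrightarrow> padic_finite p M N"
    unfolding padic_separated_def padic_complete_def padic_finite_def
      restrict_scalars_add_pow restrict_scalars_padic_sum * by (rule refl)+
qed

section \<open>Endomorphisms of the extended complex\<close>

locale base_change_cx = base_change R R' A + finite_dual_basis R R' B coord + C: chain_complex A C
  for R R' :: "'r ring" and A :: "('r, 'a) module" and B coord and C :: "('a, 'm) complex_of"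
begin

abbreviation "C' \<equiv> base_change_complex R R' A C"
abbreviation "T n \<equiv> obj C' n"

interpretation M: base_change_mod R R' A "obj C n" for n
  by (intro base_change_mod.intro base_change_axioms C.obj_module)

interpretation D: base_change_hom R R' A "obj C n" "obj C (n - 1)" "diff C n" for n
  by (intro base_change_hom.intro base_change_hom_axioms.intro M.base_change_mod_axioms C.diff_hom)

lemma obj_C': "T n = base_change_module R R' A (obj C n)"
  by (simp add: base_change_complex_def)

lemma diff_C': "diff C' n = tensor_map R R' (restrict_scalars A (obj C (n - 1))) (diff C n)"
  by (rule ext) (simp add: base_change_complex_def tensor_map_def)

abbreviation pr :: "int \<Rightarrow> 'r \<Rightarrow> 'm \<Rightarrow> ('r \<times> 'm \<Rightarrow>\<^sub>0 int) set" where
  "pr n \<equiv> scalar_extension.pure R R' (restrict_scalars A (obj C n))"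

lemma T_group: "abelian_group (T n)"
  unfolding obj_C' by (rule M.PM.abelian_group_T)

interpretation T: abelian_group "T n" for n
  by (rule T_group)

lemma T_module: "left_module A' (T n)"
  unfolding obj_C' by (rule M.left_module_base_change)

interpretation TM: left_module A' "T n" for n
  by (rule T_module)

lemma pr_closed: "x \<in> carrier R' \<Longrightarrow> m \<in> C.cr n \<Longrightarrow> pr n x m \<in> carrier (T n)"
  unfolding obj_C' using M.PM.pure_closed by simp

lemma pr_add_right: "x \<in> carrier R' \<Longrightarrow> m \<in> C.cr n \<Longrightarrow> m' \<in> C.cr n \<Longrightarrow>
    pr n x (m \<oplus>\<^bsub>obj C n\<^esub> m') = pr n x m \<oplus>\<^bsub>T n\<^esub> pr n x m'"
  unfolding obj_C' using M.PM.pure_add_right by simp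

lemma pr_add_left: "x \<in> carrier R' \<Longrightarrow> y \<in> carrier R' \<Longrightarrow> m \<in> C.cr n \<Longrightarrow>
    pr n (x \<oplus>\<^bsub>R'\<^esub> y) m = pr n x m \<oplus>\<^bsub>T n\<^esub> pr n y m"
  unfolding obj_C' using M.PM.pure_add_left by simp

lemma pr_balanced: "x \<in> carrier R' \<Longrightarrow> r \<in> carrier R \<Longrightarrow> m \<in> C.cr n \<Longrightarrow>
    pr n (x \<otimes>\<^bsub>R'\<^esub> r) m = pr n x ((r \<odot>\<^bsub>A\<^esub> \<one>\<^bsub>A\<^esub>) \<odot>\<^bsub>obj C n\<^esub> m)"
  using M.PM.pure_balanced by simp

lemma smult_pr: "x \<in> carrier R' \<Longrightarrow> a \<in> carrier A \<Longrightarrow> y \<in> carrier R' \<Longrightarrow> m \<in> C.cr n \<Longrightarrow>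
    PA.pure x a \<odot>\<^bsub>T n\<^esub> pr n y m = pr n (x \<otimes>\<^bsub>R'\<^esub> y) (a \<odot>\<^bsub>obj C n\<^esub> m)"
  unfolding obj_C' by (rule M.smult_pure)

lemma diff_pr: "x \<in> carrier R' \<Longrightarrow> m \<in> C.cr n \<Longrightarrow> diff C' n (pr n x m) = pr (n - 1) x (diff C n m)"
  unfolding diff_C' by (rule D.f'_pure)

lemma T_induct [consumes 1, case_names pr minus]:
  assumes "U \<in> carrier (T n)" "\<And>x m. x \<in> carrier R' \<Longrightarrow> m \<in> C.cr n \<Longrightarrow> P (pr n x m)"
    "\<And>U V. U \<in> carrier (T n) \<Longrightarrow> V \<in> carrier (T n) \<Longrightarrow> P U \<Longrightarrow> P V \<Longrightarrow> P (U \<ominus>\<^bsub>T n\<^esub> V)"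
  shows "P U"
  using assms unfolding obj_C' by (intro M.PM.tensor_induct[of U n P]) simp_all

lemma pr_additive_right:
  assumes "x \<in> carrier R'"
  shows "pr n x \<zero>\<^bsub>obj C n\<^esub> = \<zero>\<^bsub>T n\<^esub>"
    and "m \<in> C.cr n \<Longrightarrow> pr n x ([(k::nat)] \<cdot>\<^bsub>obj C n\<^esub> m) = [k] \<cdot>\<^bsub>T n\<^esub> pr n x m"
  using additive_map_minus(1,3)[OF C.obj_group T_group, of n "pr n x" n] assms pr_closed pr_add_right by auto

lemma diff_hom': "diff C' n \<in> left_module_hom A' (T n) (T (n - 1))"
  unfolding diff_C' obj_C' by (rule D.f'_hom)

lemma diff'_closed: "U \<in> carrier (T n) \<Longrightarrow> diff C' n U \<in> carrier (T (n - 1))"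
  and diff'_add: "U \<in> carrier (T n) \<Longrightarrow> V \<in> carrier (T n) \<Longrightarrow>
    diff C' n (U \<oplus>\<^bsub>T n\<^esub> V) = diff C' n U \<oplus>\<^bsub>T (n - 1)\<^esub> diff C' n V"
  using diff_hom'[of n] by (auto simp: left_module_hom_def)

lemma diff'_minus: "U \<in> carrier (T n) \<Longrightarrow> V \<in> carrier (T n) \<Longrightarrow>
    diff C' n (U \<ominus>\<^bsub>T n\<^esub> V) = diff C' n U \<ominus>\<^bsub>T (n - 1)\<^esub> diff C' n V"
  by (rule additive_map_minus(2)[OF T_group T_group diff'_closed diff'_add])

lemma chain_complex_C': "chain_complex A' C'"
proof (rule chain_complex.intro)
  fix n
  show "left_module A' (T n)" by (rule T_module)
  show "diff C' n \<in> left_module_hom A' (T n) (T (n - 1))" by (rule diff_hom')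
  fix U assume "U \<in> carrier (T n)"
  then show "diff C' (n - 1) (diff C' n U) = \<zero>\<^bsub>T (n - 1 - 1)\<^esub>"
  proof (induction rule: T_induct)
    case (pr x m)
    then show ?case by (simp add: diff_pr C.diff_closed C.diff_diff pr_additive_right(1))
  next
    case (minus U V)
    then have "diff C' (n - 1) (diff C' n (U \<ominus>\<^bsub>T n\<^esub> V)) =
        \<zero>\<^bsub>T (n - 1 - 1)\<^esub> \<ominus>\<^bsub>T (n - 1 - 1)\<^esub> \<zero>\<^bsub>T (n - 1 - 1)\<^esub>"
      by (simp only: diff'_minus diff'_closed)
    also have "\<dots> = \<zero>\<^bsub>T (n - 1 - 1)\<^esub>" by (rule T.r_neg[OF T.zero_closed, folded T.minus_eq])
    finally show ?case .
  qed
qed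

sublocale C': chain_complex A' C' by (rule chain_complex_C')

text \<open>These conditions characterise \<open>coord b \<otimes> id\<close>.\<close>

definition coordinate_map :: "'r \<Rightarrow> int \<Rightarrow> (('r \<times> 'm \<Rightarrow>\<^sub>0 int) set \<Rightarrow> 'm) \<Rightarrow> bool" where
  "coordinate_map b n g \<longleftrightarrow> g \<in> carrier (T n) \<rightarrow> C.cr n \<and>
     (\<forall>U\<in>carrier (T n). \<forall>V\<in>carrier (T n). g (U \<oplus>\<^bsub>T n\<^esub> V) = g U \<oplus>\<^bsub>obj C n\<^esub> g V) \<and>
     (\<forall>x\<in>carrier R'. \<forall>m\<in>C.cr n. g (pr n x m) = (coord b x \<odot>\<^bsub>A\<^esub> \<one>\<^bsub>A\<^esub>) \<odot>\<^bsub>obj C n\<^esub> m)"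

definition proj :: "'r \<Rightarrow> int \<Rightarrow> ('r \<times> 'm \<Rightarrow>\<^sub>0 int) set \<Rightarrow> 'm" where
  "proj b n = (SOME g. coordinate_map b n g)"

text \<open>The universal property applied to the map that sends x and m to coord b x times m; it is
  balanced because \<open>coord b\<close> is linear over R.\<close>

lemma coordinate_map_proj:
  assumes b: "b \<in> B"
  shows "coordinate_map b n (proj b n)"
proof -
  let ?f = "\<lambda>x m. coord b x \<odot>\<^bsub>restrict_scalars A (obj C n)\<^esub> m"
  have "\<exists>g. g \<in> carrier (T n) \<rightarrow> carrier (obj C n) \<and>
    (\<forall>U\<in>carrier (T n). \<forall>V\<in>carrier (T n). g (U \<oplus>\<^bsub>T n\<^esub> V) = g U \<oplus>\<^bsub>obj C n\<^esub> g V) \<and>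
    (\<forall>x\<in>carrier R'. \<forall>m\<in>carrier (restrict_scalars A (obj C n)). g (pr n x m) = ?f x m)"
    unfolding obj_C'
  proof (rule M.PM.tensor_universal[OF C.obj_group])
    fix x y m m' r
    assume x: "x \<in> carrier R'" and m: "m \<in> carrier (restrict_scalars A (obj C n))"
    have cx: "coord b x \<in> carrier R" by (rule coord_closed[OF b x])
    show "?f x m \<in> C.cr n" using module.smult_closed[OF M.module_MR cx m] by simp
    show "?f (x \<oplus>\<^bsub>R'\<^esub> y) m = ?f x m \<oplus>\<^bsub>obj C n\<^esub> ?f y m" if y: "y \<in> carrier R'"
      using module.smult_l_distr[OF M.module_MR cx coord_closed[OF b y] m] coord_add[OF b x y] by simp
    show "?f x (m \<oplus>\<^bsub>restrict_scalars A (obj C n)\<^esub> m') = ?f x m \<oplus>\<^bsub>obj C n\<^esub> ?f x m'"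
      if "m' \<in> carrier (restrict_scalars A (obj C n))"
      using module.smult_r_distr[OF M.module_MR cx m that] by simp
    show "?f (x \<otimes>\<^bsub>R'\<^esub> r) m = ?f x (r \<odot>\<^bsub>restrict_scalars A (obj C n)\<^esub> m)" if r: "r \<in> carrier R"
      using module.smult_assoc1[OF M.module_MR cx r m] coord_mult[OF b x r] by simp
  qed
  then have "\<exists>g. coordinate_map b n g" unfolding coordinate_map_def by simp
  then show ?thesis unfolding proj_def by (rule someI_ex)
qed

lemma proj_closed: "b \<in> B \<Longrightarrow> U \<in> carrier (T n) \<Longrightarrow> proj b n U \<in> C.cr n"
  and proj_add: "b \<in> B \<Longrightarrow> U \<in> carrier (T n) \<Longrightarrow> V \<in> carrier (T n) \<Longrightarrow>
    proj b n (U \<oplus>\<^bsub>T n\<^esub> V) = proj b n U \<oplus>\<^bsub>obj C n\<^esub> proj b n V"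
  and proj_pr: "b \<in> B \<Longrightarrow> x \<in> carrier R' \<Longrightarrow> m \<in> C.cr n \<Longrightarrow>
    proj b n (pr n x m) = (coord b x \<odot>\<^bsub>A\<^esub> \<one>\<^bsub>A\<^esub>) \<odot>\<^bsub>obj C n\<^esub> m"
  using coordinate_map_proj[of b n] unfolding coordinate_map_def by auto

lemma proj_additive:
  assumes "b \<in> B"
  shows "proj b n \<zero>\<^bsub>T n\<^esub> = \<zero>\<^bsub>obj C n\<^esub>"
    and "U \<in> carrier (T n) \<Longrightarrow> V \<in> carrier (T n) \<Longrightarrow> proj b n (U \<ominus>\<^bsub>T n\<^esub> V) = proj b n U \<ominus>\<^bsub>obj C n\<^esub> proj b n V"
    and "U \<in> carrier (T n) \<Longrightarrow> proj b n ([(k::nat)] \<cdot>\<^bsub>T n\<^esub> U) = [k] \<cdot>\<^bsub>obj C n\<^esub> proj b n U"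
    and "finite I \<Longrightarrow> g \<in> I \<rightarrow> carrier (T n) \<Longrightarrow> proj b n (\<Oplus>\<^bsub>T n\<^esub>i\<in>I. g i) = (\<Oplus>\<^bsub>obj C n\<^esub>i\<in>I. proj b n (g i))"
proof -
  note * = T_group C.obj_group proj_closed[OF assms] proj_add[OF assms]
  show "proj b n \<zero>\<^bsub>T n\<^esub> = \<zero>\<^bsub>obj C n\<^esub>" by (rule additive_map_minus(1)[OF *])
  show "proj b n (U \<ominus>\<^bsub>T n\<^esub> V) = proj b n U \<ominus>\<^bsub>obj C n\<^esub> proj b n V" if "U \<in> carrier (T n)" "V \<in> carrier (T n)"
    by (rule additive_map_minus(2)[OF * that])
  show "proj b n ([(k::nat)] \<cdot>\<^bsub>T n\<^esub> U) = [k] \<cdot>\<^bsub>obj C n\<^esub> proj b n U" if "U \<in> carrier (T n)"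
    by (rule additive_map_minus(3)[OF * that])
  show "proj b n (\<Oplus>\<^bsub>T n\<^esub>i\<in>I. g i) = (\<Oplus>\<^bsub>obj C n\<^esub>i\<in>I. proj b n (g i))" if "finite I" "g \<in> I \<rightarrow> carrier (T n)"
    by (rule additive_map_minus(4)[OF * that])
qed

lemma B_carrier': "b \<in> B \<Longrightarrow> b \<in> carrier R'"
  using B_carrier by blast

text \<open>On a pure tensor the scalar coord b x moves across the tensor sign, and the sum becomes
  the expansion of x in R'; both sides are additive, which gives the general case.\<close>

lemma expand:
  assumes "U \<in> carrier (T n)"
  shows "(\<Oplus>\<^bsub>T n\<^esub>b\<in>B. pr n b (proj b n U)) = U"
proof -
  define \<Psi> where "\<Psi> U = (\<Oplus>\<^bsub>T n\<^esub>b\<in>B. pr n b (proj b n U))" for U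
  have summand: "(\<lambda>b. pr n b (proj b n U)) \<in> B \<rightarrow> carrier (T n)" if "U \<in> carrier (T n)" for U
    using that by (auto intro!: pr_closed B_carrier' proj_closed)
  have closed: "\<Psi> U \<in> carrier (T n)" if "U \<in> carrier (T n)" for U
    unfolding \<Psi>_def by (rule T.finsum_closed[OF summand[OF that]])
  have add: "\<Psi> (U \<oplus>\<^bsub>T n\<^esub> V) = \<Psi> U \<oplus>\<^bsub>T n\<^esub> \<Psi> V" if U: "U \<in> carrier (T n)" and V: "V \<in> carrier (T n)" for U V
  proof -
    have "\<Psi> (U \<oplus>\<^bsub>T n\<^esub> V) = (\<Oplus>\<^bsub>T n\<^esub>b\<in>B. pr n b (proj b n U) \<oplus>\<^bsub>T n\<^esub> pr n b (proj b n V))"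
      unfolding \<Psi>_def using U V
      by (intro T.finsum_cong') (auto simp: proj_add pr_add_right B_carrier' proj_closed pr_closed)
    also have "\<dots> = \<Psi> U \<oplus>\<^bsub>T n\<^esub> \<Psi> V"
      unfolding \<Psi>_def by (rule T.finsum_addf[OF summand[OF U] summand[OF V]])
    finally show ?thesis .
  qed
  from assms have "\<Psi> U = U"
  proof (induction rule: T_induct)
    case (pr x m)
    have c: "coord b x \<in> carrier R" "b \<in> carrier R'" "coord b x \<in> carrier R'" if "b \<in> B" for b
      using coord_closed[OF that pr(1)] B_carrier'[OF that] sub_carrier by auto
    have "\<Psi> (pr n x m) = (\<Oplus>\<^bsub>T n\<^esub>b\<in>B. pr n (coord b x \<otimes>\<^bsub>R'\<^esub> b) m)"
      unfolding \<Psi>_def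
    proof (rule T.finsum_cong')
      fix b assume b: "b \<in> B"
      have "pr n b (proj b n (pr n x m)) = pr n (b \<otimes>\<^bsub>R'\<^esub> coord b x) m"
        using c[OF b] pr b by (simp add: proj_pr pr_balanced)
      then show "pr n b (proj b n (pr n x m)) = pr n (coord b x \<otimes>\<^bsub>R'\<^esub> b) m"
        using c[OF b] by (simp add: R'.m_comm)
    qed (use pr c pr_closed in auto)
    also have "\<dots> = pr n (\<Oplus>\<^bsub>R'\<^esub>b\<in>B. coord b x \<otimes>\<^bsub>R'\<^esub> b) m"
      using pr c finite_B pr_closed pr_add_left
      by (intro additive_map_minus(4)[OF R'.abelian_group_axioms T_group, of "\<lambda>y. pr n y m", symmetric]) auto
    also have "\<dots> = pr n x m" using coord_sum[OF pr(1)] by simp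
    finally show ?case .
  next
    case (minus U V)
    then show ?case using additive_map_minus(2)[OF T_group T_group closed add] by simp
  qed
  then show ?thesis by (simp add: \<Psi>_def)
qed

lemma smult_minus': "a \<in> carrier A' \<Longrightarrow> U \<in> carrier (T n) \<Longrightarrow> V \<in> carrier (T n) \<Longrightarrow>
    a \<odot>\<^bsub>T n\<^esub> (U \<ominus>\<^bsub>T n\<^esub> V) = a \<odot>\<^bsub>T n\<^esub> U \<ominus>\<^bsub>T n\<^esub> a \<odot>\<^bsub>T n\<^esub> V"
  by (intro additive_map_minus(2)[OF T_group T_group, of n "\<lambda>U. a \<odot>\<^bsub>T n\<^esub> U"]) (auto simp: TM.smult_closed TM.smult_r_distr)

lemma smult_minus_C: "a \<in> carrier A \<Longrightarrow> x \<in> C.cr n \<Longrightarrow> y \<in> C.cr n \<Longrightarrow>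
    a \<odot>\<^bsub>obj C n\<^esub> (x \<ominus>\<^bsub>obj C n\<^esub> y) = a \<odot>\<^bsub>obj C n\<^esub> x \<ominus>\<^bsub>obj C n\<^esub> a \<odot>\<^bsub>obj C n\<^esub> y"
  by (intro additive_map_minus(2)[OF C.obj_group C.obj_group, of n "\<lambda>U. a \<odot>\<^bsub>obj C n\<^esub> U"])
    (auto simp: M.M.smult_closed M.M.smult_r_distr)

lemma diff_minus_C: "x \<in> C.cr n \<Longrightarrow> y \<in> C.cr n \<Longrightarrow>
    diff C n (x \<ominus>\<^bsub>obj C n\<^esub> y) = diff C n x \<ominus>\<^bsub>obj C (n - 1)\<^esub> diff C n y"
  by (rule additive_map_minus(2)[OF C.obj_group C.obj_group C.diff_closed C.diff_add])

text \<open>Coordinates are linear over A, embedded as 1 \<otimes> a: the scalars by which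
  coordinate maps multiply are central in A.\<close>

lemma proj_smult:
  assumes "b \<in> B" "a \<in> carrier A" "U \<in> carrier (T n)"
  shows "proj b n (PA.pure \<one>\<^bsub>R'\<^esub> a \<odot>\<^bsub>T n\<^esub> U) = a \<odot>\<^bsub>obj C n\<^esub> proj b n U"
proof -
  have p: "PA.pure \<one>\<^bsub>R'\<^esub> a \<in> carrier A'" using assms(2) by (intro PA.pure_closed) auto
  show ?thesis using assms(3)
  proof (induction rule: T_induct)
    case (pr x m)
    have c: "coord b x \<in> carrier R" by (rule coord_closed[OF assms(1) pr(1)])
    then have c1: "coord b x \<odot>\<^bsub>A\<^esub> \<one>\<^bsub>A\<^esub> \<in> carrier A" by simp
    have "proj b n (PA.pure \<one>\<^bsub>R'\<^esub> a \<odot>\<^bsub>T n\<^esub> pr n x m) = (coord b x \<odot>\<^bsub>A\<^esub> \<one>\<^bsub>A\<^esub>) \<odot>\<^bsub>obj C n\<^esub> (a \<odot>\<^bsub>obj C n\<^esub> m)"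
      using pr assms(1,2) by (simp add: smult_pr proj_pr M.M.smult_closed)
    also have "\<dots> = a \<odot>\<^bsub>obj C n\<^esub> ((coord b x \<odot>\<^bsub>A\<^esub> \<one>\<^bsub>A\<^esub>) \<odot>\<^bsub>obj C n\<^esub> m)"
      using M.M.smult_assoc1[OF c1 assms(2) pr(2)] M.M.smult_assoc1[OF assms(2) c1 pr(2)]
        M.smult_one_mult[OF c assms(2)] by simp
    finally show ?case using pr assms(1) by (simp add: proj_pr)
  next
    case (minus U V)
    then show ?case
      using p assms(1,2) by (simp add: smult_minus' proj_additive TM.smult_closed smult_minus_C proj_closed)
  qed
qed

lemma proj_diff:
  assumes "b \<in> B" "U \<in> carrier (T n)"
  shows "proj b (n - 1) (diff C' n U) = diff C n (proj b n U)"
  using assms(2)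
proof (induction rule: T_induct)
  case (pr x m)
  have c: "coord b x \<odot>\<^bsub>A\<^esub> \<one>\<^bsub>A\<^esub> \<in> carrier A" using coord_closed[OF assms(1) pr(1)] by simp
  show ?case using pr assms(1) c by (simp add: diff_pr proj_pr C.diff_closed C.diff_smult)
next
  case (minus U V)
  then show ?case using assms(1) by (simp add: diff'_minus proj_additive diff'_closed diff_minus_C proj_closed)
qed

abbreviation "EC \<equiv> end_ring A C"
abbreviation "EC' \<equiv> end_ring A' C'"

text \<open>The coordinate of \<phi> at b: by \<open>expand\<close>, \<phi> sends 1 \<otimes> m to
  the sum of the b \<otimes> (\<kappa> b \<phi>) m. These coordinates play the role of the expansion
  of \<phi> in R' \<otimes> End C.\<close>

definition \<kappa> :: "'r \<Rightarrow> (int \<Rightarrow> ('r \<times> 'm \<Rightarrow>\<^sub>0 int) set \<Rightarrow> ('r \<times> 'm \<Rightarrow>\<^sub>0 int) set) \<Rightarrow> int \<Rightarrow> 'm \<Rightarrow> 'm" where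
  "\<kappa> b \<phi> = (\<lambda>n. \<lambda>m\<in>C.cr n. proj b n (\<phi> n (pr n \<one>\<^bsub>R'\<^esub> m)))"

lemma \<kappa>_closed:
  assumes b: "b \<in> B" and \<phi>: "\<phi> \<in> carrier EC'"
  shows "\<kappa> b \<phi> \<in> carrier EC"
  unfolding \<kappa>_def
proof (rule C.endI)
  fix n m assume m: "m \<in> C.cr n"
  have p: "pr n \<one>\<^bsub>R'\<^esub> m \<in> carrier (T n)" using m by (intro pr_closed) auto
  show "proj b n (\<phi> n (pr n \<one>\<^bsub>R'\<^esub> m)) \<in> C.cr n" by (rule proj_closed[OF b C'.end_closed[OF \<phi> p]])
  show "proj b (n - 1) (\<phi> (n - 1) (pr (n - 1) \<one>\<^bsub>R'\<^esub> (diff C n m))) = diff C n (proj b n (\<phi> n (pr n \<one>\<^bsub>R'\<^esub> m)))"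
    using C'.end_diff[OF \<phi> p] proj_diff[OF b C'.end_closed[OF \<phi> p]] diff_pr[OF R'.one_closed m] by simp
next
  fix n m m' assume "m \<in> C.cr n" "m' \<in> C.cr n"
  then show "proj b n (\<phi> n (pr n \<one>\<^bsub>R'\<^esub> (m \<oplus>\<^bsub>obj C n\<^esub> m'))) =
      proj b n (\<phi> n (pr n \<one>\<^bsub>R'\<^esub> m)) \<oplus>\<^bsub>obj C n\<^esub> proj b n (\<phi> n (pr n \<one>\<^bsub>R'\<^esub> m'))"
    using \<phi> b by (simp add: pr_add_right C'.end_add C'.end_closed pr_closed proj_add)
next
  fix n a m assume a: "a \<in> carrier A" and m: "m \<in> C.cr n"
  have p: "pr n \<one>\<^bsub>R'\<^esub> m \<in> carrier (T n)" using m by (intro pr_closed) auto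
  have pa: "PA.pure \<one>\<^bsub>R'\<^esub> a \<in> carrier A'" using a by (intro PA.pure_closed) auto
  have "pr n \<one>\<^bsub>R'\<^esub> (a \<odot>\<^bsub>obj C n\<^esub> m) = PA.pure \<one>\<^bsub>R'\<^esub> a \<odot>\<^bsub>T n\<^esub> pr n \<one>\<^bsub>R'\<^esub> m"
    using smult_pr[OF R'.one_closed a R'.one_closed m] by simp
  then show "proj b n (\<phi> n (pr n \<one>\<^bsub>R'\<^esub> (a \<odot>\<^bsub>obj C n\<^esub> m))) = a \<odot>\<^bsub>obj C n\<^esub> proj b n (\<phi> n (pr n \<one>\<^bsub>R'\<^esub> m))"
    using C'.end_smult[OF \<phi> pa p] proj_smult[OF b a C'.end_closed[OF \<phi> p]] by simp
qed

lemma \<kappa>_apply: "m \<in> C.cr n \<Longrightarrow> \<kappa> b \<phi> n m = proj b n (\<phi> n (pr n \<one>\<^bsub>R'\<^esub> m))"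
  by (simp add: \<kappa>_def)

lemma \<kappa>_minus:
  assumes b: "b \<in> B" and "\<phi> \<in> carrier EC'" "\<psi> \<in> carrier EC'"
  shows "\<kappa> b (\<phi> \<ominus>\<^bsub>EC'\<^esub> \<psi>) = \<kappa> b \<phi> \<ominus>\<^bsub>EC\<^esub> \<kappa> b \<psi>"
proof (rule C.end_eqI)
  fix n m assume m: "m \<in> C.cr n"
  have p: "pr n \<one>\<^bsub>R'\<^esub> m \<in> carrier (T n)" using m by (intro pr_closed) auto
  show "\<kappa> b (\<phi> \<ominus>\<^bsub>EC'\<^esub> \<psi>) n m = (\<kappa> b \<phi> \<ominus>\<^bsub>EC\<^esub> \<kappa> b \<psi>) n m"
    using assms m p by (simp add: \<kappa>_apply C.E_minus C'.E_minus \<kappa>_closed proj_additive C'.end_closed)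
qed (use assms in \<open>auto intro!: \<kappa>_closed\<close>)

text \<open>x \<otimes> m is (x \<otimes> 1) applied to 1 \<otimes> m, so linearity over A' reduces
  \<phi> to its values on the tensors 1 \<otimes> m.\<close>

lemma end_pr:
  assumes \<phi>: "\<phi> \<in> carrier EC'" and x: "x \<in> carrier R'" and m: "m \<in> C.cr n"
  shows "\<phi> n (pr n x m) = (\<Oplus>\<^bsub>T n\<^esub>b\<in>B. pr n (x \<otimes>\<^bsub>R'\<^esub> b) (\<kappa> b \<phi> n m))"
proof -
  have p: "pr n \<one>\<^bsub>R'\<^esub> m \<in> carrier (T n)" using m by (intro pr_closed) auto
  have pa: "PA.pure x \<one>\<^bsub>A\<^esub> \<in> carrier A'" using x by (intro PA.pure_closed) auto
  have kc: "\<kappa> b \<phi> n m \<in> C.cr n" if "b \<in> B" for b by (rule C.end_closed[OF \<kappa>_closed[OF that \<phi>] m])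
  have "pr n x m = PA.pure x \<one>\<^bsub>A\<^esub> \<odot>\<^bsub>T n\<^esub> pr n \<one>\<^bsub>R'\<^esub> m"
    using smult_pr[OF x A.one_closed R'.one_closed m] x m by (simp add: M.M.smult_one)
  then have "\<phi> n (pr n x m) = PA.pure x \<one>\<^bsub>A\<^esub> \<odot>\<^bsub>T n\<^esub> \<phi> n (pr n \<one>\<^bsub>R'\<^esub> m)"
    using C'.end_smult[OF \<phi> pa p] by simp
  also have "\<phi> n (pr n \<one>\<^bsub>R'\<^esub> m) = (\<Oplus>\<^bsub>T n\<^esub>b\<in>B. pr n b (\<kappa> b \<phi> n m))"
    using expand[OF C'.end_closed[OF \<phi> p]] m by (simp add: \<kappa>_apply)
  also have "PA.pure x \<one>\<^bsub>A\<^esub> \<odot>\<^bsub>T n\<^esub> \<dots> = (\<Oplus>\<^bsub>T n\<^esub>b\<in>B. PA.pure x \<one>\<^bsub>A\<^esub> \<odot>\<^bsub>T n\<^esub> pr n b (\<kappa> b \<phi> n m))"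
    using pa finite_B kc
    by (intro additive_map_minus(4)[OF T_group T_group, of n "\<lambda>U. PA.pure x \<one>\<^bsub>A\<^esub> \<odot>\<^bsub>T n\<^esub> U" n])
      (auto simp: TM.smult_closed TM.smult_r_distr intro!: pr_closed B_carrier')
  also have "\<dots> = (\<Oplus>\<^bsub>T n\<^esub>b\<in>B. pr n (x \<otimes>\<^bsub>R'\<^esub> b) (\<kappa> b \<phi> n m))"
  proof (rule T.finsum_cong')
    fix b assume b: "b \<in> B"
    show "PA.pure x \<one>\<^bsub>A\<^esub> \<odot>\<^bsub>T n\<^esub> pr n b (\<kappa> b \<phi> n m) = pr n (x \<otimes>\<^bsub>R'\<^esub> b) (\<kappa> b \<phi> n m)"
      using smult_pr[OF x A.one_closed B_carrier'[OF b] kc[OF b]] kc[OF b] by (simp add: M.M.smult_one)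
  qed (use x kc in \<open>auto simp: B_carrier' pr_closed\<close>)
  finally show ?thesis .
qed

text \<open>A scalar of R viewed as an endomorphism of C. In this way the structure constants of R'
  become central elements of End C.\<close>

definition \<rho> :: "'r \<Rightarrow> int \<Rightarrow> 'm \<Rightarrow> 'm" where
  "\<rho> r = (\<lambda>n. \<lambda>m\<in>C.cr n. (r \<odot>\<^bsub>A\<^esub> \<one>\<^bsub>A\<^esub>) \<odot>\<^bsub>obj C n\<^esub> m)"

lemma \<rho>_closed:
  assumes r: "r \<in> carrier R"
  shows "\<rho> r \<in> carrier EC"
proof -
  have r1: "r \<odot>\<^bsub>A\<^esub> \<one>\<^bsub>A\<^esub> \<in> carrier A" using r by simp
  show ?thesis unfolding \<rho>_def
  proof (rule C.endI)
    fix n a x assume a: "a \<in> carrier A" and x: "x \<in> C.cr n"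
    show "(r \<odot>\<^bsub>A\<^esub> \<one>\<^bsub>A\<^esub>) \<odot>\<^bsub>obj C n\<^esub> (a \<odot>\<^bsub>obj C n\<^esub> x) = a \<odot>\<^bsub>obj C n\<^esub> ((r \<odot>\<^bsub>A\<^esub> \<one>\<^bsub>A\<^esub>) \<odot>\<^bsub>obj C n\<^esub> x)"
      using M.M.smult_assoc1[OF r1 a x] M.M.smult_assoc1[OF a r1 x] M.smult_one_mult[OF r a] by simp
  qed (use r1 in \<open>simp_all add: M.M.smult_closed M.M.smult_r_distr C.diff_smult\<close>)
qed

lemma \<rho>_central:
  assumes r: "r \<in> carrier R" and \<phi>: "\<phi> \<in> carrier EC"
  shows "\<rho> r \<otimes>\<^bsub>EC\<^esub> \<phi> = \<phi> \<otimes>\<^bsub>EC\<^esub> \<rho> r"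
proof (rule C.end_eqI)
  fix n x assume x: "x \<in> C.cr n"
  show "(\<rho> r \<otimes>\<^bsub>EC\<^esub> \<phi>) n x = (\<phi> \<otimes>\<^bsub>EC\<^esub> \<rho> r) n x"
    using x r \<phi> C.end_closed[OF \<phi> x] by (simp add: C.E_simps \<rho>_def C.end_smult)
qed (use \<rho>_closed[OF r] \<phi> in auto)

text \<open>Applying \<psi> and then \<phi> to 1 \<otimes> m gives the sum of the (l i) \<otimes>
  (\<kappa> i \<phi>) (\<kappa> l \<psi>) m. The coordinate of l i at t is a structure constant of
  R'.\<close>

lemma \<kappa>_mult:
  assumes t: "t \<in> B" and \<phi>: "\<phi> \<in> carrier EC'" and \<psi>: "\<psi> \<in> carrier EC'"
  shows "\<kappa> t (\<phi> \<otimes>\<^bsub>EC'\<^esub> \<psi>) =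
    (\<Oplus>\<^bsub>EC\<^esub>l\<in>B. \<Oplus>\<^bsub>EC\<^esub>i\<in>B. \<rho> (coord t (l \<otimes>\<^bsub>R'\<^esub> i)) \<otimes>\<^bsub>EC\<^esub> (\<kappa> i \<phi> \<otimes>\<^bsub>EC\<^esub> \<kappa> l \<psi>))"
    (is "_ = (\<Oplus>\<^bsub>EC\<^esub>l\<in>B. \<Oplus>\<^bsub>EC\<^esub>i\<in>B. ?g l i)")
proof (rule C.end_eqI)
  have kk: "\<kappa> i \<phi> \<in> carrier EC" "\<kappa> i \<psi> \<in> carrier EC" if "i \<in> B" for i using that \<phi> \<psi> \<kappa>_closed by auto
  have li: "l \<otimes>\<^bsub>R'\<^esub> i \<in> carrier R'" if "l \<in> B" "i \<in> B" for l i using that B_carrier' by simp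
  have gc: "?g l i \<in> carrier EC" if "l \<in> B" "i \<in> B" for l i
    using that t by (intro C.E_mult_closed \<rho>_closed coord_closed li kk)
  have gs: "(\<Oplus>\<^bsub>EC\<^esub>i\<in>B. ?g l i) \<in> carrier EC" if "l \<in> B" for l
    using gc that by (intro C.E.finsum_closed) auto
  show "\<kappa> t (\<phi> \<otimes>\<^bsub>EC'\<^esub> \<psi>) \<in> carrier EC" using t \<phi> \<psi> by (intro \<kappa>_closed) auto
  show "(\<Oplus>\<^bsub>EC\<^esub>l\<in>B. \<Oplus>\<^bsub>EC\<^esub>i\<in>B. ?g l i) \<in> carrier EC" using gs by (intro C.E.finsum_closed) auto
  fix n m assume m: "m \<in> C.cr n"
  have p: "pr n \<one>\<^bsub>R'\<^esub> m \<in> carrier (T n)" using m by (intro pr_closed) auto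
  have km: "\<kappa> l \<psi> n m \<in> C.cr n" if "l \<in> B" for l using kk that m C.end_closed by blast
  have kkm: "\<kappa> i \<phi> n (\<kappa> l \<psi> n m) \<in> C.cr n" if "l \<in> B" "i \<in> B" for l i using kk that km C.end_closed by blast
  have "\<psi> n (pr n \<one>\<^bsub>R'\<^esub> m) = (\<Oplus>\<^bsub>T n\<^esub>l\<in>B. pr n l (\<kappa> l \<psi> n m))"
    using expand[OF C'.end_closed[OF \<psi> p]] m by (simp add: \<kappa>_apply)
  then have "(\<phi> \<otimes>\<^bsub>EC'\<^esub> \<psi>) n (pr n \<one>\<^bsub>R'\<^esub> m) = \<phi> n (\<Oplus>\<^bsub>T n\<^esub>l\<in>B. pr n l (\<kappa> l \<psi> n m))"
    using p by (simp add: C'.E_simps)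
  also have "\<dots> = (\<Oplus>\<^bsub>T n\<^esub>l\<in>B. \<phi> n (pr n l (\<kappa> l \<psi> n m)))"
    using km by (intro C'.end_finsum[OF \<phi> finite_B]) (auto intro!: pr_closed B_carrier')
  finally have "\<kappa> t (\<phi> \<otimes>\<^bsub>EC'\<^esub> \<psi>) n m = proj t n (\<Oplus>\<^bsub>T n\<^esub>l\<in>B. \<phi> n (pr n l (\<kappa> l \<psi> n m)))"
    using m by (simp add: \<kappa>_apply)
  also have "\<dots> = (\<Oplus>\<^bsub>obj C n\<^esub>l\<in>B. proj t n (\<phi> n (pr n l (\<kappa> l \<psi> n m))))"
    using km by (intro proj_additive(4)[OF t finite_B]) (auto intro!: C'.end_closed[OF \<phi>] pr_closed B_carrier')
  also have "\<dots> = (\<Oplus>\<^bsub>obj C n\<^esub>l\<in>B. \<Oplus>\<^bsub>obj C n\<^esub>i\<in>B. ?g l i n m)"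
  proof (rule M.M.finsum_cong')
    fix l assume l: "l \<in> B"
    have "proj t n (\<phi> n (pr n l (\<kappa> l \<psi> n m))) =
        proj t n (\<Oplus>\<^bsub>T n\<^esub>i\<in>B. pr n (l \<otimes>\<^bsub>R'\<^esub> i) (\<kappa> i \<phi> n (\<kappa> l \<psi> n m)))"
      by (simp only: end_pr[OF \<phi> B_carrier'[OF l] km[OF l]])
    also have "\<dots> = (\<Oplus>\<^bsub>obj C n\<^esub>i\<in>B. proj t n (pr n (l \<otimes>\<^bsub>R'\<^esub> i) (\<kappa> i \<phi> n (\<kappa> l \<psi> n m))))"
      using l by (intro proj_additive(4)[OF t finite_B]) (auto intro!: pr_closed li kkm)
    also have "\<dots> = (\<Oplus>\<^bsub>obj C n\<^esub>i\<in>B. ?g l i n m)"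
    proof (rule M.M.finsum_cong')
      fix i assume i: "i \<in> B"
      show "proj t n (pr n (l \<otimes>\<^bsub>R'\<^esub> i) (\<kappa> i \<phi> n (\<kappa> l \<psi> n m))) = ?g l i n m"
        using m proj_pr[OF t li[OF l i] kkm[OF l i]] kkm[OF l i] by (simp add: C.E_simps \<rho>_def)
    qed (use l gc m C.end_closed in auto)
    finally show "proj t n (\<phi> n (pr n l (\<kappa> l \<psi> n m))) = (\<Oplus>\<^bsub>obj C n\<^esub>i\<in>B. ?g l i n m)" .
  qed (use gc m C.end_closed in \<open>auto intro!: M.M.finsum_closed\<close>)
  also have "\<dots> = (\<Oplus>\<^bsub>obj C n\<^esub>l\<in>B. (\<Oplus>\<^bsub>EC\<^esub>i\<in>B. ?g l i) n m)"
  proof (rule M.M.finsum_cong')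
    fix l assume l: "l \<in> B"
    show "(\<Oplus>\<^bsub>obj C n\<^esub>i\<in>B. ?g l i n m) = (\<Oplus>\<^bsub>EC\<^esub>i\<in>B. ?g l i) n m"
      using gc[OF l] by (intro C.finsum_E_apply[OF finite_B _ m, symmetric]) auto
  qed (use gs m C.end_closed in auto)
  also have "\<dots> = (\<Oplus>\<^bsub>EC\<^esub>l\<in>B. \<Oplus>\<^bsub>EC\<^esub>i\<in>B. ?g l i) n m"
    using gs by (intro C.finsum_E_apply[OF finite_B _ m, symmetric]) auto
  finally show "\<kappa> t (\<phi> \<otimes>\<^bsub>EC'\<^esub> \<psi>) n m = (\<Oplus>\<^bsub>EC\<^esub>l\<in>B. \<Oplus>\<^bsub>EC\<^esub>i\<in>B. ?g l i) n m" .
qed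

text \<open>The structure constants are symmetric because R' is commutative. After exchanging
  indices the two products differ by scalar multiples of commutators of coordinates, which lie in
  J.\<close>

lemma \<kappa>_commutator:
  assumes J: "ideal J EC" and comm: "\<And>x y. x \<in> carrier EC \<Longrightarrow> y \<in> carrier EC \<Longrightarrow> x \<otimes>\<^bsub>EC\<^esub> y \<ominus>\<^bsub>EC\<^esub> y \<otimes>\<^bsub>EC\<^esub> x \<in> J"
    and t: "t \<in> B" and \<phi>: "\<phi> \<in> carrier EC'" and \<psi>: "\<psi> \<in> carrier EC'"
  shows "\<kappa> t (\<phi> \<otimes>\<^bsub>EC'\<^esub> \<psi> \<ominus>\<^bsub>EC'\<^esub> \<psi> \<otimes>\<^bsub>EC'\<^esub> \<phi>) \<in> J"
proof -
  interpret J: ideal J EC by (rule J)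
  define c where "c l i = \<rho> (coord t (l \<otimes>\<^bsub>R'\<^esub> i))" for l i
  have cc: "c l i \<in> carrier EC" if "l \<in> B" "i \<in> B" for l i
    unfolding c_def using that B_carrier' t by (intro \<rho>_closed coord_closed) auto
  have csym: "c l i = c i l" if "l \<in> B" "i \<in> B" for l i
    unfolding c_def using that B_carrier' by (simp add: R'.m_comm)
  have k: "\<kappa> i \<phi> \<in> carrier EC" "\<kappa> i \<psi> \<in> carrier EC" if "i \<in> B" for i using that \<phi> \<psi> \<kappa>_closed by auto
  have g: "c l i \<otimes>\<^bsub>EC\<^esub> (\<kappa> i \<phi> \<otimes>\<^bsub>EC\<^esub> \<kappa> l \<psi>) \<in> carrier EC" "c l i \<otimes>\<^bsub>EC\<^esub> (\<kappa> l \<psi> \<otimes>\<^bsub>EC\<^esub> \<kappa> i \<phi>) \<in> carrier EC"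
    "c l i \<otimes>\<^bsub>EC\<^esub> (\<kappa> i \<psi> \<otimes>\<^bsub>EC\<^esub> \<kappa> l \<phi>) \<in> carrier EC"
    if "l \<in> B" "i \<in> B" for l i
    using cc[OF that] k that by simp_all
  have "\<kappa> t (\<psi> \<otimes>\<^bsub>EC'\<^esub> \<phi>) = (\<Oplus>\<^bsub>EC\<^esub>l\<in>B. \<Oplus>\<^bsub>EC\<^esub>i\<in>B. c l i \<otimes>\<^bsub>EC\<^esub> (\<kappa> i \<psi> \<otimes>\<^bsub>EC\<^esub> \<kappa> l \<phi>))"
    unfolding c_def by (rule \<kappa>_mult[OF t \<psi> \<phi>])
  \<comment> \<open>Exchanging the summations pairs \<kappa> l \<psi> with \<kappa> i \<phi>, the
    same two factors that occur at (l, i) in the other product.\<close>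
  also have "\<dots> = (\<Oplus>\<^bsub>EC\<^esub>l\<in>B. \<Oplus>\<^bsub>EC\<^esub>i\<in>B. c i l \<otimes>\<^bsub>EC\<^esub> (\<kappa> l \<psi> \<otimes>\<^bsub>EC\<^esub> \<kappa> i \<phi>))"
    using g by (intro C.E.finsum_swap finite_B) auto
  also have "\<dots> = (\<Oplus>\<^bsub>EC\<^esub>l\<in>B. \<Oplus>\<^bsub>EC\<^esub>i\<in>B. c l i \<otimes>\<^bsub>EC\<^esub> (\<kappa> l \<psi> \<otimes>\<^bsub>EC\<^esub> \<kappa> i \<phi>))"
  proof (rule C.E.finsum_cong')
    fix l assume l: "l \<in> B"
    show "(\<Oplus>\<^bsub>EC\<^esub>i\<in>B. c i l \<otimes>\<^bsub>EC\<^esub> (\<kappa> l \<psi> \<otimes>\<^bsub>EC\<^esub> \<kappa> i \<phi>)) = (\<Oplus>\<^bsub>EC\<^esub>i\<in>B. c l i \<otimes>\<^bsub>EC\<^esub> (\<kappa> l \<psi> \<otimes>\<^bsub>EC\<^esub> \<kappa> i \<phi>))"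
      using g l csym by (intro C.E.finsum_cong') auto
  qed (use g in \<open>auto intro!: C.E.finsum_closed\<close>)
  finally have 2: "\<kappa> t (\<psi> \<otimes>\<^bsub>EC'\<^esub> \<phi>) = \<dots>" .
  have 1: "\<kappa> t (\<phi> \<otimes>\<^bsub>EC'\<^esub> \<psi>) = (\<Oplus>\<^bsub>EC\<^esub>l\<in>B. \<Oplus>\<^bsub>EC\<^esub>i\<in>B. c l i \<otimes>\<^bsub>EC\<^esub> (\<kappa> i \<phi> \<otimes>\<^bsub>EC\<^esub> \<kappa> l \<psi>))"
    unfolding c_def by (rule \<kappa>_mult[OF t \<phi> \<psi>])
  have "\<kappa> t (\<phi> \<otimes>\<^bsub>EC'\<^esub> \<psi> \<ominus>\<^bsub>EC'\<^esub> \<psi> \<otimes>\<^bsub>EC'\<^esub> \<phi>) = \<kappa> t (\<phi> \<otimes>\<^bsub>EC'\<^esub> \<psi>) \<ominus>\<^bsub>EC\<^esub> \<kappa> t (\<psi> \<otimes>\<^bsub>EC'\<^esub> \<phi>)"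
    using \<phi> \<psi> by (intro \<kappa>_minus[OF t]) auto
  also have "\<dots> \<in> J"
    unfolding 1 2
  proof (intro J.finsum_minus_mem finite_B)
    fix l i assume li: "l \<in> B" "i \<in> B"
    have "c l i \<otimes>\<^bsub>EC\<^esub> (\<kappa> i \<phi> \<otimes>\<^bsub>EC\<^esub> \<kappa> l \<psi>) \<ominus>\<^bsub>EC\<^esub> c l i \<otimes>\<^bsub>EC\<^esub> (\<kappa> l \<psi> \<otimes>\<^bsub>EC\<^esub> \<kappa> i \<phi>) =
        c l i \<otimes>\<^bsub>EC\<^esub> (\<kappa> i \<phi> \<otimes>\<^bsub>EC\<^esub> \<kappa> l \<psi> \<ominus>\<^bsub>EC\<^esub> \<kappa> l \<psi> \<otimes>\<^bsub>EC\<^esub> \<kappa> i \<phi>)"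
      using cc[OF li] k li by (simp add: C.E.minus_eq C.E.r_distr C.E.r_minus)
    also have "\<dots> \<in> J" using comm k li cc[OF li] by (intro J.I_l_closed) auto
    finally show "c l i \<otimes>\<^bsub>EC\<^esub> (\<kappa> i \<phi> \<otimes>\<^bsub>EC\<^esub> \<kappa> l \<psi>) \<ominus>\<^bsub>EC\<^esub> c l i \<otimes>\<^bsub>EC\<^esub> (\<kappa> l \<psi> \<otimes>\<^bsub>EC\<^esub> \<kappa> i \<phi>) \<in> J" .
  qed (use g in \<open>auto intro!: C.E.finsum_closed\<close>)
  finally show ?thesis .
qed

end

section \<open>Transfer of the p-adic properties to C' and the decomposition\<close>

lemma finitely_generated_padic:
  fixes R :: "'r ring" and A :: "('r, 'a) module" and M :: "('a, 'm) module"
  assumes R: "padic_domain p R" and A: "assoc_algebra R A" "finitely_generated R A"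
    and M: "left_module A M" "finitely_generated A M"
  shows "padic_separated p M (carrier M)" "padic_complete p M (carrier M)" "padic_finite p M (carrier M)"
proof -
  obtain gs where gs: "set gs \<subseteq> carrier M" "gspan R (restrict_scalars A M) gs = carrier M"
    using finitely_generated_gspan[OF A(1) M(1) A(2) M(2)] .
  interpret padic_module p R "restrict_scalars A M"
    by (intro padic_module.intro R module_restrict_scalars A(1) M(1))
  have gs': "set gs \<subseteq> carrier (restrict_scalars A M)" using gs(1) by (simp add: restrict_scalars_def)
  show "padic_separated p M (carrier M)" "padic_complete p M (carrier M)" "padic_finite p M (carrier M)"
    using padic_separated_gspan[OF gs'] padic_complete_gspan[OF gs'] padic_finite_gspan[OF gs']
    unfolding gs(2) restrict_scalars_padic by auto
qed

context base_change_cx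
begin

interpretation Cn: abelian_group "obj C n" for n
  by (rule C.obj_group)

interpretation T: abelian_group "T n" for n
  by (rule T_group)

text \<open>In the product rule every summand is a central element times a product from J and L, so
  it stays in N.\<close>

lemma \<kappa>_mult_mem:
  assumes N: "N \<subseteq> carrier EC" "\<zero>\<^bsub>EC\<^esub> \<in> N" "\<And>x y. x \<in> N \<Longrightarrow> y \<in> N \<Longrightarrow> x \<oplus>\<^bsub>EC\<^esub> y \<in> N"
    and central: "\<And>z x. z \<in> carrier EC \<Longrightarrow> (\<And>y. y \<in> carrier EC \<Longrightarrow> z \<otimes>\<^bsub>EC\<^esub> y = y \<otimes>\<^bsub>EC\<^esub> z) \<Longrightarrow>
      x \<in> N \<Longrightarrow> z \<otimes>\<^bsub>EC\<^esub> x \<in> N"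
    and JL: "\<And>a x. a \<in> J \<Longrightarrow> x \<in> L \<Longrightarrow> a \<otimes>\<^bsub>EC\<^esub> x \<in> N"
    and \<phi>: "\<phi> \<in> carrier EC'" "\<And>t. t \<in> B \<Longrightarrow> \<kappa> t \<phi> \<in> J"
    and \<psi>: "\<psi> \<in> carrier EC'" "\<And>t. t \<in> B \<Longrightarrow> \<kappa> t \<psi> \<in> L"
    and t: "t \<in> B"
  shows "\<kappa> t (\<phi> \<otimes>\<^bsub>EC'\<^esub> \<psi>) \<in> N"
  unfolding \<kappa>_mult[OF t \<phi>(1) \<psi>(1)]
proof (intro C.E.finsum_mem[OF finite_B _ N])
  fix l i assume li: "l \<in> B" "i \<in> B"
  have c: "coord t (l \<otimes>\<^bsub>R'\<^esub> i) \<in> carrier R" using li t B_carrier' by (intro coord_closed) auto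
  have mem: "\<kappa> i \<phi> \<otimes>\<^bsub>EC\<^esub> \<kappa> l \<psi> \<in> N" by (rule JL[OF \<phi>(2)[OF li(2)] \<psi>(2)[OF li(1)]])
  show "\<rho> (coord t (l \<otimes>\<^bsub>R'\<^esub> i)) \<otimes>\<^bsub>EC\<^esub> (\<kappa> i \<phi> \<otimes>\<^bsub>EC\<^esub> \<kappa> l \<psi>) \<in> N"
    by (rule central[OF \<rho>_closed[OF c] _ mem]) (rule \<rho>_central[OF c])
qed

text \<open>The zeroth power has coordinates somewhere in \<open>L M\<close>, the whole ring; each
  further factor on the left lowers the stage by one.\<close>

lemma \<kappa>_pow_mem:
  assumes L: "\<And>j. L j \<subseteq> carrier EC" "\<And>j. \<zero>\<^bsub>EC\<^esub> \<in> L j" "\<And>j x y. x \<in> L j \<Longrightarrow> y \<in> L j \<Longrightarrow> x \<oplus>\<^bsub>EC\<^esub> y \<in> L j"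
    and central: "\<And>j z x. z \<in> carrier EC \<Longrightarrow> (\<And>y. y \<in> carrier EC \<Longrightarrow> z \<otimes>\<^bsub>EC\<^esub> y = y \<otimes>\<^bsub>EC\<^esub> z) \<Longrightarrow>
      x \<in> L j \<Longrightarrow> z \<otimes>\<^bsub>EC\<^esub> x \<in> L j"
    and JL: "\<And>j a x. a \<in> J \<Longrightarrow> x \<in> L (Suc j) \<Longrightarrow> a \<otimes>\<^bsub>EC\<^esub> x \<in> L j"
    and LM: "L M = carrier EC"
    and \<phi>: "\<phi> \<in> carrier EC'" "\<And>t. t \<in> B \<Longrightarrow> \<kappa> t \<phi> \<in> J"
  shows "j \<le> M \<Longrightarrow> t \<in> B \<Longrightarrow> \<kappa> t (\<phi> [^]\<^bsub>EC'\<^esub> (j::nat)) \<in> L (M - j)"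
proof (induction j arbitrary: t)
  case 0
  then show ?case by (simp add: LM \<kappa>_closed)
next
  case (Suc j)
  \<comment> \<open>For j < M the stage \<open>M - j\<close> is \<open>Suc (M - Suc j)\<close>, the
    form to which the descent by J applies.\<close>
  have "\<kappa> s (\<phi> [^]\<^bsub>EC'\<^esub> j) \<in> L (Suc (M - Suc j))" if "s \<in> B" for s
    using Suc.IH[OF _ that] Suc.prems(1) by (simp add: Suc_diff_Suc)
  then have "\<kappa> t (\<phi> \<otimes>\<^bsub>EC'\<^esub> \<phi> [^]\<^bsub>EC'\<^esub> j) \<in> L (M - Suc j)"
    using Suc.prems(2) \<phi>(1) by (intro \<kappa>_mult_mem[OF L central JL \<phi>(1) \<phi>(2)]) auto
  then show ?case using C'.E.nat_pow_Suc2[OF \<phi>(1)] by simp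
qed

text \<open>By \<open>end_pr\<close> a value of \<phi> on a pure tensor is a sum of tensors whose
  second entries are values of the coordinates, and a factor p^k there can be pulled out.\<close>

lemma padic_ideal_C'I:
  assumes \<phi>: "\<phi> \<in> carrier EC'" and \<kappa>: "\<And>t. t \<in> B \<Longrightarrow> \<kappa> t \<phi> \<in> padic_ideal p A C k"
  shows "\<phi> \<in> padic_ideal p A' C' k"
proof -
  have "\<exists>Y\<in>carrier (T n). \<phi> n U = [(p ^ k)] \<cdot>\<^bsub>T n\<^esub> Y" if "U \<in> carrier (T n)" for n U
    using that
  proof (induction rule: T_induct)
    case (pr x m)
    let ?N = "{[(p ^ k)] \<cdot>\<^bsub>T n\<^esub> Y | Y. Y \<in> carrier (T n)}"
    have "(\<Oplus>\<^bsub>T n\<^esub>b\<in>B. pr n (x \<otimes>\<^bsub>R'\<^esub> b) (\<kappa> b \<phi> n m)) \<in> ?N"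
    proof (rule T.finsum_mem[OF finite_B])
      fix b assume b: "b \<in> B"
      then obtain y where y: "y \<in> C.cr n" "\<kappa> b \<phi> n m = [(p ^ k)] \<cdot>\<^bsub>obj C n\<^esub> y"
        using \<kappa>[OF b] pr(2) unfolding padic_ideal_def by blast
      have xb: "x \<otimes>\<^bsub>R'\<^esub> b \<in> carrier R'" using pr(1) B_carrier'[OF b] by simp
      show "pr n (x \<otimes>\<^bsub>R'\<^esub> b) (\<kappa> b \<phi> n m) \<in> ?N"
        using pr_additive_right(2)[OF xb y(1)] pr_closed[OF xb y(1)] y(2) by auto
    next
      show "?N \<subseteq> carrier (T n)" by auto
      have "\<zero>\<^bsub>T n\<^esub> = [(p ^ k)] \<cdot>\<^bsub>T n\<^esub> \<zero>\<^bsub>T n\<^esub>" by simp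
      then show "\<zero>\<^bsub>T n\<^esub> \<in> ?N" by blast
      fix u v assume "u \<in> ?N" "v \<in> ?N"
      then obtain Y Z where "Y \<in> carrier (T n)" "Z \<in> carrier (T n)"
        "u = [(p ^ k)] \<cdot>\<^bsub>T n\<^esub> Y" "v = [(p ^ k)] \<cdot>\<^bsub>T n\<^esub> Z" by blast
      then have "u \<oplus>\<^bsub>T n\<^esub> v = [(p ^ k)] \<cdot>\<^bsub>T n\<^esub> (Y \<oplus>\<^bsub>T n\<^esub> Z)" "Y \<oplus>\<^bsub>T n\<^esub> Z \<in> carrier (T n)"
        by (simp_all add: T.add_pow_add)
      then show "u \<oplus>\<^bsub>T n\<^esub> v \<in> ?N" by blast
    qed
    then show ?case using end_pr[OF \<phi> pr] by auto
  next
    case (minus U V)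
    then obtain Y Z where Y: "Y \<in> carrier (T n)" "Z \<in> carrier (T n)"
      "\<phi> n U = [(p ^ k)] \<cdot>\<^bsub>T n\<^esub> Y" "\<phi> n V = [(p ^ k)] \<cdot>\<^bsub>T n\<^esub> Z" by blast
    have "\<phi> n (U \<ominus>\<^bsub>T n\<^esub> V) = \<phi> n U \<ominus>\<^bsub>T n\<^esub> \<phi> n V"
      by (rule additive_map_minus(2)[OF T_group T_group C'.end_closed[OF \<phi>] C'.end_add[OF \<phi>] minus(1,2)])
    also have "\<dots> = [(p ^ k)] \<cdot>\<^bsub>T n\<^esub> (Y \<ominus>\<^bsub>T n\<^esub> Z)" using Y by (simp add: T.add_pow_minus)
    finally show ?case using T.minus_closed[OF Y(1,2)] by blast
  qed
  then show ?thesis using \<phi> by (auto simp: padic_ideal_def)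
qed

lemma expand_zero:
  assumes U: "U \<in> carrier (T n)" and z: "\<And>b. b \<in> B \<Longrightarrow> proj b n U = \<zero>\<^bsub>obj C n\<^esub>"
  shows "U = \<zero>\<^bsub>T n\<^esub>"
proof -
  have "U = (\<Oplus>\<^bsub>T n\<^esub>b\<in>B. pr n b (proj b n U))" by (rule expand[OF U, symmetric])
  also have "\<dots> = (\<Oplus>\<^bsub>T n\<^esub>b\<in>B. \<zero>\<^bsub>T n\<^esub>)"
    by (rule T.finsum_cong') (use z pr_additive_right(1) B_carrier' in auto)
  also have "\<dots> = \<zero>\<^bsub>T n\<^esub>" by (rule T.finsum_zero)
  finally show ?thesis .
qed

text \<open>Coordinate maps are additive, so infinite divisibility passes to the coordinates; these
  vanish, and together they determine the element.\<close>

lemma padic_separated_C':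
  assumes sep: "padic_separated p (obj C n) (C.cr n)"
  shows "padic_separated p (T n) (carrier (T n))"
  unfolding padic_separated_def
proof (intro ballI impI)
  fix U assume U: "U \<in> carrier (T n)" and div: "\<forall>k::nat. \<exists>Y\<in>carrier (T n). U = [(p ^ k)] \<cdot>\<^bsub>T n\<^esub> Y"
  show "U = \<zero>\<^bsub>T n\<^esub>"
  proof (rule expand_zero[OF U])
    fix b assume b: "b \<in> B"
    have "\<exists>y\<in>C.cr n. proj b n U = [(p ^ k)] \<cdot>\<^bsub>obj C n\<^esub> y" for k :: nat
    proof -
      obtain Y where Y: "Y \<in> carrier (T n)" "U = [(p ^ k)] \<cdot>\<^bsub>T n\<^esub> Y" using div by blast
      then have "proj b n U = [(p ^ k)] \<cdot>\<^bsub>obj C n\<^esub> proj b n Y" using proj_additive(3)[OF b Y(1)] by simp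
      then show ?thesis using proj_closed[OF b Y(1)] by blast
    qed
    then show "proj b n U = \<zero>\<^bsub>obj C n\<^esub>"
      using sep proj_closed[OF b U] unfolding padic_separated_def by blast
  qed
qed

text \<open>Representatives are the sums of b \<otimes> s with all entries s from a finite set that
  represents C modulo p.\<close>

lemma padic_finite_C':
  assumes fin: "padic_finite p (obj C n) (C.cr n)"
  shows "padic_finite p (T n) (carrier (T n))"
proof -
  obtain S where S: "finite S" "S \<subseteq> C.cr n"
    "\<And>x. x \<in> C.cr n \<Longrightarrow> \<exists>t\<in>S. \<exists>y\<in>C.cr n. x = t \<oplus>\<^bsub>obj C n\<^esub> [p] \<cdot>\<^bsub>obj C n\<^esub> y"
    using fin unfolding padic_finite_def by blast
  define \<sigma> where "\<sigma> f = (\<Oplus>\<^bsub>T n\<^esub>b\<in>B. pr n b (f b))" for f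
  have \<sigma>: "(\<lambda>b. pr n b (f b)) \<in> B \<rightarrow> carrier (T n)" if "\<And>b. b \<in> B \<Longrightarrow> f b \<in> C.cr n" for f
    using that pr_closed B_carrier' by auto
  have \<sigma>c: "\<sigma> f \<in> carrier (T n)" if "\<And>b. b \<in> B \<Longrightarrow> f b \<in> C.cr n" for f
    unfolding \<sigma>_def by (rule T.finsum_closed[OF \<sigma>[OF that]])
  show ?thesis
    unfolding padic_finite_def
  proof (intro exI[of _ "\<sigma> ` (\<Pi>\<^sub>E b\<in>B. S)"] conjI ballI)
    show "finite (\<sigma> ` (\<Pi>\<^sub>E b\<in>B. S))" using S(1) finite_B by (intro finite_imageI finite_PiE) auto
    show "\<sigma> ` (\<Pi>\<^sub>E b\<in>B. S) \<subseteq> carrier (T n)"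
    proof (rule image_subsetI)
      fix f assume f: "f \<in> (\<Pi>\<^sub>E b\<in>B. S)"
      show "\<sigma> f \<in> carrier (T n)" using f S(2) by (intro \<sigma>c) auto
    qed
    fix U assume U: "U \<in> carrier (T n)"
    let ?P = "\<lambda>b ty. fst ty \<in> S \<and> snd ty \<in> C.cr n \<and> proj b n U = fst ty \<oplus>\<^bsub>obj C n\<^esub> [p] \<cdot>\<^bsub>obj C n\<^esub> snd ty"
    have ex: "\<exists>ty. ?P b ty" if "b \<in> B" for b
      using S(3)[OF proj_closed[OF that U]] by auto
    have ty: "?P b (SOME ty. ?P b ty)" if "b \<in> B" for b
      by (rule someI_ex[of "?P b", OF ex[OF that]])
    define t where "t = (\<lambda>b\<in>B. fst (SOME ty. ?P b ty))"
    define y where "y b = snd (SOME ty. ?P b ty)" for b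
    have t: "t b \<in> S" "y b \<in> C.cr n" "proj b n U = t b \<oplus>\<^bsub>obj C n\<^esub> [p] \<cdot>\<^bsub>obj C n\<^esub> y b" if "b \<in> B" for b
      using ty[OF that] that unfolding t_def y_def by simp_all
    have tc: "t b \<in> C.cr n" if "b \<in> B" for b using t(1)[OF that] S(2) by blast
    have py: "[p] \<cdot>\<^bsub>obj C n\<^esub> y b \<in> C.cr n" if "b \<in> B" for b using t(2)[OF that] by simp
    have tP: "t \<in> (\<Pi>\<^sub>E b\<in>B. S)" using t(1) by (auto simp: t_def)
    have "U = (\<Oplus>\<^bsub>T n\<^esub>b\<in>B. pr n b (proj b n U))" by (rule expand[OF U, symmetric])
    also have "\<dots> = (\<Oplus>\<^bsub>T n\<^esub>b\<in>B. pr n b (t b) \<oplus>\<^bsub>T n\<^esub> pr n b ([p] \<cdot>\<^bsub>obj C n\<^esub> y b))"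
      by (rule T.finsum_cong') (use t tc py pr_closed pr_add_right B_carrier' in auto)
    also have "\<dots> = \<sigma> t \<oplus>\<^bsub>T n\<^esub> (\<Oplus>\<^bsub>T n\<^esub>b\<in>B. pr n b ([p] \<cdot>\<^bsub>obj C n\<^esub> y b))"
      unfolding \<sigma>_def by (rule T.finsum_addf) (rule \<sigma>, simp add: tc py)+
    also have "(\<Oplus>\<^bsub>T n\<^esub>b\<in>B. pr n b ([p] \<cdot>\<^bsub>obj C n\<^esub> y b)) = (\<Oplus>\<^bsub>T n\<^esub>b\<in>B. [p] \<cdot>\<^bsub>T n\<^esub> pr n b (y b))"
      by (rule T.finsum_cong') (use t pr_closed pr_additive_right(2) B_carrier' in auto)
    also have "\<dots> = [p] \<cdot>\<^bsub>T n\<^esub> \<sigma> y"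
      unfolding \<sigma>_def
      by (rule additive_map_minus(4)[OF T_group T_group T.add_pow_closed T.add_pow_add finite_B \<sigma>[OF t(2)], symmetric])
    finally have eq: "U = \<sigma> t \<oplus>\<^bsub>T n\<^esub> [p] \<cdot>\<^bsub>T n\<^esub> \<sigma> y" .
    show "\<exists>s\<in>\<sigma> ` (\<Pi>\<^sub>E b\<in>B. S). \<exists>Y\<in>carrier (T n). U = s \<oplus>\<^bsub>T n\<^esub> [p] \<cdot>\<^bsub>T n\<^esub> Y"
      by (rule bexI[of _ "\<sigma> t"], rule bexI[of _ "\<sigma> y"], rule eq, rule \<sigma>c[OF t(2)], assumption, rule imageI[OF tP])
  qed
qed

lemma bounded_complex_C':
  assumes "bounded_complex C"
  shows "bounded_complex C'"
proof -
  obtain a b where ab: "\<And>n. n \<notin> {a..b} \<Longrightarrow> C.cr n = {\<zero>\<^bsub>obj C n\<^esub>}"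
    using assms unfolding bounded_complex_def by blast
  have "carrier (T n) = {\<zero>\<^bsub>T n\<^esub>}" if n: "n \<notin> {a..b}" for n
  proof -
    have "U = \<zero>\<^bsub>T n\<^esub>" if U: "U \<in> carrier (T n)" for U
      using proj_closed[OF _ U] ab[OF n] by (intro expand_zero[OF U]) auto
    then show ?thesis by auto
  qed
  then show ?thesis unfolding bounded_complex_def by blast
qed

text \<open>The arithmetic of the two rings enters only through the dual basis and the p-adic
  properties of the modules of C.\<close>

theorem nonisomorphic_decomposition:
  assumes padic: "\<And>n. padic_separated p (obj C n) (C.cr n)" "\<And>n. padic_complete p (obj C n) (C.cr n)"
      "\<And>n. padic_finite p (obj C n) (C.cr n)"
    and bounded: "bounded_complex C" and ind: "indecomposable_complex A C"
  shows "\<exists>(r :: nat) D.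
    internal_direct_sum A' C' {..<r} D \<and>
    (\<forall>i<r. indecomposable_complex A' (restrict_complex C' (D i))) \<and>
    (\<forall>i<r. \<forall>j<r. i \<noteq> j \<longrightarrow>
       \<not> complex_iso A' (restrict_complex C' (D i)) (restrict_complex C' (D j)))"
proof -
  let ?I = "padic_ideal p A C" and ?I' = "padic_ideal p A' C' 1"
  \<comment> \<open>Otherwise the idempotent 1 would be zero, and with it the whole complex, which
    indecomposability excludes.\<close>
  have one: "\<one>\<^bsub>EC\<^esub> \<notin> ?I 1"
  proof
    assume "\<one>\<^bsub>EC\<^esub> \<in> ?I 1"
    then have z: "\<one>\<^bsub>EC\<^esub> = \<zero>\<^bsub>EC\<^esub>" by (intro C.idempotent_in_padic_ideal[OF padic(1)]) auto
    obtain n where n: "carrier (obj C n) \<noteq> {\<zero>\<^bsub>obj C n\<^esub>}"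
      using ind unfolding indecomposable_complex_def by blast
    have "x = \<zero>\<^bsub>obj C n\<^esub>" if "x \<in> carrier (obj C n)" for x
      using C.E_simps(3)[OF that] C.E_simps(4)[OF that] z by simp
    then show False using n abelian_group.axioms(1)[OF C.obj_group, THEN abelian_monoid.zero_closed] by blast
  qed
  have conn: "finite_connected_ring (EC Quot ?I 1)"
  proof (rule C.E.quotient_connected)
    show "ideal (?I k) EC" for k by (rule C.ideal_padic_ideal)
    show "finite (carrier (EC Quot ?I k))" for k
      by (rule C.finite_end_quotient[OF padic(3) bounded])
    show "\<phi> = \<zero>\<^bsub>EC\<^esub>" if "\<And>k. \<phi> \<in> ?I k" for \<phi>
      by (rule C.padic_ideal_separated[OF padic(1) that])
    show "\<exists>\<phi>\<in>carrier EC. \<forall>k. \<phi> \<ominus>\<^bsub>EC\<^esub> s k \<in> ?I k"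
      if "\<And>k. s k \<in> carrier EC" "\<And>k. s (Suc k) \<ominus>\<^bsub>EC\<^esub> s k \<in> ?I k" for s
      by (rule C.padic_ideal_complete[OF padic(1,2) that])
    show "e = \<zero>\<^bsub>EC\<^esub> \<or> e = \<one>\<^bsub>EC\<^esub>" if "e \<in> carrier EC" "e \<otimes>\<^bsub>EC\<^esub> e = e" for e
      by (rule C.indecomposable_idempotents[OF ind that])
  qed (rule one)
  obtain J L M where J: "\<And>x y. x \<in> carrier EC \<Longrightarrow> y \<in> carrier EC \<Longrightarrow> x \<otimes>\<^bsub>EC\<^esub> y \<ominus>\<^bsub>EC\<^esub> y \<otimes>\<^bsub>EC\<^esub> x \<in> J" "ideal J EC"
    and L0: "L (0::nat) = ?I 1" and LM: "L M = carrier EC" and L: "\<And>j. L j \<subseteq> carrier EC" "\<And>j. \<zero>\<^bsub>EC\<^esub> \<in> L j"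
    "\<And>j x y. x \<in> L j \<Longrightarrow> y \<in> L j \<Longrightarrow> x \<oplus>\<^bsub>EC\<^esub> y \<in> L j"
    "\<And>j z x. z \<in> carrier EC \<Longrightarrow> (\<And>y. y \<in> carrier EC \<Longrightarrow> z \<otimes>\<^bsub>EC\<^esub> y = y \<otimes>\<^bsub>EC\<^esub> z) \<Longrightarrow> x \<in> L j \<Longrightarrow> z \<otimes>\<^bsub>EC\<^esub> x \<in> L j"
    "\<And>j a x. a \<in> J \<Longrightarrow> x \<in> L (Suc j) \<Longrightarrow> a \<otimes>\<^bsub>EC\<^esub> x \<in> L j"
    by (rule C.E.commutator_filtration[OF C.ideal_padic_ideal conn]) blast
  \<comment> \<open>\<open>M\<close> factors bring the coordinates down to \<open>L 0\<close>, that
    is, to endomorphisms with values in p C.\<close>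
  have nil: "(v \<otimes>\<^bsub>EC'\<^esub> u \<ominus>\<^bsub>EC'\<^esub> u \<otimes>\<^bsub>EC'\<^esub> v) [^]\<^bsub>EC'\<^esub> M \<in> ?I'" if "u \<in> carrier EC'" "v \<in> carrier EC'" for u v
  proof (rule padic_ideal_C'I)
    fix t assume t: "t \<in> B"
    have "\<kappa> t ((v \<otimes>\<^bsub>EC'\<^esub> u \<ominus>\<^bsub>EC'\<^esub> u \<otimes>\<^bsub>EC'\<^esub> v) [^]\<^bsub>EC'\<^esub> M) \<in> L (M - M)"
    proof (rule \<kappa>_pow_mem[where L = L and J = J and j = M and M = M, OF L LM _ _ le_refl t])
      show "v \<otimes>\<^bsub>EC'\<^esub> u \<ominus>\<^bsub>EC'\<^esub> u \<otimes>\<^bsub>EC'\<^esub> v \<in> carrier EC'" using that by simp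
      show "\<kappa> s (v \<otimes>\<^bsub>EC'\<^esub> u \<ominus>\<^bsub>EC'\<^esub> u \<otimes>\<^bsub>EC'\<^esub> v) \<in> J" if "s \<in> B" for s
        by (rule \<kappa>_commutator[OF J(2) _ that]) (use J(1) \<open>u \<in> carrier EC'\<close> \<open>v \<in> carrier EC'\<close> in auto)
    qed
    then show "\<kappa> t ((v \<otimes>\<^bsub>EC'\<^esub> u \<ominus>\<^bsub>EC'\<^esub> u \<otimes>\<^bsub>EC'\<^esub> v) [^]\<^bsub>EC'\<^esub> M) \<in> ?I 1" by (simp add: L0)
  qed (use that in auto)
  have small: "e = \<zero>\<^bsub>EC'\<^esub>" if "e \<in> ?I'" "e \<otimes>\<^bsub>EC'\<^esub> e = e" for e
    by (rule C'.idempotent_in_padic_ideal[OF padic_separated_C'[OF padic(1)] that])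
  \<comment> \<open>The number of idempotents is bounded because E' has a finite quotient by an
    ideal without nonzero idempotents.\<close>
  obtain r e where e: "orthogonal_idempotents EC' r e"
    and prim: "\<And>i f g. i < r \<Longrightarrow> f \<in> carrier EC' \<Longrightarrow> g \<in> carrier EC' \<Longrightarrow> f \<otimes>\<^bsub>EC'\<^esub> f = f \<Longrightarrow> g \<otimes>\<^bsub>EC'\<^esub> g = g \<Longrightarrow>
      f \<otimes>\<^bsub>EC'\<^esub> g = \<zero>\<^bsub>EC'\<^esub> \<Longrightarrow> g \<otimes>\<^bsub>EC'\<^esub> f = \<zero>\<^bsub>EC'\<^esub> \<Longrightarrow> f \<oplus>\<^bsub>EC'\<^esub> g = e i \<Longrightarrow>
      f = \<zero>\<^bsub>EC'\<^esub> \<or> g = \<zero>\<^bsub>EC'\<^esub>"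
    using C'.E.primitive_decomposition[OF C'.ideal_padic_ideal
        C'.finite_end_quotient[OF padic_finite_C'[OF padic(3)] bounded_complex_C'[OF bounded]] small]
    by blast
  have ei: "e i \<in> carrier EC'" "e i \<otimes>\<^bsub>EC'\<^esub> e i = e i" "e i \<noteq> \<zero>\<^bsub>EC'\<^esub>" if "i < r" for i
    using e that by (auto simp: orthogonal_idempotents_def)
  have orth: "e i \<otimes>\<^bsub>EC'\<^esub> e j = \<zero>\<^bsub>EC'\<^esub>" if "i < r" "j < r" "i \<noteq> j" for i j
    using e that by (auto simp: orthogonal_idempotents_def)
  have sum: "(\<Oplus>\<^bsub>EC'\<^esub>i\<in>{..<r}. e i) = \<one>\<^bsub>EC'\<^esub>" using e by (auto simp: orthogonal_idempotents_def)
  let ?D = "\<lambda>i. C'.im (e i)"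
  have "internal_direct_sum A' C' {..<r} ?D"
    by (rule C'.internal_direct_sum_idempotents) (use ei orth sum in auto)
  moreover have "indecomposable_complex A' (restrict_complex C' (?D i))" if "i < r" for i
    by (rule C'.indecomposable_restrict_primitive[OF ei[OF that] prim[OF that]])
  moreover have "\<not> complex_iso A' (restrict_complex C' (?D i)) (restrict_complex C' (?D j))"
    if i: "i < r" and j: "j < r" and ij: "i \<noteq> j" for i j
  proof
    assume iso: "complex_iso A' (restrict_complex C' (?D i)) (restrict_complex C' (?D j))"
    obtain u v where uv: "u \<in> carrier EC'" "v \<in> carrier EC'" "v \<otimes>\<^bsub>EC'\<^esub> u = e i" "u \<otimes>\<^bsub>EC'\<^esub> v = e j"
      by (rule C'.complex_iso_idempotents[OF ei(1,2)[OF i] ei(1,2)[OF j] iso])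
    have "e i = \<zero>\<^bsub>EC'\<^esub>"
      by (rule C'.E.isomorphic_orthogonal_idempotents[OF C'.ideal_padic_ideal small ei(1)[OF i] ei(1)[OF j]
            uv(1,2) ei(2)[OF i] orth[OF i j ij] uv(3,4) nil[OF uv(1,2)]])
    then show False using ei(3)[OF i] by simp
  qed
  ultimately show ?thesis by blast
qed

end

theorem proposition5:
  fixes p :: nat and K Ov K' Ov' :: "'r ring"
    and A :: "('r, 'a) module" and C :: "('a, 'm) complex_of"
  defines "A' \<equiv> base_change_algebra Ov Ov' A"
    and "C' \<equiv> base_change_complex Ov Ov' A C"
  assumes "p_modular_extension p K Ov K' Ov'"
    and "finite (carrier (residue_field Ov))"
    and "finite (carrier (residue_field Ov'))"
    and "absolutely_unramified p Ov"
    and "absolutely_unramified p Ov'"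
    and "assoc_algebra Ov A"
    and "finitely_generated Ov A"
    and "chain_complex A C"
    and "bounded_complex C"
    and "\<And>n. finitely_generated A (obj C n)"
    and "indecomposable_complex A C"
  shows "\<exists>(r :: nat) D.
    internal_direct_sum A' C' {..<r} D \<and>
    (\<forall>i<r. indecomposable_complex A' (restrict_complex C' (D i))) \<and>
    (\<forall>i<r. \<forall>j<r. i \<noteq> j \<longrightarrow>
       \<not> complex_iso A' (restrict_complex C' (D i)) (restrict_complex C' (D j)))"
proof -
  interpret ext: p_modular_extension p K Ov K' Ov' by fact
  have Ov: "padic_domain p Ov" by (rule ext.base.padic_domain_Ov) fact+
  have Ov': "padic_domain p Ov'" by (rule ext.ext.padic_domain_Ov) fact+
  interpret O1: padic_domain p Ov by (rule Ov)
  interpret O2: padic_domain p Ov' by (rule Ov')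
  have sub: "subring_extension Ov Ov'"
    by (intro subring_extension.intro subring_extension_axioms.intro O1.is_cring O2.is_cring ext.subring_Ov)
  have "padic_extension p Ov Ov'" by (intro padic_extension.intro Ov Ov' sub)
  \<comment> \<open>The choice of basis stays internal to the proof: neither C' nor the conclusion
    mentions it.\<close>
  then obtain B coord where dual: "finite_dual_basis Ov Ov' B coord"
    using padic_extension.dual_basis_exists by blast
  interpret X: base_change_cx Ov Ov' A B coord C
    by (intro base_change_cx.intro base_change.intro sub dual assms)
  note padic = finitely_generated_padic[OF Ov \<open>assoc_algebra Ov A\<close> \<open>finitely_generated Ov A\<close> X.C.obj_module
      \<open>\<And>n. finitely_generated A (obj C n)\<close>]
  show ?thesis unfolding A'_def C'_def
    by (rule X.nonisomorphic_decomposition[OF padic \<open>bounded_complex C\<close> \<open>indecomposable_complex A C\<close>])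
qed

end
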